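(* In the 2-category $\mathsf{TngMnd}$ of tangent monads, each strong Cartesian tangent monad $(S,\alpha)$ on a Cartesian tangent category $(\mathbb X,\mathbb T)$ admits the construction of differential objects. Moreover, the tangentad of differential objects of $(S,\alpha)$ is the Cartesian tangent monad $\mathsf{DO}(S,\alpha)$ on the Cartesian tangent category $\mathsf{DO}(\mathbb X,\mathbb T)$ of differential objects of $(\mathbb X,\mathbb T)$, whose underlying functor sends $(A,\zeta_A,\sigma_A,\hat p_A)$ to $(SA,S\zeta_A,S\sigma_A,S\hat p_A\circ\alpha_A^{-1})$ and whose unit and multiplication are those of $S$.
   Context: Composition $\circ$ is in the usual order. A tangent category $(\mathbb X,\mathbb T)$ is a category $\mathbb X$ with a functor $T:\mathbb X\to\mathbb X$ and natural transformations $p:T\Rightarrow\mathrm{id}$, $z:\mathrm{id}\Rightarrow T$, $s:T_2\Rightarrow T$, $l:T\Rightarrow T^2$, $c:T^2\Rightarrow T^2$, where $T_nA$ is the $n$-fold pullback of $p_A$ along itself (required to exist and be preserved by all $T^m$), such that: $(p_A,z_A,s_A)$ is a commutative monoid in $\mathbb X/A$; $Tp\circ l=z\circ p$, $l\circ z=Tz\circ z$, $l\circ s=Ts\circ\langle l\pi_1,l\pi_2\rangle$; $p_T\circ c=Tp$, $c\circ Tz=z_T$, $c\circ Ts=s_T\circ\langle c\,T\pi_1,c\,T\pi_2\rangle$; $Tl\circ l=l_T\circ l$, $c\circ l=l$, $c_T\circ Tc\circ l_T=Tl\circ c$; $c\circ c=\mathrm{id}$, $Tc\circ c_T\circ Tc=c_T\circ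 Tc\circ c_T$; and the square with top $Ts\circ\langle z_T\pi_1,l\pi_2\rangle:T_2A\to T^2A$, left $p\pi_1$, right $Tp$, bottom $z:A\to TA$ is a pullback. It is Cartesian if $\mathbb X$ has finite products preserved by $T$. A lax tangent morphism $(F,\alpha):(\mathbb X',\mathbb T')\to(\mathbb X,\mathbb T)$ is a functor $F$ with $\alpha:FT'\Rightarrow TF$ such that $p_F\circ\alpha=Fp'$, $\alpha\circ Fz'=z_F$, $\alpha\circ Fs'=s_F\circ\langle\alpha F\pi_1,\alpha F\pi_2\rangle$, $l_F\circ\alpha=T\alpha\circ\alpha_{T'}\circ Fl'$, $c_F\circ T\alpha\circ\alpha_{T'}=T\alpha\circ\alpha_{T'}\circ Fc'$; strong if $\alpha$ is invertible, strict if it is an identity; $(G,\beta)\circ(F,\alpha)=(GF,\beta_F\circ G\alpha)$. A tangent natural transformation $\varphi:(F,\alpha)\Rightarrow(G,\beta)$ satisfies $T\varphi\circ\alpha=\beta\circ\varphi_{T'}$. A tangent monad on $(\mathbb X,\mathbb T)$ is a lax tangent morphism $(S,\alpha):(\mathbb X,\mathbb T)\to(\mathbb X,\mathbb T)$ with a monad structure on $S$ whose unit $\eta$ and multiplication $\mu$ are tangent natural transformations. $\mathsf{TngMnd}=\mathsf{Tng}(\mathsf{Mnd})\cong\mathsf{Mnd}(\mathsf{TngCat})$ is the 2-category whose objects are tangent monads $(\mathbb X,\mathbb T;S,\alpha)$; a 1-morphism $(G,\beta;\tau):(\mathbb X',\mathbb T';S',\alpha')\to(\mathbb X,\mathbb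 T;S,\alpha)$ is a lax tangent morphism $(G,\beta)$ with a tangent natural transformation $\tau:(S,\alpha)\circ(G,\beta)\Rightarrow(G,\beta)\circ(S',\alpha')$ such that $\tau\circ\eta_G=G\eta'$ and $\tau\circ\mu_G=G\mu'\circ\tau_{S'}\circ S\tau$; 2-morphisms $(G,\beta;\tau)\Rightarrow(G_1,\beta_1;\tau_1)$ are tangent natural transformations $\varphi$ with $\varphi_{S'}\circ\tau=\tau_1\circ S\varphi$. Each hom-category is a tangent category with $\bar T(G,\beta;\tau)=(TG,c_G\circ T\beta;T\tau\circ\alpha_G)$, $\bar T\varphi=T\varphi$ and structural transformations induced by those of $(\mathbb X,\mathbb T)$. A Cartesian tangent monad is a tangent monad $(S,\alpha)$ on a Cartesian tangent category such that $S$ preserves finite products; it is strong if $\alpha$ is invertible. In this case the hom-tangent categories into $(\mathbb X,\mathbb T;S,\alpha)$ have objectwise finite products, making them Cartesian tangent categories. $S(A\times B)$ and $T(A\times B)$ are identified with $SA\times SB$ and $TA\times TB$. A differential object of a Cartesian tangent category is $(A,\zeta_A,\sigma_A,\hat p_A)$ with $(A,\zeta_A:*\to A,\sigma_A:A\times A\to A)$ a commutative monoid and $\hat p_A:TA\to A$ such that $\hat p_A\circ T\zeta_A=\zeta_A$, $\hat p_A\circ T\sigma_A=\sigma_A\circ(\hat p_A\times\hat p_A)$, $\hat p_A\circ z_A=\zeta_A\circ{!}$, $\hat p_A\circ s_A=\sigma_A\circ\langle\hat p_A\pi_1,\hat p_A\pi_2\rangle$, $\hat p_A\circ T\hat p_A\circ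 l_A=\hat p_A$, and $A\xleftarrow{p_A}TA\xrightarrow{\hat p_A}A$ is a product diagram. Morphisms are linear maps: $f\circ\hat p_A=\hat p_B\circ Tf$. They form a Cartesian tangent category $\mathsf{DO}(\mathbb X,\mathbb T)$, with tangent bundle functor $(A,\zeta_A,\sigma_A,\hat p_A)\mapsto(TA,T\zeta_A,T\sigma_A,T\hat p_A\circ c_A)$. A differential object in a hom-tangent category is pointwise if its product diagram is computed objectwise (so that each component is a differential object of $(\mathbb X,\mathbb T)$). A Cartesian tangent monad $\mathfrak S=(\mathbb X,\mathbb T;S,\alpha)$ admits the construction of differential objects (in $\mathsf{TngMnd}$) if there are a Cartesian tangent monad $\mathsf{DO}(\mathfrak S)$, a strict 1-morphism (identity distributive law with the tangent bundle functors) $U:\mathsf{DO}(\mathfrak S)\to\mathfrak S$ and a pointwise differential object $(U;\mathcal Z,\mathcal S,\hat{\mathcal P})$ in the hom-tangent category of 1-morphisms $\mathsf{DO}(\mathfrak S)\to\mathfrak S$ such that for every tangent monad $\mathfrak S'$, sending a 1-morphism $H:\mathfrak S'\to\mathsf{DO}(\mathfrak S)$ to $(U\circ H;\mathcal Z_H,\mathcal S_H,\hat{\mathcal P}_H)$ is an isomorphism of tangent categories from the hom-tangent category of 1-morphisms $\mathfrak S'\to\mathsf{DO}(\mathfrak S)$ to the tangent category of pointwise differential objects and linear morphisms in the hom-tangent category of 1-morphisms $\mathfrak S'\to\mathfrak S$. $\mathsf{DO}(\mathfrak S)$ is called the tangentad of differential objects. *)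

theory Defs
  imports "HOL-Library.FuncSet"
begin

section \<open>Categories\<close>

text \<open>Composition is written in the usual order: \<open>g \<cdot> f\<close> is ``first \<open>f\<close>, then \<open>g\<close>''.\<close>

record ('o, 'a) category =
  Obj :: "'o set"
  Arr :: "'a set"
  Dom :: "'a \<Rightarrow> 'o"
  Cod :: "'a \<Rightarrow> 'o"
  idt :: "'o \<Rightarrow> 'a"
  Comp :: "'a \<Rightarrow> 'a \<Rightarrow> 'a" (infixr \<open>\<cdot>\<index>\<close> 70)

definition hom :: "('o, 'a, 'm) category_scheme \<Rightarrow> 'o \<Rightarrow> 'o \<Rightarrow> 'a set" where
  "hom X A B = {f \<in> Arr X. Dom X f = A \<and> Cod X f = B}"

locale category =
  fixes X :: "('o, 'a, 'm) category_scheme" (structure)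
  assumes Dom_in_Obj: "f \<in> Arr X \<Longrightarrow> Dom X f \<in> Obj X"
    and Cod_in_Obj: "f \<in> Arr X \<Longrightarrow> Cod X f \<in> Obj X"
    and idt_in_hom: "A \<in> Obj X \<Longrightarrow> idt X A \<in> hom X A A"
    and comp_in_hom: "f \<in> hom X A B \<Longrightarrow> g \<in> hom X B C \<Longrightarrow> g \<cdot> f \<in> hom X A C"
    and comp_idt_right: "f \<in> hom X A B \<Longrightarrow> f \<cdot> idt X A = f"
    and comp_idt_left: "f \<in> hom X A B \<Longrightarrow> idt X B \<cdot> f = f"
    and comp_assoc: "f \<in> hom X A B \<Longrightarrow> g \<in> hom X B C \<Longrightarrow> h \<in> hom X C D \<Longrightarrow>
      h \<cdot> (g \<cdot> f) = (h \<cdot> g) \<cdot> f"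

definition is_iso :: "('o, 'a, 'm) category_scheme \<Rightarrow> 'a \<Rightarrow> bool" where
  "is_iso X f \<longleftrightarrow> f \<in> Arr X \<and>
     (\<exists>g \<in> hom X (Cod X f) (Dom X f).
        g \<cdot>\<^bsub>X\<^esub> f = idt X (Dom X f) \<and> f \<cdot>\<^bsub>X\<^esub> g = idt X (Cod X f))"

definition inverse_arr :: "('o, 'a, 'm) category_scheme \<Rightarrow> 'a \<Rightarrow> 'a" where
  "inverse_arr X f = (THE g. g \<in> hom X (Cod X f) (Dom X f) \<and>
     g \<cdot>\<^bsub>X\<^esub> f = idt X (Dom X f) \<and> f \<cdot>\<^bsub>X\<^esub> g = idt X (Cod X f))"

definition is_functor ::
  "('o, 'a, 'm) category_scheme \<Rightarrow> ('p, 'b, 'n) category_scheme \<Rightarrow>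
   ('o \<Rightarrow> 'p) \<Rightarrow> ('a \<Rightarrow> 'b) \<Rightarrow> bool" where
  "is_functor X Y FO FM \<longleftrightarrow> category X \<and> category Y \<and>
     (\<forall>A \<in> Obj X. FO A \<in> Obj Y) \<and>
     (\<forall>f \<in> Arr X. FM f \<in> hom Y (FO (Dom X f)) (FO (Cod X f))) \<and>
     (\<forall>A \<in> Obj X. FM (idt X A) = idt Y (FO A)) \<and>
     (\<forall>f \<in> Arr X. \<forall>g \<in> Arr X. Dom X g = Cod X f \<longrightarrow> FM (g \<cdot>\<^bsub>X\<^esub> f) = FM g \<cdot>\<^bsub>Y\<^esub> FM f)"

definition natural_transformation ::
  "('o, 'a, 'm) category_scheme \<Rightarrow> ('p, 'b, 'n) category_scheme \<Rightarrow>
   ('o \<Rightarrow> 'p) \<Rightarrow> ('a \<Rightarrow> 'b) \<Rightarrow> ('o \<Rightarrow> 'p) \<Rightarrow> ('a \<Rightarrow> 'b) \<Rightarrow> ('o \<Rightarrow> 'b) \<Rightarrow> bool" where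
  "natural_transformation X Y FO FM GO GM t \<longleftrightarrow>
     is_functor X Y FO FM \<and> is_functor X Y GO GM \<and>
     (\<forall>A \<in> Obj X. t A \<in> hom Y (FO A) (GO A)) \<and>
     (\<forall>f \<in> Arr X. t (Cod X f) \<cdot>\<^bsub>Y\<^esub> FM f = GM f \<cdot>\<^bsub>Y\<^esub> t (Dom X f))"

definition is_terminal :: "('o, 'a, 'm) category_scheme \<Rightarrow> 'o \<Rightarrow> bool" where
  "is_terminal X Z \<longleftrightarrow> Z \<in> Obj X \<and> (\<forall>A \<in> Obj X. \<exists>!f. f \<in> hom X A Z)"

definition is_product ::
  "('o, 'a, 'm) category_scheme \<Rightarrow> 'o \<Rightarrow> 'a \<Rightarrow> 'a \<Rightarrow> 'o \<Rightarrow> 'o \<Rightarrow> bool" where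
  "is_product X P p1 p2 A B \<longleftrightarrow> p1 \<in> hom X P A \<and> p2 \<in> hom X P B \<and>
     (\<forall>C \<in> Obj X. \<forall>f \<in> hom X C A. \<forall>g \<in> hom X C B.
        \<exists>!h. h \<in> hom X C P \<and> p1 \<cdot>\<^bsub>X\<^esub> h = f \<and> p2 \<cdot>\<^bsub>X\<^esub> h = g)"

definition is_pullback ::
  "('o, 'a, 'm) category_scheme \<Rightarrow> 'o \<Rightarrow> 'a \<Rightarrow> 'a \<Rightarrow> 'a \<Rightarrow> 'a \<Rightarrow> bool" where
  "is_pullback X P p1 p2 f g \<longleftrightarrow>
     f \<in> Arr X \<and> g \<in> Arr X \<and> Cod X f = Cod X g \<and>
     p1 \<in> hom X P (Dom X f) \<and> p2 \<in> hom X P (Dom X g) \<and> f \<cdot>\<^bsub>X\<^esub> p1 = g \<cdot>\<^bsub>X\<^esub> p2 \<and>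
     (\<forall>C \<in> Obj X. \<forall>u \<in> hom X C (Dom X f). \<forall>v \<in> hom X C (Dom X g).
        f \<cdot>\<^bsub>X\<^esub> u = g \<cdot>\<^bsub>X\<^esub> v \<longrightarrow>
        (\<exists>!h. h \<in> hom X C P \<and> p1 \<cdot>\<^bsub>X\<^esub> h = u \<and> p2 \<cdot>\<^bsub>X\<^esub> h = v))"

text \<open>The \<open>n\<close>-fold pullback of \<open>f\<close> along itself: the cone consists of the common composite
  \<open>q: P \<rightarrow> Cod f\<close> and of the projections \<open>\<pi> 0, \<dots>, \<pi> (n - 1)\<close>. Including \<open>q\<close> in the cone makes the
  case \<open>n = 0\<close> (where \<open>P\<close> is \<open>Cod f\<close>) correct as well.\<close>

definition is_fold_pullback ::
  "('o, 'a, 'm) category_scheme \<Rightarrow> nat \<Rightarrow> 'a \<Rightarrow> 'o \<Rightarrow> 'a \<Rightarrow> (nat \<Rightarrow> 'a) \<Rightarrow> bool" where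
  "is_fold_pullback X n f P q \<pi> \<longleftrightarrow>
     f \<in> Arr X \<and> q \<in> hom X P (Cod X f) \<and>
     (\<forall>i < n. \<pi> i \<in> hom X P (Dom X f) \<and> f \<cdot>\<^bsub>X\<^esub> \<pi> i = q) \<and>
     (\<forall>C \<in> Obj X. \<forall>r \<in> hom X C (Cod X f). \<forall>u.
        (\<forall>i < n. u i \<in> hom X C (Dom X f) \<and> f \<cdot>\<^bsub>X\<^esub> u i = r) \<longrightarrow>
        (\<exists>!h. h \<in> hom X C P \<and> q \<cdot>\<^bsub>X\<^esub> h = r \<and> (\<forall>i < n. \<pi> i \<cdot>\<^bsub>X\<^esub> h = u i)))"

text \<open>The map \<open>\<langle>f, g\<rangle>\<close> into a product or pullback with projections \<open>p1\<close>, \<open>p2\<close>.\<close>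

definition pair :: "('o, 'a, 'm) category_scheme \<Rightarrow> 'a \<Rightarrow> 'a \<Rightarrow> 'a \<Rightarrow> 'a \<Rightarrow> 'a" where
  "pair X p1 p2 f g =
     (THE h. h \<in> hom X (Dom X f) (Dom X p1) \<and> p1 \<cdot>\<^bsub>X\<^esub> h = f \<and> p2 \<cdot>\<^bsub>X\<^esub> h = g)"


section \<open>Tangent categories\<close>

text \<open>A chosen pullback \<open>T\<^sub>2 A\<close> with projections \<open>tpi1\<close>, \<open>tpi2\<close> is part of the structure, since it is
  the domain of the sum. The other \<open>T\<^sub>n A\<close> are only required to exist.\<close>

record ('o, 'a) tangent_category = "('o, 'a) category" +
  TO :: "'o \<Rightarrow> 'o"
  TM :: "'a \<Rightarrow> 'a"
  T2 :: "'o \<Rightarrow> 'o"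
  tpi1 :: "'o \<Rightarrow> 'a"
  tpi2 :: "'o \<Rightarrow> 'a"
  tproj :: "'o \<Rightarrow> 'a"
  tzero :: "'o \<Rightarrow> 'a"
  tsum :: "'o \<Rightarrow> 'a"
  tlift :: "'o \<Rightarrow> 'a"
  tflip :: "'o \<Rightarrow> 'a"

text \<open>The pairing into \<open>T\<^sub>2 A\<close>, and \<open>T\<^sub>2\<close> on morphisms.\<close>

definition pair2 :: "('o, 'a, 'm) tangent_category_scheme \<Rightarrow> 'o \<Rightarrow> 'a \<Rightarrow> 'a \<Rightarrow> 'a" where
  "pair2 X A f g = pair X (tpi1 X A) (tpi2 X A) f g"

definition T2M :: "('o, 'a, 'm) tangent_category_scheme \<Rightarrow> 'a \<Rightarrow> 'a" where
  "T2M X f = pair2 X (Cod X f)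
     (TM X f \<cdot>\<^bsub>X\<^esub> tpi1 X (Dom X f)) (TM X f \<cdot>\<^bsub>X\<^esub> tpi2 X (Dom X f))"

locale tangent_category = category X for X :: "('o, 'a, 'm) tangent_category_scheme" (structure) +
  assumes T_functor: "is_functor X X (TO X) (TM X)"
    and fold_pullbacks: "A \<in> Obj X \<Longrightarrow> \<exists>P q \<pi>. \<forall>m.
      is_fold_pullback X n ((TM X ^^ m) (tproj X A)) ((TO X ^^ m) P) ((TM X ^^ m) q)
        (\<lambda>i. (TM X ^^ m) (\<pi> i))"
    and T2_pullback: "A \<in> Obj X \<Longrightarrow>
      is_pullback X (T2 X A) (tpi1 X A) (tpi2 X A) (tproj X A) (tproj X A)"
    and proj_natural: "natural_transformation X X (TO X) (TM X) (\<lambda>A. A) (\<lambda>f. f) (tproj X)"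
    and zero_natural: "natural_transformation X X (\<lambda>A. A) (\<lambda>f. f) (TO X) (TM X) (tzero X)"
    and sum_natural: "natural_transformation X X (T2 X) (T2M X) (TO X) (TM X) (tsum X)"
    and lift_natural: "natural_transformation X X (TO X) (TM X)
      (TO X \<circ> TO X) (TM X \<circ> TM X) (tlift X)"
    and flip_natural: "natural_transformation X X (TO X \<circ> TO X) (TM X \<circ> TM X)
      (TO X \<circ> TO X) (TM X \<circ> TM X) (tflip X)"
    \<comment> \<open>commutative monoid in the slice over \<open>A\<close>; associativity is stated on \<open>T\<^sub>3 A\<close>\<close>
    and proj_zero: "A \<in> Obj X \<Longrightarrow> tproj X A \<cdot> tzero X A = idt X A"
    and proj_sum: "A \<in> Obj X \<Longrightarrow> tproj X A \<cdot> tsum X A = tproj X A \<cdot> tpi1 X A"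
    and sum_assoc: "A \<in> Obj X \<Longrightarrow> is_fold_pullback X 3 (tproj X A) P q \<pi> \<Longrightarrow>
      tsum X A \<cdot> pair2 X A (tsum X A \<cdot> pair2 X A (\<pi> 0) (\<pi> 1)) (\<pi> 2)
      = tsum X A \<cdot> pair2 X A (\<pi> 0) (tsum X A \<cdot> pair2 X A (\<pi> 1) (\<pi> 2))"
    and sum_zero: "A \<in> Obj X \<Longrightarrow>
      tsum X A \<cdot> pair2 X A (tzero X A \<cdot> tproj X A) (idt X (TO X A)) = idt X (TO X A)"
    and sum_comm: "A \<in> Obj X \<Longrightarrow> tsum X A \<cdot> pair2 X A (tpi2 X A) (tpi1 X A) = tsum X A"
    \<comment> \<open>additivity of the lift and of the flip\<close>
    and lift_proj: "A \<in> Obj X \<Longrightarrow> TM X (tproj X A) \<cdot> tlift X A = tzero X A \<cdot> tproj X A"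
    and lift_zero: "A \<in> Obj X \<Longrightarrow> tlift X A \<cdot> tzero X A = TM X (tzero X A) \<cdot> tzero X A"
    and lift_sum: "A \<in> Obj X \<Longrightarrow> tlift X A \<cdot> tsum X A = TM X (tsum X A) \<cdot>
      pair X (TM X (tpi1 X A)) (TM X (tpi2 X A)) (tlift X A \<cdot> tpi1 X A) (tlift X A \<cdot> tpi2 X A)"
    and flip_proj: "A \<in> Obj X \<Longrightarrow> tproj X (TO X A) \<cdot> tflip X A = TM X (tproj X A)"
    and flip_zero: "A \<in> Obj X \<Longrightarrow> tflip X A \<cdot> TM X (tzero X A) = tzero X (TO X A)"
    and flip_sum: "A \<in> Obj X \<Longrightarrow> tflip X A \<cdot> TM X (tsum X A) = tsum X (TO X A) \<cdot>
      pair2 X (TO X A) (tflip X A \<cdot> TM X (tpi1 X A)) (tflip X A \<cdot> TM X (tpi2 X A))"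
    \<comment> \<open>coherence of the lift and the flip\<close>
    and lift_lift: "A \<in> Obj X \<Longrightarrow>
      TM X (tlift X A) \<cdot> tlift X A = tlift X (TO X A) \<cdot> tlift X A"
    and flip_lift: "A \<in> Obj X \<Longrightarrow> tflip X A \<cdot> tlift X A = tlift X A"
    and flip_flip_lift: "A \<in> Obj X \<Longrightarrow>
      tflip X (TO X A) \<cdot> TM X (tflip X A) \<cdot> tlift X (TO X A) = TM X (tlift X A) \<cdot> tflip X A"
    and flip_flip: "A \<in> Obj X \<Longrightarrow> tflip X A \<cdot> tflip X A = idt X (TO X (TO X A))"
    and flip_braid: "A \<in> Obj X \<Longrightarrow>
      TM X (tflip X A) \<cdot> tflip X (TO X A) \<cdot> TM X (tflip X A)
      = tflip X (TO X A) \<cdot> TM X (tflip X A) \<cdot> tflip X (TO X A)"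
    \<comment> \<open>universality of the vertical lift\<close>
    and lift_universal: "A \<in> Obj X \<Longrightarrow>
      is_pullback X (T2 X A)
        (TM X (tsum X A) \<cdot> pair X (TM X (tpi1 X A)) (TM X (tpi2 X A))
           (tzero X (TO X A) \<cdot> tpi1 X A) (tlift X A \<cdot> tpi2 X A))
        (tproj X A \<cdot> tpi1 X A)
        (TM X (tproj X A)) (tzero X A)"

text \<open>In lax tangent morphisms \<open>(F, \<alpha>)\<close> the transformation is \<open>\<alpha>: F T' \<Rightarrow> T F\<close>.\<close>

definition lax_tangent_morphism ::
  "('p, 'b, 'n) tangent_category_scheme \<Rightarrow> ('o, 'a, 'm) tangent_category_scheme \<Rightarrow>
   ('p \<Rightarrow> 'o) \<Rightarrow> ('b \<Rightarrow> 'a) \<Rightarrow> ('p \<Rightarrow> 'a) \<Rightarrow> bool" where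
  "lax_tangent_morphism X' X FO FM \<alpha> \<longleftrightarrow>
     tangent_category X' \<and> tangent_category X \<and>
     is_functor X' X FO FM \<and>
     natural_transformation X' X (FO \<circ> TO X') (FM \<circ> TM X') (TO X \<circ> FO) (TM X \<circ> FM) \<alpha> \<and>
     (\<forall>A \<in> Obj X'.
        tproj X (FO A) \<cdot>\<^bsub>X\<^esub> \<alpha> A = FM (tproj X' A) \<and>
        \<alpha> A \<cdot>\<^bsub>X\<^esub> FM (tzero X' A) = tzero X (FO A) \<and>
        \<alpha> A \<cdot>\<^bsub>X\<^esub> FM (tsum X' A)
          = tsum X (FO A) \<cdot>\<^bsub>X\<^esub>
            pair2 X (FO A) (\<alpha> A \<cdot>\<^bsub>X\<^esub> FM (tpi1 X' A)) (\<alpha> A \<cdot>\<^bsub>X\<^esub> FM (tpi2 X' A)) \<and>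
        tlift X (FO A) \<cdot>\<^bsub>X\<^esub> \<alpha> A = TM X (\<alpha> A) \<cdot>\<^bsub>X\<^esub> \<alpha> (TO X' A) \<cdot>\<^bsub>X\<^esub> FM (tlift X' A) \<and>
        tflip X (FO A) \<cdot>\<^bsub>X\<^esub> TM X (\<alpha> A) \<cdot>\<^bsub>X\<^esub> \<alpha> (TO X' A)
          = TM X (\<alpha> A) \<cdot>\<^bsub>X\<^esub> \<alpha> (TO X' A) \<cdot>\<^bsub>X\<^esub> FM (tflip X' A))"

text \<open>Isomorphisms of tangent categories are strict: the comparison transformation is an identity
  (by typing this forces \<open>FO (TO X' A) = TO X (FO A)\<close>), and \<open>F\<close> is bijective.\<close>

definition tangent_isomorphism ::
  "('p, 'b, 'n) tangent_category_scheme \<Rightarrow> ('o, 'a, 'm) tangent_category_scheme \<Rightarrow>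
   ('p \<Rightarrow> 'o) \<Rightarrow> ('b \<Rightarrow> 'a) \<Rightarrow> bool" where
  "tangent_isomorphism X' X FO FM \<longleftrightarrow>
     lax_tangent_morphism X' X FO FM (\<lambda>A. idt X (TO X (FO A))) \<and>
     bij_betw FO (Obj X') (Obj X) \<and> bij_betw FM (Arr X') (Arr X)"

definition tangent_transformation ::
  "('p, 'b, 'n) tangent_category_scheme \<Rightarrow> ('o, 'a, 'm) tangent_category_scheme \<Rightarrow>
   ('p \<Rightarrow> 'o) \<Rightarrow> ('b \<Rightarrow> 'a) \<Rightarrow> ('p \<Rightarrow> 'a) \<Rightarrow>
   ('p \<Rightarrow> 'o) \<Rightarrow> ('b \<Rightarrow> 'a) \<Rightarrow> ('p \<Rightarrow> 'a) \<Rightarrow> ('p \<Rightarrow> 'a) \<Rightarrow> bool" where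
  "tangent_transformation X' X FO FM \<alpha> GO GM \<beta> \<phi> \<longleftrightarrow>
     natural_transformation X' X FO FM GO GM \<phi> \<and>
     (\<forall>A \<in> Obj X'. TM X (\<phi> A) \<cdot>\<^bsub>X\<^esub> \<alpha> A = \<beta> A \<cdot>\<^bsub>X\<^esub> \<phi> (TO X' A))"


section \<open>Cartesian tangent categories and differential objects\<close>

record ('o, 'a) cartesian_tangent_category = "('o, 'a) tangent_category" +
  terminal :: "'o"
  cprod :: "'o \<Rightarrow> 'o \<Rightarrow> 'o"
  cfst :: "'o \<Rightarrow> 'o \<Rightarrow> 'a"
  csnd :: "'o \<Rightarrow> 'o \<Rightarrow> 'a"

locale cartesian_tangent_category = tangent_category X
  for X :: "('o, 'a, 'm) cartesian_tangent_category_scheme" (structure) +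
  assumes terminal: "is_terminal X (terminal X)"
    and product: "A \<in> Obj X \<Longrightarrow> B \<in> Obj X \<Longrightarrow>
      is_product X (cprod X A B) (cfst X A B) (csnd X A B) A B"
    and T_terminal: "is_terminal X (TO X (terminal X))"
    and T_product: "A \<in> Obj X \<Longrightarrow> B \<in> Obj X \<Longrightarrow>
      is_product X (TO X (cprod X A B)) (TM X (cfst X A B)) (TM X (csnd X A B)) (TO X A) (TO X B)"

definition bang :: "('o, 'a, 'm) cartesian_tangent_category_scheme \<Rightarrow> 'o \<Rightarrow> 'a" where
  "bang X A = (THE f. f \<in> hom X A (terminal X))"

definition cpair ::
  "('o, 'a, 'm) cartesian_tangent_category_scheme \<Rightarrow> 'o \<Rightarrow> 'o \<Rightarrow> 'a \<Rightarrow> 'a \<Rightarrow> 'a" where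
  "cpair X A B f g = pair X (cfst X A B) (csnd X A B) f g"

definition cmap ::
  "('o, 'a, 'm) cartesian_tangent_category_scheme \<Rightarrow> 'a \<Rightarrow> 'a \<Rightarrow> 'a" where
  "cmap X f g = cpair X (Cod X f) (Cod X g)
     (f \<cdot>\<^bsub>X\<^esub> cfst X (Dom X f) (Dom X g)) (g \<cdot>\<^bsub>X\<^esub> csnd X (Dom X f) (Dom X g))"

text \<open>For an endofunctor \<open>F\<close> preserving finite products: the canonical comparisons
  \<open>* \<rightarrow> F *\<close> and \<open>F A \<times> F B \<rightarrow> F (A \<times> B)\<close> which identify these objects.\<close>

definition unit_cmp ::
  "('o, 'a, 'm) cartesian_tangent_category_scheme \<Rightarrow> ('o \<Rightarrow> 'o) \<Rightarrow> 'a" where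
  "unit_cmp X FO = (THE f. f \<in> hom X (terminal X) (FO (terminal X)))"

definition prod_cmp ::
  "('o, 'a, 'm) cartesian_tangent_category_scheme \<Rightarrow> ('o \<Rightarrow> 'o) \<Rightarrow> ('a \<Rightarrow> 'a) \<Rightarrow>
   'o \<Rightarrow> 'o \<Rightarrow> 'a" where
  "prod_cmp X FO FM A B =
     pair X (FM (cfst X A B)) (FM (csnd X A B)) (cfst X (FO A) (FO B)) (csnd X (FO A) (FO B))"

definition commutative_monoid ::
  "('o, 'a, 'm) cartesian_tangent_category_scheme \<Rightarrow> 'o \<Rightarrow> 'a \<Rightarrow> 'a \<Rightarrow> bool" where
  "commutative_monoid X A \<zeta> \<sigma> \<longleftrightarrow>
     A \<in> Obj X \<and> \<zeta> \<in> hom X (terminal X) A \<and> \<sigma> \<in> hom X (cprod X A A) A \<and>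
     \<sigma> \<cdot>\<^bsub>X\<^esub> cpair X A A (\<zeta> \<cdot>\<^bsub>X\<^esub> bang X A) (idt X A) = idt X A \<and>
     \<sigma> \<cdot>\<^bsub>X\<^esub> cpair X A A (csnd X A A) (cfst X A A) = \<sigma> \<and>
     (let \<pi> = cfst X (cprod X A A) A; x = cfst X A A \<cdot>\<^bsub>X\<^esub> \<pi>; y = csnd X A A \<cdot>\<^bsub>X\<^esub> \<pi>;
          w = csnd X (cprod X A A) A
      in \<sigma> \<cdot>\<^bsub>X\<^esub> cpair X A A (\<sigma> \<cdot>\<^bsub>X\<^esub> cpair X A A x y) w
         = \<sigma> \<cdot>\<^bsub>X\<^esub> cpair X A A x (\<sigma> \<cdot>\<^bsub>X\<^esub> cpair X A A y w))"

record ('o, 'a) diff_object =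
  carrier :: "'o"
  zeta :: "'a"
  sigma :: "'a"
  phat :: "'a"

definition differential_object ::
  "('o, 'a, 'm) cartesian_tangent_category_scheme \<Rightarrow> ('o, 'a) diff_object \<Rightarrow> bool" where
  "differential_object X D \<longleftrightarrow>
     (let A = carrier D; \<zeta> = zeta D; \<sigma> = sigma D; p = phat D in
       commutative_monoid X A \<zeta> \<sigma> \<and> p \<in> hom X (TO X A) A \<and>
       p \<cdot>\<^bsub>X\<^esub> TM X \<zeta> \<cdot>\<^bsub>X\<^esub> unit_cmp X (TO X) = \<zeta> \<and>
       p \<cdot>\<^bsub>X\<^esub> TM X \<sigma> \<cdot>\<^bsub>X\<^esub> prod_cmp X (TO X) (TM X) A A = \<sigma> \<cdot>\<^bsub>X\<^esub> cmap X p p \<and>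
       p \<cdot>\<^bsub>X\<^esub> tzero X A = \<zeta> \<cdot>\<^bsub>X\<^esub> bang X A \<and>
       p \<cdot>\<^bsub>X\<^esub> tsum X A = \<sigma> \<cdot>\<^bsub>X\<^esub> cpair X A A (p \<cdot>\<^bsub>X\<^esub> tpi1 X A) (p \<cdot>\<^bsub>X\<^esub> tpi2 X A) \<and>
       p \<cdot>\<^bsub>X\<^esub> TM X p \<cdot>\<^bsub>X\<^esub> tlift X A = p \<and>
       is_product X (TO X A) (tproj X A) p A A)"

definition linear_map ::
  "('o, 'a, 'm) cartesian_tangent_category_scheme \<Rightarrow>
   ('o, 'a) diff_object \<Rightarrow> ('o, 'a) diff_object \<Rightarrow> 'a \<Rightarrow> bool" where
  "linear_map X D E f \<longleftrightarrow>
     f \<in> hom X (carrier D) (carrier E) \<and> f \<cdot>\<^bsub>X\<^esub> phat D = phat E \<cdot>\<^bsub>X\<^esub> TM X f"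

text \<open>Morphisms of structured objects, tagged with their source and target.\<close>

datatype ('o, 'f) arrow = Arrow (asrc: 'o) (amap: 'f) (atrg: 'o)

definition DO_T ::
  "('o, 'a, 'm) cartesian_tangent_category_scheme \<Rightarrow>
   ('o, 'a) diff_object \<Rightarrow> ('o, 'a) diff_object" where
  "DO_T X D = \<lparr>carrier = TO X (carrier D),
     zeta = TM X (zeta D) \<cdot>\<^bsub>X\<^esub> unit_cmp X (TO X),
     sigma = TM X (sigma D) \<cdot>\<^bsub>X\<^esub> prod_cmp X (TO X) (TM X) (carrier D) (carrier D),
     phat = TM X (phat D) \<cdot>\<^bsub>X\<^esub> tflip X (carrier D)\<rparr>"

text \<open>The differential object on \<open>T\<^sub>2 A\<close>: the structure maps are the unique ones for which both
  projections to \<open>DO_T X D\<close> preserve the structure.\<close>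

definition DO_T2 ::
  "('o, 'a, 'm) cartesian_tangent_category_scheme \<Rightarrow>
   ('o, 'a) diff_object \<Rightarrow> ('o, 'a) diff_object" where
  "DO_T2 X D = (let A = carrier D; E = DO_T X D in
     \<lparr>carrier = T2 X A,
      zeta = pair2 X A (zeta E) (zeta E),
      sigma = pair2 X A (sigma E \<cdot>\<^bsub>X\<^esub> cmap X (tpi1 X A) (tpi1 X A))
                        (sigma E \<cdot>\<^bsub>X\<^esub> cmap X (tpi2 X A) (tpi2 X A)),
      phat = pair2 X A (phat E \<cdot>\<^bsub>X\<^esub> TM X (tpi1 X A)) (phat E \<cdot>\<^bsub>X\<^esub> TM X (tpi2 X A))\<rparr>)"

definition DO_terminal ::
  "('o, 'a, 'm) cartesian_tangent_category_scheme \<Rightarrow> ('o, 'a) diff_object" where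
  "DO_terminal X = (let Z = terminal X in
     \<lparr>carrier = Z, zeta = idt X Z, sigma = bang X (cprod X Z Z), phat = bang X (TO X Z)\<rparr>)"

definition DO_prod ::
  "('o, 'a, 'm) cartesian_tangent_category_scheme \<Rightarrow>
   ('o, 'a) diff_object \<Rightarrow> ('o, 'a) diff_object \<Rightarrow> ('o, 'a) diff_object" where
  "DO_prod X D E = (let A = carrier D; B = carrier E; \<pi>1 = cfst X A B; \<pi>2 = csnd X A B in
     \<lparr>carrier = cprod X A B,
      zeta = cpair X A B (zeta D) (zeta E),
      sigma = cpair X A B (sigma D \<cdot>\<^bsub>X\<^esub> cmap X \<pi>1 \<pi>1) (sigma E \<cdot>\<^bsub>X\<^esub> cmap X \<pi>2 \<pi>2),
      phat = cpair X A B (phat D \<cdot>\<^bsub>X\<^esub> TM X \<pi>1) (phat E \<cdot>\<^bsub>X\<^esub> TM X \<pi>2)\<rparr>)"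

definition DO ::
  "('o, 'a, 'm) cartesian_tangent_category_scheme \<Rightarrow>
   (('o, 'a) diff_object, (('o, 'a) diff_object, 'a) arrow) cartesian_tangent_category" where
  "DO X = \<lparr>
     Obj = {D. differential_object X D},
     Arr = {Arrow D f E | D f E.
              differential_object X D \<and> differential_object X E \<and> linear_map X D E f},
     Dom = asrc, Cod = atrg,
     idt = (\<lambda>D. Arrow D (idt X (carrier D)) D),
     Comp = (\<lambda>g f. Arrow (asrc f) (amap g \<cdot>\<^bsub>X\<^esub> amap f) (atrg g)),
     TO = DO_T X,
     TM = (\<lambda>f. Arrow (DO_T X (asrc f)) (TM X (amap f)) (DO_T X (atrg f))),
     T2 = DO_T2 X,
     tpi1 = (\<lambda>D. Arrow (DO_T2 X D) (tpi1 X (carrier D)) (DO_T X D)),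
     tpi2 = (\<lambda>D. Arrow (DO_T2 X D) (tpi2 X (carrier D)) (DO_T X D)),
     tproj = (\<lambda>D. Arrow (DO_T X D) (tproj X (carrier D)) D),
     tzero = (\<lambda>D. Arrow D (tzero X (carrier D)) (DO_T X D)),
     tsum = (\<lambda>D. Arrow (DO_T2 X D) (tsum X (carrier D)) (DO_T X D)),
     tlift = (\<lambda>D. Arrow (DO_T X D) (tlift X (carrier D)) (DO_T X (DO_T X D))),
     tflip = (\<lambda>D. Arrow (DO_T X (DO_T X D)) (tflip X (carrier D)) (DO_T X (DO_T X D))),
     terminal = DO_terminal X,
     cprod = DO_prod X,
     cfst = (\<lambda>D E. Arrow (DO_prod X D E) (cfst X (carrier D) (carrier E)) D),
     csnd = (\<lambda>D E. Arrow (DO_prod X D E) (csnd X (carrier D) (carrier E)) E)\<rparr>"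


section \<open>Tangent monads\<close>

record ('o, 'a, 'm) tangent_monad =
  base :: "('o, 'a, 'm) tangent_category_scheme"
  SO :: "'o \<Rightarrow> 'o"
  SM :: "'a \<Rightarrow> 'a"
  sdist :: "'o \<Rightarrow> 'a"
  eta :: "'o \<Rightarrow> 'a"
  mu :: "'o \<Rightarrow> 'a"

type_synonym ('o, 'a) cart_tangent_monad =
  "('o, 'a, ('o, 'a, unit) cartesian_tangent_category_ext) tangent_monad"

definition tangent_monad :: "('o, 'a, 'm) tangent_monad \<Rightarrow> bool" where
  "tangent_monad S \<longleftrightarrow>
     (let X = base S in
       lax_tangent_morphism X X (SO S) (SM S) (sdist S) \<and>
       tangent_transformation X X (\<lambda>A. A) (\<lambda>f. f) (\<lambda>A. idt X (TO X A))
         (SO S) (SM S) (sdist S) (eta S) \<and>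
       tangent_transformation X X (SO S \<circ> SO S) (SM S \<circ> SM S)
         (\<lambda>A. sdist S (SO S A) \<cdot>\<^bsub>X\<^esub> SM S (sdist S A))
         (SO S) (SM S) (sdist S) (mu S) \<and>
       (\<forall>A \<in> Obj X.
          mu S A \<cdot>\<^bsub>X\<^esub> eta S (SO S A) = idt X (SO S A) \<and>
          mu S A \<cdot>\<^bsub>X\<^esub> SM S (eta S A) = idt X (SO S A) \<and>
          mu S A \<cdot>\<^bsub>X\<^esub> SM S (mu S A) = mu S A \<cdot>\<^bsub>X\<^esub> mu S (SO S A)))"

definition strong_tangent_monad :: "('o, 'a, 'm) tangent_monad \<Rightarrow> bool" where
  "strong_tangent_monad S \<longleftrightarrow>
     tangent_monad S \<and> (\<forall>A \<in> Obj (base S). is_iso (base S) (sdist S A))"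

definition cartesian_tangent_monad :: "('o, 'a) cart_tangent_monad \<Rightarrow> bool" where
  "cartesian_tangent_monad S \<longleftrightarrow>
     (let X = base S in
       tangent_monad S \<and> cartesian_tangent_category X \<and>
       is_terminal X (SO S (terminal X)) \<and>
       (\<forall>A \<in> Obj X. \<forall>B \<in> Obj X.
          is_product X (SO S (cprod X A B)) (SM S (cfst X A B)) (SM S (csnd X A B))
            (SO S A) (SO S B)))"


section \<open>The 2-category of tangent monads\<close>

text \<open>A 1-morphism \<open>(G, \<beta>; \<tau>)\<close>. The maps in a 1-morphism and the families in a 2-morphism are
  \<^const>\<open>extensional\<close>, so that equality in HOL is equality of functors and of transformations.\<close>

record ('p, 'b, 'o, 'a) mor1 =
  GO :: "'p \<Rightarrow> 'o"
  GM :: "'b \<Rightarrow> 'a"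
  gdist :: "'p \<Rightarrow> 'a"
  gtau :: "'p \<Rightarrow> 'a"

definition one_morphism ::
  "('p, 'b, 'n) tangent_monad \<Rightarrow> ('o, 'a, 'm) tangent_monad \<Rightarrow>
   ('p, 'b, 'o, 'a) mor1 \<Rightarrow> bool" where
  "one_morphism S' S G \<longleftrightarrow>
     (let X' = base S'; X = base S in
       GO G \<in> extensional (Obj X') \<and> GM G \<in> extensional (Arr X') \<and>
       gdist G \<in> extensional (Obj X') \<and> gtau G \<in> extensional (Obj X') \<and>
       lax_tangent_morphism X' X (GO G) (GM G) (gdist G) \<and>
       tangent_transformation X' X
         (SO S \<circ> GO G) (SM S \<circ> GM G) (\<lambda>A. sdist S (GO G A) \<cdot>\<^bsub>X\<^esub> SM S (gdist G A))
         (GO G \<circ> SO S') (GM G \<circ> SM S') (\<lambda>A. gdist G (SO S' A) \<cdot>\<^bsub>X\<^esub> GM G (sdist S' A))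
         (gtau G) \<and>
       (\<forall>A \<in> Obj X'.
          gtau G A \<cdot>\<^bsub>X\<^esub> eta S (GO G A) = GM G (eta S' A) \<and>
          gtau G A \<cdot>\<^bsub>X\<^esub> mu S (GO G A)
            = GM G (mu S' A) \<cdot>\<^bsub>X\<^esub> gtau G (SO S' A) \<cdot>\<^bsub>X\<^esub> SM S (gtau G A)))"

definition two_morphism ::
  "('p, 'b, 'n) tangent_monad \<Rightarrow> ('o, 'a, 'm) tangent_monad \<Rightarrow>
   ('p, 'b, 'o, 'a) mor1 \<Rightarrow> ('p, 'b, 'o, 'a) mor1 \<Rightarrow> ('p \<Rightarrow> 'a) \<Rightarrow> bool" where
  "two_morphism S' S G H \<phi> \<longleftrightarrow>
     (let X' = base S'; X = base S in
       \<phi> \<in> extensional (Obj X') \<and>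
       tangent_transformation X' X (GO G) (GM G) (gdist G) (GO H) (GM H) (gdist H) \<phi> \<and>
       (\<forall>A \<in> Obj X'. \<phi> (SO S' A) \<cdot>\<^bsub>X\<^esub> gtau G A = gtau H A \<cdot>\<^bsub>X\<^esub> SM S (\<phi> A)))"

text \<open>A 1-morphism is strict if its distributive law with the tangent bundle functors is the
  identity; nothing is required of \<open>\<tau>\<close>.\<close>

definition strict_one_morphism ::
  "('p, 'b, 'n) tangent_monad \<Rightarrow> ('o, 'a, 'm) tangent_monad \<Rightarrow>
   ('p, 'b, 'o, 'a) mor1 \<Rightarrow> bool" where
  "strict_one_morphism S' S G \<longleftrightarrow> one_morphism S' S G \<and>
     (\<forall>A \<in> Obj (base S'). gdist G A = idt (base S) (TO (base S) (GO G A)))"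

text \<open>The composite \<open>(G, \<beta>; \<tau>) \<circ> (H, \<beta>'; \<tau>')\<close>, where \<open>H\<close> has source \<open>S''\<close> and \<open>G\<close> has
  target \<open>S\<close>, and the two whiskerings.\<close>

definition comp1 ::
  "('q, 'c, 'k) tangent_monad \<Rightarrow> ('o, 'a, 'm) tangent_monad \<Rightarrow>
   ('p, 'b, 'o, 'a) mor1 \<Rightarrow> ('q, 'c, 'p, 'b) mor1 \<Rightarrow> ('q, 'c, 'o, 'a) mor1" where
  "comp1 S'' S G H = \<lparr>
     GO = (\<lambda>A \<in> Obj (base S''). GO G (GO H A)),
     GM = (\<lambda>f \<in> Arr (base S''). GM G (GM H f)),
     gdist = (\<lambda>A \<in> Obj (base S''). gdist G (GO H A) \<cdot>\<^bsub>base S\<^esub> GM G (gdist H A)),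
     gtau = (\<lambda>A \<in> Obj (base S''). GM G (gtau H A) \<cdot>\<^bsub>base S\<^esub> gtau G (GO H A))\<rparr>"

definition whisker_right ::
  "('q, 'c, 'k) tangent_monad \<Rightarrow> ('o, 'a, 'm) tangent_monad \<Rightarrow>
   (('p, 'b, 'o, 'a) mor1, 'p \<Rightarrow> 'a) arrow \<Rightarrow> ('q, 'c, 'p, 'b) mor1 \<Rightarrow>
   (('q, 'c, 'o, 'a) mor1, 'q \<Rightarrow> 'a) arrow" where
  "whisker_right S'' S \<phi> H =
     Arrow (comp1 S'' S (asrc \<phi>) H) (\<lambda>A \<in> Obj (base S''). amap \<phi> (GO H A))
       (comp1 S'' S (atrg \<phi>) H)"

definition whisker_left ::
  "('q, 'c, 'k) tangent_monad \<Rightarrow> ('o, 'a, 'm) tangent_monad \<Rightarrow>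
   ('p, 'b, 'o, 'a) mor1 \<Rightarrow> (('q, 'c, 'p, 'b) mor1, 'q \<Rightarrow> 'b) arrow \<Rightarrow>
   (('q, 'c, 'o, 'a) mor1, 'q \<Rightarrow> 'a) arrow" where
  "whisker_left S'' S G \<phi> =
     Arrow (comp1 S'' S G (asrc \<phi>)) (\<lambda>A \<in> Obj (base S''). GM G (amap \<phi> A))
       (comp1 S'' S G (atrg \<phi>))"

text \<open>The tangent bundle functor of the hom-tangent category, its \<open>T\<^sub>2\<close>, and its terminal object and
  products. The latter three are computed objectwise; the components of \<open>gdist\<close> and \<open>gtau\<close> are the
  unique maps for which the objectwise projections are 2-morphisms.\<close>

definition mor1_T ::
  "('p, 'b, 'n) tangent_monad \<Rightarrow> ('o, 'a, 'm) tangent_monad \<Rightarrow>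
   ('p, 'b, 'o, 'a) mor1 \<Rightarrow> ('p, 'b, 'o, 'a) mor1" where
  "mor1_T S' S G = (let X' = base S'; X = base S in \<lparr>
     GO = (\<lambda>A \<in> Obj X'. TO X (GO G A)),
     GM = (\<lambda>f \<in> Arr X'. TM X (GM G f)),
     gdist = (\<lambda>A \<in> Obj X'. tflip X (GO G A) \<cdot>\<^bsub>X\<^esub> TM X (gdist G A)),
     gtau = (\<lambda>A \<in> Obj X'. TM X (gtau G A) \<cdot>\<^bsub>X\<^esub> sdist S (GO G A))\<rparr>)"

definition mor1_T2 ::
  "('p, 'b, 'n) tangent_monad \<Rightarrow> ('o, 'a, 'm) tangent_monad \<Rightarrow>
   ('p, 'b, 'o, 'a) mor1 \<Rightarrow> ('p, 'b, 'o, 'a) mor1" where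
  "mor1_T2 S' S G = (let X' = base S'; X = base S; TG = mor1_T S' S G in \<lparr>
     GO = (\<lambda>A \<in> Obj X'. T2 X (GO G A)),
     GM = (\<lambda>f \<in> Arr X'. T2M X (GM G f)),
     gdist = (\<lambda>A \<in> Obj X'.
       pair X (TM X (tpi1 X (GO G A))) (TM X (tpi2 X (GO G A)))
         (gdist TG A \<cdot>\<^bsub>X\<^esub> tpi1 X (GO G (TO X' A)))
         (gdist TG A \<cdot>\<^bsub>X\<^esub> tpi2 X (GO G (TO X' A)))),
     gtau = (\<lambda>A \<in> Obj X'. pair2 X (GO G (SO S' A))
         (gtau TG A \<cdot>\<^bsub>X\<^esub> SM S (tpi1 X (GO G A)))
         (gtau TG A \<cdot>\<^bsub>X\<^esub> SM S (tpi2 X (GO G A))))\<rparr>)"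

definition mor1_terminal ::
  "('p, 'b, 'n) tangent_monad \<Rightarrow> ('o, 'a) cart_tangent_monad \<Rightarrow> ('p, 'b, 'o, 'a) mor1" where
  "mor1_terminal S' S = (let X' = base S'; X = base S in \<lparr>
     GO = (\<lambda>A \<in> Obj X'. terminal X),
     GM = (\<lambda>f \<in> Arr X'. idt X (terminal X)),
     gdist = (\<lambda>A \<in> Obj X'. unit_cmp X (TO X)),
     gtau = (\<lambda>A \<in> Obj X'. bang X (SO S (terminal X)))\<rparr>)"

definition mor1_prod ::
  "('p, 'b, 'n) tangent_monad \<Rightarrow> ('o, 'a) cart_tangent_monad \<Rightarrow>
   ('p, 'b, 'o, 'a) mor1 \<Rightarrow> ('p, 'b, 'o, 'a) mor1 \<Rightarrow> ('p, 'b, 'o, 'a) mor1" where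
  "mor1_prod S' S G H = (let X' = base S'; X = base S in \<lparr>
     GO = (\<lambda>A \<in> Obj X'. cprod X (GO G A) (GO H A)),
     GM = (\<lambda>f \<in> Arr X'. cmap X (GM G f) (GM H f)),
     gdist = (\<lambda>A \<in> Obj X'. prod_cmp X (TO X) (TM X) (GO G A) (GO H A) \<cdot>\<^bsub>X\<^esub>
                cmap X (gdist G A) (gdist H A)),
     gtau = (\<lambda>A \<in> Obj X'. cpair X (GO G (SO S' A)) (GO H (SO S' A))
         (gtau G A \<cdot>\<^bsub>X\<^esub> SM S (cfst X (GO G A) (GO H A)))
         (gtau H A \<cdot>\<^bsub>X\<^esub> SM S (csnd X (GO G A) (GO H A))))\<rparr>)"

text \<open>The hom-tangent category of 1-morphisms \<open>S' \<rightarrow> S\<close>. Its last four fields (finite products) are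
  the only ones that refer to the Cartesian structure of \<open>S\<close>.\<close>

definition hom_tangent ::
  "('p, 'b, 'n) tangent_monad \<Rightarrow> ('o, 'a) cart_tangent_monad \<Rightarrow>
   (('p, 'b, 'o, 'a) mor1, (('p, 'b, 'o, 'a) mor1, 'p \<Rightarrow> 'a) arrow)
     cartesian_tangent_category" where
  "hom_tangent S' S = (let X' = base S'; X = base S; T = mor1_T S' S; TT = mor1_T2 S' S in \<lparr>
     Obj = {G. one_morphism S' S G},
     Arr = {Arrow G \<phi> H | G \<phi> H.
              one_morphism S' S G \<and> one_morphism S' S H \<and> two_morphism S' S G H \<phi>},
     Dom = asrc, Cod = atrg,
     idt = (\<lambda>G. Arrow G (\<lambda>A \<in> Obj X'. idt X (GO G A)) G),
     Comp = (\<lambda>\<psi> \<phi>. Arrow (asrc \<phi>) (\<lambda>A \<in> Obj X'. amap \<psi> A \<cdot>\<^bsub>X\<^esub> amap \<phi> A) (atrg \<psi>)),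
     TO = T,
     TM = (\<lambda>\<phi>. Arrow (T (asrc \<phi>)) (\<lambda>A \<in> Obj X'. TM X (amap \<phi> A)) (T (atrg \<phi>))),
     T2 = TT,
     tpi1 = (\<lambda>G. Arrow (TT G) (\<lambda>A \<in> Obj X'. tpi1 X (GO G A)) (T G)),
     tpi2 = (\<lambda>G. Arrow (TT G) (\<lambda>A \<in> Obj X'. tpi2 X (GO G A)) (T G)),
     tproj = (\<lambda>G. Arrow (T G) (\<lambda>A \<in> Obj X'. tproj X (GO G A)) G),
     tzero = (\<lambda>G. Arrow G (\<lambda>A \<in> Obj X'. tzero X (GO G A)) (T G)),
     tsum = (\<lambda>G. Arrow (TT G) (\<lambda>A \<in> Obj X'. tsum X (GO G A)) (T G)),
     tlift = (\<lambda>G. Arrow (T G) (\<lambda>A \<in> Obj X'. tlift X (GO G A)) (T (T G))),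
     tflip = (\<lambda>G. Arrow (T (T G)) (\<lambda>A \<in> Obj X'. tflip X (GO G A)) (T (T G))),
     terminal = mor1_terminal S' S,
     cprod = mor1_prod S' S,
     cfst = (\<lambda>G H. Arrow (mor1_prod S' S G H) (\<lambda>A \<in> Obj X'. cfst X (GO G A) (GO H A)) G),
     csnd = (\<lambda>G H. Arrow (mor1_prod S' S G H) (\<lambda>A \<in> Obj X'. csnd X (GO G A) (GO H A)) H)\<rparr>)"


section \<open>The construction of differential objects\<close>

definition full_subcategory ::
  "('o, 'a, 'm) category_scheme \<Rightarrow> ('o \<Rightarrow> bool) \<Rightarrow> ('o, 'a, 'm) category_scheme" where
  "full_subcategory X Q =
     X\<lparr>Obj := {A \<in> Obj X. Q A}, Arr := {f \<in> Arr X. Q (Dom X f) \<and> Q (Cod X f)}\<rparr>"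

definition pointwise ::
  "('p, 'b, 'n) tangent_monad \<Rightarrow> ('o, 'a) cart_tangent_monad \<Rightarrow>
   (('p, 'b, 'o, 'a) mor1, (('p, 'b, 'o, 'a) mor1, 'p \<Rightarrow> 'a) arrow) diff_object \<Rightarrow> bool" where
  "pointwise S' S D \<longleftrightarrow>
     (\<forall>A \<in> Obj (base S'). let X = base S; B = GO (carrier D) A in
        is_product X (TO X B) (tproj X B) (amap (phat D) A) B B)"

definition pointwise_DO ::
  "('p, 'b, 'n) tangent_monad \<Rightarrow> ('o, 'a) cart_tangent_monad \<Rightarrow>
   ((('p, 'b, 'o, 'a) mor1, (('p, 'b, 'o, 'a) mor1, 'p \<Rightarrow> 'a) arrow) diff_object,
    ((('p, 'b, 'o, 'a) mor1, (('p, 'b, 'o, 'a) mor1, 'p \<Rightarrow> 'a) arrow) diff_object,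
     (('p, 'b, 'o, 'a) mor1, 'p \<Rightarrow> 'a) arrow) arrow) cartesian_tangent_category" where
  "pointwise_DO S' S = full_subcategory (DO (hom_tangent S' S)) (pointwise S' S)"

text \<open>The functor \<open>H \<mapsto> (U \<circ> H; Z\<^sub>H, S\<^sub>H, P\<^sub>H)\<close> induced by a differential object
  \<open>(U; Z, S, P)\<close> in the hom-tangent category into \<open>S\<close>.\<close>

definition restrict_along ::
  "('q, 'c, 'k) tangent_monad \<Rightarrow> ('o, 'a) cart_tangent_monad \<Rightarrow>
   (('p, 'b, 'o, 'a) mor1, (('p, 'b, 'o, 'a) mor1, 'p \<Rightarrow> 'a) arrow) diff_object \<Rightarrow>
   ('q, 'c, 'p, 'b) mor1 \<Rightarrow>
   (('q, 'c, 'o, 'a) mor1, (('q, 'c, 'o, 'a) mor1, 'q \<Rightarrow> 'a) arrow) diff_object" where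
  "restrict_along S' S U H = \<lparr>
     carrier = comp1 S' S (carrier U) H,
     zeta = whisker_right S' S (zeta U) H,
     sigma = whisker_right S' S (sigma U) H,
     phat = whisker_right S' S (phat U) H\<rparr>"

definition restrict_along_map ::
  "('q, 'c, 'k) tangent_monad \<Rightarrow> ('o, 'a) cart_tangent_monad \<Rightarrow>
   (('p, 'b, 'o, 'a) mor1, (('p, 'b, 'o, 'a) mor1, 'p \<Rightarrow> 'a) arrow) diff_object \<Rightarrow>
   (('q, 'c, 'p, 'b) mor1, 'q \<Rightarrow> 'b) arrow \<Rightarrow>
   ((('q, 'c, 'o, 'a) mor1, (('q, 'c, 'o, 'a) mor1, 'q \<Rightarrow> 'a) arrow) diff_object,
    (('q, 'c, 'o, 'a) mor1, 'q \<Rightarrow> 'a) arrow) arrow" where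
  "restrict_along_map S' S U \<phi> =
     Arrow (restrict_along S' S U (asrc \<phi>)) (whisker_left S' S (carrier U) \<phi>)
       (restrict_along S' S U (atrg \<phi>))"

text \<open>\<open>E\<close> together with the differential object \<open>U = (U; Z, S, P)\<close> is a tangentad of differential
  objects of \<open>S\<close>. The type arguments are the types of objects and morphisms of the tangent monads
  \<open>S'\<close> against which the universal property is tested: HOL cannot quantify over types inside a
  formula.\<close>

definition tangentad_of_differential_objects ::
  "'q itself \<Rightarrow> 'c itself \<Rightarrow> ('o, 'a) cart_tangent_monad \<Rightarrow> ('p, 'b) cart_tangent_monad \<Rightarrow>
   (('p, 'b, 'o, 'a) mor1, (('p, 'b, 'o, 'a) mor1, 'p \<Rightarrow> 'a) arrow) diff_object \<Rightarrow> bool" where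
  "tangentad_of_differential_objects _ _ S E U \<longleftrightarrow>
     cartesian_tangent_monad E \<and>
     strict_one_morphism E S (carrier U) \<and>
     U \<in> Obj (pointwise_DO E S) \<and>
     (\<forall>S' :: ('q, 'c, unit) tangent_monad. tangent_monad S' \<longrightarrow>
        tangent_isomorphism (hom_tangent S' E) (pointwise_DO S' S)
          (restrict_along S' S U) (restrict_along_map S' S U))"

definition admits_differential_objects ::
  "'q itself \<Rightarrow> 'c itself \<Rightarrow> 'p itself \<Rightarrow> 'b itself \<Rightarrow> ('o, 'a) cart_tangent_monad \<Rightarrow> bool"
where
  "admits_differential_objects q c _ _ S \<longleftrightarrow>
     cartesian_tangent_monad S \<and>
     (\<exists>(E :: ('p, 'b) cart_tangent_monad) U. tangentad_of_differential_objects q c S E U)"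


section \<open>The monad on the category of differential objects\<close>

definition DO_S :: "('o, 'a) cart_tangent_monad \<Rightarrow> ('o, 'a) diff_object \<Rightarrow> ('o, 'a) diff_object"
where
  "DO_S S D = (let X = base S; A = carrier D in \<lparr>
     carrier = SO S A,
     zeta = SM S (zeta D) \<cdot>\<^bsub>X\<^esub> unit_cmp X (SO S),
     sigma = SM S (sigma D) \<cdot>\<^bsub>X\<^esub> prod_cmp X (SO S) (SM S) A A,
     phat = SM S (phat D) \<cdot>\<^bsub>X\<^esub> inverse_arr X (sdist S A)\<rparr>)"

definition DO_monad ::
  "('o, 'a) cart_tangent_monad \<Rightarrow>
   (('o, 'a) diff_object, (('o, 'a) diff_object, 'a) arrow) cart_tangent_monad" where
  "DO_monad S = \<lparr>
     base = DO (base S),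
     SO = DO_S S,
     SM = (\<lambda>f. Arrow (DO_S S (asrc f)) (SM S (amap f)) (DO_S S (atrg f))),
     sdist = (\<lambda>D. Arrow (DO_S S (DO_T (base S) D)) (sdist S (carrier D))
                        (DO_T (base S) (DO_S S D))),
     eta = (\<lambda>D. Arrow D (eta S (carrier D)) (DO_S S D)),
     mu = (\<lambda>D. Arrow (DO_S S (DO_S S D)) (mu S (carrier D)) (DO_S S D))\<rparr>"

definition forgetful ::
  "('o, 'a) cart_tangent_monad \<Rightarrow>
   (('o, 'a) diff_object, (('o, 'a) diff_object, 'a) arrow, 'o, 'a) mor1" where
  "forgetful S = (let X = base S in \<lparr>
     GO = (\<lambda>D \<in> Obj (DO X). carrier D),
     GM = (\<lambda>f \<in> Arr (DO X). amap f),
     gdist = (\<lambda>D \<in> Obj (DO X). idt X (TO X (carrier D))),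
     gtau = (\<lambda>D \<in> Obj (DO X). idt X (SO S (carrier D)))\<rparr>)"

text \<open>The forgetful 1-morphism with its tautological differential structure, whose components at
  \<open>(A, \<zeta>, \<sigma>, p)\<close> are \<open>\<zeta>\<close>, \<open>\<sigma>\<close> and \<open>p\<close>.\<close>

definition tautological ::
  "('o, 'a) cart_tangent_monad \<Rightarrow>
   ((('o, 'a) diff_object, (('o, 'a) diff_object, 'a) arrow, 'o, 'a) mor1,
    ((('o, 'a) diff_object, (('o, 'a) diff_object, 'a) arrow, 'o, 'a) mor1,
     ('o, 'a) diff_object \<Rightarrow> 'a) arrow) diff_object" where
  "tautological S = (let X = base S; U = forgetful S; Y = hom_tangent (DO_monad S) S in \<lparr>
     carrier = U,
     zeta = Arrow (terminal Y) (\<lambda>D \<in> Obj (DO X). zeta D) U,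
     sigma = Arrow (cprod Y U U) (\<lambda>D \<in> Obj (DO X). sigma D) U,
     phat = Arrow (TO Y U) (\<lambda>D \<in> Obj (DO X). phat D) U\<rparr>)"

end

theory Submission
  imports Defs
begin

text \<open>
  A category of structured objects inherits a tangent structure along a jointly faithful family of
  functors that forget the structure, provided that the objects \<open>T\<^sub>n A\<close> lift and that maps lift
  whenever their composites with suitable jointly monic legs do (locale \<open>tangent_creation\<close>, theorem
  \<open>created_tangent_category\<close>). Differential objects are such structured objects, with one forgetful
  functor (\<open>DO_creation\<close>), and so are 1-morphisms into a Cartesian tangent monad, with the evaluations at
  the objects of the source (\<open>H_creation\<close>). The pullback that expresses the universality of the lift is not
  required to be preserved by \<open>T\<close>; it is created nevertheless, since \<open>T\<close> turns the map
  \<open>T\<^sub>2 A \<rightarrow> T\<^sup>2 A\<close> in question into a monic map (\<open>T_vert_monic\<close>).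

  The monad acts on differential objects through the inverse of its distributive law. The axiom that
  is not formal relates \<open>p\<close> to the addition of tangent vectors, for it involves \<open>T\<^sub>2\<close>, which \<open>S\<close> does
  not have to preserve. For a differential object, however, \<open>T\<^sub>2 A\<close> is a power of \<open>A\<close>, and \<open>S\<close> preserves
  finite products (\<open>lift_pairs\<close>, \<open>F_DO_differential_object\<close>). The same lemmas, applied to \<open>T\<close> with the
  flip, give the tangent bundle of a differential object. As the distributive law, the unit and the
  multiplication are linear, differential objects carry a Cartesian tangent monad (\<open>E_cartesian\<close>).

  For the universal property, let \<open>S'\<close> be a tangent monad. A 1-morphism \<open>K\<close> from \<open>S'\<close> to the monad on
  differential objects and a pointwise differential object in the hom-tangent category from \<open>S'\<close> to \<open>S\<close>
  unfold to the same data: a 1-morphism \<open>G\<close> and differential objects \<open>D A\<close> with carriers \<open>G A\<close>, such that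
  all maps \<open>G f\<close> and all components of the two distributive laws of \<open>G\<close> are linear (\<open>linear_family\<close>).
  For \<open>K\<close> this is its image under the forgetful 1-morphism together with its values
  (\<open>over_family\<close>, \<open>lift_one_morphism\<close>). For differential objects, these linearity conditions say exactly
  that the maps \<open>p\<close> form a 2-morphism (\<open>family_phat\<close>); then so do \<open>\<zeta>\<close> and \<open>\<sigma>\<close>, because linear maps
  preserve zero and sums (\<open>linear_map_additive\<close>, \<open>family_zeta\<close>, \<open>family_sigma\<close>), and the axioms can be
  tested at each \<open>A\<close> (\<open>differential_object_underlying\<close>). The resulting bijection preserves the tangent
  structure strictly, since a differential structure on \<open>T\<^sub>2 A\<close> with linear projections is unique
  (\<open>DO_T2_unique\<close>). That pointwise differential objects form a tangent category at all then follows by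
  transport along the bijection (\<open>tangent_category_transport\<close>).
\<close>

section \<open>Calculating in categories\<close>

lemma in_hom_iff [simp]: "f \<in> hom X A B \<longleftrightarrow> f \<in> Arr X \<and> Dom X f = A \<and> Cod X f = B"
  by (auto simp: hom_def)

context category
begin

lemma Obj_ends [simp]: "f \<in> Arr X \<Longrightarrow> Dom X f \<in> Obj X" "f \<in> Arr X \<Longrightarrow> Cod X f \<in> Obj X"
  by (auto simp: Dom_in_Obj Cod_in_Obj)

lemma idt_typing [simp]:
  "A \<in> Obj X \<Longrightarrow> idt X A \<in> Arr X" "A \<in> Obj X \<Longrightarrow> Dom X (idt X A) = A" "A \<in> Obj X \<Longrightarrow> Cod X (idt X A) = A"
  using idt_in_hom by auto

lemma comp_typing [simp]:
  assumes "f \<in> Arr X" "g \<in> Arr X" "Dom X g = Cod X f"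
  shows "g \<cdot> f \<in> Arr X" "Dom X (g \<cdot> f) = Dom X f" "Cod X (g \<cdot> f) = Cod X g"
  using comp_in_hom[of f "Dom X f" "Cod X f" g "Cod X g"] assms by auto

lemma comp_idt [simp]:
  "f \<in> Arr X \<Longrightarrow> Cod X f = A \<Longrightarrow> idt X A \<cdot> f = f"
  "f \<in> Arr X \<Longrightarrow> Dom X f = A \<Longrightarrow> f \<cdot> idt X A = f"
  using comp_idt_left comp_idt_right by auto

lemma assoc [simp]:
  "f \<in> Arr X \<Longrightarrow> g \<in> Arr X \<Longrightarrow> h \<in> Arr X \<Longrightarrow> Dom X g = Cod X f \<Longrightarrow> Dom X h = Cod X g \<Longrightarrow>
    (h \<cdot> g) \<cdot> f = h \<cdot> (g \<cdot> f)"
  using comp_assoc[of f "Dom X f" "Cod X f" g "Cod X g" h "Cod X h"] by auto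

text \<open>Composites are kept in right-associated normal form, so an equation between composites is
  needed a second time with an arbitrary map precomposed on both sides.\<close>

lemma tail:
  assumes "g \<cdot> f = k" "f \<in> Arr X" "g \<in> Arr X" "Dom X g = Cod X f" "x \<in> Arr X" "Cod X x = Dom X f"
  shows "g \<cdot> (f \<cdot> x) = k \<cdot> x"
  using assms by (simp flip: assms(1))

lemma tail3:
  assumes "h \<cdot> (g \<cdot> f) = k" "f \<in> Arr X" "g \<in> Arr X" "h \<in> Arr X" "Dom X g = Cod X f" "Dom X h = Cod X g"
    "x \<in> Arr X" "Cod X x = Dom X f"
  shows "h \<cdot> (g \<cdot> (f \<cdot> x)) = k \<cdot> x"
  using assms by (simp flip: assms(1))

end

lemma is_functorD:
  assumes "is_functor X Y FO FM"
  shows "category X" "category Y" "\<And>A. A \<in> Obj X \<Longrightarrow> FO A \<in> Obj Y"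
    "\<And>f. f \<in> Arr X \<Longrightarrow> FM f \<in> Arr Y" "\<And>f. f \<in> Arr X \<Longrightarrow> Dom Y (FM f) = FO (Dom X f)"
    "\<And>f. f \<in> Arr X \<Longrightarrow> Cod Y (FM f) = FO (Cod X f)"
    "\<And>A. A \<in> Obj X \<Longrightarrow> FM (idt X A) = idt Y (FO A)"
    "\<And>f g. f \<in> Arr X \<Longrightarrow> g \<in> Arr X \<Longrightarrow> Dom X g = Cod X f \<Longrightarrow> FM (g \<cdot>\<^bsub>X\<^esub> f) = FM g \<cdot>\<^bsub>Y\<^esub> FM f"
  using assms by (auto simp: is_functor_def)

lemma natural_transformationD:
  assumes "natural_transformation X Y FO FM HO HM t"
  shows "is_functor X Y FO FM" "is_functor X Y HO HM"
    "\<And>A. A \<in> Obj X \<Longrightarrow> t A \<in> Arr Y" "\<And>A. A \<in> Obj X \<Longrightarrow> Dom Y (t A) = FO A"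
    "\<And>A. A \<in> Obj X \<Longrightarrow> Cod Y (t A) = HO A"
    "\<And>f B. f \<in> Arr X \<Longrightarrow> Cod X f = B \<Longrightarrow> t B \<cdot>\<^bsub>Y\<^esub> FM f = HM f \<cdot>\<^bsub>Y\<^esub> t (Dom X f)"
  using assms by (auto simp: natural_transformation_def)

lemma natural_transformationI:
  assumes "is_functor X Y FO FM" "is_functor X Y HO HM"
    "\<And>A. A \<in> Obj X \<Longrightarrow> t A \<in> Arr Y \<and> Dom Y (t A) = FO A \<and> Cod Y (t A) = HO A"
    "\<And>f. f \<in> Arr X \<Longrightarrow> t (Cod X f) \<cdot>\<^bsub>Y\<^esub> FM f = HM f \<cdot>\<^bsub>Y\<^esub> t (Dom X f)"
  shows "natural_transformation X Y FO FM HO HM t"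
  using assms by (auto simp: natural_transformation_def)

lemma is_functor_comp:
  assumes "is_functor X Y FO FM" "is_functor Y Z HO HM"
  shows "is_functor X Z (\<lambda>A. HO (FO A)) (\<lambda>f. HM (FM f))"
  using assms by (auto simp: is_functor_def)

section \<open>Limits\<close>

text \<open>Limits of diagrams of objects \<open>B k\<close> with at most one map \<open>d k k'\<close> between any two of them.
  Terminal objects, products, pullbacks and fold pullbacks are the instances that occur; treating
  them together means that limits have to be lifted to categories of structured objects only once.\<close>

definition is_cone ::
  "('o, 'a, 'm) category_scheme \<Rightarrow> nat set \<Rightarrow> (nat \<times> nat) set \<Rightarrow> (nat \<Rightarrow> nat \<Rightarrow> 'a) \<Rightarrow> (nat \<Rightarrow> 'o) \<Rightarrow>
   'o \<Rightarrow> (nat \<Rightarrow> 'a) \<Rightarrow> bool" where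
  "is_cone X K E d B C u \<longleftrightarrow> C \<in> Obj X \<and> (\<forall>k\<in>K. u k \<in> hom X C (B k)) \<and>
     (\<forall>k k'. (k, k') \<in> E \<longrightarrow> d k k' \<cdot>\<^bsub>X\<^esub> u k = u k')"

definition is_diagram ::
  "('o, 'a, 'm) category_scheme \<Rightarrow> nat set \<Rightarrow> (nat \<times> nat) set \<Rightarrow> (nat \<Rightarrow> nat \<Rightarrow> 'a) \<Rightarrow> (nat \<Rightarrow> 'o) \<Rightarrow>
   bool" where
  "is_diagram X K E d B \<longleftrightarrow> (\<forall>k\<in>K. B k \<in> Obj X) \<and>
     (\<forall>k k'. (k, k') \<in> E \<longrightarrow> k \<in> K \<and> k' \<in> K \<and> d k k' \<in> hom X (B k) (B k'))"

definition is_limit ::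
  "('o, 'a, 'm) category_scheme \<Rightarrow> nat set \<Rightarrow> (nat \<times> nat) set \<Rightarrow> (nat \<Rightarrow> nat \<Rightarrow> 'a) \<Rightarrow> (nat \<Rightarrow> 'o) \<Rightarrow>
   'o \<Rightarrow> (nat \<Rightarrow> 'a) \<Rightarrow> bool" where
  "is_limit X K E d B P \<pi> \<longleftrightarrow> is_diagram X K E d B \<and> is_cone X K E d B P \<pi> \<and>
     (\<forall>C u. is_cone X K E d B C u \<longrightarrow> (\<exists>!h. h \<in> hom X C P \<and> (\<forall>k\<in>K. \<pi> k \<cdot>\<^bsub>X\<^esub> h = u k)))"

definition jointly_monic :: "('o, 'a, 'm) category_scheme \<Rightarrow> nat set \<Rightarrow> 'o \<Rightarrow> (nat \<Rightarrow> 'a) \<Rightarrow> bool" where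
  "jointly_monic X K P \<pi> \<longleftrightarrow> (\<forall>f\<in>Arr X. \<forall>g\<in>Arr X. Dom X f = Dom X g \<longrightarrow> Cod X f = P \<longrightarrow>
     Cod X g = P \<longrightarrow> (\<forall>k\<in>K. \<pi> k \<cdot>\<^bsub>X\<^esub> f = \<pi> k \<cdot>\<^bsub>X\<^esub> g) \<longrightarrow> f = g)"

lemma jointly_monicD:
  "jointly_monic X K P \<pi> \<Longrightarrow> f \<in> Arr X \<Longrightarrow> g \<in> Arr X \<Longrightarrow> Dom X f = Dom X g \<Longrightarrow> Cod X f = P \<Longrightarrow>
     Cod X g = P \<Longrightarrow> (\<And>k. k \<in> K \<Longrightarrow> \<pi> k \<cdot>\<^bsub>X\<^esub> f = \<pi> k \<cdot>\<^bsub>X\<^esub> g) \<Longrightarrow> f = g"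
  by (auto simp: jointly_monic_def)

lemma is_limitD:
  assumes "is_limit X K E d B P \<pi>"
  shows "P \<in> Obj X" "\<And>k. k \<in> K \<Longrightarrow> \<pi> k \<in> Arr X" "\<And>k. k \<in> K \<Longrightarrow> Dom X (\<pi> k) = P"
    "\<And>k. k \<in> K \<Longrightarrow> Cod X (\<pi> k) = B k" "\<And>k. k \<in> K \<Longrightarrow> B k \<in> Obj X"
    "\<And>k k'. (k, k') \<in> E \<Longrightarrow> d k k' \<cdot>\<^bsub>X\<^esub> \<pi> k = \<pi> k'"
    "\<And>k k'. (k, k') \<in> E \<Longrightarrow> d k k' \<in> Arr X"
    "\<And>k k'. (k, k') \<in> E \<Longrightarrow> Dom X (d k k') = B k"
    "\<And>k k'. (k, k') \<in> E \<Longrightarrow> Cod X (d k k') = B k'"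
  using assms by (auto simp: is_limit_def is_cone_def is_diagram_def)

lemma is_limit_edge:
  assumes "is_limit X K E d B P \<pi>" "(k, k') \<in> E"
  shows "k \<in> K" "k' \<in> K"
  using assms by (auto simp: is_limit_def is_diagram_def)

lemma is_limit_obtain:
  assumes "is_limit X K E d B P \<pi>" "C \<in> Obj X"
    "\<And>k. k \<in> K \<Longrightarrow> u k \<in> Arr X \<and> Dom X (u k) = C \<and> Cod X (u k) = B k"
    "\<And>k k'. (k, k') \<in> E \<Longrightarrow> d k k' \<cdot>\<^bsub>X\<^esub> u k = u k'"
  obtains h where "h \<in> Arr X" "Dom X h = C" "Cod X h = P" "\<And>k. k \<in> K \<Longrightarrow> \<pi> k \<cdot>\<^bsub>X\<^esub> h = u k"
proof -
  have "is_cone X K E d B C u" using assms(2-) by (auto simp: is_cone_def)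
  then have "\<exists>!h. h \<in> hom X C P \<and> (\<forall>k\<in>K. \<pi> k \<cdot>\<^bsub>X\<^esub> h = u k)"
    using assms(1) unfolding is_limit_def by blast
  then show ?thesis using that by auto
qed

context category
begin

lemma is_limit_jointly_monic:
  assumes "is_limit X K E d B P \<pi>"
  shows "jointly_monic X K P \<pi>"
  unfolding jointly_monic_def
proof (intro ballI impI)
  fix f g assume fg: "f \<in> Arr X" "g \<in> Arr X" "Dom X f = Dom X g" "Cod X f = P" "Cod X g = P"
    "\<forall>k\<in>K. \<pi> k \<cdot> f = \<pi> k \<cdot> g"
  note L = is_limitD[OF assms]
  have "is_cone X K E d B (Dom X f) (\<lambda>k. \<pi> k \<cdot> f)"
    unfolding is_cone_def
  proof (intro conjI allI impI ballI)
    fix k k' assume e: "(k, k') \<in> E"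
    note k = is_limit_edge[OF assms e]
    show "d k k' \<cdot> (\<pi> k \<cdot> f) = \<pi> k' \<cdot> f"
      using tail[OF L(6)[OF e]] L(2-4)[OF k(1)] L(7,8)[OF e] fg by simp
  qed (use fg L in auto)
  then have "\<exists>!h. h \<in> hom X (Dom X f) P \<and> (\<forall>k\<in>K. \<pi> k \<cdot> h = \<pi> k \<cdot> f)"
    using assms unfolding is_limit_def by blast
  moreover have "f \<in> hom X (Dom X f) P" "g \<in> hom X (Dom X f) P" using fg by auto
  ultimately show "f = g" using fg(6) by metis
qed

lemma is_limitI:
  assumes "is_diagram X K E d B" "is_cone X K E d B P \<pi>" "jointly_monic X K P \<pi>"
    "\<And>C u. is_cone X K E d B C u \<Longrightarrow> \<exists>h. h \<in> hom X C P \<and> (\<forall>k\<in>K. \<pi> k \<cdot> h = u k)"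
  shows "is_limit X K E d B P \<pi>"
  unfolding is_limit_def
proof (intro conjI allI impI assms)
  fix C u assume "is_cone X K E d B C u"
  with assms(4) obtain h where "h \<in> hom X C P \<and> (\<forall>k\<in>K. \<pi> k \<cdot> h = u k)" by blast
  then show "\<exists>!h. h \<in> hom X C P \<and> (\<forall>k\<in>K. \<pi> k \<cdot> h = u k)"
  proof (rule ex1I[of _ h])
    fix g assume "g \<in> hom X C P \<and> (\<forall>k\<in>K. \<pi> k \<cdot> g = u k)"
    with \<open>h \<in> hom X C P \<and> (\<forall>k\<in>K. \<pi> k \<cdot> h = u k)\<close> show "g = h"
      by - (rule jointly_monicD[OF assms(3), of g h], simp_all)
  qed
qed

lemma is_limit_iso:
  assumes L: "is_limit X K E d B P \<pi>" and L': "is_limit X K E d B Q \<rho>"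
  obtains t t' where "t \<in> Arr X" "Dom X t = Q" "Cod X t = P" "t' \<in> Arr X" "Dom X t' = P" "Cod X t' = Q"
    "t \<cdot> t' = idt X P" "t' \<cdot> t = idt X Q" "\<forall>k\<in>K. \<pi> k \<cdot> t = \<rho> k"
proof -
  note LD = is_limitD[OF L] is_limitD[OF L']
  obtain t where t: "t \<in> Arr X" "Dom X t = Q" "Cod X t = P" "\<And>k. k \<in> K \<Longrightarrow> \<pi> k \<cdot> t = \<rho> k"
    using is_limit_obtain[OF L, of Q \<rho>] LD by metis
  obtain t' where t': "t' \<in> Arr X" "Dom X t' = P" "Cod X t' = Q" "\<And>k. k \<in> K \<Longrightarrow> \<rho> k \<cdot> t' = \<pi> k"
    using is_limit_obtain[OF L', of P \<pi>] LD by metis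
  have "t \<cdot> t' = idt X P"
    using jointly_monicD[OF is_limit_jointly_monic[OF L], of "t \<cdot> t'" "idt X P"] t t' LD
    by (simp flip: assoc)
  moreover have "t' \<cdot> t = idt X Q"
    using jointly_monicD[OF is_limit_jointly_monic[OF L'], of "t' \<cdot> t" "idt X Q"] t t' LD
    by (simp flip: assoc)
  ultimately show thesis by (intro that[OF t(1-3) t'(1-3)] ballI t(4))
qed

lemma is_limit_iso_cong:
  assumes L: "is_limit X K E d B P \<pi>"
    and t: "t \<in> Arr X" "Dom X t = Q" "Cod X t = P" "t' \<in> Arr X" "Dom X t' = P" "Cod X t' = Q"
    "t \<cdot> t' = idt X P" "t' \<cdot> t = idt X Q" "\<And>k. k \<in> K \<Longrightarrow> \<pi> k \<cdot> t = \<rho> k"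
  shows "is_limit X K E d B Q \<rho>"
proof (rule is_limitI)
  note LD = is_limitD[OF L]
  show "is_diagram X K E d B" using L by (simp add: is_limit_def)
  have Q: "Q \<in> Obj X" using t Obj_ends by metis
  have \<rho>: "\<And>k. k \<in> K \<Longrightarrow> \<rho> k \<in> Arr X \<and> Dom X (\<rho> k) = Q \<and> Cod X (\<rho> k) = B k"
    using LD t(1-3) by (simp flip: t(9))
  show "is_cone X K E d B Q \<rho>"
    unfolding is_cone_def
  proof (intro conjI allI impI ballI)
    fix k k' assume e: "(k, k') \<in> E"
    note k = is_limit_edge[OF L e]
    have "d k k' \<cdot> (\<pi> k \<cdot> t) = \<pi> k' \<cdot> t"
      using tail[OF LD(6)[OF e]] LD(2-4)[OF k(1)] LD(7,8)[OF e] t(1-3) by simp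
    then show "d k k' \<cdot> \<rho> k = \<rho> k'" using t(9) k by simp
  qed (use \<rho> Q in auto)
  show "jointly_monic X K Q \<rho>"
    unfolding jointly_monic_def
  proof (intro ballI impI)
    fix f g assume fg: "f \<in> Arr X" "g \<in> Arr X" "Dom X f = Dom X g" "Cod X f = Q" "Cod X g = Q"
      "\<forall>k\<in>K. \<rho> k \<cdot> f = \<rho> k \<cdot> g"
    have "t \<cdot> f = t \<cdot> g"
      using jointly_monicD[OF is_limit_jointly_monic[OF L], of "t \<cdot> f" "t \<cdot> g"] fg LD t
      by (simp flip: assoc)
    then have "t' \<cdot> (t \<cdot> f) = t' \<cdot> (t \<cdot> g)" by simp
    then show "f = g" using fg t by (simp flip: assoc)
  qed
  fix C u assume c: "is_cone X K E d B C u"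
  then obtain h where h: "h \<in> Arr X" "Dom X h = C" "Cod X h = P" "\<And>k. k \<in> K \<Longrightarrow> \<pi> k \<cdot> h = u k"
    using is_limit_obtain[OF L, of C u] by (auto simp: is_cone_def)
  have "t' \<cdot> h \<in> hom X C Q" using h(1-3) t(1-6) by simp
  moreover have "\<forall>k\<in>K. \<rho> k \<cdot> (t' \<cdot> h) = u k"
  proof
    fix k assume k: "k \<in> K"
    have "\<rho> k \<cdot> (t' \<cdot> h) = (\<pi> k \<cdot> t) \<cdot> (t' \<cdot> h)" using t(9) k by simp
    also have "\<dots> = \<pi> k \<cdot> ((t \<cdot> t') \<cdot> h)" using LD t(1-6) h k by simp
    also have "\<dots> = u k" using t(7) h k by simp
    finally show "\<rho> k \<cdot> (t' \<cdot> h) = u k" .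
  qed
  ultimately show "\<exists>h. h \<in> hom X C Q \<and> (\<forall>k\<in>K. \<rho> k \<cdot> h = u k)" by blast
qed

lemma is_terminal_limit: "is_terminal X Z \<longleftrightarrow> is_limit X {} {} d B Z \<pi>"
  by (simp add: is_terminal_def is_limit_def is_cone_def is_diagram_def Ball_def del: in_hom_iff)

lemma is_product_limit:
  assumes "A \<in> Obj X" "B \<in> Obj X"
  shows "is_product X P p1 p2 A B \<longleftrightarrow>
    is_limit X {0, 1} {} d (case_nat A (\<lambda>_. B)) P (case_nat p1 (\<lambda>_. p2))" (is "_ \<longleftrightarrow> ?L")
proof
  assume p: "is_product X P p1 p2 A B"
  show ?L
    unfolding is_limit_def
  proof (intro conjI allI impI)
    show "is_diagram X {0, 1} {} d (case_nat A (\<lambda>_. B))" using assms by (auto simp: is_diagram_def)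
    show "is_cone X {0, 1} {} d (case_nat A (\<lambda>_. B)) P (case_nat p1 (\<lambda>_. p2))"
      using p Obj_ends by (auto simp: is_cone_def is_product_def)
    fix C u assume "is_cone X {0, 1} {} d (case_nat A (\<lambda>_. B)) C u"
    then have "C \<in> Obj X" "u 0 \<in> hom X C A" "u 1 \<in> hom X C B" by (auto simp: is_cone_def)
    then have "\<exists>!h. h \<in> hom X C P \<and> p1 \<cdot> h = u 0 \<and> p2 \<cdot> h = u 1"
      using p unfolding is_product_def by blast
    then show "\<exists>!h. h \<in> hom X C P \<and> (\<forall>k\<in>{0, 1}. (case k of 0 \<Rightarrow> p1 | Suc x \<Rightarrow> p2) \<cdot> h = u k)"
      by (simp del: in_hom_iff)
  qed
next
  assume L: ?L
  show "is_product X P p1 p2 A B"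
    unfolding is_product_def
  proof (intro conjI ballI)
    show "p1 \<in> hom X P A" "p2 \<in> hom X P B"
      using is_limitD(2,3,4)[OF L, of 0] is_limitD(2,3,4)[OF L, of 1] by auto
    fix C f g assume "C \<in> Obj X" "f \<in> hom X C A" "g \<in> hom X C B"
    then have "is_cone X {0, 1} {} d (case_nat A (\<lambda>_. B)) C (case_nat f (\<lambda>_. g))"
      by (auto simp: is_cone_def)
    then have "\<exists>!h. h \<in> hom X C P \<and> (\<forall>k\<in>{0, 1}. case_nat p1 (\<lambda>_. p2) k \<cdot> h = case_nat f (\<lambda>_. g) k)"
      using L unfolding is_limit_def by blast
    then show "\<exists>!h. h \<in> hom X C P \<and> p1 \<cdot> h = f \<and> p2 \<cdot> h = g"
      by (simp del: in_hom_iff)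
  qed
qed

text \<open>The fold pullback as a limit: the common composite is the leg with index \<open>n\<close>.\<close>

lemma is_fold_pullback_limit:
  shows "is_fold_pullback X n f P q \<pi> \<longleftrightarrow> f \<in> Arr X \<and>
    is_limit X {..n} ({..<n} \<times> {n}) (\<lambda>_ _. f) ((\<lambda>_. Dom X f)(n := Cod X f)) P (\<pi>(n := q))"
    (is "_ \<longleftrightarrow> _ \<and> ?L")
proof (intro iffI conjI)
  assume p: "is_fold_pullback X n f P q \<pi>"
  then show f: "f \<in> Arr X" by (simp add: is_fold_pullback_def)
  show ?L
    unfolding is_limit_def
  proof (intro conjI allI impI)
    show "is_diagram X {..n} ({..<n} \<times> {n}) (\<lambda>_ _. f) ((\<lambda>_. Dom X f)(n := Cod X f))"
      using f by (auto simp: is_diagram_def)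
    show "is_cone X {..n} ({..<n} \<times> {n}) (\<lambda>_ _. f) ((\<lambda>_. Dom X f)(n := Cod X f)) P (\<pi>(n := q))"
      using p Obj_ends(1)[of q] by (auto simp: is_cone_def is_fold_pullback_def)
    fix C u assume "is_cone X {..n} ({..<n} \<times> {n}) (\<lambda>_ _. f) ((\<lambda>_. Dom X f)(n := Cod X f)) C u"
    then have u: "C \<in> Obj X" "u n \<in> hom X C (Cod X f)" "\<forall>i<n. u i \<in> hom X C (Dom X f) \<and> f \<cdot> u i = u n"
      by (auto simp: is_cone_def)
    have "\<exists>!h. h \<in> hom X C P \<and> q \<cdot> h = u n \<and> (\<forall>i<n. \<pi> i \<cdot> h = u i)"
      using p u unfolding is_fold_pullback_def by blast
    moreover have "(q \<cdot> h = u n \<and> (\<forall>i<n. \<pi> i \<cdot> h = u i)) \<longleftrightarrow> (\<forall>k\<in>{..n}. (\<pi>(n := q)) k \<cdot> h = u k)" for h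
      by (auto simp: le_less)
    ultimately show "\<exists>!h. h \<in> hom X C P \<and> (\<forall>k\<in>{..n}. (\<pi>(n := q)) k \<cdot> h = u k)"
      by simp
  qed
next
  assume L: "f \<in> Arr X \<and> ?L"
  note LD = is_limitD[OF conjunct2[OF L]]
  show "is_fold_pullback X n f P q \<pi>"
    unfolding is_fold_pullback_def
  proof (intro conjI ballI allI impI)
    show "f \<in> Arr X" using L by simp
    show "q \<in> hom X P (Cod X f)" using LD(2,3,4)[of n] by simp
    fix i assume "i < n" then show "\<pi> i \<in> hom X P (Dom X f)" "f \<cdot> \<pi> i = q"
      using LD(2,3,4)[of i] LD(6)[of i n] by auto
  next
    fix C r u assume "C \<in> Obj X" "r \<in> hom X C (Cod X f)" "\<forall>i<n. u i \<in> hom X C (Dom X f) \<and> f \<cdot> u i = r"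
    then have "is_cone X {..n} ({..<n} \<times> {n}) (\<lambda>_ _. f) ((\<lambda>_. Dom X f)(n := Cod X f)) C (u(n := r))"
      by (auto simp: is_cone_def)
    then have "\<exists>!h. h \<in> hom X C P \<and> (\<forall>k\<in>{..n}. (\<pi>(n := q)) k \<cdot> h = (u(n := r)) k)"
      using L unfolding is_limit_def by blast
    moreover have "(q \<cdot> h = r \<and> (\<forall>i<n. \<pi> i \<cdot> h = u i)) \<longleftrightarrow> (\<forall>k\<in>{..n}. (\<pi>(n := q)) k \<cdot> h = (u(n := r)) k)" for h
      by (auto simp: le_less)
    ultimately show "\<exists>!h. h \<in> hom X C P \<and> q \<cdot> h = r \<and> (\<forall>i<n. \<pi> i \<cdot> h = u i)"
      by simp
  qed
qed

text \<open>The preservation axiom speaks of fold pullbacks; through this equivalence it reaches \<open>T\<^sub>2 A\<close>, which is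
  given as a binary pullback.\<close>

lemma is_pullback_fold:
  assumes "f \<in> Arr X"
  shows "is_pullback X P p1 p2 f f \<longleftrightarrow> is_fold_pullback X 2 f P (f \<cdot> p1) (case_nat p1 (\<lambda>_. p2))"
    (is "?L \<longleftrightarrow> ?R")
proof
  assume p: ?L
  have P: "p1 \<in> hom X P (Dom X f)" "p2 \<in> hom X P (Dom X f)"
    using p by (auto simp: is_pullback_def)
  show ?R
    unfolding is_fold_pullback_def
  proof (intro conjI ballI allI impI)
    show "f \<in> Arr X" "f \<cdot> p1 \<in> hom X P (Cod X f)" using assms p by (auto simp: is_pullback_def)
    fix i :: nat assume "i < 2"
    then show "case_nat p1 (\<lambda>_. p2) i \<in> hom X P (Dom X f)" "f \<cdot> case_nat p1 (\<lambda>_. p2) i = f \<cdot> p1"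
      using p by (auto simp: is_pullback_def split: nat.split)
  next
    fix C r u assume u: "C \<in> Obj X" "r \<in> hom X C (Cod X f)"
      "\<forall>i<2::nat. u i \<in> hom X C (Dom X f) \<and> f \<cdot> u i = r"
    have [simp]: "(\<forall>i<2::nat. Q i) \<longleftrightarrow> Q 0 \<and> Q 1" for Q by (auto simp: less_2_cases_iff)
    have "\<exists>!h. h \<in> hom X C P \<and> p1 \<cdot> h = u 0 \<and> p2 \<cdot> h = u 1"
      using p u unfolding is_pullback_def by simp
    moreover have "h \<in> hom X C P \<and> (f \<cdot> p1) \<cdot> h = r \<and> (\<forall>i<2. case_nat p1 (\<lambda>_. p2) i \<cdot> h = u i) \<longleftrightarrow>
        h \<in> hom X C P \<and> p1 \<cdot> h = u 0 \<and> p2 \<cdot> h = u 1" for h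
    proof -
      have "(f \<cdot> p1) \<cdot> h = f \<cdot> (p1 \<cdot> h)" if "h \<in> hom X C P" using that P assms by simp
      then show ?thesis using u(3) by (auto simp del: in_hom_iff assoc)
    qed
    ultimately show "\<exists>!h. h \<in> hom X C P \<and> (f \<cdot> p1) \<cdot> h = r \<and> (\<forall>i<2. case_nat p1 (\<lambda>_. p2) i \<cdot> h = u i)"
      by (simp only:)
  qed
next
  assume p: ?R
  have [simp]: "(\<forall>i<2::nat. Q i) \<longleftrightarrow> Q 0 \<and> Q 1" for Q by (auto simp: less_2_cases_iff)
  have P: "p1 \<in> hom X P (Dom X f)" "p2 \<in> hom X P (Dom X f)" "f \<cdot> p1 = f \<cdot> p2"
    using p by (auto simp: is_fold_pullback_def)
  show ?L
    unfolding is_pullback_def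
  proof (intro conjI ballI impI P assms refl)
    fix C u v assume u: "C \<in> Obj X" "u \<in> hom X C (Dom X f)" "v \<in> hom X C (Dom X f)" "f \<cdot> u = f \<cdot> v"
    have A: "f \<cdot> u \<in> hom X C (Cod X f)"
      "\<forall>i<2. case_nat u (\<lambda>_. v) i \<in> hom X C (Dom X f) \<and> f \<cdot> case_nat u (\<lambda>_. v) i = f \<cdot> u"
      using u assms by simp_all
    from p have "\<forall>C\<in>Obj X. \<forall>r\<in>hom X C (Cod X f). \<forall>u. (\<forall>i<2. u i \<in> hom X C (Dom X f) \<and> f \<cdot> u i = r) \<longrightarrow>
        (\<exists>!h. h \<in> hom X C P \<and> (f \<cdot> p1) \<cdot> h = r \<and> (\<forall>i<2. case_nat p1 (\<lambda>_. p2) i \<cdot> h = u i))"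
      unfolding is_fold_pullback_def by (elim conjE)
    note p' = this[rule_format, OF u(1) A(1), of "case_nat u (\<lambda>_. v)", OF A(2)[rule_format]]
    have "\<exists>!h. h \<in> hom X C P \<and> (f \<cdot> p1) \<cdot> h = f \<cdot> u \<and> (\<forall>i<2. case_nat p1 (\<lambda>_. p2) i \<cdot> h = case_nat u (\<lambda>_. v) i)"
      by (rule p')
    moreover have "h \<in> hom X C P \<and> (f \<cdot> p1) \<cdot> h = f \<cdot> u \<and>
        (\<forall>i<2. case_nat p1 (\<lambda>_. p2) i \<cdot> h = case_nat u (\<lambda>_. v) i) \<longleftrightarrow>
        h \<in> hom X C P \<and> p1 \<cdot> h = u \<and> p2 \<cdot> h = v" for h
    proof -
      have "(f \<cdot> p1) \<cdot> h = f \<cdot> (p1 \<cdot> h)" if "h \<in> hom X C P" using that P(1) assms by simp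
      then show ?thesis by (auto simp del: in_hom_iff assoc)
    qed
    ultimately show "\<exists>!h. h \<in> hom X C P \<and> p1 \<cdot> h = u \<and> p2 \<cdot> h = v"
      by (simp only:)
  qed
qed

lemma is_pullback_jointly_monic:
  assumes "is_pullback X P p1 p2 f g"
  shows "jointly_monic X {0, 1} P (case_nat p1 (\<lambda>_. p2))"
  unfolding jointly_monic_def
proof (intro ballI impI)
  fix x y assume xy: "x \<in> Arr X" "y \<in> Arr X" "Dom X x = Dom X y" "Cod X x = P" "Cod X y = P"
    "\<forall>k\<in>{0, 1}. case_nat p1 (\<lambda>_. p2) k \<cdot> x = case_nat p1 (\<lambda>_. p2) k \<cdot> y"
  have p: "p1 \<in> hom X P (Dom X f)" "p2 \<in> hom X P (Dom X g)" "f \<cdot> p1 = g \<cdot> p2" "f \<in> Arr X" "g \<in> Arr X"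
    using assms by (auto simp: is_pullback_def)
  have "p1 \<cdot> x \<in> hom X (Dom X x) (Dom X f)" "p2 \<cdot> x \<in> hom X (Dom X x) (Dom X g)"
    "f \<cdot> (p1 \<cdot> x) = g \<cdot> (p2 \<cdot> x)" using tail[OF p(3), of x] p(1,2,4,5) xy(1,4) by simp_all
  then have "\<exists>!h. h \<in> hom X (Dom X x) P \<and> p1 \<cdot> h = p1 \<cdot> x \<and> p2 \<cdot> h = p2 \<cdot> x"
    using assms[unfolded is_pullback_def] Obj_ends(1)[OF xy(1)] by blast
  moreover have "p1 \<cdot> x = p1 \<cdot> y" "p2 \<cdot> x = p2 \<cdot> y" using xy(6) by auto
  moreover have "x \<in> hom X (Dom X x) P" "y \<in> hom X (Dom X x) P" using xy by auto
  ultimately show "x = y" by metis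
qed

end

section \<open>Calculating in tangent categories\<close>

context category
begin

text \<open>Products and pullbacks are both jointly monic cones, which is all that the definite description in
  \<open>pair\<close> needs.\<close>

lemma pair_eqI:
  assumes "is_product X P p1 p2 A B \<or> is_pullback X P p1 p2 f g"
    and "h \<in> Arr X" "Dom X h = Dom X u" "Cod X h = P" "p1 \<cdot> h = u" "p2 \<cdot> h = v"
  shows "pair X p1 p2 u v = h"
proof -
  have P: "p1 \<in> hom X P (Cod X p1)" "p2 \<in> hom X P (Cod X p2)"
    using assms(1) by (auto simp: is_product_def is_pullback_def)
  have j: "jointly_monic X {0, 1} P (case_nat p1 (\<lambda>_. p2))"
    using assms(1)
  proof
    assume p: "is_product X P p1 p2 A B"
    then have "A \<in> Obj X" "B \<in> Obj X" by (auto simp: is_product_def)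
    with p show ?thesis using is_product_limit is_limit_jointly_monic by blast
  qed (rule is_pullback_jointly_monic)
  show ?thesis
    unfolding pair_def
  proof (rule the_equality)
    show "h \<in> hom X (Dom X u) (Dom X p1) \<and> p1 \<cdot> h = u \<and> p2 \<cdot> h = v" using assms P by simp
    fix k assume "k \<in> hom X (Dom X u) (Dom X p1) \<and> p1 \<cdot> k = u \<and> p2 \<cdot> k = v"
    then show "k = h" using assms(2-6) P by - (rule jointly_monicD[OF j, of k h], auto)
  qed
qed

lemma pullback_pair:
  assumes p: "is_pullback X P p1 p2 f g"
    and "u \<in> Arr X" "v \<in> Arr X" "Dom X u = Dom X v" "Cod X u = Dom X f" "Cod X v = Dom X g" "f \<cdot> u = g \<cdot> v"
  shows "pair X p1 p2 u v \<in> Arr X" "Dom X (pair X p1 p2 u v) = Dom X u" "Cod X (pair X p1 p2 u v) = P"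
    "p1 \<cdot> pair X p1 p2 u v = u" "p2 \<cdot> pair X p1 p2 u v = v"
proof -
  have "u \<in> hom X (Dom X u) (Dom X f)" "v \<in> hom X (Dom X u) (Dom X g)" "Dom X u \<in> Obj X" using assms by auto
  then have "\<exists>!h. h \<in> hom X (Dom X u) P \<and> p1 \<cdot> h = u \<and> p2 \<cdot> h = v"
    using p assms(7) unfolding is_pullback_def by blast
  then obtain h where h: "h \<in> Arr X" "Dom X h = Dom X u" "Cod X h = P" "p1 \<cdot> h = u" "p2 \<cdot> h = v" by auto
  have "pair X p1 p2 u v = h" using p h by - (rule pair_eqI[where f = f and g = g], auto)
  then show "pair X p1 p2 u v \<in> Arr X" "Dom X (pair X p1 p2 u v) = Dom X u" "Cod X (pair X p1 p2 u v) = P"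
    "p1 \<cdot> pair X p1 p2 u v = u" "p2 \<cdot> pair X p1 p2 u v = v" using h by auto
qed

lemma product_pair:
  assumes p: "is_product X P p1 p2 A B"
    and "u \<in> Arr X" "v \<in> Arr X" "Dom X u = Dom X v" "Cod X u = A" "Cod X v = B"
  shows "pair X p1 p2 u v \<in> Arr X" "Dom X (pair X p1 p2 u v) = Dom X u" "Cod X (pair X p1 p2 u v) = P"
    "p1 \<cdot> pair X p1 p2 u v = u" "p2 \<cdot> pair X p1 p2 u v = v"
proof -
  have "u \<in> hom X (Dom X u) A" "v \<in> hom X (Dom X u) B" "Dom X u \<in> Obj X" using assms by auto
  then have "\<exists>!h. h \<in> hom X (Dom X u) P \<and> p1 \<cdot> h = u \<and> p2 \<cdot> h = v"
    using p unfolding is_product_def by blast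
  then obtain h where h: "h \<in> Arr X" "Dom X h = Dom X u" "Cod X h = P" "p1 \<cdot> h = u" "p2 \<cdot> h = v" by auto
  have "pair X p1 p2 u v = h" using p h by - (rule pair_eqI[where A = A and B = B], auto)
  then show "pair X p1 p2 u v \<in> Arr X" "Dom X (pair X p1 p2 u v) = Dom X u" "Cod X (pair X p1 p2 u v) = P"
    "p1 \<cdot> pair X p1 p2 u v = u" "p2 \<cdot> pair X p1 p2 u v = v" using h by auto
qed

lemma pullback_ext:
  assumes p: "is_pullback X P p1 p2 f g" and "x \<in> Arr X" "y \<in> Arr X" "Dom X x = Dom X y"
    "Cod X x = P" "Cod X y = P" "p1 \<cdot> x = p1 \<cdot> y" "p2 \<cdot> x = p2 \<cdot> y"
  shows "x = y"
  by (rule jointly_monicD[OF is_pullback_jointly_monic[OF p]]) (use assms in auto)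

lemma product_ext:
  assumes p: "is_product X P p1 p2 A B" and "x \<in> Arr X" "y \<in> Arr X" "Dom X x = Dom X y"
    "Cod X x = P" "Cod X y = P" "p1 \<cdot> x = p1 \<cdot> y" "p2 \<cdot> x = p2 \<cdot> y"
  shows "x = y"
proof -
  have "pair X p1 p2 (p1 \<cdot> x) (p2 \<cdot> x) = x" "pair X p1 p2 (p1 \<cdot> x) (p2 \<cdot> x) = y"
    using assms by (auto intro: pair_eqI[where A = A and B = B] simp: is_product_def)
  then show ?thesis by simp
qed

end

context tangent_category
begin

lemmas T_rules = is_functorD(3-)[OF T_functor]

lemma TM_simps [simp]:
  "A \<in> Obj X \<Longrightarrow> TO X A \<in> Obj X"
  "f \<in> Arr X \<Longrightarrow> TM X f \<in> Arr X"
  "f \<in> Arr X \<Longrightarrow> Dom X (TM X f) = TO X (Dom X f)"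
  "f \<in> Arr X \<Longrightarrow> Cod X (TM X f) = TO X (Cod X f)"
  "A \<in> Obj X \<Longrightarrow> TM X (idt X A) = idt X (TO X A)"
  "f \<in> Arr X \<Longrightarrow> g \<in> Arr X \<Longrightarrow> Dom X g = Cod X f \<Longrightarrow> TM X (g \<cdot> f) = TM X g \<cdot> TM X f"
  using T_rules by auto

lemma T2_Obj [simp]: "A \<in> Obj X \<Longrightarrow> T2 X A \<in> Obj X"
  using T2_pullback[of A] Obj_ends(1)[of "tpi1 X A"] by (simp add: is_pullback_def)

lemma proj_typing [simp]:
  "A \<in> Obj X \<Longrightarrow> tproj X A \<in> Arr X" "A \<in> Obj X \<Longrightarrow> Dom X (tproj X A) = TO X A"
  "A \<in> Obj X \<Longrightarrow> Cod X (tproj X A) = A"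
  "A \<in> Obj X \<Longrightarrow> tzero X A \<in> Arr X" "A \<in> Obj X \<Longrightarrow> Dom X (tzero X A) = A"
  "A \<in> Obj X \<Longrightarrow> Cod X (tzero X A) = TO X A"
  "A \<in> Obj X \<Longrightarrow> tsum X A \<in> Arr X" "A \<in> Obj X \<Longrightarrow> Dom X (tsum X A) = T2 X A"
  "A \<in> Obj X \<Longrightarrow> Cod X (tsum X A) = TO X A"
  "A \<in> Obj X \<Longrightarrow> tlift X A \<in> Arr X" "A \<in> Obj X \<Longrightarrow> Dom X (tlift X A) = TO X A"
  "A \<in> Obj X \<Longrightarrow> Cod X (tlift X A) = TO X (TO X A)"
  "A \<in> Obj X \<Longrightarrow> tflip X A \<in> Arr X" "A \<in> Obj X \<Longrightarrow> Dom X (tflip X A) = TO X (TO X A)"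
  "A \<in> Obj X \<Longrightarrow> Cod X (tflip X A) = TO X (TO X A)"
  using natural_transformationD(3-5)[OF proj_natural] natural_transformationD(3-5)[OF zero_natural]
    natural_transformationD(3-5)[OF sum_natural] natural_transformationD(3-5)[OF lift_natural]
    natural_transformationD(3-5)[OF flip_natural] by auto

lemma tpi_typing [simp]:
  assumes "A \<in> Obj X"
  shows "tpi1 X A \<in> Arr X" "Dom X (tpi1 X A) = T2 X A" "Cod X (tpi1 X A) = TO X A"
    "tpi2 X A \<in> Arr X" "Dom X (tpi2 X A) = T2 X A" "Cod X (tpi2 X A) = TO X A"
  using T2_pullback[OF assms] assms by (auto simp: is_pullback_def)

lemma tpi_proj: "A \<in> Obj X \<Longrightarrow> tproj X A \<cdot> tpi2 X A = tproj X A \<cdot> tpi1 X A"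
  using T2_pullback[of A] by (simp add: is_pullback_def)

lemma pair2_simps [simp]:
  assumes "u \<in> Arr X" "v \<in> Arr X" "Dom X u = Dom X v" "Cod X u = TO X A" "Cod X v = TO X A"
    "tproj X A \<cdot> u = tproj X A \<cdot> v" "A \<in> Obj X"
  shows "pair2 X A u v \<in> Arr X" "Dom X (pair2 X A u v) = Dom X v" "Cod X (pair2 X A u v) = T2 X A"
    "tpi1 X A \<cdot> pair2 X A u v = u" "tpi2 X A \<cdot> pair2 X A u v = v"
  unfolding pair2_def using pullback_pair[OF T2_pullback[of A], of u v] assms by auto

lemma T2_ext:
  assumes "A \<in> Obj X" "x \<in> Arr X" "y \<in> Arr X" "Dom X x = Dom X y" "Cod X x = T2 X A" "Cod X y = T2 X A"
    "tpi1 X A \<cdot> x = tpi1 X A \<cdot> y" "tpi2 X A \<cdot> x = tpi2 X A \<cdot> y"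
  shows "x = y"
  using pullback_ext[OF T2_pullback[of A]] assms by blast

lemma pair2_tail [simp]:
  assumes "u \<in> Arr X" "v \<in> Arr X" "Dom X u = Dom X v" "Cod X u = TO X A" "Cod X v = TO X A"
    "tproj X A \<cdot> u = tproj X A \<cdot> v" "A \<in> Obj X" "x \<in> Arr X" "Cod X x = Dom X v"
  shows "tpi1 X A \<cdot> (pair2 X A u v \<cdot> x) = u \<cdot> x" "tpi2 X A \<cdot> (pair2 X A u v \<cdot> x) = v \<cdot> x"
  using assms by (simp_all add: tail[OF pair2_simps(4)] tail[OF pair2_simps(5)])

lemma pair2_comp:
  assumes "u \<in> Arr X" "v \<in> Arr X" "Dom X u = Dom X v" "Cod X u = TO X A" "Cod X v = TO X A"
    "tproj X A \<cdot> u = tproj X A \<cdot> v" "A \<in> Obj X" "x \<in> Arr X" "Cod X x = Dom X v"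
  shows "pair2 X A u v \<cdot> x = pair2 X A (u \<cdot> x) (v \<cdot> x)"
proof -
  have "tproj X A \<cdot> (u \<cdot> x) = tproj X A \<cdot> (v \<cdot> x)"
    using tail[OF assms(6), of x] assms by simp
  then show ?thesis using assms by - (rule T2_ext[of A], simp_all)
qed

lemma proj_nat: "f \<in> Arr X \<Longrightarrow> Cod X f = B \<Longrightarrow> tproj X B \<cdot> TM X f = f \<cdot> tproj X (Dom X f)"
  using natural_transformationD(6)[OF proj_natural, of f B] by simp

lemma zero_nat: "f \<in> Arr X \<Longrightarrow> Cod X f = B \<Longrightarrow> tzero X B \<cdot> f = TM X f \<cdot> tzero X (Dom X f)"
  using natural_transformationD(6)[OF zero_natural, of f B] by simp

lemma lift_nat: "f \<in> Arr X \<Longrightarrow> Cod X f = B \<Longrightarrow> tlift X B \<cdot> TM X f = TM X (TM X f) \<cdot> tlift X (Dom X f)"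
  using natural_transformationD(6)[OF lift_natural, of f B] by simp

lemma flip_nat: "f \<in> Arr X \<Longrightarrow> Cod X f = B \<Longrightarrow>
    tflip X B \<cdot> TM X (TM X f) = TM X (TM X f) \<cdot> tflip X (Dom X f)"
  using natural_transformationD(6)[OF flip_natural, of f B] by simp

lemma T2M_simps [simp]:
  assumes "f \<in> Arr X"
  shows "T2M X f \<in> Arr X" "Dom X (T2M X f) = T2 X (Dom X f)" "Cod X (T2M X f) = T2 X (Cod X f)"
    "tpi1 X (Cod X f) \<cdot> T2M X f = TM X f \<cdot> tpi1 X (Dom X f)"
    "tpi2 X (Cod X f) \<cdot> T2M X f = TM X f \<cdot> tpi2 X (Dom X f)"
proof -
  have "tproj X (Cod X f) \<cdot> (TM X f \<cdot> tpi1 X (Dom X f)) = tproj X (Cod X f) \<cdot> (TM X f \<cdot> tpi2 X (Dom X f))"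
    using assms by (simp add: tail[OF proj_nat] tpi_proj)
  then show "T2M X f \<in> Arr X" "Dom X (T2M X f) = T2 X (Dom X f)" "Cod X (T2M X f) = T2 X (Cod X f)"
    "tpi1 X (Cod X f) \<cdot> T2M X f = TM X f \<cdot> tpi1 X (Dom X f)"
    "tpi2 X (Cod X f) \<cdot> T2M X f = TM X f \<cdot> tpi2 X (Dom X f)"
    unfolding T2M_def using assms by simp_all
qed

lemma sum_nat: "f \<in> Arr X \<Longrightarrow> Cod X f = B \<Longrightarrow> tsum X B \<cdot> T2M X f = TM X f \<cdot> tsum X (Dom X f)"
  using natural_transformationD(6)[OF sum_natural, of f B] by simp

lemma T2_functor: "is_functor X X (T2 X) (T2M X)"
  using natural_transformationD(1)[OF sum_natural] .

text \<open>The addition of tangent vectors is natural; in terms of pairs this says that \<open>T f\<close> is additive.\<close>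

lemma sum_pair_nat:
  assumes "f \<in> Arr X" "u \<in> Arr X" "v \<in> Arr X" "Dom X u = Dom X v" "Cod X u = TO X (Dom X f)"
    "Cod X v = TO X (Dom X f)" "tproj X (Dom X f) \<cdot> u = tproj X (Dom X f) \<cdot> v"
  shows "TM X f \<cdot> (tsum X (Dom X f) \<cdot> pair2 X (Dom X f) u v)
    = tsum X (Cod X f) \<cdot> pair2 X (Cod X f) (TM X f \<cdot> u) (TM X f \<cdot> v)"
proof -
  have *: "tproj X (Cod X f) \<cdot> (TM X f \<cdot> u) = tproj X (Cod X f) \<cdot> (TM X f \<cdot> v)"
    using assms by (simp add: tail[OF proj_nat])
  have "T2M X f \<cdot> pair2 X (Dom X f) u v = pair2 X (Cod X f) (TM X f \<cdot> u) (TM X f \<cdot> v)"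
    using assms * by - (rule T2_ext[of "Cod X f"], (simp_all add: tail[OF T2M_simps(4)] tail[OF T2M_simps(5)]))
  then show ?thesis using tail[OF sum_nat[of f "Cod X f"], of "pair2 X (Dom X f) u v"] assms by simp
qed

lemma TM_funpow [simp]:
  "A \<in> Obj X \<Longrightarrow> (TO X ^^ m) A \<in> Obj X"
  "f \<in> Arr X \<Longrightarrow> (TM X ^^ m) f \<in> Arr X"
  "f \<in> Arr X \<Longrightarrow> Dom X ((TM X ^^ m) f) = (TO X ^^ m) (Dom X f)"
  "f \<in> Arr X \<Longrightarrow> Cod X ((TM X ^^ m) f) = (TO X ^^ m) (Cod X f)"
  by (induction m) auto

lemma TM_funpow_comp:
  "f \<in> Arr X \<Longrightarrow> g \<in> Arr X \<Longrightarrow> Dom X g = Cod X f \<Longrightarrow> (TM X ^^ m) (g \<cdot> f) = (TM X ^^ m) g \<cdot> (TM X ^^ m) f"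
  "A \<in> Obj X \<Longrightarrow> (TM X ^^ m) (idt X A) = idt X ((TO X ^^ m) A)"
  by (induction m) auto

text \<open>Limits that all powers of \<open>T\<close> preserve. The axioms provide this for some choice of \<open>T\<^sub>n A\<close>; since limits
  are unique up to isomorphism, it holds for the given \<open>T\<^sub>2 A\<close> as well.\<close>

definition T_limit ::
  "nat set \<Rightarrow> (nat \<times> nat) set \<Rightarrow> (nat \<Rightarrow> nat \<Rightarrow> 'a) \<Rightarrow> (nat \<Rightarrow> 'o) \<Rightarrow> 'o \<Rightarrow> (nat \<Rightarrow> 'a) \<Rightarrow> bool" where
  "T_limit K E d B P \<pi> \<longleftrightarrow> (\<forall>m. is_limit X K E (\<lambda>k k'. (TM X ^^ m) (d k k')) (\<lambda>k. (TO X ^^ m) (B k))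
     ((TO X ^^ m) P) (\<lambda>k. (TM X ^^ m) (\<pi> k)))"

lemma T_limitD:
  assumes "T_limit K E d B P \<pi>"
  shows "is_limit X K E d B P \<pi>"
    "is_limit X K E (\<lambda>k k'. TM X (d k k')) (\<lambda>k. TO X (B k)) (TO X P) (\<lambda>k. TM X (\<pi> k))"
    "is_limit X K E (\<lambda>k k'. TM X (TM X (d k k'))) (\<lambda>k. TO X (TO X (B k))) (TO X (TO X P)) (\<lambda>k. TM X (TM X (\<pi> k)))"
  using assms[unfolded T_limit_def, rule_format, of 0] assms[unfolded T_limit_def, rule_format, of 1]
    assms[unfolded T_limit_def, rule_format, of 2] by (simp_all add: numeral_2_eq_2)

lemma T_limit_unique:
  assumes T: "T_limit K E d B P \<pi>" and L: "is_limit X K E d B Q \<rho>"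
  shows "T_limit K E d B Q \<rho>"
proof -
  note TD = T_limitD(1)[OF T]
  obtain t t' where t: "t \<in> Arr X" "Dom X t = Q" "Cod X t = P" "t' \<in> Arr X" "Dom X t' = P" "Cod X t' = Q"
    "t \<cdot> t' = idt X P" "t' \<cdot> t = idt X Q" "\<forall>k\<in>K. \<pi> k \<cdot> t = \<rho> k"
    by (rule is_limit_iso[OF TD L])
  note LD = is_limitD[OF TD] is_limitD[OF L]
  show ?thesis
    unfolding T_limit_def
  proof
    fix m
    have *: "(TM X ^^ m) t \<cdot> (TM X ^^ m) t' = idt X ((TO X ^^ m) P)"
      "(TM X ^^ m) t' \<cdot> (TM X ^^ m) t = idt X ((TO X ^^ m) Q)"
      using LD(1) is_limitD(1)[OF L] t(1-6) TM_funpow_comp(1)[of t' t m] TM_funpow_comp(1)[of t t' m]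
        TM_funpow_comp(2) t(7,8) by simp_all
    show "is_limit X K E (\<lambda>k k'. (TM X ^^ m) (d k k')) (\<lambda>k. (TO X ^^ m) (B k)) ((TO X ^^ m) Q) (\<lambda>k. (TM X ^^ m) (\<rho> k))"
    proof (rule is_limit_iso_cong[OF T[unfolded T_limit_def, rule_format]])
      show "(TM X ^^ m) t \<cdot> (TM X ^^ m) t' = idt X ((TO X ^^ m) P)"
        "(TM X ^^ m) t' \<cdot> (TM X ^^ m) t = idt X ((TO X ^^ m) Q)" by (fact *)+
      fix k assume k: "k \<in> K"
      then show "(TM X ^^ m) (\<pi> k) \<cdot> (TM X ^^ m) t = (TM X ^^ m) (\<rho> k)"
        using LD(2,3) t(1-3) bspec[OF t(9) k] TM_funpow_comp(1)[of t "\<pi> k" m] by simp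
    qed (use t in simp_all)
  qed
qed

lemma T_limit_fold:
  assumes "A \<in> Obj X"
    "\<forall>m. is_fold_pullback X n ((TM X ^^ m) (tproj X A)) ((TO X ^^ m) P) ((TM X ^^ m) q) (\<lambda>i. (TM X ^^ m) (\<pi> i))"
  shows "T_limit {..n} ({..<n} \<times> {n}) (\<lambda>_ _. tproj X A) ((\<lambda>_. TO X A)(n := A)) P (\<pi>(n := q))"
  unfolding T_limit_def
proof
  fix m
  have "(\<lambda>k. (TO X ^^ m) (((\<lambda>_. TO X A)(n := A)) k)) = (\<lambda>_. (TO X ^^ m) (TO X A))(n := (TO X ^^ m) A)"
    "(\<lambda>k. (TM X ^^ m) ((\<pi>(n := q)) k)) = (\<lambda>k. (TM X ^^ m) (\<pi> k))(n := (TM X ^^ m) q)" by auto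
  then show "is_limit X {..n} ({..<n} \<times> {n}) (\<lambda>k k'. (TM X ^^ m) (tproj X A))
      (\<lambda>k. (TO X ^^ m) (((\<lambda>_. TO X A)(n := A)) k)) ((TO X ^^ m) P) (\<lambda>k. (TM X ^^ m) ((\<pi>(n := q)) k))"
    using assms(1) assms(2)[rule_format, of m] unfolding is_fold_pullback_limit by simp
qed

abbreviation "T2_legs A \<equiv> (case_nat (tpi1 X A) (\<lambda>_. tpi2 X A))(2 := tproj X A \<cdot> tpi1 X A)"

lemma T2_T_limit:
  assumes "A \<in> Obj X"
  shows "T_limit {..2} ({..<2} \<times> {2}) (\<lambda>_ _. tproj X A) ((\<lambda>_. TO X A)(2 := A)) (T2 X A) (T2_legs A)"
proof -
  obtain P q \<pi> where
    "\<forall>m. is_fold_pullback X 2 ((TM X ^^ m) (tproj X A)) ((TO X ^^ m) P) ((TM X ^^ m) q) (\<lambda>i. (TM X ^^ m) (\<pi> i))"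
    using fold_pullbacks[OF assms, of 2] by blast
  from T_limit_unique[OF T_limit_fold[OF assms this]] show ?thesis
    using T2_pullback[OF assms] assms is_pullback_fold[of "tproj X A"] is_fold_pullback_limit[of 2 "tproj X A"]
    by simp
qed

lemma T_T2_pullback:
  assumes "A \<in> Obj X"
  shows "is_pullback X ((TO X ^^ m) (T2 X A)) ((TM X ^^ m) (tpi1 X A)) ((TM X ^^ m) (tpi2 X A))
    ((TM X ^^ m) (tproj X A)) ((TM X ^^ m) (tproj X A))"
proof -
  have "(\<lambda>k. (TO X ^^ m) (((\<lambda>_. TO X A)(2::nat := A)) k)) = (\<lambda>_. (TO X ^^ m) (TO X A))(2 := (TO X ^^ m) A)"
    "(\<lambda>k. (TM X ^^ m) (T2_legs A k))
     = (case_nat ((TM X ^^ m) (tpi1 X A)) (\<lambda>_. (TM X ^^ m) (tpi2 X A)))(2 := (TM X ^^ m) (tproj X A) \<cdot> (TM X ^^ m) (tpi1 X A))"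
    using assms by (auto simp: TM_funpow_comp split: nat.split)
  then show ?thesis
    using T2_T_limit[OF assms, unfolded T_limit_def, rule_format, of m] assms
      is_pullback_fold[of "(TM X ^^ m) (tproj X A)"] is_fold_pullback_limit[of 2 "(TM X ^^ m) (tproj X A)"]
    by simp
qed

lemma proj_tails:
  "A \<in> Obj X \<Longrightarrow> x \<in> Arr X \<Longrightarrow> Cod X x = A \<Longrightarrow> tproj X A \<cdot> (tzero X A \<cdot> x) = x"
  "A \<in> Obj X \<Longrightarrow> x \<in> Arr X \<Longrightarrow> Cod X x = T2 X A \<Longrightarrow> tproj X A \<cdot> (tsum X A \<cdot> x) = tproj X A \<cdot> (tpi1 X A \<cdot> x)"
  "A \<in> Obj X \<Longrightarrow> x \<in> Arr X \<Longrightarrow> Cod X x = T2 X A \<Longrightarrow> tproj X A \<cdot> (tpi2 X A \<cdot> x) = tproj X A \<cdot> (tpi1 X A \<cdot> x)"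
  using tail[OF proj_zero, of A x] tail[OF proj_sum, of A x] tail[OF tpi_proj, of A x] by simp_all

lemma lift_tails:
  "A \<in> Obj X \<Longrightarrow> x \<in> Arr X \<Longrightarrow> Cod X x = TO X A \<Longrightarrow> TM X (tproj X A) \<cdot> (tlift X A \<cdot> x) = tzero X A \<cdot> (tproj X A \<cdot> x)"
  "A \<in> Obj X \<Longrightarrow> x \<in> Arr X \<Longrightarrow> Cod X x = A \<Longrightarrow> tlift X A \<cdot> (tzero X A \<cdot> x) = TM X (tzero X A) \<cdot> (tzero X A \<cdot> x)"
  "A \<in> Obj X \<Longrightarrow> x \<in> Arr X \<Longrightarrow> Cod X x = TO X A \<Longrightarrow> TM X (tlift X A) \<cdot> (tlift X A \<cdot> x) = tlift X (TO X A) \<cdot> (tlift X A \<cdot> x)"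
  using tail[OF lift_proj, of A x] tail[OF lift_zero, of A x] tail[OF lift_lift, of A x] by simp_all

lemma flip_tails:
  "A \<in> Obj X \<Longrightarrow> x \<in> Arr X \<Longrightarrow> Cod X x = TO X (TO X A) \<Longrightarrow>
    tproj X (TO X A) \<cdot> (tflip X A \<cdot> x) = TM X (tproj X A) \<cdot> x"
  "A \<in> Obj X \<Longrightarrow> x \<in> Arr X \<Longrightarrow> Cod X x = TO X A \<Longrightarrow>
    tflip X A \<cdot> (TM X (tzero X A) \<cdot> x) = tzero X (TO X A) \<cdot> x"
  "A \<in> Obj X \<Longrightarrow> x \<in> Arr X \<Longrightarrow> Cod X x = TO X A \<Longrightarrow> tflip X A \<cdot> (tlift X A \<cdot> x) = tlift X A \<cdot> x"
  "A \<in> Obj X \<Longrightarrow> x \<in> Arr X \<Longrightarrow> Cod X x = TO X (TO X A) \<Longrightarrow> tflip X A \<cdot> (tflip X A \<cdot> x) = x"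
  using tail[OF flip_proj, of A x] tail[OF flip_zero, of A x] tail[OF flip_lift, of A x]
    tail[OF flip_flip, of A x] by simp_all

lemma Tflip_Tflip:
  "A \<in> Obj X \<Longrightarrow> TM X (tflip X A) \<cdot> TM X (tflip X A) = idt X (TO X (TO X (TO X A)))"
  using TM_simps(6)[of "tflip X A" "tflip X A"] flip_flip[of A] by simp

lemma Tflip_Tflip_tail:
  "A \<in> Obj X \<Longrightarrow> x \<in> Arr X \<Longrightarrow> Cod X x = TO X (TO X (TO X A)) \<Longrightarrow> TM X (tflip X A) \<cdot> (TM X (tflip X A) \<cdot> x) = x"
  using tail[OF Tflip_Tflip, of A x] by simp

text \<open>Up to the involution \<open>c\<close>, the coherence between lift and flip also reads from right to left.\<close>

lemma lift_flip:
  assumes A: "A \<in> Obj X"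
  shows "tlift X (TO X A) \<cdot> tflip X A = TM X (tflip X A) \<cdot> (tflip X (TO X A) \<cdot> TM X (tlift X A))"
proof -
  have "TM X (tlift X A) = tflip X (TO X A) \<cdot> (TM X (tflip X A) \<cdot> (tlift X (TO X A) \<cdot> tflip X A))"
    using tail3[OF flip_flip_lift[OF A], of "tflip X A"] A by (simp add: flip_flip)
  then show ?thesis using A by (simp add: flip_tails(4) Tflip_Tflip_tail)
qed

lemma flip_proj_T: "A \<in> Obj X \<Longrightarrow> TM X (tproj X A) \<cdot> tflip X A = tproj X (TO X A)"
  by (simp flip: flip_proj add: flip_flip)

lemma T2_T_ext:
  assumes "A \<in> Obj X" "x \<in> Arr X" "y \<in> Arr X" "Dom X x = Dom X y" "Cod X x = TO X (T2 X A)" "Cod X y = TO X (T2 X A)"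
    "TM X (tpi1 X A) \<cdot> x = TM X (tpi1 X A) \<cdot> y" "TM X (tpi2 X A) \<cdot> x = TM X (tpi2 X A) \<cdot> y"
  shows "x = y"
  using pullback_ext[OF T_T2_pullback[of A 1]] assms by simp

lemma T_pair_simps:
  assumes "u \<in> Arr X" "v \<in> Arr X" "Dom X u = Dom X v" "Cod X u = TO X (TO X A)" "Cod X v = TO X (TO X A)"
    "TM X (tproj X A) \<cdot> u = TM X (tproj X A) \<cdot> v" "A \<in> Obj X"
  shows "pair X (TM X (tpi1 X A)) (TM X (tpi2 X A)) u v \<in> Arr X"
    "Dom X (pair X (TM X (tpi1 X A)) (TM X (tpi2 X A)) u v) = Dom X u"
    "Cod X (pair X (TM X (tpi1 X A)) (TM X (tpi2 X A)) u v) = TO X (T2 X A)"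
    "TM X (tpi1 X A) \<cdot> pair X (TM X (tpi1 X A)) (TM X (tpi2 X A)) u v = u"
    "TM X (tpi2 X A) \<cdot> pair X (TM X (tpi1 X A)) (TM X (tpi2 X A)) u v = v"
  using pullback_pair[OF T_T2_pullback[of A 1], of u v] assms by simp_all

text \<open>The map \<open>v: T\<^sub>2 A \<rightarrow> T\<^sup>2 A\<close> of the universality of the vertical lift.\<close>

abbreviation vert :: "'o \<Rightarrow> 'a" where
  "vert A \<equiv> TM X (tsum X A) \<cdot> pair X (TM X (tpi1 X A)) (TM X (tpi2 X A))
     (tzero X (TO X A) \<cdot> tpi1 X A) (tlift X A \<cdot> tpi2 X A)"

lemma vert_pair_compat:
  "A \<in> Obj X \<Longrightarrow> TM X (tproj X A) \<cdot> (tzero X (TO X A) \<cdot> tpi1 X A) = TM X (tproj X A) \<cdot> (tlift X A \<cdot> tpi2 X A)"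
  by (simp add: lift_tails tpi_proj tail[OF zero_nat[symmetric]] zero_nat tail[OF zero_nat, symmetric])

lemma vert_typing [simp]:
  assumes "A \<in> Obj X"
  shows "pair X (TM X (tpi1 X A)) (TM X (tpi2 X A)) (tzero X (TO X A) \<cdot> tpi1 X A) (tlift X A \<cdot> tpi2 X A) \<in> Arr X"
    "Dom X (pair X (TM X (tpi1 X A)) (TM X (tpi2 X A)) (tzero X (TO X A) \<cdot> tpi1 X A) (tlift X A \<cdot> tpi2 X A)) = T2 X A"
    "Cod X (pair X (TM X (tpi1 X A)) (TM X (tpi2 X A)) (tzero X (TO X A) \<cdot> tpi1 X A) (tlift X A \<cdot> tpi2 X A)) = TO X (T2 X A)"
    "TM X (tpi1 X A) \<cdot> pair X (TM X (tpi1 X A)) (TM X (tpi2 X A)) (tzero X (TO X A) \<cdot> tpi1 X A) (tlift X A \<cdot> tpi2 X A)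
     = tzero X (TO X A) \<cdot> tpi1 X A"
    "TM X (tpi2 X A) \<cdot> pair X (TM X (tpi1 X A)) (TM X (tpi2 X A)) (tzero X (TO X A) \<cdot> tpi1 X A) (tlift X A \<cdot> tpi2 X A)
     = tlift X A \<cdot> tpi2 X A"
  using T_pair_simps[OF _ _ _ _ _ vert_pair_compat[OF assms] assms] assms by simp_all

text \<open>The pullback square that expresses the universality of the lift is not required to be preserved
  by \<open>T\<close>, but \<open>T v\<close> is conjugate, through flips, to the map \<open>v\<close> of \<open>T A\<close>.\<close>

lemma T_vert:
  assumes A: "A \<in> Obj X"
  shows "TM X (tflip X A) \<cdot> (tflip X (TO X A) \<cdot> TM X (vert A))
    = vert (TO X A) \<cdot> pair2 X (TO X A) (tflip X A \<cdot> TM X (tpi1 X A)) (tflip X A \<cdot> TM X (tpi2 X A))"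
proof -
  define B where "B = TO X A"
  define w where "w = pair X (TM X (tpi1 X A)) (TM X (tpi2 X A)) (tzero X (TO X A) \<cdot> tpi1 X A) (tlift X A \<cdot> tpi2 X A)"
  define v where "v = pair X (TM X (tpi1 X (TO X A))) (TM X (tpi2 X (TO X A))) (tzero X (TO X (TO X A)) \<cdot> tpi1 X (TO X A))
     (tlift X (TO X A) \<cdot> tpi2 X (TO X A))"
  define q where "q = pair2 X (TO X A) (tflip X A \<cdot> TM X (tpi1 X A)) (tflip X A \<cdot> TM X (tpi2 X A))"
  have B: "B \<in> Obj X" "TO X A = B" using A by (simp_all add: B_def)
  have p: "TM X (tproj X A) \<cdot> TM X (tpi1 X A) = TM X (tproj X A) \<cdot> TM X (tpi2 X A)"
    using TM_simps(6)[of "tpi1 X A" "tproj X A"] TM_simps(6)[of "tpi2 X A" "tproj X A"] tpi_proj[OF A] A by simp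
  have q: "q \<in> Arr X" "Dom X q = TO X (T2 X A)" "Cod X q = T2 X B"
    "tpi1 X B \<cdot> q = tflip X A \<cdot> TM X (tpi1 X A)" "tpi2 X B \<cdot> q = tflip X A \<cdot> TM X (tpi2 X A)"
    unfolding q_def B_def using A by (simp_all add: flip_tails p)
  have w: "w \<in> Arr X" "Dom X w = T2 X A" "Cod X w = TO X (T2 X A)"
    "TM X (tpi1 X A) \<cdot> w = tzero X B \<cdot> tpi1 X A" "TM X (tpi2 X A) \<cdot> w = tlift X A \<cdot> tpi2 X A"
    unfolding w_def B_def by (rule vert_typing[OF A])+
  have v: "v \<in> Arr X" "Dom X v = T2 X B" "Cod X v = TO X (T2 X B)"
    "TM X (tpi1 X B) \<cdot> v = tzero X (TO X B) \<cdot> tpi1 X B" "TM X (tpi2 X B) \<cdot> v = tlift X B \<cdot> tpi2 X B"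
    unfolding v_def B_def by (rule vert_typing[OF TM_simps(1)[OF A]])+
  have Tw: "TM X (TM X (tpi1 X A)) \<cdot> TM X w = TM X (tzero X B) \<cdot> TM X (tpi1 X A)"
    "TM X (TM X (tpi2 X A)) \<cdot> TM X w = TM X (tlift X A) \<cdot> TM X (tpi2 X A)"
    using arg_cong[OF w(4), of "TM X"] arg_cong[OF w(5), of "TM X"] w(1-3) A B by simp_all
  have Tq: "TM X (tpi1 X B) \<cdot> TM X q = TM X (tflip X A) \<cdot> TM X (TM X (tpi1 X A))"
    "TM X (tpi2 X B) \<cdot> TM X q = TM X (tflip X A) \<cdot> TM X (TM X (tpi2 X A))"
    using arg_cong[OF q(4), of "TM X"] arg_cong[OF q(5), of "TM X"] q(1-3) A B by simp_all
  have fn: "TM X (TM X (tpi1 X A)) \<cdot> (tflip X (T2 X A) \<cdot> x) = tflip X B \<cdot> (TM X (TM X (tpi1 X A)) \<cdot> x)"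
    "TM X (TM X (tpi2 X A)) \<cdot> (tflip X (T2 X A) \<cdot> x) = tflip X B \<cdot> (TM X (TM X (tpi2 X A)) \<cdot> x)"
    "TM X (TM X (tsum X A)) \<cdot> (tflip X (T2 X A) \<cdot> x) = tflip X B \<cdot> (TM X (TM X (tsum X A)) \<cdot> x)"
    if "x \<in> Arr X" "Cod X x = TO X (TO X (T2 X A))" for x
    using tail[OF flip_nat[of "tpi1 X A" B, symmetric], of x] tail[OF flip_nat[of "tpi2 X A" B, symmetric], of x]
      tail[OF flip_nat[of "tsum X A" B, symmetric], of x] A B that by simp_all
  have lf: "TM X (tflip X A) \<cdot> (tflip X B \<cdot> (TM X (tlift X A) \<cdot> x)) = tlift X B \<cdot> (tflip X A \<cdot> x)"
    if "x \<in> Arr X" "Cod X x = TO X B" for x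
    using tail[OF lift_flip[OF A], of x] A B that by simp
  have zf: "TM X (tflip X A) \<cdot> (tzero X (TO X B) \<cdot> x) = tzero X (TO X B) \<cdot> (tflip X A \<cdot> x)"
    if "x \<in> Arr X" "Cod X x = TO X B" for x
    using tail[OF zero_nat[of "tflip X A" "TO X B"], of x] A B that by simp
  have e: "TM X q \<cdot> (tflip X (T2 X A) \<cdot> TM X w) = v \<cdot> q"
  proof (rule T2_T_ext[of B])
    show "TM X (tpi1 X B) \<cdot> (TM X q \<cdot> (tflip X (T2 X A) \<cdot> TM X w)) = TM X (tpi1 X B) \<cdot> (v \<cdot> q)"
      using A B q w(1-3) v(1-3)
      by (simp add: tail[OF Tq(1)] fn Tw flip_tails tail[OF v(4)] zf)
    show "TM X (tpi2 X B) \<cdot> (TM X q \<cdot> (tflip X (T2 X A) \<cdot> TM X w)) = TM X (tpi2 X B) \<cdot> (v \<cdot> q)"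
      using A B q w(1-3) v(1-3)
      by (simp add: tail[OF Tq(2)] fn Tw tail[OF v(5)] lf)
  qed (use A B q(1-3) w(1-3) v(1-3) in simp_all)
  have ts: "TM X (tflip X A) \<cdot> TM X (TM X (tsum X A)) = TM X (tsum X B) \<cdot> TM X q"
    using arg_cong[OF flip_sum[OF A, folded q_def], of "TM X"] A B q(1-3) by (simp add: B_def[symmetric])
  have "TM X (tflip X A) \<cdot> (tflip X B \<cdot> TM X (TM X (tsum X A) \<cdot> w))
    = TM X (tflip X A) \<cdot> (TM X (TM X (tsum X A)) \<cdot> (tflip X (T2 X A) \<cdot> TM X w))"
    using A B w(1-3) by (simp add: fn)
  also have "\<dots> = TM X (tsum X B) \<cdot> (TM X q \<cdot> (tflip X (T2 X A) \<cdot> TM X w))"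
    using tail[OF ts] A B q(1-3) w(1-3) by simp
  also have "\<dots> = (TM X (tsum X B) \<cdot> v) \<cdot> q" unfolding e using A B q(1-3) v(1-3) by simp
  finally show ?thesis unfolding w_def v_def q_def B_def .
qed

text \<open>The map \<open>v\<close> of \<open>T A\<close> is monic: together with \<open>p \<pi>\<^sub>1\<close> it is jointly monic, and it determines \<open>p \<pi>\<^sub>1\<close> because
  \<open>T p\<close> composed with \<open>v\<close> is \<open>z p \<pi>\<^sub>1\<close>. The comparison \<open>T T\<^sub>2 A \<rightarrow> T\<^sub>2 T A\<close> is monic because \<open>T\<close> preserves the
  pullback \<open>T\<^sub>2 A\<close>. By the previous lemma, \<open>T v\<close> is monic too.\<close>

lemma T_vert_monic:
  assumes A: "A \<in> Obj X" and xy: "x \<in> Arr X" "y \<in> Arr X" "Dom X x = Dom X y" "Cod X x = TO X (T2 X A)"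
    "Cod X y = TO X (T2 X A)" and e: "TM X (vert A) \<cdot> x = TM X (vert A) \<cdot> y"
  shows "x = y"
proof -
  define q where "q = pair2 X (TO X A) (tflip X A \<cdot> TM X (tpi1 X A)) (tflip X A \<cdot> TM X (tpi2 X A))"
  define V where "V = vert (TO X A)"
  define W where "W = TM X (vert A)"
  define B where "B = TO X A"
  have p: "TM X (tproj X A) \<cdot> TM X (tpi1 X A) = TM X (tproj X A) \<cdot> TM X (tpi2 X A)"
    using TM_simps(6)[of "tpi1 X A" "tproj X A"] TM_simps(6)[of "tpi2 X A" "tproj X A"] tpi_proj[OF A] A by simp
  have q: "q \<in> Arr X" "Dom X q = TO X (T2 X A)" "Cod X q = T2 X B"
    "tpi1 X B \<cdot> q = tflip X A \<cdot> TM X (tpi1 X A)" "tpi2 X B \<cdot> q = tflip X A \<cdot> TM X (tpi2 X A)"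
    unfolding q_def B_def using A by (simp_all add: flip_tails p)
  have B: "B \<in> Obj X" using A by (simp add: B_def)
  have V: "V \<in> Arr X" "Dom X V = T2 X B" "Cod X V = TO X (TO X B)" unfolding V_def B_def using A by simp_all
  have W: "W \<in> Arr X" "Dom X W = TO X (T2 X A)" "Cod X W = TO X (TO X B)" unfolding W_def B_def using A by simp_all
  have U: "is_pullback X (T2 X B) V (tproj X B \<cdot> tpi1 X B) (TM X (tproj X B)) (tzero X B)"
    unfolding V_def B_def using lift_universal[of "TO X A"] A by simp
  then have U': "TM X (tproj X B) \<cdot> V = tzero X B \<cdot> (tproj X B \<cdot> tpi1 X B)" by (simp add: is_pullback_def)
  have "V \<cdot> q = TM X (tflip X A) \<cdot> (tflip X B \<cdot> W)"
    unfolding V_def W_def q_def B_def by (rule T_vert[OF A, symmetric])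
  from tail[OF this q(1) V(1)] have "V \<cdot> (q \<cdot> z) = TM X (tflip X A) \<cdot> (tflip X B \<cdot> (W \<cdot> z))"
    if "z \<in> Arr X" "Cod X z = TO X (T2 X A)" for z
    using that q V W A B by (simp add: B_def)
  then have vq: "V \<cdot> (q \<cdot> x) = V \<cdot> (q \<cdot> y)" using xy e by (simp add: W_def[symmetric])
  have qe: "q \<cdot> x = q \<cdot> y"
  proof (rule pullback_ext[OF U])
    have "tproj X B \<cdot> (TM X (tproj X B) \<cdot> (V \<cdot> (q \<cdot> z))) = tproj X B \<cdot> (tpi1 X B \<cdot> (q \<cdot> z))"
      if "z \<in> Arr X" "Cod X z = TO X (T2 X A)" for z
      using tail[OF U', of "q \<cdot> z"] that B q(1-3) V by (simp add: proj_tails)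
    from this[of x] this[of y]
    show "(tproj X B \<cdot> tpi1 X B) \<cdot> (q \<cdot> x) = (tproj X B \<cdot> tpi1 X B) \<cdot> (q \<cdot> y)"
      using vq xy B q(1-3) by simp
  qed (use vq xy B q(1-3) in simp_all)
  have t: "tpi1 X B \<cdot> (q \<cdot> z) = tflip X A \<cdot> (TM X (tpi1 X A) \<cdot> z)" "tpi2 X B \<cdot> (q \<cdot> z) = tflip X A \<cdot> (TM X (tpi2 X A) \<cdot> z)"
    if "z \<in> Arr X" "Cod X z = TO X (T2 X A)" for z
    using tail[OF q(4), of z] tail[OF q(5), of z] that A B q(1-3) by simp_all
  have "tflip X A \<cdot> (TM X (tpi1 X A) \<cdot> x) = tflip X A \<cdot> (TM X (tpi1 X A) \<cdot> y)"
    "tflip X A \<cdot> (TM X (tpi2 X A) \<cdot> x) = tflip X A \<cdot> (TM X (tpi2 X A) \<cdot> y)"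
    unfolding t[OF xy(1,4), symmetric] t[OF xy(2,5), symmetric] qe by (rule refl)+
  then have "tflip X A \<cdot> (tflip X A \<cdot> (TM X (tpi1 X A) \<cdot> x)) = tflip X A \<cdot> (tflip X A \<cdot> (TM X (tpi1 X A) \<cdot> y))"
    "tflip X A \<cdot> (tflip X A \<cdot> (TM X (tpi2 X A) \<cdot> x)) = tflip X A \<cdot> (tflip X A \<cdot> (TM X (tpi2 X A) \<cdot> y))" by simp_all
  then have "TM X (tpi1 X A) \<cdot> x = TM X (tpi1 X A) \<cdot> y" "TM X (tpi2 X A) \<cdot> x = TM X (tpi2 X A) \<cdot> y"
    using xy A by (simp_all add: flip_tails(4))
  then show "x = y" by (rule T2_T_ext[OF A xy])
qed

text \<open>Associativity of the sum in terms of maps into the fibres of \<open>p\<close>, rather than in terms of a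
  chosen \<open>T\<^sub>3 A\<close>.\<close>

lemma sum_assoc_elements:
  assumes A: "A \<in> Obj X" and u: "\<And>i. i < 3 \<Longrightarrow> u i \<in> Arr X \<and> Dom X (u i) = C \<and> Cod X (u i) = TO X A \<and> tproj X A \<cdot> u i = r"
  shows "tsum X A \<cdot> pair2 X A (tsum X A \<cdot> pair2 X A (u 0) (u 1)) (u 2)
      = tsum X A \<cdot> pair2 X A (u 0) (tsum X A \<cdot> pair2 X A (u 1) (u (2::nat)))"
proof -
  obtain P q \<pi> where "\<forall>m. is_fold_pullback X 3 ((TM X ^^ m) (tproj X A)) ((TO X ^^ m) P) ((TM X ^^ m) q) (\<lambda>i. (TM X ^^ m) (\<pi> i))"
    using fold_pullbacks[OF A, of 3] by blast
  from this[rule_format, of 0] have F: "is_fold_pullback X 3 (tproj X A) P q \<pi>" by simp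
  note a = sum_assoc[OF A F]
  have \<pi>: "\<pi> i \<in> Arr X" "Dom X (\<pi> i) = P" "Cod X (\<pi> i) = TO X A" "tproj X A \<cdot> \<pi> i = q" if "i < 3" for i
    using F that A by (auto simp: is_fold_pullback_def)
  have r: "r \<in> hom X C (Cod X (tproj X A))" "C \<in> Obj X"
    using u[of 0] A comp_typing[of "u 0" "tproj X A"] Obj_ends(1)[of "u 0"] by auto
  have "\<forall>C \<in> Obj X. \<forall>r \<in> hom X C (Cod X (tproj X A)). \<forall>u.
        (\<forall>i < 3. u i \<in> hom X C (Dom X (tproj X A)) \<and> tproj X A \<cdot> u i = r) \<longrightarrow>
        (\<exists>!h. h \<in> hom X C P \<and> q \<cdot> h = r \<and> (\<forall>i < 3. \<pi> i \<cdot> h = u i))"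
    using F unfolding is_fold_pullback_def by (elim conjE)
  from this[rule_format, OF r(2,1), of u] obtain h where h: "h \<in> Arr X" "Dom X h = C" "Cod X h = P" "\<And>i. i < 3 \<Longrightarrow> \<pi> i \<cdot> h = u i"
    using u A by auto
  obtain a b c where abc: "\<pi> 0 = a" "\<pi> 1 = b" "\<pi> 2 = c" by blast
  have t: "a \<in> Arr X" "Dom X a = P" "Cod X a = TO X A" "b \<in> Arr X" "Dom X b = P" "Cod X b = TO X A"
    "c \<in> Arr X" "Dom X c = P" "Cod X c = TO X A" "tproj X A \<cdot> b = tproj X A \<cdot> a" "tproj X A \<cdot> c = tproj X A \<cdot> a"
    using \<pi>[of 0] \<pi>[of 1] \<pi>[of 2] unfolding abc by simp_all
  have h': "a \<cdot> h = u 0" "b \<cdot> h = u 1" "c \<cdot> h = u 2" using h(4)[of 0] h(4)[of 1] h(4)[of 2] unfolding abc by simp_all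
  note p1 = pair2_simps[of a b A] and p2 = pair2_simps[of b c A]
  have e: "pair2 X A (tsum X A \<cdot> pair2 X A a b) c \<cdot> h = pair2 X A (tsum X A \<cdot> (pair2 X A a b \<cdot> h)) (c \<cdot> h)"
    "pair2 X A a (tsum X A \<cdot> pair2 X A b c) \<cdot> h = pair2 X A (a \<cdot> h) (tsum X A \<cdot> (pair2 X A b c \<cdot> h))"
    "pair2 X A a b \<cdot> h = pair2 X A (a \<cdot> h) (b \<cdot> h)" "pair2 X A b c \<cdot> h = pair2 X A (b \<cdot> h) (c \<cdot> h)"
    using t p1 p2 h(1-3) A by (simp_all add: pair2_comp proj_tails(2))
  have f: "(tsum X A \<cdot> pair2 X A (tsum X A \<cdot> pair2 X A a b) c) \<cdot> h = tsum X A \<cdot> (pair2 X A (tsum X A \<cdot> pair2 X A a b) c \<cdot> h)"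
    "(tsum X A \<cdot> pair2 X A a (tsum X A \<cdot> pair2 X A b c)) \<cdot> h = tsum X A \<cdot> (pair2 X A a (tsum X A \<cdot> pair2 X A b c) \<cdot> h)"
    using t p1 p2 h(1-3) A by (simp_all add: proj_tails(2))
  note E = arg_cong[OF a[unfolded abc], of "\<lambda>k. k \<cdot> h"]
  show ?thesis by (rule E[unfolded f, unfolded e(1,2), unfolded e(3,4) h'])
qed

end

section \<open>Tangent structure created by a family of functors\<close>

definition tangent_typing :: "('o, 'a, 'm) tangent_category_scheme \<Rightarrow> bool" where
  "tangent_typing Y \<longleftrightarrow>
     (\<forall>A\<in>Obj Y. TO Y A \<in> Obj Y \<and> T2 Y A \<in> Obj Y \<and>
        tpi1 Y A \<in> hom Y (T2 Y A) (TO Y A) \<and> tpi2 Y A \<in> hom Y (T2 Y A) (TO Y A) \<and>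
        tproj Y A \<in> hom Y (TO Y A) A \<and> tzero Y A \<in> hom Y A (TO Y A) \<and>
        tsum Y A \<in> hom Y (T2 Y A) (TO Y A) \<and> tlift Y A \<in> hom Y (TO Y A) (TO Y (TO Y A)) \<and>
        tflip Y A \<in> hom Y (TO Y (TO Y A)) (TO Y (TO Y A))) \<and>
     (\<forall>f\<in>Arr Y. TM Y f \<in> hom Y (TO Y (Dom Y f)) (TO Y (Cod Y f)))"

definition preserves_tangent_structure ::
  "('p, 'b, 'n) tangent_category_scheme \<Rightarrow> ('o, 'a, 'm) tangent_category_scheme \<Rightarrow>
   ('p \<Rightarrow> 'o) \<Rightarrow> ('b \<Rightarrow> 'a) \<Rightarrow> bool" where
  "preserves_tangent_structure Y X FO FM \<longleftrightarrow> is_functor Y X FO FM \<and>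
     (\<forall>A\<in>Obj Y. FO (TO Y A) = TO X (FO A) \<and> FO (T2 Y A) = T2 X (FO A) \<and>
        FM (tpi1 Y A) = tpi1 X (FO A) \<and> FM (tpi2 Y A) = tpi2 X (FO A) \<and>
        FM (tproj Y A) = tproj X (FO A) \<and> FM (tzero Y A) = tzero X (FO A) \<and>
        FM (tsum Y A) = tsum X (FO A) \<and> FM (tlift Y A) = tlift X (FO A) \<and>
        FM (tflip Y A) = tflip X (FO A)) \<and>
     (\<forall>f\<in>Arr Y. FM (TM Y f) = TM X (FM f))"

text \<open>A category \<open>Y\<close> of structured objects, with jointly faithful functors \<open>U i\<close> to a tangent
  category that forget the structure. The assumption \<open>lifting\<close> says that maps of underlying objects
  lift to \<open>Y\<close> as soon as their composites with the legs of a cone do, provided that the legs and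
  their images under \<open>T\<close> are jointly monic. It is here that limits in \<open>Y\<close> come from: a map of
  structured objects is a map subject to equations whose two sides end in an object \<open>P\<close> or \<open>T P\<close>,
  which can be tested on the legs. The objects \<open>T\<^sub>n A\<close> themselves have to be given, by \<open>fold_lift\<close>.\<close>

locale tangent_creation = X: tangent_category X + Y: category Y
  for X :: "('o, 'a, 'm) tangent_category_scheme" (structure)
  and Y :: "('p, 'b, 'n) tangent_category_scheme"
  and I :: "'i set" and UO :: "'i \<Rightarrow> 'p \<Rightarrow> 'o" and UM :: "'i \<Rightarrow> 'b \<Rightarrow> 'a" +
  assumes typing: "tangent_typing Y"
    and preserves: "i \<in> I \<Longrightarrow> preserves_tangent_structure Y X (UO i) (UM i)"
    and faithful: "f \<in> Arr Y \<Longrightarrow> g \<in> Arr Y \<Longrightarrow> Dom Y f = Dom Y g \<Longrightarrow> Cod Y f = Cod Y g \<Longrightarrow>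
      (\<And>i. i \<in> I \<Longrightarrow> UM i f = UM i g) \<Longrightarrow> f = g"
    and lifting: "C \<in> Obj Y \<Longrightarrow> P \<in> Obj Y \<Longrightarrow>
      (\<And>k. k \<in> K \<Longrightarrow> \<pi> k \<in> Arr Y \<and> Dom Y (\<pi> k) = P \<and>
        v k \<in> Arr Y \<and> Dom Y (v k) = C \<and> Cod Y (v k) = Cod Y (\<pi> k)) \<Longrightarrow>
      (\<And>i. i \<in> I \<Longrightarrow> jointly_monic X K (UO i P) (\<lambda>k. UM i (\<pi> k)) \<and>
        jointly_monic X K (TO X (UO i P)) (\<lambda>k. TM X (UM i (\<pi> k)))) \<Longrightarrow>
      (\<And>i. i \<in> I \<Longrightarrow> h i \<in> Arr X \<and> Dom X (h i) = UO i C \<and> Cod X (h i) = UO i P) \<Longrightarrow>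
      (\<And>i k. i \<in> I \<Longrightarrow> k \<in> K \<Longrightarrow> UM i (\<pi> k) \<cdot> h i = UM i (v k)) \<Longrightarrow>
      \<exists>h'\<in>hom Y C P. \<forall>i\<in>I. UM i h' = h i"
    and fold_lift: "A \<in> Obj Y \<Longrightarrow> \<exists>P q \<pi>. q \<in> hom Y P A \<and> (\<forall>j<n. \<pi> j \<in> hom Y P (TO Y A)) \<and>
      (\<forall>i\<in>I. \<forall>m. is_fold_pullback X n ((TM X ^^ m) (tproj X (UO i A))) ((TO X ^^ m) (UO i P))
        ((TM X ^^ m) (UM i q)) (\<lambda>j. (TM X ^^ m) (UM i (\<pi> j))))"
begin

abbreviation cmp_Y (infixr \<open>\<odot>\<close> 70) where "g \<odot> f \<equiv> g \<cdot>\<^bsub>Y\<^esub> f"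

lemma typing_simps [simp]:
  assumes "A \<in> Obj Y"
  shows "TO Y A \<in> Obj Y" "T2 Y A \<in> Obj Y"
    "tpi1 Y A \<in> Arr Y" "Dom Y (tpi1 Y A) = T2 Y A" "Cod Y (tpi1 Y A) = TO Y A"
    "tpi2 Y A \<in> Arr Y" "Dom Y (tpi2 Y A) = T2 Y A" "Cod Y (tpi2 Y A) = TO Y A"
    "tproj Y A \<in> Arr Y" "Dom Y (tproj Y A) = TO Y A" "Cod Y (tproj Y A) = A"
    "tzero Y A \<in> Arr Y" "Dom Y (tzero Y A) = A" "Cod Y (tzero Y A) = TO Y A"
    "tsum Y A \<in> Arr Y" "Dom Y (tsum Y A) = T2 Y A" "Cod Y (tsum Y A) = TO Y A"
    "tlift Y A \<in> Arr Y" "Dom Y (tlift Y A) = TO Y A" "Cod Y (tlift Y A) = TO Y (TO Y A)"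
    "tflip Y A \<in> Arr Y" "Dom Y (tflip Y A) = TO Y (TO Y A)" "Cod Y (tflip Y A) = TO Y (TO Y A)"
  using typing assms by (auto simp: tangent_typing_def)

lemma TM_typing [simp]:
  assumes "f \<in> Arr Y"
  shows "TM Y f \<in> Arr Y" "Dom Y (TM Y f) = TO Y (Dom Y f)" "Cod Y (TM Y f) = TO Y (Cod Y f)"
  using typing assms by (auto simp: tangent_typing_def)

lemma U_simps [simp]:
  assumes i: "i \<in> I"
  shows "A \<in> Obj Y \<Longrightarrow> UO i A \<in> Obj X"
    "f \<in> Arr Y \<Longrightarrow> UM i f \<in> Arr X" "f \<in> Arr Y \<Longrightarrow> Dom X (UM i f) = UO i (Dom Y f)"
    "f \<in> Arr Y \<Longrightarrow> Cod X (UM i f) = UO i (Cod Y f)"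
    "A \<in> Obj Y \<Longrightarrow> UM i (idt Y A) = idt X (UO i A)"
    "f \<in> Arr Y \<Longrightarrow> g \<in> Arr Y \<Longrightarrow> Dom Y g = Cod Y f \<Longrightarrow> UM i (g \<odot> f) = UM i g \<cdot> UM i f"
    "A \<in> Obj Y \<Longrightarrow> UO i (TO Y A) = TO X (UO i A)" "A \<in> Obj Y \<Longrightarrow> UO i (T2 Y A) = T2 X (UO i A)"
    "A \<in> Obj Y \<Longrightarrow> UM i (tpi1 Y A) = tpi1 X (UO i A)" "A \<in> Obj Y \<Longrightarrow> UM i (tpi2 Y A) = tpi2 X (UO i A)"
    "A \<in> Obj Y \<Longrightarrow> UM i (tproj Y A) = tproj X (UO i A)" "A \<in> Obj Y \<Longrightarrow> UM i (tzero Y A) = tzero X (UO i A)"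
    "A \<in> Obj Y \<Longrightarrow> UM i (tsum Y A) = tsum X (UO i A)" "A \<in> Obj Y \<Longrightarrow> UM i (tlift Y A) = tlift X (UO i A)"
    "A \<in> Obj Y \<Longrightarrow> UM i (tflip Y A) = tflip X (UO i A)"
    "f \<in> Arr Y \<Longrightarrow> UM i (TM Y f) = TM X (UM i f)"
  using preserves[OF i] by (auto simp: preserves_tangent_structure_def dest: is_functorD)

text \<open>Joint faithfulness gives uniqueness, the assumption \<open>lifting\<close> gives existence; the latter
  requires that the legs stay jointly monic under \<open>T\<close>.\<close>

lemma created_limit:
  assumes d: "is_diagram Y K E d B" and P: "is_cone Y K E d B P \<pi>"
    and L: "\<And>i. i \<in> I \<Longrightarrow> is_limit X K E (\<lambda>k k'. UM i (d k k')) (\<lambda>k. UO i (B k)) (UO i P) (\<lambda>k. UM i (\<pi> k))"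
    and T: "\<And>i. i \<in> I \<Longrightarrow> jointly_monic X K (TO X (UO i P)) (\<lambda>k. TM X (UM i (\<pi> k)))"
  shows "is_limit Y K E d B P \<pi>"
proof (rule Y.is_limitI[OF d P])
  have \<pi>: "P \<in> Obj Y" "\<And>k. k \<in> K \<Longrightarrow> \<pi> k \<in> Arr Y \<and> Dom Y (\<pi> k) = P \<and> Cod Y (\<pi> k) = B k"
    using P by (auto simp: is_cone_def)
  show "jointly_monic Y K P \<pi>"
    unfolding jointly_monic_def
  proof (intro ballI impI)
    fix f g assume fg: "f \<in> Arr Y" "g \<in> Arr Y" "Dom Y f = Dom Y g" "Cod Y f = P" "Cod Y g = P"
      "\<forall>k\<in>K. \<pi> k \<odot> f = \<pi> k \<odot> g"
    show "f = g"
    proof (rule faithful)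
      fix i assume i: "i \<in> I"
      show "UM i f = UM i g"
      proof (rule jointly_monicD[OF X.is_limit_jointly_monic[OF L[OF i]]])
        fix k assume k: "k \<in> K"
        show "UM i (\<pi> k) \<cdot> UM i f = UM i (\<pi> k) \<cdot> UM i g"
          using arg_cong[OF bspec[OF fg(6) k], of "UM i"] fg(1-5) \<pi>(2)[OF k] i by simp
      qed (use fg(1-5) i in simp_all)
    qed (use fg in simp_all)
  qed
  fix C u assume "is_cone Y K E d B C u"
  then have u: "C \<in> Obj Y" "\<And>k. k \<in> K \<Longrightarrow> u k \<in> Arr Y \<and> Dom Y (u k) = C \<and> Cod Y (u k) = B k"
    "\<And>k k'. (k, k') \<in> E \<Longrightarrow> d k k' \<odot> u k = u k'"
    by (auto simp: is_cone_def)
  have dd: "\<And>k k'. (k, k') \<in> E \<Longrightarrow> k \<in> K \<and> k' \<in> K \<and> d k k' \<in> Arr Y \<and> Dom Y (d k k') = B k \<and> Cod Y (d k k') = B k'"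
    using d by (auto simp: is_diagram_def)
  have "\<exists>h. h \<in> Arr X \<and> Dom X h = UO i C \<and> Cod X h = UO i P \<and> (\<forall>k\<in>K. UM i (\<pi> k) \<cdot> h = UM i (u k))" if i: "i \<in> I" for i
  proof -
    obtain h where "h \<in> Arr X" "Dom X h = UO i C" "Cod X h = UO i P" "\<And>k. k \<in> K \<Longrightarrow> UM i (\<pi> k) \<cdot> h = UM i (u k)"
    proof (rule is_limit_obtain[OF L[OF i], of "UO i C" "\<lambda>k. UM i (u k)"])
      fix k k' assume e: "(k, k') \<in> E"
      show "UM i (d k k') \<cdot> UM i (u k) = UM i (u k')"
        using arg_cong[OF u(3)[OF e], of "UM i"] dd[OF e] u(2) i by simp
    qed (use u i in auto)
    then show ?thesis by blast
  qed
  then obtain h where h: "\<And>i. i \<in> I \<Longrightarrow> h i \<in> Arr X \<and> Dom X (h i) = UO i C \<and> Cod X (h i) = UO i P"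
    "\<And>i k. i \<in> I \<Longrightarrow> k \<in> K \<Longrightarrow> UM i (\<pi> k) \<cdot> h i = UM i (u k)" by metis
  have "\<exists>h'\<in>hom Y C P. \<forall>i\<in>I. UM i h' = h i"
    by (rule lifting[where K = K and \<pi> = \<pi> and v = u])
      (use \<pi> u h T X.is_limit_jointly_monic[OF L] in auto)
  then obtain h' where h': "h' \<in> Arr Y" "Dom Y h' = C" "Cod Y h' = P" "\<And>i. i \<in> I \<Longrightarrow> UM i h' = h i" by auto
  have "\<pi> k \<odot> h' = u k" if k: "k \<in> K" for k
    by (rule faithful) (use k h' \<pi>(2)[OF k] u(2)[OF k] h(2) in auto)
  then show "\<exists>h. h \<in> hom Y C P \<and> (\<forall>k\<in>K. \<pi> k \<odot> h = u k)" using h' by auto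
qed

lemma created_product:
  assumes A: "A \<in> Obj Y" "B \<in> Obj Y" and p: "p1 \<in> hom Y P A" "p2 \<in> hom Y P B"
    and L: "\<And>i. i \<in> I \<Longrightarrow> is_product X (UO i P) (UM i p1) (UM i p2) (UO i A) (UO i B)"
    and T: "\<And>i. i \<in> I \<Longrightarrow> jointly_monic X {0, 1} (TO X (UO i P)) (case_nat (TM X (UM i p1)) (\<lambda>_. TM X (UM i p2)))"
  shows "is_product Y P p1 p2 A B"
  unfolding Y.is_product_limit[OF A, where d = undefined]
proof (rule created_limit)
  show "is_diagram Y {0, 1} {} undefined (case_nat A (\<lambda>_. B))" using A by (auto simp: is_diagram_def)
  show "is_cone Y {0, 1} {} undefined (case_nat A (\<lambda>_. B)) P (case_nat p1 (\<lambda>_. p2))"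
    using p by (auto simp: is_cone_def)
  fix i assume i: "i \<in> I"
  have [simp]: "(\<lambda>k. UO i (case_nat A (\<lambda>_. B) k)) = case_nat (UO i A) (\<lambda>_. UO i B)"
    "(\<lambda>k. UM i (case_nat p1 (\<lambda>_. p2) k)) = case_nat (UM i p1) (\<lambda>_. UM i p2)"
    "(\<lambda>k. TM X (UM i (case_nat p1 (\<lambda>_. p2) k))) = case_nat (TM X (UM i p1)) (\<lambda>_. TM X (UM i p2))"
    by (auto split: nat.split)
  show "is_limit X {0, 1} {} (\<lambda>k k'. UM i (undefined k k')) (\<lambda>k. UO i (case_nat A (\<lambda>_. B) k)) (UO i P)
      (\<lambda>k. UM i (case_nat p1 (\<lambda>_. p2) k))"
    using L[OF i] A i X.is_product_limit[where A = "UO i A" and B = "UO i B"] by simp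
  show "jointly_monic X {0, 1} (TO X (UO i P)) (\<lambda>k. TM X (UM i (case_nat p1 (\<lambda>_. p2) k)))"
    using T[OF i] by simp
qed

lemma created_terminal:
  assumes "Z \<in> Obj Y" "\<And>i. i \<in> I \<Longrightarrow> is_terminal X (UO i Z)" "\<And>i. i \<in> I \<Longrightarrow> is_terminal X (TO X (UO i Z))"
  shows "is_terminal Y Z"
  unfolding Y.is_terminal_limit[where d = undefined and B = undefined and \<pi> = undefined]
proof (rule created_limit)
  fix i assume i: "i \<in> I"
  show "is_limit X {} {} (\<lambda>k k'. UM i (undefined k k')) (\<lambda>k. UO i (undefined k)) (UO i Z) (\<lambda>k. UM i (undefined k))"
    using assms(2)[OF i] X.is_terminal_limit by blast
  show "jointly_monic X {} (TO X (UO i Z)) (\<lambda>k. TM X (UM i (undefined k)))"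
    using assms(3)[OF i] X.is_terminal_limit X.is_limit_jointly_monic by blast
qed (use assms(1) in \<open>auto simp: is_diagram_def is_cone_def\<close>)

lemma created_pullback:
  assumes f: "f \<in> Arr Y" "g \<in> Arr Y" "Cod Y f = Cod Y g"
    and p: "p1 \<in> hom Y P (Dom Y f)" "p2 \<in> hom Y P (Dom Y g)"
    and L: "\<And>i. i \<in> I \<Longrightarrow> is_pullback X (UO i P) (UM i p1) (UM i p2) (UM i f) (UM i g)"
    and T: "\<And>i. i \<in> I \<Longrightarrow> jointly_monic X {0, 1} (TO X (UO i P)) (case_nat (TM X (UM i p1)) (\<lambda>_. TM X (UM i p2)))"
  shows "is_pullback Y P p1 p2 f g"
  unfolding is_pullback_def
proof (intro conjI ballI impI f p)
  note p' = p[unfolded in_hom_iff]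
  show e: "f \<odot> p1 = g \<odot> p2"
  proof (rule faithful)
    fix i assume i: "i \<in> I"
    show "UM i (f \<odot> p1) = UM i (g \<odot> p2)" using L[OF i] i p' f by (simp add: is_pullback_def)
  qed (use p' f in simp_all)
  fix C u v assume C: "C \<in> Obj Y" and "u \<in> hom Y C (Dom Y f)" "v \<in> hom Y C (Dom Y g)" and uv: "f \<odot> u = g \<odot> v"
  then have u: "u \<in> Arr Y" "Dom Y u = C" "Cod Y u = Dom Y f" "v \<in> Arr Y" "Dom Y v = C" "Cod Y v = Dom Y g" by auto
  define h where "h i = pair X (UM i p1) (UM i p2) (UM i u) (UM i v)" for i
  have h: "h i \<in> Arr X" "Dom X (h i) = UO i C" "Cod X (h i) = UO i P"
    "UM i p1 \<cdot> h i = UM i u" "UM i p2 \<cdot> h i = UM i v" if i: "i \<in> I" for i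
    using X.pullback_pair[OF L[OF i], of "UM i u" "UM i v"] arg_cong[OF uv, of "UM i"] u f i
    unfolding h_def by simp_all
  have "\<exists>h'\<in>hom Y C P. \<forall>i\<in>I. UM i h' = h i"
  proof (rule lifting[where K = "{0, 1}" and \<pi> = "case_nat p1 (\<lambda>_. p2)" and v = "case_nat u (\<lambda>_. v)"])
    show "P \<in> Obj Y" using p Y.Obj_ends(1)[of p1] by auto
    fix i assume i: "i \<in> I"
    have [simp]: "(\<lambda>k. UM i (case_nat p1 (\<lambda>_. p2) k)) = case_nat (UM i p1) (\<lambda>_. UM i p2)"
      "(\<lambda>k. TM X (UM i (case_nat p1 (\<lambda>_. p2) k))) = case_nat (TM X (UM i p1)) (\<lambda>_. TM X (UM i p2))"
      by (auto split: nat.split)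
    show "jointly_monic X {0, 1} (UO i P) (\<lambda>k. UM i (case_nat p1 (\<lambda>_. p2) k)) \<and>
        jointly_monic X {0, 1} (TO X (UO i P)) (\<lambda>k. TM X (UM i (case_nat p1 (\<lambda>_. p2) k)))"
      using X.is_pullback_jointly_monic[OF L[OF i]] T[OF i] by simp
  next
    fix i k assume "i \<in> I" "k \<in> {0::nat, 1}"
    then show "UM i (case_nat p1 (\<lambda>_. p2) k) \<cdot> h i = UM i (case_nat u (\<lambda>_. v) k)" using h by auto
  qed (use C u p h in auto)
  then obtain h' where h': "h' \<in> Arr Y" "Dom Y h' = C" "Cod Y h' = P" "\<And>i. i \<in> I \<Longrightarrow> UM i h' = h i" by auto
  show "\<exists>!h. h \<in> hom Y C P \<and> p1 \<odot> h = u \<and> p2 \<odot> h = v"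
  proof (rule ex1I[of _ h'])
    have "p1 \<odot> h' = u" "p2 \<odot> h' = v" using p' u h' h by (auto intro!: faithful)
    then show "h' \<in> hom Y C P \<and> p1 \<odot> h' = u \<and> p2 \<odot> h' = v" using h' by simp
    fix k assume k: "k \<in> hom Y C P \<and> p1 \<odot> k = u \<and> p2 \<odot> k = v"
    show "k = h'"
    proof (rule faithful)
      fix i assume i: "i \<in> I"
      have "UM i p1 \<cdot> UM i k = UM i u" "UM i p2 \<cdot> UM i k = UM i v"
        using k i p' U_simps(6)[OF i, of k p1] U_simps(6)[OF i, of k p2] by simp_all
      then show "UM i k = UM i h'" using k h' h i by - (rule X.pullback_ext[OF L[OF i]], simp_all)
    qed (use k h' in simp_all)
  qed
qed

lemma created_T2: "A \<in> Obj Y \<Longrightarrow> is_pullback Y (T2 Y A) (tpi1 Y A) (tpi2 Y A) (tproj Y A) (tproj Y A)"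
proof (rule created_pullback)
  fix i assume A: "A \<in> Obj Y" and i: "i \<in> I"
  show "is_pullback X (UO i (T2 Y A)) (UM i (tpi1 Y A)) (UM i (tpi2 Y A)) (UM i (tproj Y A)) (UM i (tproj Y A))"
    using X.T2_pullback[of "UO i A"] A i by simp
  show "jointly_monic X {0, 1} (TO X (UO i (T2 Y A))) (case_nat (TM X (UM i (tpi1 Y A))) (\<lambda>_. TM X (UM i (tpi2 Y A))))"
    using X.is_pullback_jointly_monic[OF X.T_T2_pullback[of "UO i A" 1]] A i by simp
qed simp_all

lemma created_T_T2:
  "A \<in> Obj Y \<Longrightarrow> is_pullback Y (TO Y (T2 Y A)) (TM Y (tpi1 Y A)) (TM Y (tpi2 Y A)) (TM Y (tproj Y A)) (TM Y (tproj Y A))"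
proof (rule created_pullback)
  fix i assume A: "A \<in> Obj Y" and i: "i \<in> I"
  show "is_pullback X (UO i (TO Y (T2 Y A))) (UM i (TM Y (tpi1 Y A))) (UM i (TM Y (tpi2 Y A))) (UM i (TM Y (tproj Y A))) (UM i (TM Y (tproj Y A)))"
    using X.T_T2_pullback[of "UO i A" 1] A i by simp
  show "jointly_monic X {0, 1} (TO X (UO i (TO Y (T2 Y A)))) (case_nat (TM X (UM i (TM Y (tpi1 Y A)))) (\<lambda>_. TM X (UM i (TM Y (tpi2 Y A)))))"
    using X.is_pullback_jointly_monic[OF X.T_T2_pullback[of "UO i A" 2]] A i by (simp add: numeral_2_eq_2)
qed simp_all

lemma U_pair2:
  assumes "A \<in> Obj Y" "u \<in> Arr Y" "v \<in> Arr Y" "Dom Y u = Dom Y v" "Cod Y u = TO Y A" "Cod Y v = TO Y A"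
    "tproj Y A \<odot> u = tproj Y A \<odot> v"
  shows "pair2 Y A u v \<in> Arr Y" "Dom Y (pair2 Y A u v) = Dom Y u" "Cod Y (pair2 Y A u v) = T2 Y A"
    "tpi1 Y A \<odot> pair2 Y A u v = u" "tpi2 Y A \<odot> pair2 Y A u v = v"
    "i \<in> I \<Longrightarrow> UM i (pair2 Y A u v) = pair2 X (UO i A) (UM i u) (UM i v)"
proof -
  show *: "pair2 Y A u v \<in> Arr Y" "Dom Y (pair2 Y A u v) = Dom Y u" "Cod Y (pair2 Y A u v) = T2 Y A"
    "tpi1 Y A \<odot> pair2 Y A u v = u" "tpi2 Y A \<odot> pair2 Y A u v = v"
    unfolding pair2_def using Y.pullback_pair[OF created_T2[OF assms(1)], of u v] assms by simp_all
  assume i: "i \<in> I"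
  show "UM i (pair2 Y A u v) = pair2 X (UO i A) (UM i u) (UM i v)"
    unfolding pair2_def[of X]
  proof (rule X.pair_eqI[symmetric])
    show "is_product X (T2 X (UO i A)) (tpi1 X (UO i A)) (tpi2 X (UO i A)) undefined undefined \<or>
      is_pullback X (T2 X (UO i A)) (tpi1 X (UO i A)) (tpi2 X (UO i A)) (tproj X (UO i A)) (tproj X (UO i A))"
      using X.T2_pullback[of "UO i A"] assms i by simp
    show "tpi1 X (UO i A) \<cdot> UM i (pair2 Y A u v) = UM i u" "tpi2 X (UO i A) \<cdot> UM i (pair2 Y A u v) = UM i v"
      using arg_cong[OF *(4), of "UM i"] arg_cong[OF *(5), of "UM i"] *(1-3) assms i by simp_all
  qed (use * assms i in simp_all)
qed

lemma U_T_pair: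
  assumes "A \<in> Obj Y" "u \<in> Arr Y" "v \<in> Arr Y" "Dom Y u = Dom Y v" "Cod Y u = TO Y (TO Y A)" "Cod Y v = TO Y (TO Y A)"
    "TM Y (tproj Y A) \<odot> u = TM Y (tproj Y A) \<odot> v"
  defines "w \<equiv> pair Y (TM Y (tpi1 Y A)) (TM Y (tpi2 Y A)) u v"
  shows "w \<in> Arr Y" "Dom Y w = Dom Y u" "Cod Y w = TO Y (T2 Y A)"
    "i \<in> I \<Longrightarrow> UM i w = pair X (TM X (tpi1 X (UO i A))) (TM X (tpi2 X (UO i A))) (UM i u) (UM i v)"
proof -
  have *: "w \<in> Arr Y" "Dom Y w = Dom Y u" "Cod Y w = TO Y (T2 Y A)" "TM Y (tpi1 Y A) \<odot> w = u" "TM Y (tpi2 Y A) \<odot> w = v"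
    unfolding w_def using Y.pullback_pair[OF created_T_T2[OF assms(1)], of u v] assms by simp_all
  then show "w \<in> Arr Y" "Dom Y w = Dom Y u" "Cod Y w = TO Y (T2 Y A)" by auto
  assume i: "i \<in> I"
  show "UM i w = pair X (TM X (tpi1 X (UO i A))) (TM X (tpi2 X (UO i A))) (UM i u) (UM i v)"
  proof (rule X.pair_eqI[symmetric])
    show "is_product X (TO X (T2 X (UO i A))) (TM X (tpi1 X (UO i A))) (TM X (tpi2 X (UO i A))) undefined undefined \<or>
      is_pullback X (TO X (T2 X (UO i A))) (TM X (tpi1 X (UO i A))) (TM X (tpi2 X (UO i A))) (TM X (tproj X (UO i A))) (TM X (tproj X (UO i A)))"
      using X.T_T2_pullback[of "UO i A" 1] assms i by simp
    show "TM X (tpi1 X (UO i A)) \<cdot> UM i w = UM i u" "TM X (tpi2 X (UO i A)) \<cdot> UM i w = UM i v"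
      using arg_cong[OF *(4), of "UM i"] arg_cong[OF *(5), of "UM i"] *(1-3) assms(1-6) i by simp_all
  qed (use *(1-3) assms(1-6) i in simp_all)
qed

lemma proj_eqI:
  "A \<in> Obj Y \<Longrightarrow> u \<in> Arr Y \<Longrightarrow> v \<in> Arr Y \<Longrightarrow> Dom Y u = Dom Y v \<Longrightarrow> Cod Y u = TO Y A \<Longrightarrow> Cod Y v = TO Y A \<Longrightarrow>
   (\<And>i. i \<in> I \<Longrightarrow> tproj X (UO i A) \<cdot> UM i u = tproj X (UO i A) \<cdot> UM i v) \<Longrightarrow>
   tproj Y A \<odot> u = tproj Y A \<odot> v"
  by (rule faithful) simp_all

lemma Tproj_eqI:
  "A \<in> Obj Y \<Longrightarrow> u \<in> Arr Y \<Longrightarrow> v \<in> Arr Y \<Longrightarrow> Dom Y u = Dom Y v \<Longrightarrow> Cod Y u = TO Y (TO Y A) \<Longrightarrow> Cod Y v = TO Y (TO Y A) \<Longrightarrow>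
   (\<And>i. i \<in> I \<Longrightarrow> TM X (tproj X (UO i A)) \<cdot> UM i u = TM X (tproj X (UO i A)) \<cdot> UM i v) \<Longrightarrow>
   TM Y (tproj Y A) \<odot> u = TM Y (tproj Y A) \<odot> v"
  by (rule faithful) simp_all

lemma U_T2M:
  assumes "f \<in> Arr Y"
  shows "T2M Y f \<in> Arr Y" "Dom Y (T2M Y f) = T2 Y (Dom Y f)" "Cod Y (T2M Y f) = T2 Y (Cod Y f)"
    "i \<in> I \<Longrightarrow> UM i (T2M Y f) = T2M X (UM i f)"
proof -
  have *: "tproj Y (Cod Y f) \<odot> (TM Y f \<odot> tpi1 Y (Dom Y f)) = tproj Y (Cod Y f) \<odot> (TM Y f \<odot> tpi2 Y (Dom Y f))"
    using assms by (intro proj_eqI) (simp_all add: X.tail[OF X.proj_nat] X.tpi_proj)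
  show "T2M Y f \<in> Arr Y" "Dom Y (T2M Y f) = T2 Y (Dom Y f)" "Cod Y (T2M Y f) = T2 Y (Cod Y f)"
    unfolding T2M_def using U_pair2(1-3)[OF _ _ _ _ _ _ *] assms by simp_all
  assume i: "i \<in> I"
  show "UM i (T2M Y f) = T2M X (UM i f)"
    unfolding T2M_def using U_pair2(6)[OF _ _ _ _ _ _ * i] assms i by simp
qed

lemma funpow_simps [simp]:
  "A \<in> Obj Y \<Longrightarrow> (TO Y ^^ m) A \<in> Obj Y"
  "f \<in> Arr Y \<Longrightarrow> (TM Y ^^ m) f \<in> Arr Y"
  "f \<in> Arr Y \<Longrightarrow> Dom Y ((TM Y ^^ m) f) = (TO Y ^^ m) (Dom Y f)"
  "f \<in> Arr Y \<Longrightarrow> Cod Y ((TM Y ^^ m) f) = (TO Y ^^ m) (Cod Y f)"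
  "i \<in> I \<Longrightarrow> A \<in> Obj Y \<Longrightarrow> UO i ((TO Y ^^ m) A) = (TO X ^^ m) (UO i A)"
  "i \<in> I \<Longrightarrow> f \<in> Arr Y \<Longrightarrow> UM i ((TM Y ^^ m) f) = (TM X ^^ m) (UM i f)"
proof -
  show 1: "(TO Y ^^ m) A \<in> Obj Y" if "A \<in> Obj Y" for A m using that by (induction m) simp_all
  show 2: "(TM Y ^^ m) f \<in> Arr Y" if "f \<in> Arr Y" for f m using that by (induction m) simp_all
  show "f \<in> Arr Y \<Longrightarrow> Dom Y ((TM Y ^^ m) f) = (TO Y ^^ m) (Dom Y f)" using 2 by (induction m) simp_all
  show "f \<in> Arr Y \<Longrightarrow> Cod Y ((TM Y ^^ m) f) = (TO Y ^^ m) (Cod Y f)" using 2 by (induction m) simp_all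
  show "i \<in> I \<Longrightarrow> A \<in> Obj Y \<Longrightarrow> UO i ((TO Y ^^ m) A) = (TO X ^^ m) (UO i A)" using 1 by (induction m) simp_all
  show "i \<in> I \<Longrightarrow> f \<in> Arr Y \<Longrightarrow> UM i ((TM Y ^^ m) f) = (TM X ^^ m) (UM i f)" using 2 by (induction m) simp_all
qed

lemma created_fold:
  assumes A: "A \<in> Obj Y"
  shows "\<exists>P q \<pi>. \<forall>m. is_fold_pullback Y n ((TM Y ^^ m) (tproj Y A)) ((TO Y ^^ m) P) ((TM Y ^^ m) q) (\<lambda>j. (TM Y ^^ m) (\<pi> j))"
proof -
  obtain P q \<pi> where q: "q \<in> hom Y P A" and \<pi>: "\<And>j. j < n \<Longrightarrow> \<pi> j \<in> hom Y P (TO Y A)"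
    and L: "\<And>i m. i \<in> I \<Longrightarrow> is_fold_pullback X n ((TM X ^^ m) (tproj X (UO i A))) ((TO X ^^ m) (UO i P))
        ((TM X ^^ m) (UM i q)) (\<lambda>j. (TM X ^^ m) (UM i (\<pi> j)))"
    using fold_lift[OF A, of n] by blast
  have P: "P \<in> Obj Y" using q Y.Obj_ends(1)[of q] by simp
  have "is_fold_pullback Y n ((TM Y ^^ m) (tproj Y A)) ((TO Y ^^ m) P) ((TM Y ^^ m) q) (\<lambda>j. (TM Y ^^ m) (\<pi> j))" for m
    unfolding Y.is_fold_pullback_limit
  proof (intro conjI created_limit)
    let ?B = "(\<lambda>_. Dom Y ((TM Y ^^ m) (tproj Y A)))(n := Cod Y ((TM Y ^^ m) (tproj Y A)))"
    show "is_diagram Y {..n} ({..<n} \<times> {n}) (\<lambda>_ _. (TM Y ^^ m) (tproj Y A)) ?B"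
      using A by (auto simp: is_diagram_def)
    have em: "(TM Y ^^ m) (tproj Y A) \<odot> (TM Y ^^ m) (\<pi> j) = (TM Y ^^ m) q" if j: "j < n" for j
    proof (rule faithful)
      fix i assume i: "i \<in> I"
      show "UM i ((TM Y ^^ m) (tproj Y A) \<odot> (TM Y ^^ m) (\<pi> j)) = UM i ((TM Y ^^ m) q)"
        using L[OF i, of m] j \<pi>[OF j] i A q by (simp add: is_fold_pullback_def)
    qed (use q \<pi>[OF j] A in simp_all)
    then show "is_cone Y {..n} ({..<n} \<times> {n}) (\<lambda>_ _. (TM Y ^^ m) (tproj Y A)) ?B ((TO Y ^^ m) P)
       ((\<lambda>j. (TM Y ^^ m) (\<pi> j))(n := (TM Y ^^ m) q))"
      using q \<pi> P A by (auto simp: is_cone_def)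
    fix i assume i: "i \<in> I"
    have *: "(\<lambda>k. UO i (?B k)) = (\<lambda>_. (TO X ^^ m) (TO X (UO i A)))(n := (TO X ^^ m) (UO i A))"
      using A i by auto
    have e1: "k \<le> n \<Longrightarrow> UM i (((\<lambda>j. (TM Y ^^ m) (\<pi> j))(n := (TM Y ^^ m) q)) k)
       = ((\<lambda>j. (TM X ^^ m) (UM i (\<pi> j)))(n := (TM X ^^ m) (UM i q))) k" for k
      using q \<pi> i by auto
    have cong: "is_limit X K E d B Q \<rho>'" if "is_limit X K E d B Q \<rho>" "\<And>k. k \<in> K \<Longrightarrow> \<rho> k = \<rho>' k" for K E d B Q \<rho> \<rho>'
    proof (rule X.is_limit_iso_cong[OF that(1)])
      show "idt X Q \<in> Arr X" "Dom X (idt X Q) = Q" "Cod X (idt X Q) = Q" "idt X Q \<in> Arr X" "Dom X (idt X Q) = Q" "Cod X (idt X Q) = Q"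
        "idt X Q \<cdot> idt X Q = idt X Q" "idt X Q \<cdot> idt X Q = idt X Q"
        using is_limitD(1)[OF that(1)] by simp_all
      fix k assume "k \<in> K" then show "\<rho> k \<cdot> idt X Q = \<rho>' k"
        using is_limitD(2,3)[OF that(1)] that(2) by simp
    qed
    show "is_limit X {..n} ({..<n} \<times> {n}) (\<lambda>k k'. UM i ((TM Y ^^ m) (tproj Y A))) (\<lambda>k. UO i (?B k))
      (UO i ((TO Y ^^ m) P)) (\<lambda>k. UM i (((\<lambda>j. (TM Y ^^ m) (\<pi> j))(n := (TM Y ^^ m) q)) k))"
      unfolding *
      by (rule cong[where \<rho> = "(\<lambda>j. (TM X ^^ m) (UM i (\<pi> j)))(n := (TM X ^^ m) (UM i q))"])
        (use L[OF i, of m] A P i e1 in \<open>simp_all add: X.is_fold_pullback_limit\<close>)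
    have "jointly_monic X {..n} (TO X ((TO X ^^ m) (UO i P))) ((\<lambda>j. TM X ((TM X ^^ m) (UM i (\<pi> j))))(n := TM X ((TM X ^^ m) (UM i q))))"
      using L[OF i, of "Suc m"] X.is_limit_jointly_monic unfolding X.is_fold_pullback_limit by auto
    then have "jointly_monic X {..n} (TO X ((TO X ^^ m) (UO i P)))
      (\<lambda>k. TM X (((\<lambda>j. (TM X ^^ m) (UM i (\<pi> j)))(n := (TM X ^^ m) (UM i q))) k))"
      by (rule back_subst[of "jointly_monic X {..n} (TO X ((TO X ^^ m) (UO i P)))"]) auto
    then show "jointly_monic X {..n} (TO X (UO i ((TO Y ^^ m) P))) (\<lambda>k. TM X (UM i (((\<lambda>j. (TM Y ^^ m) (\<pi> j))(n := (TM Y ^^ m) q)) k)))"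
      using e1 P i by (simp add: jointly_monic_def del: fun_upd_apply)
  qed (use A in simp_all)
  then show ?thesis by blast
qed

text \<open>Equations between structure maps hold because they hold for the underlying maps. In the universality
  of the lift, the legs stay jointly monic under \<open>T\<close> by \<open>T_vert_monic\<close>.\<close>

theorem created_tangent_category: "tangent_category Y"
proof
  have T: "is_functor Y Y (TO Y) (TM Y)"
    unfolding is_functor_def by (auto intro!: faithful Y.category_axioms)
  show "is_functor Y Y (TO Y) (TM Y)" by (fact T)
  have I: "is_functor Y Y (\<lambda>A. A) (\<lambda>f. f)"
    unfolding is_functor_def by (auto intro: Y.category_axioms)
  have TT: "is_functor Y Y (TO Y \<circ> TO Y) (TM Y \<circ> TM Y)"
    using is_functor_comp[OF T T] by (simp add: comp_def)
  have T2: "is_functor Y Y (T2 Y) (T2M Y)"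
    unfolding is_functor_def
    by (auto intro!: faithful Y.category_axioms simp: U_T2M is_functorD(7,8)[OF X.T2_functor])
  show "natural_transformation Y Y (TO Y) (TM Y) (\<lambda>A. A) (\<lambda>f. f) (tproj Y)"
    by (rule natural_transformationI[OF T I]) (auto intro!: faithful X.proj_nat[THEN trans])
  show "natural_transformation Y Y (\<lambda>A. A) (\<lambda>f. f) (TO Y) (TM Y) (tzero Y)"
    by (rule natural_transformationI[OF I T]) (auto intro!: faithful X.zero_nat[THEN trans])
  show "natural_transformation Y Y (T2 Y) (T2M Y) (TO Y) (TM Y) (tsum Y)"
    by (rule natural_transformationI[OF T2 T]) (auto intro!: faithful X.sum_nat[THEN trans] simp: U_T2M)
  show "natural_transformation Y Y (TO Y) (TM Y) (TO Y \<circ> TO Y) (TM Y \<circ> TM Y) (tlift Y)"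
    by (rule natural_transformationI[OF T TT]) (auto intro!: faithful X.lift_nat[THEN trans])
  show "natural_transformation Y Y (TO Y \<circ> TO Y) (TM Y \<circ> TM Y) (TO Y \<circ> TO Y) (TM Y \<circ> TM Y) (tflip Y)"
    by (rule natural_transformationI[OF TT TT]) (auto intro!: faithful X.flip_nat[THEN trans])
  fix A n
  assume A: "A \<in> Obj Y"
  show "\<exists>P q \<pi>. \<forall>m. is_fold_pullback Y n ((TM Y ^^ m) (tproj Y A)) ((TO Y ^^ m) P) ((TM Y ^^ m) q) (\<lambda>j. (TM Y ^^ m) (\<pi> j))"
    by (rule created_fold[OF A])
  show "is_pullback Y (T2 Y A) (tpi1 Y A) (tpi2 Y A) (tproj Y A) (tproj Y A)" by (rule created_T2[OF A])
  show "tproj Y A \<odot> tzero Y A = idt Y A" using A by (intro faithful) (simp_all add: X.proj_zero)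
  show "tproj Y A \<odot> tsum Y A = tproj Y A \<odot> tpi1 Y A" using A by (intro faithful) (simp_all add: X.proj_sum)
  show "tsum Y A \<odot> pair2 Y A (tsum Y A \<odot> pair2 Y A (\<pi> 0) (\<pi> 1)) (\<pi> 2)
      = tsum Y A \<odot> pair2 Y A (\<pi> 0) (tsum Y A \<odot> pair2 Y A (\<pi> 1) (\<pi> 2))"
    if F: "is_fold_pullback Y 3 (tproj Y A) P q \<pi>" for P q \<pi>
  proof -
    have \<pi>: "\<pi> i \<in> Arr Y" "Dom Y (\<pi> i) = P" "Cod Y (\<pi> i) = TO Y A" "tproj Y A \<odot> \<pi> i = q" if "i < 3" for i
      using F that A by (auto simp: is_fold_pullback_def)
    note \<pi>' = \<pi>[of 0, simplified] \<pi>[of 1, simplified] \<pi>[of 2, simplified]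
    have ps: "tproj Y A \<odot> (tsum Y A \<odot> x) = tproj Y A \<odot> (tpi1 Y A \<odot> x)" if "x \<in> Arr Y" "Cod Y x = T2 Y A" for x
      using that A by (intro faithful) (simp_all add: X.proj_tails)
    have t: "pair2 Y A (\<pi> 0) (\<pi> 1) \<in> Arr Y" "Dom Y (pair2 Y A (\<pi> 0) (\<pi> 1)) = P" "Cod Y (pair2 Y A (\<pi> 0) (\<pi> 1)) = T2 Y A"
      "tpi1 Y A \<odot> pair2 Y A (\<pi> 0) (\<pi> 1) = \<pi> 0"
      "pair2 Y A (\<pi> 1) (\<pi> 2) \<in> Arr Y" "Dom Y (pair2 Y A (\<pi> 1) (\<pi> 2)) = P" "Cod Y (pair2 Y A (\<pi> 1) (\<pi> 2)) = T2 Y A"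
      "tpi1 Y A \<odot> pair2 Y A (\<pi> 1) (\<pi> 2) = \<pi> 1"
      using U_pair2(1-4)[OF A, of "\<pi> 0" "\<pi> 1"] U_pair2(1-4)[OF A, of "\<pi> 1" "\<pi> 2"] \<pi>' by simp_all
    note U = U_pair2[OF A]
    show ?thesis
    proof (rule faithful)
      fix i assume i: "i \<in> I"
      have a: "tsum X (UO i A) \<cdot> pair2 X (UO i A) (tsum X (UO i A) \<cdot> pair2 X (UO i A) (UM i (\<pi> 0)) (UM i (\<pi> 1))) (UM i (\<pi> 2))
      = tsum X (UO i A) \<cdot> pair2 X (UO i A) (UM i (\<pi> 0)) (tsum X (UO i A) \<cdot> pair2 X (UO i A) (UM i (\<pi> 1)) (UM i (\<pi> 2)))"
      proof (rule X.sum_assoc_elements[of "UO i A" "\<lambda>j. UM i (\<pi> j)" "UO i P" "UM i q"])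
        fix j :: nat assume j: "j < 3"
        show "UM i (\<pi> j) \<in> Arr X \<and> Dom X (UM i (\<pi> j)) = UO i P \<and> Cod X (UM i (\<pi> j)) = TO X (UO i A) \<and>
          tproj X (UO i A) \<cdot> UM i (\<pi> j) = UM i q"
          using \<pi>(1-3)[OF j] i A arg_cong[OF \<pi>(4)[OF j], of "UM i"] by simp
      qed (use i A in simp)
      show "UM i (tsum Y A \<odot> pair2 Y A (tsum Y A \<odot> pair2 Y A (\<pi> 0) (\<pi> 1)) (\<pi> 2))
      = UM i (tsum Y A \<odot> pair2 Y A (\<pi> 0) (tsum Y A \<odot> pair2 Y A (\<pi> 1) (\<pi> 2)))"
        using a A i t \<pi>' by (simp add: U ps)
    qed (use A t \<pi>' in \<open>simp_all add: U ps\<close>)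
  qed
  show "tsum Y A \<odot> pair2 Y A (tzero Y A \<odot> tproj Y A) (idt Y (TO Y A)) = idt Y (TO Y A)"
  proof -
    have "tproj Y A \<odot> (tzero Y A \<odot> tproj Y A) = tproj Y A \<odot> idt Y (TO Y A)"
      using A by (intro proj_eqI) (simp_all add: X.proj_tails)
    from U_pair2[OF A _ _ _ _ _ this] show ?thesis using A by (intro faithful) (simp_all add: X.sum_zero)
  qed
  show "tsum Y A \<odot> pair2 Y A (tpi2 Y A) (tpi1 Y A) = tsum Y A"
  proof -
    have "tproj Y A \<odot> tpi2 Y A = tproj Y A \<odot> tpi1 Y A"
      using A by (intro proj_eqI) (simp_all add: X.tpi_proj)
    from U_pair2[OF A _ _ _ _ _ this] show ?thesis using A by (intro faithful) (simp_all add: X.sum_comm)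
  qed
  show "TM Y (tproj Y A) \<odot> tlift Y A = tzero Y A \<odot> tproj Y A" using A by (intro faithful) (simp_all add: X.lift_proj)
  show "tlift Y A \<odot> tzero Y A = TM Y (tzero Y A) \<odot> tzero Y A" using A by (intro faithful) (simp_all add: X.lift_zero)
  show "tlift Y A \<odot> tsum Y A = TM Y (tsum Y A) \<odot>
      pair Y (TM Y (tpi1 Y A)) (TM Y (tpi2 Y A)) (tlift Y A \<odot> tpi1 Y A) (tlift Y A \<odot> tpi2 Y A)"
  proof -
    have "TM Y (tproj Y A) \<odot> (tlift Y A \<odot> tpi1 Y A) = TM Y (tproj Y A) \<odot> (tlift Y A \<odot> tpi2 Y A)"
      using A by (intro Tproj_eqI) (simp_all add: X.lift_tails X.tpi_proj)
    from U_T_pair[OF A _ _ _ _ _ this] show ?thesis using A by (intro faithful) (simp_all add: X.lift_sum)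
  qed
  show "tproj Y (TO Y A) \<odot> tflip Y A = TM Y (tproj Y A)" using A by (intro faithful) (simp_all add: X.flip_proj)
  show "tflip Y A \<odot> TM Y (tzero Y A) = tzero Y (TO Y A)" using A by (intro faithful) (simp_all add: X.flip_zero)
  show "tflip Y A \<odot> TM Y (tsum Y A) = tsum Y (TO Y A) \<odot>
      pair2 Y (TO Y A) (tflip Y A \<odot> TM Y (tpi1 Y A)) (tflip Y A \<odot> TM Y (tpi2 Y A))"
  proof -
    have "TM X (tproj X B) \<cdot> TM X (tpi1 X B) = TM X (tproj X B) \<cdot> TM X (tpi2 X B)" if "B \<in> Obj X" for B
      using that X.T_T2_pullback[OF that, of 1] by (simp add: is_pullback_def)
    then have "tproj Y (TO Y A) \<odot> (tflip Y A \<odot> TM Y (tpi1 Y A)) = tproj Y (TO Y A) \<odot> (tflip Y A \<odot> TM Y (tpi2 Y A))"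
      using A by (intro proj_eqI) (simp_all add: X.flip_tails)
    from U_pair2[OF _ _ _ _ _ _ this] show ?thesis using A by (intro faithful) (simp_all add: X.flip_sum)
  qed
  show "TM Y (tlift Y A) \<odot> tlift Y A = tlift Y (TO Y A) \<odot> tlift Y A" using A by (intro faithful) (simp_all add: X.lift_lift)
  show "tflip Y A \<odot> tlift Y A = tlift Y A" using A by (intro faithful) (simp_all add: X.flip_lift)
  show "tflip Y (TO Y A) \<odot> TM Y (tflip Y A) \<odot> tlift Y (TO Y A) = TM Y (tlift Y A) \<odot> tflip Y A"
    using A by (intro faithful) (simp_all add: X.flip_flip_lift)
  show "tflip Y A \<odot> tflip Y A = idt Y (TO Y (TO Y A))" using A by (intro faithful) (simp_all add: X.flip_flip)
  show "TM Y (tflip Y A) \<odot> tflip Y (TO Y A) \<odot> TM Y (tflip Y A)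
      = tflip Y (TO Y A) \<odot> TM Y (tflip Y A) \<odot> tflip Y (TO Y A)"
    using A by (intro faithful) (simp_all add: X.flip_braid)
  let ?w = "pair Y (TM Y (tpi1 Y A)) (TM Y (tpi2 Y A)) (tzero Y (TO Y A) \<odot> tpi1 Y A) (tlift Y A \<odot> tpi2 Y A)"
  have "TM Y (tproj Y A) \<odot> (tzero Y (TO Y A) \<odot> tpi1 Y A) = TM Y (tproj Y A) \<odot> (tlift Y A \<odot> tpi2 Y A)"
    using A by (intro Tproj_eqI) (simp_all add: X.vert_pair_compat del: X.assoc)
  note w = U_T_pair[OF A _ _ _ _ _ this]
  have w1: "?w \<in> Arr Y" "Dom Y ?w = T2 Y A" "Cod Y ?w = TO Y (T2 Y A)" using w(1-3) A by simp_all
  have w2: "UM i (TM Y (tsum Y A) \<odot> ?w) = X.vert (UO i A)" if "i \<in> I" for i using w(4)[OF _ _ _ _ _ that] w1 A that by simp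
  show "is_pullback Y (T2 Y A) (TM Y (tsum Y A) \<odot> ?w) (tproj Y A \<odot> tpi1 Y A) (TM Y (tproj Y A)) (tzero Y A)"
  proof (rule created_pullback)
    fix i assume i: "i \<in> I"
    have [simp]: "UM i (tproj Y A \<odot> tpi1 Y A) = tproj X (UO i A) \<cdot> tpi1 X (UO i A)" using A i by simp
    show "is_pullback X (UO i (T2 Y A)) (UM i (TM Y (tsum Y A) \<odot> ?w)) (UM i (tproj Y A \<odot> tpi1 Y A))
      (UM i (TM Y (tproj Y A))) (UM i (tzero Y A))"
      unfolding w2[OF i] using X.lift_universal[of "UO i A"] A i by (simp del: U_simps(6))
    show "jointly_monic X {0, 1} (TO X (UO i (T2 Y A)))
      (case_nat (TM X (UM i (TM Y (tsum Y A) \<odot> ?w))) (\<lambda>_. TM X (UM i (tproj Y A \<odot> tpi1 Y A))))"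
      unfolding w2[OF i] jointly_monic_def
    proof (intro ballI impI)
      fix x y assume "x \<in> Arr X" "y \<in> Arr X" "Dom X x = Dom X y" "Cod X x = TO X (UO i (T2 Y A))" "Cod X y = TO X (UO i (T2 Y A))"
        "\<forall>k\<in>{0, 1}. case_nat (TM X (X.vert (UO i A))) (\<lambda>_. TM X (UM i (tproj Y A \<odot> tpi1 Y A))) k \<cdot> x
         = case_nat (TM X (X.vert (UO i A))) (\<lambda>_. TM X (UM i (tproj Y A \<odot> tpi1 Y A))) k \<cdot> y"
      then show "x = y" using A i X.T_vert_monic[of "UO i A" x y] by (simp del: X.TM_simps(6) U_simps(6))
    qed
  qed (use A w1 in simp_all)
qed

end

section \<open>Products and differential objects\<close>

context category
begin

lemma product_iso:
  assumes p: "is_product X P p1 p2 A B"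
    and t: "t \<in> Arr X" "Dom X t = Q" "Cod X t = P" "t' \<in> Arr X" "Dom X t' = P" "Cod X t' = Q"
    "t \<cdot> t' = idt X P" "t' \<cdot> t = idt X Q" and q: "p1 \<cdot> t = q1" "p2 \<cdot> t = q2"
  shows "is_product X Q q1 q2 A B"
  unfolding is_product_def
proof (intro conjI ballI)
  have p': "p1 \<in> Arr X" "Dom X p1 = P" "Cod X p1 = A" "p2 \<in> Arr X" "Dom X p2 = P" "Cod X p2 = B"
    using p by (auto simp: is_product_def)
  show "q1 \<in> hom X Q A" "q2 \<in> hom X Q B" using p' t(1-3) by (auto simp flip: q)
  fix C f g assume fg: "C \<in> Obj X" "f \<in> hom X C A" "g \<in> hom X C B"
  let ?h = "pair X p1 p2 f g"
  have h: "?h \<in> Arr X" "Dom X ?h = C" "Cod X ?h = P" "p1 \<cdot> ?h = f" "p2 \<cdot> ?h = g"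
    using product_pair[OF p, of f g] fg by auto
  have th: "t \<cdot> (t' \<cdot> ?h) = ?h" using tail[OF t(7), of ?h] t(1-6) h by simp
  show "\<exists>!h. h \<in> hom X C Q \<and> q1 \<cdot> h = f \<and> q2 \<cdot> h = g"
  proof (rule ex1I[of _ "t' \<cdot> ?h"])
    show "t' \<cdot> ?h \<in> hom X C Q \<and> q1 \<cdot> (t' \<cdot> ?h) = f \<and> q2 \<cdot> (t' \<cdot> ?h) = g"
      using h t(1-6) p' th by (simp flip: q)
    fix k assume k: "k \<in> hom X C Q \<and> q1 \<cdot> k = f \<and> q2 \<cdot> k = g"
    have "t \<cdot> k = ?h"
      using k t(1-6) p' h tail[OF q(1), of k] tail[OF q(2), of k] by - (rule product_ext[OF p], simp_all)
    then show "k = t' \<cdot> ?h" using k t(1-6) tail[OF t(8), of k] by (metis comp_idt(1) in_hom_iff)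
  qed
qed

lemma products_iso:
  assumes p: "is_product X P p1 p2 A B" and q: "is_product X Q q1 q2 A B"
  obtains t t' where "t \<in> Arr X" "Dom X t = Q" "Cod X t = P" "t' \<in> Arr X" "Dom X t' = P" "Cod X t' = Q"
    "t \<cdot> t' = idt X P" "t' \<cdot> t = idt X Q" "p1 \<cdot> t = q1" "p2 \<cdot> t = q2"
proof -
  have p': "p1 \<in> Arr X" "Dom X p1 = P" "Cod X p1 = A" "p2 \<in> Arr X" "Dom X p2 = P" "Cod X p2 = B"
    "q1 \<in> Arr X" "Dom X q1 = Q" "Cod X q1 = A" "q2 \<in> Arr X" "Dom X q2 = Q" "Cod X q2 = B"
    using p q by (auto simp: is_product_def)
  note t = product_pair[OF p, of q1 q2] and t' = product_pair[OF q, of p1 p2]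
  have O: "P \<in> Obj X" "Q \<in> Obj X" using p' Obj_ends by metis+
  have "pair X p1 p2 q1 q2 \<cdot> pair X q1 q2 p1 p2 = idt X P"
    using p' t t' O tail[OF t(4), of "pair X q1 q2 p1 p2"] tail[OF t(5), of "pair X q1 q2 p1 p2"]
    by - (rule product_ext[OF p], simp_all)
  moreover have "pair X q1 q2 p1 p2 \<cdot> pair X p1 p2 q1 q2 = idt X Q"
    using p' t t' O tail[OF t'(4), of "pair X p1 p2 q1 q2"] tail[OF t'(5), of "pair X p1 p2 q1 q2"]
    by - (rule product_ext[OF q], simp_all)
  ultimately show thesis using that p' t t' by simp
qed

end

context cartesian_tangent_category
begin

abbreviation One :: 'o where "One \<equiv> terminal X"

lemma terminal_Obj [simp]: "One \<in> Obj X"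
  using terminal by (simp add: is_terminal_def)

lemma terminal_unique:
  assumes "f \<in> Arr X" "g \<in> Arr X" "Dom X f = Dom X g" "is_terminal X (Cod X f)" "Cod X g = Cod X f"
  shows "f = g"
proof -
  have "\<exists>!h. h \<in> hom X (Dom X f) (Cod X f)" using assms by (simp add: is_terminal_def del: in_hom_iff)
  then show ?thesis using assms by auto
qed

lemma bang_simps [simp]:
  assumes "A \<in> Obj X"
  shows "bang X A \<in> Arr X" "Dom X (bang X A) = A" "Cod X (bang X A) = One"
proof -
  have "\<exists>!f. f \<in> hom X A One" using terminal assms by (simp add: is_terminal_def del: in_hom_iff)
  from theI'[OF this] show "bang X A \<in> Arr X" "Dom X (bang X A) = A" "Cod X (bang X A) = One"
    unfolding bang_def by simp_all
qed

lemma bang_unique: "f \<in> Arr X \<Longrightarrow> Cod X f = One \<Longrightarrow> f = bang X (Dom X f)"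
  using terminal by - (rule terminal_unique, simp_all)

lemma bang_comp [simp]: "f \<in> Arr X \<Longrightarrow> Cod X f = A \<Longrightarrow> bang X A \<cdot> f = bang X (Dom X f)"
  using bang_unique[of "bang X A \<cdot> f"] by auto

lemma prod_typing [simp]:
  assumes "A \<in> Obj X" "B \<in> Obj X"
  shows "cprod X A B \<in> Obj X"
    "cfst X A B \<in> Arr X" "Dom X (cfst X A B) = cprod X A B" "Cod X (cfst X A B) = A"
    "csnd X A B \<in> Arr X" "Dom X (csnd X A B) = cprod X A B" "Cod X (csnd X A B) = B"
  using product[OF assms] Obj_ends(1)[of "cfst X A B"] by (auto simp: is_product_def)

lemma cpair_simps [simp]:
  assumes "u \<in> Arr X" "v \<in> Arr X" "Dom X u = Dom X v" "Cod X u = A" "Cod X v = B"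
  shows "cpair X A B u v \<in> Arr X" "Dom X (cpair X A B u v) = Dom X v" "Cod X (cpair X A B u v) = cprod X A B"
    "cfst X A B \<cdot> cpair X A B u v = u" "csnd X A B \<cdot> cpair X A B u v = v"
proof -
  have "A \<in> Obj X" "B \<in> Obj X" using assms by auto
  from product_pair[OF product[OF this], of u v] assms
  show "cpair X A B u v \<in> Arr X" "Dom X (cpair X A B u v) = Dom X v" "Cod X (cpair X A B u v) = cprod X A B"
    "cfst X A B \<cdot> cpair X A B u v = u" "csnd X A B \<cdot> cpair X A B u v = v"
    unfolding cpair_def by simp_all
qed

lemma prod_ext:
  assumes "A \<in> Obj X" "B \<in> Obj X" "x \<in> Arr X" "y \<in> Arr X" "Dom X x = Dom X y" "Cod X x = cprod X A B" "Cod X y = cprod X A B"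
    "cfst X A B \<cdot> x = cfst X A B \<cdot> y" "csnd X A B \<cdot> x = csnd X A B \<cdot> y"
  shows "x = y"
  using product_ext[OF product] assms by blast

lemma cpair_tail [simp]:
  assumes "u \<in> Arr X" "v \<in> Arr X" "Dom X u = Dom X v" "Cod X u = A" "Cod X v = B" "x \<in> Arr X" "Cod X x = Dom X v"
  shows "cfst X A B \<cdot> (cpair X A B u v \<cdot> x) = u \<cdot> x" "csnd X A B \<cdot> (cpair X A B u v \<cdot> x) = v \<cdot> x"
proof -
  have "A \<in> Obj X" "B \<in> Obj X" using assms by auto
  then show "cfst X A B \<cdot> (cpair X A B u v \<cdot> x) = u \<cdot> x" "csnd X A B \<cdot> (cpair X A B u v \<cdot> x) = v \<cdot> x"
    using tail[OF cpair_simps(4), of u v A B x] tail[OF cpair_simps(5), of u v A B x] assms by simp_all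
qed

lemma cpair_comp [simp]:
  assumes "u \<in> Arr X" "v \<in> Arr X" "Dom X u = Dom X v" "Cod X u = A" "Cod X v = B" "x \<in> Arr X" "Cod X x = Dom X v"
  shows "cpair X A B u v \<cdot> x = cpair X A B (u \<cdot> x) (v \<cdot> x)"
proof -
  have "A \<in> Obj X" "B \<in> Obj X" using assms by auto
  then show ?thesis using assms by - (rule prod_ext[of A B], simp_all)
qed

lemma cmap_cpair:
  assumes "f \<in> Arr X" "g \<in> Arr X"
  shows "cmap X f g = cpair X (Cod X f) (Cod X g) (f \<cdot> cfst X (Dom X f) (Dom X g)) (g \<cdot> csnd X (Dom X f) (Dom X g))"
    "cmap X f g \<in> Arr X" "Dom X (cmap X f g) = cprod X (Dom X f) (Dom X g)"
    "Cod X (cmap X f g) = cprod X (Cod X f) (Cod X g)"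
  unfolding cmap_def using assms by simp_all

text \<open>Preservation is an axiom for the chosen products; any other product is isomorphic to a chosen one.\<close>

lemma T_preserves_products:
  assumes p: "is_product X P p1 p2 A B"
  shows "is_product X (TO X P) (TM X p1) (TM X p2) (TO X A) (TO X B)"
proof -
  have O: "A \<in> Obj X" "B \<in> Obj X" using p Obj_ends(2)[of p1] Obj_ends(2)[of p2] by (auto simp: is_product_def)
  obtain t t' where t: "t \<in> Arr X" "Dom X t = P" "Cod X t = cprod X A B" "t' \<in> Arr X" "Dom X t' = cprod X A B" "Cod X t' = P"
    "t \<cdot> t' = idt X (cprod X A B)" "t' \<cdot> t = idt X P" "cfst X A B \<cdot> t = p1" "csnd X A B \<cdot> t = p2"
    by (rule products_iso[OF product[OF O] p])
  have P: "P \<in> Obj X" using t(1,2) Obj_ends(1) by metis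
  show ?thesis
    by (rule product_iso[OF T_product[OF O], of "TM X t" "TO X P" "TM X t'"])
      (use t(1-6) O P arg_cong[OF t(7), of "TM X"] arg_cong[OF t(8), of "TM X"]
        arg_cong[OF t(9), of "TM X"] arg_cong[OF t(10), of "TM X"] in simp_all)
qed

lemma product_T_limit:
  assumes "is_product X P p1 p2 A B"
  shows "T_limit {0, 1} {} d (case_nat A (\<lambda>_. B)) P (case_nat p1 (\<lambda>_. p2))"
  unfolding T_limit_def
proof
  fix m
  have O: "A \<in> Obj X" "B \<in> Obj X" using assms Obj_ends(2)[of p1] Obj_ends(2)[of p2] by (auto simp: is_product_def)
  have "is_product X ((TO X ^^ m) P) ((TM X ^^ m) p1) ((TM X ^^ m) p2) ((TO X ^^ m) A) ((TO X ^^ m) B)"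
    by (induction m) (simp_all add: assms T_preserves_products)
  then have "is_limit X {0, 1} {} (\<lambda>k k'. (TM X ^^ m) (d k k')) (case_nat ((TO X ^^ m) A) (\<lambda>_. (TO X ^^ m) B)) ((TO X ^^ m) P)
     (case_nat ((TM X ^^ m) p1) (\<lambda>_. (TM X ^^ m) p2))"
    by (rule iffD1[OF is_product_limit, rotated 2]) (use O in simp_all)
  moreover have "case_nat ((TO X ^^ m) A) (\<lambda>_. (TO X ^^ m) B) = (\<lambda>k. (TO X ^^ m) (case_nat A (\<lambda>_. B) k))"
    "case_nat ((TM X ^^ m) p1) (\<lambda>_. (TM X ^^ m) p2) = (\<lambda>k. (TM X ^^ m) (case_nat p1 (\<lambda>_. p2) k))"
    by (auto split: nat.split)
  ultimately show "is_limit X {0, 1} {} (\<lambda>k k'. (TM X ^^ m) (d k k')) (\<lambda>k. (TO X ^^ m) (case_nat A (\<lambda>_. B) k))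
     ((TO X ^^ m) P) (\<lambda>k. (TM X ^^ m) (case_nat p1 (\<lambda>_. p2) k))" by simp
qed

lemma T_preserves_terminal:
  assumes "is_terminal X Z"
  shows "is_terminal X (TO X Z)"
proof -
  have L: "is_limit X {} {} undefined undefined Z undefined" "is_limit X {} {} undefined undefined One undefined"
    using assms terminal is_terminal_limit by blast+
  obtain t t' where t: "t \<in> Arr X" "Dom X t = Z" "Cod X t = One" "t' \<in> Arr X" "Dom X t' = One" "Cod X t' = Z"
    "t \<cdot> t' = idt X One" "t' \<cdot> t = idt X Z"
    by (rule is_limit_iso[OF L(2) L(1)])
  have Z: "Z \<in> Obj X" using assms by (simp add: is_terminal_def)
  have "is_limit X {} {} undefined undefined (TO X One) undefined" using T_terminal is_terminal_limit by blast
  from is_limit_iso_cong[OF this, of "TM X t" "TO X Z" "TM X t'"]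
  show ?thesis using t(1-6) Z arg_cong[OF t(7), of "TM X"] arg_cong[OF t(8), of "TM X"] is_terminal_limit by auto
qed

lemma terminal_T_limit:
  assumes "is_terminal X Z"
  shows "T_limit {} {} d B Z \<pi>"
  unfolding T_limit_def
proof
  fix m
  have "is_terminal X ((TO X ^^ m) Z)" by (induction m) (simp_all add: assms T_preserves_terminal)
  then show "is_limit X {} {} (\<lambda>k k'. (TM X ^^ m) (d k k')) (\<lambda>k. (TO X ^^ m) (B k)) ((TO X ^^ m) Z) (\<lambda>k. (TM X ^^ m) (\<pi> k))"
    using is_terminal_limit by blast
qed

text \<open>The laws of a commutative monoid for generalized elements \<open>u, v, w: C \<rightarrow> A\<close>.\<close>

lemma commutative_monoidD:
  assumes "commutative_monoid X A \<zeta> \<sigma>"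
  shows "A \<in> Obj X" "\<zeta> \<in> Arr X" "Dom X \<zeta> = One" "Cod X \<zeta> = A" "\<sigma> \<in> Arr X" "Dom X \<sigma> = cprod X A A" "Cod X \<sigma> = A"
    "\<And>u C. u \<in> Arr X \<Longrightarrow> Cod X u = A \<Longrightarrow> Dom X u = C \<Longrightarrow> \<sigma> \<cdot> cpair X A A (\<zeta> \<cdot> bang X C) u = u"
    "\<And>u v. u \<in> Arr X \<Longrightarrow> v \<in> Arr X \<Longrightarrow> Dom X u = Dom X v \<Longrightarrow> Cod X u = A \<Longrightarrow> Cod X v = A \<Longrightarrow>
      \<sigma> \<cdot> cpair X A A u v = \<sigma> \<cdot> cpair X A A v u"
    "\<And>u v w. u \<in> Arr X \<Longrightarrow> v \<in> Arr X \<Longrightarrow> w \<in> Arr X \<Longrightarrow> Dom X u = Dom X v \<Longrightarrow> Dom X w = Dom X v \<Longrightarrow>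
      Cod X u = A \<Longrightarrow> Cod X v = A \<Longrightarrow> Cod X w = A \<Longrightarrow>
      \<sigma> \<cdot> cpair X A A (\<sigma> \<cdot> cpair X A A u v) w = \<sigma> \<cdot> cpair X A A u (\<sigma> \<cdot> cpair X A A v w)"
proof -
  show t: "A \<in> Obj X" "\<zeta> \<in> Arr X" "Dom X \<zeta> = One" "Cod X \<zeta> = A" "\<sigma> \<in> Arr X" "Dom X \<sigma> = cprod X A A" "Cod X \<sigma> = A"
    using assms by (auto simp: commutative_monoid_def)
  have l: "\<sigma> \<cdot> cpair X A A (\<zeta> \<cdot> bang X A) (idt X A) = idt X A" "\<sigma> \<cdot> cpair X A A (csnd X A A) (cfst X A A) = \<sigma>"
    "\<sigma> \<cdot> cpair X A A (\<sigma> \<cdot> cpair X A A (cfst X A A \<cdot> cfst X (cprod X A A) A) (csnd X A A \<cdot> cfst X (cprod X A A) A)) (csnd X (cprod X A A) A)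
     = \<sigma> \<cdot> cpair X A A (cfst X A A \<cdot> cfst X (cprod X A A) A) (\<sigma> \<cdot> cpair X A A (csnd X A A \<cdot> cfst X (cprod X A A) A) (csnd X (cprod X A A) A))"
    using assms by (auto simp: commutative_monoid_def Let_def)
  show "\<sigma> \<cdot> cpair X A A (\<zeta> \<cdot> bang X C) u = u" if "u \<in> Arr X" "Cod X u = A" "Dom X u = C" for u C
    using tail[OF l(1), of u] t that by simp
  show "\<sigma> \<cdot> cpair X A A u v = \<sigma> \<cdot> cpair X A A v u"
    if "u \<in> Arr X" "v \<in> Arr X" "Dom X u = Dom X v" "Cod X u = A" "Cod X v = A" for u v
    using tail[OF l(2), of "cpair X A A v u"] t that by simp
  show "\<sigma> \<cdot> cpair X A A (\<sigma> \<cdot> cpair X A A u v) w = \<sigma> \<cdot> cpair X A A u (\<sigma> \<cdot> cpair X A A v w)"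
    if "u \<in> Arr X" "v \<in> Arr X" "w \<in> Arr X" "Dom X u = Dom X v" "Dom X w = Dom X v"
      "Cod X u = A" "Cod X v = A" "Cod X w = A" for u v w
    using arg_cong[OF l(3), of "\<lambda>k. k \<cdot> cpair X (cprod X A A) A (cpair X A A u v) w"] t that by simp
qed

lemma commutative_monoidI:
  assumes t: "A \<in> Obj X" "\<zeta> \<in> Arr X" "Dom X \<zeta> = One" "Cod X \<zeta> = A" "\<sigma> \<in> Arr X" "Dom X \<sigma> = cprod X A A" "Cod X \<sigma> = A"
    and u: "\<And>u. u \<in> Arr X \<Longrightarrow> Cod X u = A \<Longrightarrow> \<sigma> \<cdot> cpair X A A (\<zeta> \<cdot> bang X (Dom X u)) u = u"
    and c: "\<And>u v. u \<in> Arr X \<Longrightarrow> v \<in> Arr X \<Longrightarrow> Dom X u = Dom X v \<Longrightarrow> Cod X u = A \<Longrightarrow> Cod X v = A \<Longrightarrow>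
      \<sigma> \<cdot> cpair X A A u v = \<sigma> \<cdot> cpair X A A v u"
    and a: "\<And>u v w. u \<in> Arr X \<Longrightarrow> v \<in> Arr X \<Longrightarrow> w \<in> Arr X \<Longrightarrow> Dom X u = Dom X v \<Longrightarrow> Dom X w = Dom X v \<Longrightarrow>
      Cod X u = A \<Longrightarrow> Cod X v = A \<Longrightarrow> Cod X w = A \<Longrightarrow>
      \<sigma> \<cdot> cpair X A A (\<sigma> \<cdot> cpair X A A u v) w = \<sigma> \<cdot> cpair X A A u (\<sigma> \<cdot> cpair X A A v w)"
  shows "commutative_monoid X A \<zeta> \<sigma>"
proof -
  have "cpair X A A (cfst X A A) (csnd X A A) = idt X (cprod X A A)"
    using t(1) by - (rule prod_ext[of A A], simp_all)
  then have "\<sigma> \<cdot> cpair X A A (csnd X A A) (cfst X A A) = \<sigma>"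
    using c[of "csnd X A A" "cfst X A A"] t by simp
  then show ?thesis
    unfolding commutative_monoid_def Let_def using t u[of "idt X A"] by (intro conjI a) simp_all
qed

lemma unit_cmp_eq:
  assumes "f \<in> Arr X" "Dom X f = One" "Cod X f = HO One" "is_terminal X (HO One)"
  shows "unit_cmp X HO = f"
  unfolding unit_cmp_def using assms by (intro the_equality) (auto intro: terminal_unique)

lemma unit_cmp_typing:
  assumes "is_terminal X (HO One)"
  shows "unit_cmp X HO \<in> Arr X" "Dom X (unit_cmp X HO) = One" "Cod X (unit_cmp X HO) = HO One"
proof -
  have "\<exists>f. f \<in> hom X One (HO One)" using assms unfolding is_terminal_def by (meson terminal_Obj ex1_implies_ex)
  then obtain f where "f \<in> hom X One (HO One)" ..
  with unit_cmp_eq[of f HO] assms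
  show "unit_cmp X HO \<in> Arr X" "Dom X (unit_cmp X HO) = One" "Cod X (unit_cmp X HO) = HO One" by simp_all
qed

text \<open>The axioms of a differential object, again for generalized elements.\<close>

lemma differential_objectD:
  assumes "differential_object X D"
  defines "A \<equiv> carrier D" and "\<zeta> \<equiv> zeta D" and "\<sigma> \<equiv> sigma D" and "p \<equiv> phat D"
  shows "commutative_monoid X A \<zeta> \<sigma>" "p \<in> Arr X" "Dom X p = TO X A" "Cod X p = A"
    "is_product X (TO X A) (tproj X A) p A A"
    "p \<cdot> TM X \<zeta> = \<zeta> \<cdot> bang X (TO X One)"
    "p \<cdot> TM X \<sigma> = \<sigma> \<cdot> cpair X A A (p \<cdot> TM X (cfst X A A)) (p \<cdot> TM X (csnd X A A))"
    "p \<cdot> tzero X A = \<zeta> \<cdot> bang X A"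
    "p \<cdot> tsum X A = \<sigma> \<cdot> cpair X A A (p \<cdot> tpi1 X A) (p \<cdot> tpi2 X A)"
    "p \<cdot> (TM X p \<cdot> tlift X A) = p"
proof -
  show M: "commutative_monoid X A \<zeta> \<sigma>" and p: "p \<in> Arr X" "Dom X p = TO X A" "Cod X p = A"
    and "is_product X (TO X A) (tproj X A) p A A" "p \<cdot> tzero X A = \<zeta> \<cdot> bang X A"
    "p \<cdot> tsum X A = \<sigma> \<cdot> cpair X A A (p \<cdot> tpi1 X A) (p \<cdot> tpi2 X A)"
    "p \<cdot> (TM X p \<cdot> tlift X A) = p"
    using assms(1) unfolding differential_object_def Let_def assms(2-5) by auto
  note M = commutative_monoidD[OF M]
  have "p \<cdot> (TM X \<zeta> \<cdot> unit_cmp X (TO X)) = \<zeta>"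
    using assms(1) unfolding differential_object_def Let_def assms(2-5) by auto
  moreover have "unit_cmp X (TO X) \<cdot> bang X (TO X One) = idt X (TO X One)"
    using T_terminal unit_cmp_typing[where HO = "TO X", OF T_terminal] by - (rule terminal_unique, simp_all)
  ultimately show "p \<cdot> TM X \<zeta> = \<zeta> \<cdot> bang X (TO X One)"
    using p M unit_cmp_typing[where HO = "TO X", OF T_terminal] tail3[of p "TM X \<zeta>" "unit_cmp X (TO X)" \<zeta> "bang X (TO X One)"] by simp
  let ?m = "prod_cmp X (TO X) (TM X) A A"
  have m: "?m \<in> Arr X" "Dom X ?m = cprod X (TO X A) (TO X A)" "Cod X ?m = TO X (cprod X A A)"
    "TM X (cfst X A A) \<cdot> ?m = cfst X (TO X A) (TO X A)" "TM X (csnd X A A) \<cdot> ?m = csnd X (TO X A) (TO X A)"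
    unfolding prod_cmp_def
    using product_pair[OF T_product[of A A], of "cfst X (TO X A) (TO X A)" "csnd X (TO X A) (TO X A)"] M by simp_all
  have i: "?m \<cdot> cpair X (TO X A) (TO X A) (TM X (cfst X A A)) (TM X (csnd X A A)) = idt X (TO X (cprod X A A))"
    using M m by - (rule product_ext[OF T_product[of A A]], (simp_all add: tail[OF m(4)] tail[OF m(5)]))
  have "p \<cdot> (TM X \<sigma> \<cdot> ?m) = \<sigma> \<cdot> cmap X p p"
    using assms(1) unfolding differential_object_def Let_def assms(2-5) by auto
  then have "p \<cdot> (TM X \<sigma> \<cdot> (?m \<cdot> cpair X (TO X A) (TO X A) (TM X (cfst X A A)) (TM X (csnd X A A))))
    = \<sigma> \<cdot> cmap X p p \<cdot> cpair X (TO X A) (TO X A) (TM X (cfst X A A)) (TM X (csnd X A A))"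
    using tail3[of p "TM X \<sigma>" ?m _ "cpair X (TO X A) (TO X A) (TM X (cfst X A A)) (TM X (csnd X A A))"] M p m
    by (simp add: cmap_cpair)
  then show "p \<cdot> TM X \<sigma> = \<sigma> \<cdot> cpair X A A (p \<cdot> TM X (cfst X A A)) (p \<cdot> TM X (csnd X A A))"
    unfolding i using M p by (simp add: cmap_cpair)
qed

lemma differential_objectI:
  assumes M: "commutative_monoid X A \<zeta> \<sigma>" and p: "p \<in> Arr X" "Dom X p = TO X A" "Cod X p = A"
    and P: "is_product X (TO X A) (tproj X A) p A A"
    and l: "p \<cdot> TM X \<zeta> = \<zeta> \<cdot> bang X (TO X One)"
    "p \<cdot> TM X \<sigma> = \<sigma> \<cdot> cpair X A A (p \<cdot> TM X (cfst X A A)) (p \<cdot> TM X (csnd X A A))"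
    "p \<cdot> tzero X A = \<zeta> \<cdot> bang X A"
    "p \<cdot> tsum X A = \<sigma> \<cdot> cpair X A A (p \<cdot> tpi1 X A) (p \<cdot> tpi2 X A)"
    "p \<cdot> (TM X p \<cdot> tlift X A) = p"
  shows "differential_object X \<lparr>carrier = A, zeta = \<zeta>, sigma = \<sigma>, phat = p\<rparr>"
proof -
  note M' = commutative_monoidD[OF M] and u = unit_cmp_typing[where HO = "TO X", OF T_terminal]
  let ?m = "prod_cmp X (TO X) (TM X) A A"
  have m: "?m \<in> Arr X" "Dom X ?m = cprod X (TO X A) (TO X A)" "Cod X ?m = TO X (cprod X A A)"
    "TM X (cfst X A A) \<cdot> ?m = cfst X (TO X A) (TO X A)" "TM X (csnd X A A) \<cdot> ?m = csnd X (TO X A) (TO X A)"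
    unfolding prod_cmp_def
    using product_pair[OF T_product[of A A], of "cfst X (TO X A) (TO X A)" "csnd X (TO X A) (TO X A)"] M' by simp_all
  have "bang X One = idt X One" using bang_unique[of "idt X One"] by simp
  then have "p \<cdot> (TM X \<zeta> \<cdot> unit_cmp X (TO X)) = \<zeta>"
    using tail[OF l(1), of "unit_cmp X (TO X)"] M' p u by simp
  moreover have "p \<cdot> (TM X \<sigma> \<cdot> ?m) = \<sigma> \<cdot> cmap X p p"
    using tail[OF l(2), of ?m] M' p m by (simp add: cmap_cpair)
  ultimately show ?thesis
    unfolding differential_object_def Let_def using M p P l by simp
qed

text \<open>A linear map preserves zero and addition, since \<open>\<zeta>\<close> and \<open>\<sigma>\<close> are recovered from \<open>z\<close> and \<open>s\<close>: every
  pair of elements \<open>u, v\<close> is the image under \<open>p\<close> of a pair of tangent vectors, say at zero.\<close>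

lemma linear_map_additive:
  assumes D: "differential_object X D" and E: "differential_object X E" and f: "linear_map X D E f"
  shows "f \<cdot> zeta D = zeta E"
    "\<And>u v. u \<in> Arr X \<Longrightarrow> v \<in> Arr X \<Longrightarrow> Dom X u = Dom X v \<Longrightarrow> Cod X u = carrier D \<Longrightarrow> Cod X v = carrier D \<Longrightarrow>
       f \<cdot> (sigma D \<cdot> cpair X (carrier D) (carrier D) u v) = sigma E \<cdot> cpair X (carrier E) (carrier E) (f \<cdot> u) (f \<cdot> v)"
proof -
  note DD = differential_objectD[OF D] and EE = differential_objectD[OF E]
  note DM = commutative_monoidD[OF DD(1)] and EM = commutative_monoidD[OF EE(1)]
  have F: "f \<in> Arr X" "Dom X f = carrier D" "Cod X f = carrier E" "f \<cdot> phat D = phat E \<cdot> TM X f"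
    using f by (auto simp: linear_map_def)
  have b: "bang X One = idt X One" using bang_unique[of "idt X One"] by simp
  have "f \<cdot> (phat D \<cdot> (tzero X (carrier D) \<cdot> zeta D)) = phat E \<cdot> (tzero X (carrier E) \<cdot> (f \<cdot> zeta D))"
    using tail[OF F(4), of "tzero X (carrier D) \<cdot> zeta D"] tail[OF zero_nat[of f "carrier E"], of "zeta D"] F(1-3) DD(2-4) EE(2-4) DM(1-7) EM(1-7)
    by simp
  then show "f \<cdot> zeta D = zeta E"
    using tail[OF DD(8), of "zeta D"] tail[OF EE(8), of "f \<cdot> zeta D"] F(1-3) DD(2-4) EE(2-4) DM(1-7) EM(1-7) b by simp
  fix u v assume uv: "u \<in> Arr X" "v \<in> Arr X" "Dom X u = Dom X v" "Cod X u = carrier D" "Cod X v = carrier D"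
  let ?A = "carrier D" and ?B = "carrier E"
  \<comment> \<open>the tangent vector at zero with principal part \<open>w\<close>\<close>
  define g where "g w = pair X (tproj X ?A) (phat D) (zeta D \<cdot> bang X (Dom X w)) w" for w
  have g: "g w \<in> Arr X" "Dom X (g w) = Dom X w" "Cod X (g w) = TO X ?A" "tproj X ?A \<cdot> g w = zeta D \<cdot> bang X (Dom X w)" "phat D \<cdot> g w = w"
    if "w \<in> Arr X" "Cod X w = ?A" for w
    unfolding g_def using product_pair[OF DD(5), of "zeta D \<cdot> bang X (Dom X w)" w] that DM(1-7) by simp_all
  note gu = g[OF uv(1,4)] and gv = g[OF uv(2,5)]
  define k where "k = pair2 X ?A (g u) (g v)"
  have k: "k \<in> Arr X" "Dom X k = Dom X v" "Cod X k = T2 X ?A" "tpi1 X ?A \<cdot> k = g u" "tpi2 X ?A \<cdot> k = g v"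
    unfolding k_def using gu gv uv DM(1) by simp_all
  have s1: "phat D \<cdot> (tsum X ?A \<cdot> k) = sigma D \<cdot> cpair X ?A ?A u v"
    using tail[OF DD(9), of k] k gu gv DD(2-4) DM(1-7) uv by simp
  have t2: "T2M X f \<cdot> k = pair2 X ?B (TM X f \<cdot> g u) (TM X f \<cdot> g v)"
    using k gu gv F(1-3) DM(1) EM(1) uv tail[OF T2M_simps(4), of f k] tail[OF T2M_simps(5), of f k]
    by - (rule T2_ext[of ?B], (simp_all add: tail[OF proj_nat]))
  have pf: "phat E \<cdot> (TM X f \<cdot> g u) = f \<cdot> u" "phat E \<cdot> (TM X f \<cdot> g v) = f \<cdot> v"
    using tail[OF F(4), of "g u"] tail[OF F(4), of "g v"] gu gv F(1-3) DD(2-4) EE(2-4) DM(1) EM(1) by simp_all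
  have "tproj X ?B \<cdot> (TM X f \<cdot> g u) = tproj X ?B \<cdot> (TM X f \<cdot> g v)"
    using gu gv F(1-3) DM(1-7) EM(1) uv by (simp add: tail[OF proj_nat])
  moreover have t: "TM X f \<cdot> g u \<in> Arr X" "TM X f \<cdot> g v \<in> Arr X" "Dom X (TM X f \<cdot> g u) = Dom X (TM X f \<cdot> g v)"
    "Cod X (TM X f \<cdot> g u) = TO X ?B" "Cod X (TM X f \<cdot> g v) = TO X ?B" "Dom X (TM X f \<cdot> g v) = Dom X v"
    using gu(1-3) gv(1-3) F(1-3) uv(3) by simp_all
  ultimately have q: "tproj X ?B \<cdot> (TM X f \<cdot> g u) = tproj X ?B \<cdot> (TM X f \<cdot> g v)" by simp
  define r where "r = pair2 X ?B (TM X f \<cdot> g u) (TM X f \<cdot> g v)"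
  note r = pair2_simps[OF t(1-5) q EM(1), folded r_def, unfolded t(6)]
  have "f \<cdot> (phat D \<cdot> (tsum X ?A \<cdot> k)) = phat E \<cdot> (tsum X ?B \<cdot> (T2M X f \<cdot> k))"
    using tail[OF F(4), of "tsum X ?A \<cdot> k"] tail[OF sum_nat[of f ?B], of k] k F(1-3) DD(2-4) EE(2-4) DM(1) EM(1) by simp
  also have "\<dots> = phat E \<cdot> (tsum X ?B \<cdot> r)" unfolding t2 r_def ..
  also have "\<dots> = (sigma E \<cdot> cpair X ?B ?B (phat E \<cdot> tpi1 X ?B) (phat E \<cdot> tpi2 X ?B)) \<cdot> r"
    using tail[OF EE(9), of r] r(1-3) EE(2-4) EM(1-7) by simp
  also have "\<dots> = sigma E \<cdot> cpair X ?B ?B (phat E \<cdot> (tpi1 X ?B \<cdot> r)) (phat E \<cdot> (tpi2 X ?B \<cdot> r))"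
    using r(1-3) EE(2-4) EM(1-7) by simp
  also have "\<dots> = sigma E \<cdot> cpair X ?B ?B (f \<cdot> u) (f \<cdot> v)" unfolding r(4,5) pf ..
  finally show "f \<cdot> (sigma D \<cdot> cpair X ?A ?A u v) = sigma E \<cdot> cpair X ?B ?B (f \<cdot> u) (f \<cdot> v)"
    unfolding s1 .
qed

end

section \<open>Strong product-preserving endomorphisms act on differential objects\<close>

context category
begin

lemma inverse_arr_eq:
  assumes "f \<in> Arr X" "g \<in> Arr X" "Dom X g = Cod X f" "Cod X g = Dom X f"
    "g \<cdot> f = idt X (Dom X f)" "f \<cdot> g = idt X (Cod X f)"
  shows "inverse_arr X f = g"
  unfolding inverse_arr_def
proof (rule the_equality)
  fix k assume k: "k \<in> hom X (Cod X f) (Dom X f) \<and> k \<cdot> f = idt X (Dom X f) \<and> f \<cdot> k = idt X (Cod X f)"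
  have "k = (g \<cdot> f) \<cdot> k" using k assms by simp
  also have "\<dots> = g" using k assms(1-4) by simp
  finally show "k = g" .
qed (use assms in simp)

lemma inverse_arr_simps:
  assumes "is_iso X f"
  shows "inverse_arr X f \<in> Arr X" "Dom X (inverse_arr X f) = Cod X f" "Cod X (inverse_arr X f) = Dom X f"
    "inverse_arr X f \<cdot> f = idt X (Dom X f)" "f \<cdot> inverse_arr X f = idt X (Cod X f)"
proof -
  obtain g where "f \<in> Arr X" "g \<in> hom X (Cod X f) (Dom X f)" "g \<cdot> f = idt X (Dom X f)" "f \<cdot> g = idt X (Cod X f)"
    using assms by (auto simp: is_iso_def)
  with inverse_arr_eq[of f g] show "inverse_arr X f \<in> Arr X" "Dom X (inverse_arr X f) = Cod X f"
    "Cod X (inverse_arr X f) = Dom X f" "inverse_arr X f \<cdot> f = idt X (Dom X f)" "f \<cdot> inverse_arr X f = idt X (Cod X f)"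
    by simp_all
qed

end

lemma lax_tangent_morphismD:
  assumes "lax_tangent_morphism X' X FO FM \<alpha>"
  shows "tangent_category X'" "tangent_category X" "is_functor X' X FO FM"
    "\<And>A. A \<in> Obj X' \<Longrightarrow> \<alpha> A \<in> Arr X" "\<And>A. A \<in> Obj X' \<Longrightarrow> Dom X (\<alpha> A) = FO (TO X' A)"
    "\<And>A. A \<in> Obj X' \<Longrightarrow> Cod X (\<alpha> A) = TO X (FO A)"
    "\<And>f B. f \<in> Arr X' \<Longrightarrow> Cod X' f = B \<Longrightarrow> \<alpha> B \<cdot>\<^bsub>X\<^esub> FM (TM X' f) = TM X (FM f) \<cdot>\<^bsub>X\<^esub> \<alpha> (Dom X' f)"
    "\<And>A. A \<in> Obj X' \<Longrightarrow> tproj X (FO A) \<cdot>\<^bsub>X\<^esub> \<alpha> A = FM (tproj X' A)"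
    "\<And>A. A \<in> Obj X' \<Longrightarrow> \<alpha> A \<cdot>\<^bsub>X\<^esub> FM (tzero X' A) = tzero X (FO A)"
    "\<And>A. A \<in> Obj X' \<Longrightarrow> \<alpha> A \<cdot>\<^bsub>X\<^esub> FM (tsum X' A) = tsum X (FO A) \<cdot>\<^bsub>X\<^esub>
       pair2 X (FO A) (\<alpha> A \<cdot>\<^bsub>X\<^esub> FM (tpi1 X' A)) (\<alpha> A \<cdot>\<^bsub>X\<^esub> FM (tpi2 X' A))"
    "\<And>A. A \<in> Obj X' \<Longrightarrow> tlift X (FO A) \<cdot>\<^bsub>X\<^esub> \<alpha> A = TM X (\<alpha> A) \<cdot>\<^bsub>X\<^esub> \<alpha> (TO X' A) \<cdot>\<^bsub>X\<^esub> FM (tlift X' A)"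
    "\<And>A. A \<in> Obj X' \<Longrightarrow> tflip X (FO A) \<cdot>\<^bsub>X\<^esub> TM X (\<alpha> A) \<cdot>\<^bsub>X\<^esub> \<alpha> (TO X' A)
       = TM X (\<alpha> A) \<cdot>\<^bsub>X\<^esub> \<alpha> (TO X' A) \<cdot>\<^bsub>X\<^esub> FM (tflip X' A)"
  using assms by (auto simp: lax_tangent_morphism_def natural_transformation_def)

text \<open>The two instances are the functor of a strong Cartesian tangent monad, with its distributive law, and
  the tangent bundle functor, with the flip. Their actions on differential objects are thus obtained
  together.\<close>

locale product_endomorphism = cartesian_tangent_category X
  for X :: "('o, 'a, 'm) cartesian_tangent_category_scheme" (structure) +
  fixes FO :: "'o \<Rightarrow> 'o" and FM :: "'a \<Rightarrow> 'a" and \<alpha> :: "'o \<Rightarrow> 'a"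
  assumes lax: "lax_tangent_morphism X X FO FM \<alpha>"
    and F_terminal: "is_terminal X (FO (terminal X))"
    and F_product: "A \<in> Obj X \<Longrightarrow> B \<in> Obj X \<Longrightarrow>
      is_product X (FO (cprod X A B)) (FM (cfst X A B)) (FM (csnd X A B)) (FO A) (FO B)"
    and iso: "A \<in> Obj X \<Longrightarrow> is_iso X (\<alpha> A)"
begin

lemma F_simps [simp]:
  "A \<in> Obj X \<Longrightarrow> FO A \<in> Obj X"
  "f \<in> Arr X \<Longrightarrow> FM f \<in> Arr X" "f \<in> Arr X \<Longrightarrow> Dom X (FM f) = FO (Dom X f)"
  "f \<in> Arr X \<Longrightarrow> Cod X (FM f) = FO (Cod X f)" "A \<in> Obj X \<Longrightarrow> FM (idt X A) = idt X (FO A)"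
  "f \<in> Arr X \<Longrightarrow> g \<in> Arr X \<Longrightarrow> Dom X g = Cod X f \<Longrightarrow> FM (g \<cdot> f) = FM g \<cdot> FM f"
  using is_functorD[OF lax_tangent_morphismD(3)[OF lax]] by auto

abbreviation \<alpha>i :: "'o \<Rightarrow> 'a" where "\<alpha>i A \<equiv> inverse_arr X (\<alpha> A)"

lemma \<alpha>_simps [simp]:
  assumes "A \<in> Obj X"
  shows "\<alpha> A \<in> Arr X" "Dom X (\<alpha> A) = FO (TO X A)" "Cod X (\<alpha> A) = TO X (FO A)"
    "\<alpha>i A \<in> Arr X" "Dom X (\<alpha>i A) = TO X (FO A)" "Cod X (\<alpha>i A) = FO (TO X A)"
    "\<alpha>i A \<cdot> \<alpha> A = idt X (FO (TO X A))" "\<alpha> A \<cdot> \<alpha>i A = idt X (TO X (FO A))"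
  using lax_tangent_morphismD(4-6)[OF lax] inverse_arr_simps[OF iso] assms by simp_all

lemma \<alpha>_tails [simp]:
  assumes "A \<in> Obj X"
  shows "x \<in> Arr X \<Longrightarrow> Cod X x = FO (TO X A) \<Longrightarrow> \<alpha>i A \<cdot> (\<alpha> A \<cdot> x) = x"
    "x \<in> Arr X \<Longrightarrow> Cod X x = TO X (FO A) \<Longrightarrow> \<alpha> A \<cdot> (\<alpha>i A \<cdot> x) = x"
  using tail[OF \<alpha>_simps(7), of A x] tail[OF \<alpha>_simps(8), of A x] assms by simp_all

lemma \<alpha>_cancel:
  assumes "A \<in> Obj X" "x \<in> Arr X" "y \<in> Arr X" "Dom X x = TO X (FO A)" "Dom X y = TO X (FO A)" "x \<cdot> \<alpha> A = y \<cdot> \<alpha> A"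
  shows "x = y"
proof -
  have "x = (x \<cdot> \<alpha> A) \<cdot> \<alpha>i A" using assms(1-5) by simp
  also have "\<dots> = y" unfolding assms(6) using assms(1-5) by simp
  finally show ?thesis .
qed

lemma \<alpha>_nat: "f \<in> Arr X \<Longrightarrow> Cod X f = B \<Longrightarrow> \<alpha> B \<cdot> FM (TM X f) = TM X (FM f) \<cdot> \<alpha> (Dom X f)"
  using lax_tangent_morphismD(7)[OF lax] .

lemma \<alpha>i_nat:
  assumes "f \<in> Arr X" "Cod X f = B"
  shows "\<alpha>i B \<cdot> TM X (FM f) = FM (TM X f) \<cdot> \<alpha>i (Dom X f)"
proof -
  have B: "B \<in> Obj X" using assms by auto
  have "\<alpha>i B \<cdot> (TM X (FM f) \<cdot> (\<alpha> (Dom X f) \<cdot> \<alpha>i (Dom X f))) = \<alpha>i B \<cdot> (\<alpha> B \<cdot> (FM (TM X f) \<cdot> \<alpha>i (Dom X f)))"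
    using tail[OF \<alpha>_nat[of f B], of "\<alpha>i (Dom X f)"] assms B by simp
  then show ?thesis using assms B by simp
qed

lemma F_preserves_products:
  assumes p: "is_product X P p1 p2 A B"
  shows "is_product X (FO P) (FM p1) (FM p2) (FO A) (FO B)"
proof -
  have O: "A \<in> Obj X" "B \<in> Obj X" using p Obj_ends(2)[of p1] Obj_ends(2)[of p2] by (auto simp: is_product_def)
  obtain t t' where t: "t \<in> Arr X" "Dom X t = P" "Cod X t = cprod X A B" "t' \<in> Arr X" "Dom X t' = cprod X A B" "Cod X t' = P"
    "t \<cdot> t' = idt X (cprod X A B)" "t' \<cdot> t = idt X P" "cfst X A B \<cdot> t = p1" "csnd X A B \<cdot> t = p2"
    by (rule products_iso[OF product[OF O] p])
  have P: "P \<in> Obj X" using t(1,2) Obj_ends(1) by metis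
  show ?thesis
    by (rule product_iso[OF F_product[OF O], of "FM t" "FO P" "FM t'"])
      (use t(1-6) O P arg_cong[OF t(7), of "FM"] arg_cong[OF t(8), of "FM"]
        arg_cong[OF t(9), of "FM"] arg_cong[OF t(10), of "FM"] in simp_all)
qed

lemma cmp_simps:
  assumes "A \<in> Obj X" "B \<in> Obj X"
  defines "m \<equiv> prod_cmp X FO FM A B"
  shows "m \<in> Arr X" "Dom X m = cprod X (FO A) (FO B)" "Cod X m = FO (cprod X A B)"
    "FM (cfst X A B) \<cdot> m = cfst X (FO A) (FO B)" "FM (csnd X A B) \<cdot> m = csnd X (FO A) (FO B)"
  unfolding m_def prod_cmp_def
  using product_pair[OF F_product[of A B], of "cfst X (FO A) (FO B)" "csnd X (FO A) (FO B)"] assms by simp_all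

lemma cmp_cpair:
  assumes "a \<in> Arr X" "b \<in> Arr X" "Dom X a = Dom X b" "Cod X a = A" "Cod X b = B" "k \<in> Arr X" "Cod X k = FO (Dom X b)"
  shows "prod_cmp X FO FM A B \<cdot> cpair X (FO A) (FO B) (FM a \<cdot> k) (FM b \<cdot> k) = FM (cpair X A B a b) \<cdot> k"
proof -
  have O: "A \<in> Obj X" "B \<in> Obj X" using assms by auto
  have f: "FM (cfst X A B) \<cdot> FM (cpair X A B a b) = FM a" "FM (csnd X A B) \<cdot> FM (cpair X A B a b) = FM b"
    using F_simps(6)[of "cpair X A B a b" "cfst X A B"] F_simps(6)[of "cpair X A B a b" "csnd X A B"] assms O by simp_all
  show ?thesis
    using assms O cmp_simps[OF O]
    by - (rule product_ext[OF F_product[OF O]],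
      simp_all add: tail[OF cmp_simps(4)] tail[OF cmp_simps(5)] tail[OF f(1)] tail[OF f(2)])
qed

text \<open>In general a pair of tangent vectors to \<open>F A\<close> with the same base point need not factor through \<open>F T\<^sub>2 A\<close>.
  If \<open>T A\<close> is a product of two copies of \<open>A\<close>, it does: such a pair consists of a base point and two
  principal parts in \<open>F A\<close>, hence is an element of \<open>F (A \<times> (A \<times> A))\<close>, which maps to \<open>F T\<^sub>2 A\<close>.\<close>

lemma lift_pairs:
  assumes A: "A \<in> Obj X" and p: "is_product X (TO X A) (tproj X A) p A A"
    and u: "u \<in> Arr X" "Cod X u = TO X (FO A)" and v: "v \<in> Arr X" "Cod X v = TO X (FO A)" "Dom X v = Dom X u"
    and e: "tproj X (FO A) \<cdot> u = tproj X (FO A) \<cdot> v"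
  obtains k where "k \<in> Arr X" "Dom X k = Dom X u" "Cod X k = FO (T2 X A)"
    "\<alpha> A \<cdot> (FM (tpi1 X A) \<cdot> k) = u" "\<alpha> A \<cdot> (FM (tpi2 X A) \<cdot> k) = v"
proof -
  \<comment> \<open>\<open>x\<close> is the base point, \<open>a\<close> and \<open>b\<close> are the principal parts, \<open>g c\<close> is the tangent vector at \<open>x\<close> with
    principal part \<open>c\<close>.\<close>
  define B where "B = cprod X A (cprod X A A)"
  define x where "x = cfst X A (cprod X A A)"
  define a where "a = cfst X A A \<cdot> csnd X A (cprod X A A)"
  define b where "b = csnd X A A \<cdot> csnd X A (cprod X A A)"
  have xab: "x \<in> Arr X" "Dom X x = B" "Cod X x = A" "a \<in> Arr X" "Dom X a = B" "Cod X a = A"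
    "b \<in> Arr X" "Dom X b = B" "Cod X b = A" unfolding x_def a_def b_def B_def using A by simp_all
  have p': "p \<in> Arr X" "Dom X p = TO X A" "Cod X p = A" using p by (auto simp: is_product_def)
  define g where "g c = pair X (tproj X A) p x c" for c
  have g: "g c \<in> Arr X" "Dom X (g c) = B" "Cod X (g c) = TO X A" "tproj X A \<cdot> g c = x" "p \<cdot> g c = c"
    if "c \<in> Arr X" "Dom X c = B" "Cod X c = A" for c
    unfolding g_def using product_pair[OF p, of x c] xab that by simp_all
  note ga = g[OF xab(4-6)] and gb = g[OF xab(7-9)]
  define r where "r = pair2 X A (g a) (g b)"
  have r: "r \<in> Arr X" "Dom X r = B" "Cod X r = T2 X A" "tpi1 X A \<cdot> r = g a" "tpi2 X A \<cdot> r = g b"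
    unfolding r_def using ga gb A by simp_all
  define q where "q = FM p \<cdot> \<alpha>i A"
  have q: "q \<in> Arr X" "Dom X q = TO X (FO A)" "Cod X q = FO A" unfolding q_def using p' A by simp_all
  have P: "is_product X (TO X (FO A)) (tproj X (FO A)) q (FO A) (FO A)"
  proof (rule product_iso[OF F_preserves_products[OF p], of "\<alpha>i A" _ "\<alpha> A"])
    show "FM (tproj X A) \<cdot> \<alpha>i A = tproj X (FO A)"
      unfolding lax_tangent_morphismD(8)[OF lax A, symmetric] using A by simp
  qed (use A in \<open>simp_all add: q_def\<close>)
  define m1 where "m1 = prod_cmp X FO FM A (cprod X A A)"
  define m2 where "m2 = prod_cmp X FO FM A A"
  have AA: "cprod X A A \<in> Obj X" using A by simp
  note m1 = cmp_simps[OF A AA, folded m1_def] and m2 = cmp_simps[OF A A, folded m2_def]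
  define y where "y = m2 \<cdot> cpair X (FO A) (FO A) (q \<cdot> u) (q \<cdot> v)"
  define w where "w = m1 \<cdot> cpair X (FO A) (FO (cprod X A A)) (tproj X (FO A) \<cdot> u) y"
  have y: "y \<in> Arr X" "Dom X y = Dom X u" "Cod X y = FO (cprod X A A)" "FM (cfst X A A) \<cdot> y = q \<cdot> u" "FM (csnd X A A) \<cdot> y = q \<cdot> v"
    unfolding y_def using m2 q u v A by (simp_all add: tail[OF m2(4)] tail[OF m2(5)])
  have w': "w \<in> Arr X" "Dom X w = Dom X u" "Cod X w = FO B" "FM x \<cdot> w = tproj X (FO A) \<cdot> u" "FM (csnd X A (cprod X A A)) \<cdot> w = y"
    unfolding w_def x_def B_def using m1 y u A by (simp_all add: tail[OF m1(4)] tail[OF m1(5)])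
  have w: "FM a \<cdot> w = q \<cdot> u" "FM b \<cdot> w = q \<cdot> v"
    unfolding a_def b_def using w' y A by (simp_all add: B_def)
  have Fr: "FM (tpi1 X A) \<cdot> FM r = FM (g a)" "FM (tpi2 X A) \<cdot> FM r = FM (g b)"
    using F_simps(6)[of r "tpi1 X A"] F_simps(6)[of r "tpi2 X A"] r A by simp_all
  have Fp: "FM (tproj X A) \<cdot> FM (g c) = FM x" "FM p \<cdot> FM (g c) = FM c" if "c \<in> Arr X" "Dom X c = B" "Cod X c = A" for c
    using F_simps(6)[of "g c" "tproj X A"] F_simps(6)[of "g c" p] g[OF that] p' A by simp_all
  have \<alpha>p: "tproj X (FO A) \<cdot> (\<alpha> A \<cdot> z) = FM (tproj X A) \<cdot> z" if "z \<in> Arr X" "Cod X z = FO (TO X A)" for z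
    using tail[OF lax_tangent_morphismD(8)[OF lax A], of z] that A by simp
  have key: "\<alpha> A \<cdot> (FM (g c) \<cdot> w) = t"
    if c: "c \<in> Arr X" "Dom X c = B" "Cod X c = A" and t: "t \<in> Arr X" "Dom X t = Dom X u" "Cod X t = TO X (FO A)"
      "tproj X (FO A) \<cdot> t = tproj X (FO A) \<cdot> u" "FM c \<cdot> w = q \<cdot> t" for c t
  proof (rule product_ext[OF P])
    show "tproj X (FO A) \<cdot> (\<alpha> A \<cdot> (FM (g c) \<cdot> w)) = tproj X (FO A) \<cdot> t"
      using g[OF c] w'(1-4) A t xab by (simp add: \<alpha>p tail[OF Fp(1)[OF c]])
    show "q \<cdot> (\<alpha> A \<cdot> (FM (g c) \<cdot> w)) = q \<cdot> t"
      unfolding t(5)[symmetric] unfolding q_def using g[OF c] w'(1-3) A p' c by (simp add: tail[OF Fp(2)[OF c]])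
  qed (use g[OF c] w'(1-3) A t in simp_all)
  show thesis
  proof (rule that[of "FM r \<cdot> w"])
    show "\<alpha> A \<cdot> (FM (tpi1 X A) \<cdot> (FM r \<cdot> w)) = u"
      using key[OF xab(4-6) u(1) refl u(2) refl w(1)] tail[OF Fr(1), of w] r w'(1-3) A by simp
    show "\<alpha> A \<cdot> (FM (tpi2 X A) \<cdot> (FM r \<cdot> w)) = v"
      using key[OF xab(7-9) v(1) v(3) v(2) e[symmetric] w(2)] tail[OF Fr(2), of w] r w'(1-3) A by simp
  qed (use r w'(1-3) in simp_all)
qed

definition F_DO :: "('o, 'a) diff_object \<Rightarrow> ('o, 'a) diff_object" where
  "F_DO D = \<lparr>carrier = FO (carrier D), zeta = FM (zeta D) \<cdot> unit_cmp X FO,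
     sigma = FM (sigma D) \<cdot> prod_cmp X FO FM (carrier D) (carrier D),
     phat = FM (phat D) \<cdot> \<alpha>i (carrier D)\<rparr>"

text \<open>Elements of \<open>F A\<close> of the form \<open>F a k\<close> are added inside \<open>F\<close>. Every pair of elements of \<open>F A\<close> has this
  form, with \<open>a\<close> and \<open>b\<close> the projections of \<open>A \<times> A\<close>, so the monoid laws for \<open>F A\<close> are those for \<open>A\<close>.\<close>

lemma F_DO_monoid:
  assumes D: "commutative_monoid X A \<zeta> \<sigma>"
  defines "m \<equiv> prod_cmp X FO FM A A" and "e \<equiv> unit_cmp X FO"
  shows "commutative_monoid X (FO A) (FM \<zeta> \<cdot> e) (FM \<sigma> \<cdot> m)"
    "\<And>a b k. a \<in> Arr X \<Longrightarrow> b \<in> Arr X \<Longrightarrow> Dom X a = Dom X b \<Longrightarrow> Cod X a = A \<Longrightarrow> Cod X b = A \<Longrightarrow> k \<in> Arr X \<Longrightarrow>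
       Cod X k = FO (Dom X b) \<Longrightarrow>
       (FM \<sigma> \<cdot> m) \<cdot> cpair X (FO A) (FO A) (FM a \<cdot> k) (FM b \<cdot> k) = FM (\<sigma> \<cdot> cpair X A A a b) \<cdot> k"
    "\<And>k C. k \<in> Arr X \<Longrightarrow> Cod X k = FO C \<Longrightarrow> C \<in> Obj X \<Longrightarrow> FM (\<zeta> \<cdot> bang X C) \<cdot> k = (FM \<zeta> \<cdot> e) \<cdot> bang X (Dom X k)"
proof -
  note M = commutative_monoidD[OF D]
  note m = cmp_simps[OF M(1) M(1), folded m_def] and e = unit_cmp_typing[where HO = FO, OF F_terminal, folded e_def]
  show s: "(FM \<sigma> \<cdot> m) \<cdot> cpair X (FO A) (FO A) (FM a \<cdot> k) (FM b \<cdot> k) = FM (\<sigma> \<cdot> cpair X A A a b) \<cdot> k"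
    if "a \<in> Arr X" "b \<in> Arr X" "Dom X a = Dom X b" "Cod X a = A" "Cod X b = A" "k \<in> Arr X" "Cod X k = FO (Dom X b)" for a b k
    using cmp_cpair[OF that, folded m_def] that M(1-7) m by simp
  show z: "FM (\<zeta> \<cdot> bang X C) \<cdot> k = (FM \<zeta> \<cdot> e) \<cdot> bang X (Dom X k)" if "k \<in> Arr X" "Cod X k = FO C" "C \<in> Obj X" for k C
  proof -
    have "FM (bang X C) \<cdot> k = e \<cdot> bang X (Dom X k)"
      using that e F_terminal by - (rule terminal_unique, simp_all)
    then show ?thesis using that e M(1-7) by simp
  qed
  have AA: "cprod X A A \<in> Obj X" using M(1) by simp
  have FA: "FO A \<in> Obj X" using M(1) by simp
  show "commutative_monoid X (FO A) (FM \<zeta> \<cdot> e) (FM \<sigma> \<cdot> m)"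
  proof (rule commutative_monoidI)
    fix u assume u: "u \<in> Arr X" "Cod X u = FO A"
    have "(FM \<sigma> \<cdot> m) \<cdot> cpair X (FO A) (FO A) (FM (\<zeta> \<cdot> bang X A) \<cdot> u) (FM (idt X A) \<cdot> u) = FM (\<sigma> \<cdot> cpair X A A (\<zeta> \<cdot> bang X A) (idt X A)) \<cdot> u"
      by (rule s) (use u M(1-7) in simp_all)
    then show "(FM \<sigma> \<cdot> m) \<cdot> cpair X (FO A) (FO A) ((FM \<zeta> \<cdot> e) \<cdot> bang X (Dom X u)) u = u"
      unfolding z[OF u M(1)] M(8)[OF idt_typing(1)[OF M(1)] idt_typing(3)[OF M(1)] idt_typing(2)[OF M(1)]] using u M(1) by simp
  next
    fix u v assume uv: "u \<in> Arr X" "v \<in> Arr X" "Dom X u = Dom X v" "Cod X u = FO A" "Cod X v = FO A"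
    define k where "k = m \<cdot> cpair X (FO A) (FO A) u v"
    have k: "k \<in> Arr X" "Dom X k = Dom X v" "Cod X k = FO (cprod X A A)" "FM (cfst X A A) \<cdot> k = u" "FM (csnd X A A) \<cdot> k = v"
      unfolding k_def using uv m FA M(1) by (simp_all add: tail[OF m(4)] tail[OF m(5)])
    show "(FM \<sigma> \<cdot> m) \<cdot> cpair X (FO A) (FO A) u v = (FM \<sigma> \<cdot> m) \<cdot> cpair X (FO A) (FO A) v u"
      using s[of "cfst X A A" "csnd X A A" k] s[of "csnd X A A" "cfst X A A" k] k M(1) M(9)[of "cfst X A A" "csnd X A A"]
      by (simp del: assoc)
  next
    fix u v w assume uvw: "u \<in> Arr X" "v \<in> Arr X" "w \<in> Arr X" "Dom X u = Dom X v" "Dom X w = Dom X v"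
      "Cod X u = FO A" "Cod X v = FO A" "Cod X w = FO A"
    define k where "k = m \<cdot> cpair X (FO A) (FO A) u v"
    have k: "k \<in> Arr X" "Dom X k = Dom X v" "Cod X k = FO (cprod X A A)" "FM (cfst X A A) \<cdot> k = u" "FM (csnd X A A) \<cdot> k = v"
      unfolding k_def using uvw m FA M(1) by (simp_all add: tail[OF m(4)] tail[OF m(5)])
    note m' = cmp_simps[OF AA M(1)]
    define l where "l = prod_cmp X FO FM (cprod X A A) A \<cdot> cpair X (FO (cprod X A A)) (FO A) k w"
    have l: "l \<in> Arr X" "Dom X l = Dom X v" "Cod X l = FO (cprod X (cprod X A A) A)"
      "FM (cfst X (cprod X A A) A) \<cdot> l = k" "FM (csnd X (cprod X A A) A) \<cdot> l = w"
      unfolding l_def using uvw k m' M(1) by (simp_all add: tail[OF m'(4)] tail[OF m'(5)])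
    define x y z where "x = cfst X A A \<cdot> cfst X (cprod X A A) A" and "y = csnd X A A \<cdot> cfst X (cprod X A A) A"
      and "z = csnd X (cprod X A A) A"
    have xyz: "x \<in> Arr X" "Dom X x = cprod X (cprod X A A) A" "Cod X x = A" "y \<in> Arr X" "Dom X y = cprod X (cprod X A A) A" "Cod X y = A"
      "z \<in> Arr X" "Dom X z = cprod X (cprod X A A) A" "Cod X z = A"
      unfolding x_def y_def z_def using M(1) by simp_all
    have F: "FM x \<cdot> l = u" "FM y \<cdot> l = v" "FM z \<cdot> l = w"
      unfolding x_def y_def z_def using l k M(1) by simp_all
    have "(FM \<sigma> \<cdot> m) \<cdot> cpair X (FO A) (FO A) u v = FM (\<sigma> \<cdot> cpair X A A x y) \<cdot> l"
      using s[of x y l] xyz l(1-3) by (simp add: F del: assoc)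
    moreover have "(FM \<sigma> \<cdot> m) \<cdot> cpair X (FO A) (FO A) v w = FM (\<sigma> \<cdot> cpair X A A y z) \<cdot> l"
      using s[of y z l] xyz l(1-3) by (simp add: F del: assoc)
    moreover have "(FM \<sigma> \<cdot> m) \<cdot> cpair X (FO A) (FO A) (FM (\<sigma> \<cdot> cpair X A A x y) \<cdot> l) w
        = FM (\<sigma> \<cdot> cpair X A A (\<sigma> \<cdot> cpair X A A x y) z) \<cdot> l"
      using s[of "\<sigma> \<cdot> cpair X A A x y" z l] xyz l(1-3) M(1-7) by (simp add: F del: assoc F_simps(6))
    moreover have "(FM \<sigma> \<cdot> m) \<cdot> cpair X (FO A) (FO A) u (FM (\<sigma> \<cdot> cpair X A A y z) \<cdot> l)
        = FM (\<sigma> \<cdot> cpair X A A x (\<sigma> \<cdot> cpair X A A y z)) \<cdot> l"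
      using s[of x "\<sigma> \<cdot> cpair X A A y z" l] xyz l(1-3) M(1-7) by (simp add: F del: assoc F_simps(6))
    ultimately show "(FM \<sigma> \<cdot> m) \<cdot> cpair X (FO A) (FO A) ((FM \<sigma> \<cdot> m) \<cdot> cpair X (FO A) (FO A) u v) w
      = (FM \<sigma> \<cdot> m) \<cdot> cpair X (FO A) (FO A) u ((FM \<sigma> \<cdot> m) \<cdot> cpair X (FO A) (FO A) v w)"
      using M(10)[of x y z] xyz by (simp del: assoc F_simps(6))
  qed (use M(1-7) m e in simp_all)
qed

text \<open>All axioms but one follow from naturality and from the preservation of products. The exception is the
  compatibility with the addition of tangent vectors, for which \<open>lift_pairs\<close> provides the factorization
  through \<open>F T\<^sub>2 A\<close>.\<close>

lemma F_DO_differential_object: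
  assumes D: "differential_object X D"
  shows "differential_object X (F_DO D)"
proof -
  define A \<zeta> \<sigma> p where "A = carrier D" and "\<zeta> = zeta D" and "\<sigma> = sigma D" and "p = phat D"
  note DD = differential_objectD[OF D, folded A_def \<zeta>_def \<sigma>_def p_def]
  note M = commutative_monoidD[OF DD(1)]
  define m where "m = prod_cmp X FO FM A A"
  define e where "e = unit_cmp X FO"
  define \<zeta>' \<sigma>' q where "\<zeta>' = FM \<zeta> \<cdot> e" and "\<sigma>' = FM \<sigma> \<cdot> m" and "q = FM p \<cdot> \<alpha>i A"
  note FM = F_DO_monoid[OF DD(1), folded m_def e_def, folded \<zeta>'_def \<sigma>'_def]
  note m = cmp_simps[OF M(1) M(1), folded m_def] and e = unit_cmp_typing[where HO = FO, OF F_terminal, folded e_def]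
  have A: "A \<in> Obj X" "FO A \<in> Obj X" using M(1) by simp_all
  have q: "q \<in> Arr X" "Dom X q = TO X (FO A)" "Cod X q = FO A" unfolding q_def using DD(2-4) A by simp_all
  have "differential_object X \<lparr>carrier = FO A, zeta = \<zeta>', sigma = \<sigma>', phat = q\<rparr>"
  proof (rule differential_objectI[OF FM(1) q])
    show "is_product X (TO X (FO A)) (tproj X (FO A)) q (FO A) (FO A)"
    proof (rule product_iso[OF F_preserves_products[OF DD(5)], of "\<alpha>i A" _ "\<alpha> A"])
      show "FM (tproj X A) \<cdot> \<alpha>i A = tproj X (FO A)"
        unfolding lax_tangent_morphismD(8)[OF lax A(1), symmetric] using A by simp
    qed (use A in \<open>simp_all add: q_def\<close>)
    have "\<alpha>i A \<cdot> (TM X (FM \<zeta>) \<cdot> TM X e) = FM (TM X \<zeta>) \<cdot> (\<alpha>i One \<cdot> TM X e)"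
      using tail[OF \<alpha>i_nat[of \<zeta> A], of "TM X e"] M(1-7) e by simp
    then have "q \<cdot> TM X \<zeta>' = FM (p \<cdot> TM X \<zeta>) \<cdot> (\<alpha>i One \<cdot> TM X e)"
      unfolding q_def \<zeta>'_def using M(1-7) e DD(2-4) by simp
    also have "\<dots> = \<zeta>' \<cdot> bang X (TO X One)"
      unfolding DD(6) using FM(3)[of "\<alpha>i One \<cdot> TM X e" "TO X One"] e by simp
    finally show "q \<cdot> TM X \<zeta>' = \<zeta>' \<cdot> bang X (TO X One)" .
    let ?k = "\<alpha>i (cprod X A A) \<cdot> TM X m"
    have k: "?k \<in> Arr X" "Dom X ?k = TO X (cprod X (FO A) (FO A))" "Cod X ?k = FO (TO X (cprod X A A))"
      using A m by simp_all
    have Tm: "TM X (FM (cfst X A A)) \<cdot> TM X m = TM X (cfst X (FO A) (FO A))"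
      "TM X (FM (csnd X A A)) \<cdot> TM X m = TM X (csnd X (FO A) (FO A))"
      using arg_cong[OF m(4), of "TM X"] arg_cong[OF m(5), of "TM X"] m(1-3) A by simp_all
    have Fk: "FM (p \<cdot> TM X (cfst X A A)) \<cdot> ?k = q \<cdot> TM X (cfst X (FO A) (FO A))"
      "FM (p \<cdot> TM X (csnd X A A)) \<cdot> ?k = q \<cdot> TM X (csnd X (FO A) (FO A))"
      using tail[OF \<alpha>i_nat[of "cfst X A A" A], of "TM X m"] tail[OF \<alpha>i_nat[of "csnd X A A" A], of "TM X m"] m(1-3) A DD(2-4)
      unfolding q_def by (simp_all flip: Tm)
    have "\<alpha>i A \<cdot> (TM X (FM \<sigma>) \<cdot> TM X m) = FM (TM X \<sigma>) \<cdot> ?k"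
      using tail[OF \<alpha>i_nat[of \<sigma> A], of "TM X m"] M(1-7) m(1-3) by simp
    then have "q \<cdot> TM X \<sigma>' = FM (p \<cdot> TM X \<sigma>) \<cdot> ?k"
      unfolding q_def \<sigma>'_def using M(1-7) m(1-3) DD(2-4) by simp
    also have "\<dots> = \<sigma>' \<cdot> cpair X (FO A) (FO A) (FM (p \<cdot> TM X (cfst X A A)) \<cdot> ?k) (FM (p \<cdot> TM X (csnd X A A)) \<cdot> ?k)"
      unfolding DD(7) by (rule FM(2)[symmetric]) (use k A DD(2-4) in simp_all)
    finally show "q \<cdot> TM X \<sigma>' = \<sigma>' \<cdot> cpair X (FO A) (FO A) (q \<cdot> TM X (cfst X (FO A) (FO A))) (q \<cdot> TM X (csnd X (FO A) (FO A)))"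
      unfolding Fk .
    have "q \<cdot> tzero X (FO A) = FM (p \<cdot> tzero X A)"
      unfolding q_def lax_tangent_morphismD(9)[OF lax A(1), symmetric] using A DD(2-4) by simp
    also have "\<dots> = \<zeta>' \<cdot> bang X (FO A)"
      unfolding DD(8) using FM(3)[of "idt X (FO A)" A] A M(1-7) by simp
    finally show "q \<cdot> tzero X (FO A) = \<zeta>' \<cdot> bang X (FO A)" .
    obtain k where k: "k \<in> Arr X" "Dom X k = T2 X (FO A)" "Cod X k = FO (T2 X A)"
      "\<alpha> A \<cdot> (FM (tpi1 X A) \<cdot> k) = tpi1 X (FO A)" "\<alpha> A \<cdot> (FM (tpi2 X A) \<cdot> k) = tpi2 X (FO A)"
      by (rule lift_pairs[OF A(1) DD(5), of "tpi1 X (FO A)" "tpi2 X (FO A)"]) (use A in \<open>simp_all add: tpi_proj\<close>)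
    define w where "w = pair2 X (FO A) (\<alpha> A \<cdot> FM (tpi1 X A)) (\<alpha> A \<cdot> FM (tpi2 X A))"
    have "tproj X (FO A) \<cdot> (\<alpha> A \<cdot> FM (tpi1 X A)) = tproj X (FO A) \<cdot> (\<alpha> A \<cdot> FM (tpi2 X A))"
      using tail[OF lax_tangent_morphismD(8)[OF lax A(1)], of "FM (tpi1 X A)"] A
        tail[OF lax_tangent_morphismD(8)[OF lax A(1)], of "FM (tpi2 X A)"] arg_cong[OF tpi_proj[OF A(1)], of FM] by simp
    note w = pair2_simps[OF _ _ _ _ _ this, folded w_def]
    have "w \<cdot> k = idt X (T2 X (FO A))"
      using w k A by - (rule T2_ext[of "FO A"], simp_all add: tail[OF w(4)] tail[OF w(5)])
    then have "tsum X (FO A) = (tsum X (FO A) \<cdot> w) \<cdot> k" using w(1-3) k(1-3) A by simp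
    also have "\<dots> = \<alpha> A \<cdot> (FM (tsum X A) \<cdot> k)"
      unfolding w_def lax_tangent_morphismD(10)[OF lax A(1), symmetric] using A k(1-3) by simp
    finally have "q \<cdot> tsum X (FO A) = FM (p \<cdot> tsum X A) \<cdot> k"
      unfolding q_def using A k(1-3) DD(2-4) by simp
    also have "\<dots> = \<sigma>' \<cdot> cpair X (FO A) (FO A) (FM (p \<cdot> tpi1 X A) \<cdot> k) (FM (p \<cdot> tpi2 X A) \<cdot> k)"
      unfolding DD(9) by (rule FM(2)[symmetric]) (use k(1-3) A DD(2-4) in simp_all)
    also have "FM (p \<cdot> tpi1 X A) \<cdot> k = q \<cdot> tpi1 X (FO A)"
      unfolding q_def k(4)[symmetric] using k(1-3) A DD(2-4) by simp
    also have "FM (p \<cdot> tpi2 X A) \<cdot> k = q \<cdot> tpi2 X (FO A)"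
      unfolding q_def k(5)[symmetric] using k(1-3) A DD(2-4) by simp
    finally show "q \<cdot> tsum X (FO A) = \<sigma>' \<cdot> cpair X (FO A) (FO A) (q \<cdot> tpi1 X (FO A)) (q \<cdot> tpi2 X (FO A))" .
    show "q \<cdot> (TM X q \<cdot> tlift X (FO A)) = q"
    proof (rule \<alpha>_cancel[OF A(1)])
      have "TM X (\<alpha>i A) \<cdot> (TM X (\<alpha> A) \<cdot> z) = z" if "z \<in> Arr X" "Cod X z = TO X (FO (TO X A))" for z
        using tail[OF TM_simps(6)[of "\<alpha> A" "\<alpha>i A", symmetric], of z] that A by simp
      note this[of "\<alpha> (TO X A) \<cdot> FM (tlift X A)"]
      then have "(q \<cdot> (TM X q \<cdot> tlift X (FO A))) \<cdot> \<alpha> A = FM p \<cdot> (\<alpha>i A \<cdot> (TM X (FM p) \<cdot> (\<alpha> (TO X A) \<cdot> FM (tlift X A))))"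
        unfolding q_def using A DD(2-4) lax_tangent_morphismD(11)[OF lax A(1)] by simp
      also have "\<dots> = FM (p \<cdot> (TM X p \<cdot> tlift X A))"
        using tail[OF \<alpha>i_nat[of p A], of "\<alpha> (TO X A) \<cdot> FM (tlift X A)"] A DD(2-4) by simp
      also have "\<dots> = q \<cdot> \<alpha> A" unfolding DD(10) q_def using A DD(2-4) by simp
      finally show "(q \<cdot> (TM X q \<cdot> tlift X (FO A))) \<cdot> \<alpha> A = q \<cdot> \<alpha> A" .
    qed (use A q in simp_all)
  qed
  then show ?thesis unfolding F_DO_def A_def \<zeta>_def \<sigma>_def p_def m_def e_def \<zeta>'_def \<sigma>'_def q_def .
qed

lemma F_DO_linear:
  assumes D: "differential_object X D" and E: "differential_object X E" and f: "linear_map X D E f"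
  shows "linear_map X (F_DO D) (F_DO E) (FM f)"
proof -
  note DD = differential_objectD[OF D] and EE = differential_objectD[OF E]
  note A = commutative_monoidD(1)[OF DD(1)] commutative_monoidD(1)[OF EE(1)]
  have F: "f \<in> Arr X" "Dom X f = carrier D" "Cod X f = carrier E" "f \<cdot> phat D = phat E \<cdot> TM X f"
    using f by (auto simp: linear_map_def)
  have "FM f \<cdot> FM (phat D) = FM (phat E) \<cdot> FM (TM X f)"
    using arg_cong[OF F(4), of FM] F(1-3) DD(2-4) EE(2-4) A by simp
  from tail[OF this, of "\<alpha>i (carrier D)"] show ?thesis
    using F(1-3) DD(2-4) EE(2-4) A \<alpha>i_nat[of f "carrier E"] by (simp add: linear_map_def F_DO_def)
qed

end

section \<open>Cartesian structure created by a family of functors\<close>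

context category
begin

lemma product_jointly_monic:
  assumes "is_product X P p1 p2 A B"
  shows "jointly_monic X {0, 1} P (case_nat p1 (\<lambda>_. p2))"
proof -
  have "A \<in> Obj X" "B \<in> Obj X"
    using assms Obj_ends(2)[of p1] Obj_ends(2)[of p2] by (auto simp: is_product_def)
  then show ?thesis using assms is_product_limit is_limit_jointly_monic by blast
qed

end

locale cartesian_creation = tangent_creation X Y I UO UM + X: cartesian_tangent_category X
  for X :: "('o, 'a, 'm) cartesian_tangent_category_scheme" (structure)
  and Y :: "('p, 'b, 'n) cartesian_tangent_category_scheme"
  and I :: "'i set" and UO :: "'i \<Rightarrow> 'p \<Rightarrow> 'o" and UM :: "'i \<Rightarrow> 'b \<Rightarrow> 'a" +
  assumes terminal_typing: "terminal Y \<in> Obj Y"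
    and prod_typing: "A \<in> Obj Y \<Longrightarrow> B \<in> Obj Y \<Longrightarrow> cprod Y A B \<in> Obj Y \<and>
      cfst Y A B \<in> hom Y (cprod Y A B) A \<and> csnd Y A B \<in> hom Y (cprod Y A B) B"
    and U_terminal: "i \<in> I \<Longrightarrow> UO i (terminal Y) = terminal X"
    and U_prod: "i \<in> I \<Longrightarrow> A \<in> Obj Y \<Longrightarrow> B \<in> Obj Y \<Longrightarrow> UO i (cprod Y A B) = cprod X (UO i A) (UO i B) \<and>
      UM i (cfst Y A B) = cfst X (UO i A) (UO i B) \<and> UM i (csnd Y A B) = csnd X (UO i A) (UO i B)"
begin

theorem created_cartesian_tangent_category: "cartesian_tangent_category Y"
proof -
  interpret Y: tangent_category Y by (rule created_tangent_category)
  show ?thesis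
  proof
    show "is_terminal Y (terminal Y)" "is_terminal Y (TO Y (terminal Y))"
      using terminal_typing U_terminal X.terminal X.T_terminal X.T_preserves_terminal[OF X.T_terminal]
      by (auto intro!: created_terminal)
    fix A B assume AB: "A \<in> Obj Y" "B \<in> Obj Y"
    have *: "cprod Y A B \<in> Obj Y" "cfst Y A B \<in> hom Y (cprod Y A B) A" "csnd Y A B \<in> hom Y (cprod Y A B) B"
      using prod_typing[OF AB] by auto
    have p: "is_product X (cprod X (UO i A) (UO i B)) (cfst X (UO i A) (UO i B)) (csnd X (UO i A) (UO i B)) (UO i A) (UO i B)"
      if "i \<in> I" for i using X.product that AB by simp
    note Tp = X.T_preserves_products[OF p] X.T_preserves_products[OF X.T_preserves_products[OF p]]
    note jm = X.product_jointly_monic[OF Tp(1)] X.product_jointly_monic[OF Tp(2)]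
    show "is_product Y (cprod Y A B) (cfst Y A B) (csnd Y A B) A B"
      by (rule created_product[OF AB]) (use * U_prod AB p jm in simp_all)
    show "is_product Y (TO Y (cprod Y A B)) (TM Y (cfst Y A B)) (TM Y (csnd Y A B)) (TO Y A) (TO Y B)"
      by (rule created_product) (use * U_prod AB Tp(1) jm in simp_all)
  qed
qed

sublocale Y: cartesian_tangent_category Y
  by (rule created_cartesian_tangent_category)

lemma eq_iff_underlying:
  assumes "f \<in> Arr Y" "g \<in> Arr Y" "Dom Y f = Dom Y g" "Cod Y f = Cod Y g"
  shows "f = g \<longleftrightarrow> (\<forall>i\<in>I. UM i f = UM i g)"
  using faithful[OF assms] by auto

lemma U_cartesian [simp]:
  assumes i: "i \<in> I"
  shows "UO i (terminal Y) = terminal X"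
    "A \<in> Obj Y \<Longrightarrow> B \<in> Obj Y \<Longrightarrow> UO i (cprod Y A B) = cprod X (UO i A) (UO i B)"
    "A \<in> Obj Y \<Longrightarrow> B \<in> Obj Y \<Longrightarrow> UM i (cfst Y A B) = cfst X (UO i A) (UO i B)"
    "A \<in> Obj Y \<Longrightarrow> B \<in> Obj Y \<Longrightarrow> UM i (csnd Y A B) = csnd X (UO i A) (UO i B)"
    "A \<in> Obj Y \<Longrightarrow> UM i (bang Y A) = bang X (UO i A)"
  using U_terminal U_prod i X.bang_unique[of "UM i (bang Y A)"] by simp_all

lemma U_cpair [simp]:
  assumes i: "i \<in> I" and u: "u \<in> Arr Y" "v \<in> Arr Y" "Dom Y u = Dom Y v" "Cod Y u = A" "Cod Y v = B"
  shows "UM i (cpair Y A B u v) = cpair X (UO i A) (UO i B) (UM i u) (UM i v)"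
proof -
  have O: "A \<in> Obj Y" "B \<in> Obj Y" using u by auto
  show ?thesis
    using U_simps(6)[OF i, of "cpair Y A B u v" "cfst Y A B"] U_simps(6)[OF i, of "cpair Y A B u v" "csnd Y A B"] O u i
    by - (rule X.prod_ext[of "UO i A" "UO i B"], simp_all)
qed

lemma U_cmap [simp]:
  assumes "i \<in> I" "f \<in> Arr Y" "g \<in> Arr Y"
  shows "UM i (cmap Y f g) = cmap X (UM i f) (UM i g)"
  using assms by (simp add: X.cmap_cpair Y.cmap_cpair)

lemma U_unit_cmp [simp]: "i \<in> I \<Longrightarrow> UM i (unit_cmp Y (TO Y)) = unit_cmp X (TO X)"
  using Y.unit_cmp_typing[where HO = "TO Y", OF Y.T_terminal] X.T_terminal
  by (intro X.unit_cmp_eq[symmetric]) simp_all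

lemma T_cmp_typing:
  assumes "A \<in> Obj Y" "B \<in> Obj Y"
  defines "m \<equiv> prod_cmp Y (TO Y) (TM Y) A B"
  shows "m \<in> Arr Y" "Dom Y m = cprod Y (TO Y A) (TO Y B)" "Cod Y m = TO Y (cprod Y A B)"
    "TM Y (cfst Y A B) \<odot> m = cfst Y (TO Y A) (TO Y B)" "TM Y (csnd Y A B) \<odot> m = csnd Y (TO Y A) (TO Y B)"
    "i \<in> I \<Longrightarrow> UM i m = prod_cmp X (TO X) (TM X) (UO i A) (UO i B)"
proof -
  show m: "m \<in> Arr Y" "Dom Y m = cprod Y (TO Y A) (TO Y B)" "Cod Y m = TO Y (cprod Y A B)"
    "TM Y (cfst Y A B) \<odot> m = cfst Y (TO Y A) (TO Y B)" "TM Y (csnd Y A B) \<odot> m = csnd Y (TO Y A) (TO Y B)"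
    unfolding m_def prod_cmp_def using assms(1,2)
      Y.product_pair[OF Y.T_product[of A B], of "cfst Y (TO Y A) (TO Y B)" "csnd Y (TO Y A) (TO Y B)"] by simp_all
  assume i: "i \<in> I"
  show "UM i m = prod_cmp X (TO X) (TM X) (UO i A) (UO i B)"
    unfolding prod_cmp_def
  proof (rule X.pair_eqI[symmetric])
    show "is_product X (TO X (cprod X (UO i A) (UO i B))) (TM X (cfst X (UO i A) (UO i B))) (TM X (csnd X (UO i A) (UO i B)))
       (TO X (UO i A)) (TO X (UO i B)) \<or> is_pullback X (TO X (cprod X (UO i A) (UO i B))) (TM X (cfst X (UO i A) (UO i B))) (TM X (csnd X (UO i A) (UO i B))) undefined undefined"
      using X.T_product assms(1,2) i by simp
  qed (use arg_cong[OF m(4), of "UM i"] arg_cong[OF m(5), of "UM i"] m(1-3) assms(1,2) i in simp_all)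
qed

definition U_diff :: "'i \<Rightarrow> ('p, 'b) diff_object \<Rightarrow> ('o, 'a) diff_object" where
  "U_diff i D = \<lparr>carrier = UO i (carrier D), zeta = UM i (zeta D), sigma = UM i (sigma D), phat = UM i (phat D)\<rparr>"

text \<open>The equations between maps in the definition of a differential object can be tested on the
  underlying objects. For the product diagram only one direction holds, so that pointwise product
  diagrams have to be assumed for the other.\<close>

theorem differential_object_underlying:
  assumes C: "carrier D \<in> Obj Y"
    and t: "zeta D \<in> hom Y (terminal Y) (carrier D)" "sigma D \<in> hom Y (cprod Y (carrier D) (carrier D)) (carrier D)"
      "phat D \<in> hom Y (TO Y (carrier D)) (carrier D)"
  shows "(\<forall>i\<in>I. differential_object X (U_diff i D)) \<longleftrightarrow> differential_object Y D \<and>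
    (\<forall>i\<in>I. is_product X (TO X (UO i (carrier D))) (tproj X (UO i (carrier D))) (UM i (phat D)) (UO i (carrier D)) (UO i (carrier D)))"
proof -
  define A \<zeta> \<sigma> p where "A = carrier D" and "\<zeta> = zeta D" and "\<sigma> = sigma D" and "p = phat D"
  have A: "A \<in> Obj Y" using C by (simp add: A_def)
  have t: "\<zeta> \<in> Arr Y" "Dom Y \<zeta> = terminal Y" "Cod Y \<zeta> = A" "\<sigma> \<in> Arr Y" "Dom Y \<sigma> = cprod Y A A" "Cod Y \<sigma> = A"
    "p \<in> Arr Y" "Dom Y p = TO Y A" "Cod Y p = A" using t by (auto simp: A_def \<zeta>_def \<sigma>_def p_def)
  note u = Y.unit_cmp_typing[where HO = "TO Y", OF Y.T_terminal]
  note m = T_cmp_typing[OF A A]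
  define P where "P i \<longleftrightarrow> is_product X (TO X (UO i A)) (tproj X (UO i A)) (UM i p) (UO i A) (UO i A)" for i
  have pr: "is_product Y (TO Y A) (tproj Y A) p A A" if "\<forall>i\<in>I. P i"
  proof (rule created_product[OF A A])
    fix i assume i: "i \<in> I"
    then have *: "is_product X (TO X (UO i A)) (tproj X (UO i A)) (UM i p) (UO i A) (UO i A)"
      using that by (simp add: P_def)
    then show "is_product X (UO i (TO Y A)) (UM i (tproj Y A)) (UM i p) (UO i A) (UO i A)" using i A by simp
    show "jointly_monic X {0, 1} (TO X (UO i (TO Y A))) (case_nat (TM X (UM i (tproj Y A))) (\<lambda>_. TM X (UM i p)))"
      using X.product_jointly_monic[OF X.T_preserves_products[OF *]] i A by simp
  qed (use A t in simp_all)
  have e1: "\<sigma> \<odot> cpair Y A A (\<zeta> \<odot> bang Y A) (idt Y A) = idt Y A \<longleftrightarrow>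
    (\<forall>i\<in>I. UM i \<sigma> \<cdot> cpair X (UO i A) (UO i A) (UM i \<zeta> \<cdot> bang X (UO i A)) (idt X (UO i A)) = idt X (UO i A))"
    using A t by (subst eq_iff_underlying) simp_all
  have e2: "\<sigma> \<odot> cpair Y A A (csnd Y A A) (cfst Y A A) = \<sigma> \<longleftrightarrow>
    (\<forall>i\<in>I. UM i \<sigma> \<cdot> cpair X (UO i A) (UO i A) (csnd X (UO i A) (UO i A)) (cfst X (UO i A) (UO i A)) = UM i \<sigma>)"
    using A t by (subst eq_iff_underlying) simp_all
  have e3: "\<sigma> \<odot> cpair Y A A (\<sigma> \<odot> cpair Y A A (cfst Y A A \<odot> cfst Y (cprod Y A A) A) (csnd Y A A \<odot> cfst Y (cprod Y A A) A)) (csnd Y (cprod Y A A) A)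
     = \<sigma> \<odot> cpair Y A A (cfst Y A A \<odot> cfst Y (cprod Y A A) A) (\<sigma> \<odot> cpair Y A A (csnd Y A A \<odot> cfst Y (cprod Y A A) A) (csnd Y (cprod Y A A) A)) \<longleftrightarrow>
    (\<forall>i\<in>I. let B = UO i A; \<sigma> = UM i \<sigma> in \<sigma> \<cdot> cpair X B B (\<sigma> \<cdot> cpair X B B (cfst X B B \<cdot> cfst X (cprod X B B) B) (csnd X B B \<cdot> cfst X (cprod X B B) B)) (csnd X (cprod X B B) B)
     = \<sigma> \<cdot> cpair X B B (cfst X B B \<cdot> cfst X (cprod X B B) B) (\<sigma> \<cdot> cpair X B B (csnd X B B \<cdot> cfst X (cprod X B B) B) (csnd X (cprod X B B) B)))"
    using A t by (subst eq_iff_underlying) (simp_all add: Let_def)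
  have e4: "p \<odot> (TM Y \<zeta> \<odot> unit_cmp Y (TO Y)) = \<zeta> \<longleftrightarrow>
    (\<forall>i\<in>I. UM i p \<cdot> (TM X (UM i \<zeta>) \<cdot> unit_cmp X (TO X)) = UM i \<zeta>)"
    using A t u by (subst eq_iff_underlying) simp_all
  have e5: "p \<odot> (TM Y \<sigma> \<odot> prod_cmp Y (TO Y) (TM Y) A A) = \<sigma> \<odot> cmap Y p p \<longleftrightarrow>
    (\<forall>i\<in>I. UM i p \<cdot> (TM X (UM i \<sigma>) \<cdot> prod_cmp X (TO X) (TM X) (UO i A) (UO i A)) = UM i \<sigma> \<cdot> cmap X (UM i p) (UM i p))"
    using A t m by (subst eq_iff_underlying) (simp_all add: Y.cmap_cpair(2-4))
  have e6: "p \<odot> tzero Y A = \<zeta> \<odot> bang Y A \<longleftrightarrow> (\<forall>i\<in>I. UM i p \<cdot> tzero X (UO i A) = UM i \<zeta> \<cdot> bang X (UO i A))"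
    using A t by (subst eq_iff_underlying) simp_all
  have e7: "p \<odot> tsum Y A = \<sigma> \<odot> cpair Y A A (p \<odot> tpi1 Y A) (p \<odot> tpi2 Y A) \<longleftrightarrow>
    (\<forall>i\<in>I. UM i p \<cdot> tsum X (UO i A) = UM i \<sigma> \<cdot> cpair X (UO i A) (UO i A) (UM i p \<cdot> tpi1 X (UO i A)) (UM i p \<cdot> tpi2 X (UO i A)))"
    using A t by (subst eq_iff_underlying) simp_all
  have e8: "p \<odot> (TM Y p \<odot> tlift Y A) = p \<longleftrightarrow> (\<forall>i\<in>I. UM i p \<cdot> (TM X (UM i p) \<cdot> tlift X (UO i A)) = UM i p)"
    using A t by (subst eq_iff_underlying) simp_all
  have Y_iff: "differential_object Y D \<longleftrightarrow>
    \<sigma> \<odot> cpair Y A A (\<zeta> \<odot> bang Y A) (idt Y A) = idt Y A \<and> \<sigma> \<odot> cpair Y A A (csnd Y A A) (cfst Y A A) = \<sigma> \<and>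
    \<sigma> \<odot> cpair Y A A (\<sigma> \<odot> cpair Y A A (cfst Y A A \<odot> cfst Y (cprod Y A A) A) (csnd Y A A \<odot> cfst Y (cprod Y A A) A)) (csnd Y (cprod Y A A) A)
     = \<sigma> \<odot> cpair Y A A (cfst Y A A \<odot> cfst Y (cprod Y A A) A) (\<sigma> \<odot> cpair Y A A (csnd Y A A \<odot> cfst Y (cprod Y A A) A) (csnd Y (cprod Y A A) A)) \<and>
    p \<odot> (TM Y \<zeta> \<odot> unit_cmp Y (TO Y)) = \<zeta> \<and>
    p \<odot> (TM Y \<sigma> \<odot> prod_cmp Y (TO Y) (TM Y) A A) = \<sigma> \<odot> cmap Y p p \<and>
    p \<odot> tzero Y A = \<zeta> \<odot> bang Y A \<and>
    p \<odot> tsum Y A = \<sigma> \<odot> cpair Y A A (p \<odot> tpi1 Y A) (p \<odot> tpi2 Y A) \<and>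
    p \<odot> (TM Y p \<odot> tlift Y A) = p \<and> is_product Y (TO Y A) (tproj Y A) p A A"
    unfolding differential_object_def commutative_monoid_def Let_def A_def[symmetric] \<zeta>_def[symmetric] \<sigma>_def[symmetric] p_def[symmetric]
      in_hom_iff
    using A t by blast
  have X_iff: "differential_object X (U_diff i D) \<longleftrightarrow> (let B = UO i A; \<zeta> = UM i \<zeta>; \<sigma> = UM i \<sigma>; p = UM i p in
    \<sigma> \<cdot> cpair X B B (\<zeta> \<cdot> bang X B) (idt X B) = idt X B \<and> \<sigma> \<cdot> cpair X B B (csnd X B B) (cfst X B B) = \<sigma> \<and>
    \<sigma> \<cdot> cpair X B B (\<sigma> \<cdot> cpair X B B (cfst X B B \<cdot> cfst X (cprod X B B) B) (csnd X B B \<cdot> cfst X (cprod X B B) B)) (csnd X (cprod X B B) B)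
     = \<sigma> \<cdot> cpair X B B (cfst X B B \<cdot> cfst X (cprod X B B) B) (\<sigma> \<cdot> cpair X B B (csnd X B B \<cdot> cfst X (cprod X B B) B) (csnd X (cprod X B B) B)) \<and>
    p \<cdot> (TM X \<zeta> \<cdot> unit_cmp X (TO X)) = \<zeta> \<and>
    p \<cdot> (TM X \<sigma> \<cdot> prod_cmp X (TO X) (TM X) B B) = \<sigma> \<cdot> cmap X p p \<and>
    p \<cdot> tzero X B = \<zeta> \<cdot> bang X B \<and>
    p \<cdot> tsum X B = \<sigma> \<cdot> cpair X B B (p \<cdot> tpi1 X B) (p \<cdot> tpi2 X B) \<and>
    p \<cdot> (TM X p \<cdot> tlift X B) = p) \<and> P i" if i: "i \<in> I" for i
  proof -
    have "UO i A \<in> Obj X" "UM i \<zeta> \<in> Arr X" "Dom X (UM i \<zeta>) = terminal X" "Cod X (UM i \<zeta>) = UO i A"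
      "UM i \<sigma> \<in> Arr X" "Dom X (UM i \<sigma>) = cprod X (UO i A) (UO i A)" "Cod X (UM i \<sigma>) = UO i A"
      "UM i p \<in> Arr X" "Dom X (UM i p) = TO X (UO i A)" "Cod X (UM i p) = UO i A"
      using A t i by simp_all
    then show ?thesis
      unfolding differential_object_def commutative_monoid_def Let_def U_diff_def diff_object.simps P_def
        A_def[symmetric] \<zeta>_def[symmetric] \<sigma>_def[symmetric] p_def[symmetric] in_hom_iff
      by blast
  qed
  show ?thesis
    unfolding Y_iff e1 e2 e3 e4 e5 e6 e7 e8 A_def[symmetric] p_def[symmetric] P_def[symmetric]
    using pr X_iff unfolding Let_def by blast
qed

end

section \<open>The category of differential objects\<close>

context cartesian_tangent_category
begin

text \<open>A limit of differential objects and linear maps, preserved by \<open>T\<close>, is a differential object as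
  soon as it carries structure maps for which the legs are linear and additive. The equations are
  tested on the legs; the product diagram uses that \<open>T P\<close> is again a limit.\<close>

lemma limit_differential_object:
  assumes L: "is_limit X K E d (\<lambda>k. carrier (D k)) P \<pi>"
    and LT: "is_limit X K E (\<lambda>k k'. TM X (d k k')) (\<lambda>k. TO X (carrier (D k))) (TO X P) (\<lambda>k. TM X (\<pi> k))"
    and D: "\<And>k. k \<in> K \<Longrightarrow> differential_object X (D k)"
    and d: "\<And>k k'. (k, k') \<in> E \<Longrightarrow> linear_map X (D k) (D k') (d k k')"
    and t: "\<zeta> \<in> hom X One P" "\<sigma> \<in> hom X (cprod X P P) P" "p \<in> hom X (TO X P) P"
    and e: "\<And>k. k \<in> K \<Longrightarrow> \<pi> k \<cdot> \<zeta> = zeta (D k)"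
      "\<And>k. k \<in> K \<Longrightarrow> \<pi> k \<cdot> \<sigma> = sigma (D k) \<cdot> cmap X (\<pi> k) (\<pi> k)"
      "\<And>k. k \<in> K \<Longrightarrow> \<pi> k \<cdot> p = phat (D k) \<cdot> TM X (\<pi> k)"
  shows "differential_object X \<lparr>carrier = P, zeta = \<zeta>, sigma = \<sigma>, phat = p\<rparr>"
proof -
  note J = jointly_monicD[OF is_limit_jointly_monic[OF L]]
  have P: "P \<in> Obj X" using is_limitD(1)[OF L] .
  note t = t[unfolded in_hom_iff]
  have b: "\<zeta> \<in> Arr X" "Dom X \<zeta> = One" "Cod X \<zeta> = P" "\<sigma> \<in> Arr X" "Dom X \<sigma> = cprod X P P" "Cod X \<sigma> = P"
    "p \<in> Arr X" "Dom X p = TO X P" "Cod X p = P" using t by simp_all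
  have \<pi>: "\<pi> k \<in> Arr X" "Dom X (\<pi> k) = P" "Cod X (\<pi> k) = carrier (D k)" if "k \<in> K" for k
    using is_limitD(2-4)[OF L] that by simp_all
  note DD = differential_objectD[OF D] and DM = commutative_monoidD[OF differential_objectD(1)[OF D]]
  have \<pi>\<sigma>: "\<pi> k \<cdot> (\<sigma> \<cdot> cpair X P P u v) = sigma (D k) \<cdot> cpair X (carrier (D k)) (carrier (D k)) (\<pi> k \<cdot> u) (\<pi> k \<cdot> v)"
    if "k \<in> K" "u \<in> Arr X" "v \<in> Arr X" "Dom X u = Dom X v" "Cod X u = P" "Cod X v = P" for k u v
    using tail[OF e(2)[OF that(1)], of "cpair X P P u v"] that \<pi>[OF that(1)] b DM(1-7)[OF that(1)] P
    by (simp add: cmap_cpair)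
  have \<pi>\<zeta>: "\<pi> k \<cdot> (\<zeta> \<cdot> x) = zeta (D k) \<cdot> x" if "k \<in> K" "x \<in> Arr X" "Cod X x = One" for k x
    using tail[OF e(1)[OF that(1)], of x] that \<pi>[OF that(1)] b by simp
  have \<pi>p: "\<pi> k \<cdot> (p \<cdot> x) = phat (D k) \<cdot> (TM X (\<pi> k) \<cdot> x)" if "k \<in> K" "x \<in> Arr X" "Cod X x = TO X P" for k x
    using tail[OF e(3)[OF that(1)], of x] that \<pi>[OF that(1)] b DD(2-4)[OF that(1)] by simp
  show ?thesis
  proof (rule differential_objectI)
    show "commutative_monoid X P \<zeta> \<sigma>"
    proof (rule commutative_monoidI)
      fix u assume u: "u \<in> Arr X" "Cod X u = P"
      show "\<sigma> \<cdot> cpair X P P (\<zeta> \<cdot> bang X (Dom X u)) u = u"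
      proof (rule J)
        fix k assume k: "k \<in> K"
        show "\<pi> k \<cdot> (\<sigma> \<cdot> cpair X P P (\<zeta> \<cdot> bang X (Dom X u)) u) = \<pi> k \<cdot> u"
          using u b \<pi>[OF k] k DM(8)[OF k, of "\<pi> k \<cdot> u" "Dom X u"] by (simp add: \<pi>\<sigma> \<pi>\<zeta>)
      qed (use u b in simp_all)
    next
      fix u v assume uv: "u \<in> Arr X" "v \<in> Arr X" "Dom X u = Dom X v" "Cod X u = P" "Cod X v = P"
      show "\<sigma> \<cdot> cpair X P P u v = \<sigma> \<cdot> cpair X P P v u"
      proof (rule J)
        fix k assume k: "k \<in> K"
        show "\<pi> k \<cdot> (\<sigma> \<cdot> cpair X P P u v) = \<pi> k \<cdot> (\<sigma> \<cdot> cpair X P P v u)"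
          using uv \<pi>[OF k] k DM(9)[OF k, of "\<pi> k \<cdot> u" "\<pi> k \<cdot> v"] by (simp add: \<pi>\<sigma>)
      qed (use uv b in simp_all)
    next
      fix u v w assume uvw: "u \<in> Arr X" "v \<in> Arr X" "w \<in> Arr X" "Dom X u = Dom X v" "Dom X w = Dom X v"
        "Cod X u = P" "Cod X v = P" "Cod X w = P"
      show "\<sigma> \<cdot> cpair X P P (\<sigma> \<cdot> cpair X P P u v) w = \<sigma> \<cdot> cpair X P P u (\<sigma> \<cdot> cpair X P P v w)"
      proof (rule J)
        fix k assume k: "k \<in> K"
        show "\<pi> k \<cdot> (\<sigma> \<cdot> cpair X P P (\<sigma> \<cdot> cpair X P P u v) w) = \<pi> k \<cdot> (\<sigma> \<cdot> cpair X P P u (\<sigma> \<cdot> cpair X P P v w))"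
          using uvw \<pi>[OF k] b k DM(10)[OF k, of "\<pi> k \<cdot> u" "\<pi> k \<cdot> v" "\<pi> k \<cdot> w"] by (simp add: \<pi>\<sigma>)
      qed (use uvw b in simp_all)
    qed (use b P in simp_all)
    show "is_product X (TO X P) (tproj X P) p P P"
      unfolding is_product_def
    proof (intro conjI ballI)
      fix C f g assume "C \<in> Obj X" "f \<in> hom X C P" "g \<in> hom X C P"
      then have fg: "C \<in> Obj X" "f \<in> Arr X" "Dom X f = C" "Cod X f = P" "g \<in> Arr X" "Dom X g = C" "Cod X g = P" by auto
      define h where "h k = pair X (tproj X (carrier (D k))) (phat (D k)) (\<pi> k \<cdot> f) (\<pi> k \<cdot> g)" for k
      have h: "h k \<in> Arr X" "Dom X (h k) = C" "Cod X (h k) = TO X (carrier (D k))"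
        "tproj X (carrier (D k)) \<cdot> h k = \<pi> k \<cdot> f" "phat (D k) \<cdot> h k = \<pi> k \<cdot> g" if "k \<in> K" for k
        unfolding h_def using product_pair[OF DD(5)[OF that], of "\<pi> k \<cdot> f" "\<pi> k \<cdot> g"] \<pi>[OF that] fg by simp_all
      have u: "tproj X (carrier (D k)) \<cdot> (TM X (\<pi> k) \<cdot> x) = \<pi> k \<cdot> (tproj X P \<cdot> x)" if "k \<in> K" "x \<in> Arr X" "Cod X x = TO X P" for k x
        using tail[OF proj_nat[of "\<pi> k" "carrier (D k)"], of x] \<pi>[OF that(1)] DM(1)[OF that(1)] P that by simp
      obtain z where z: "z \<in> Arr X" "Dom X z = C" "Cod X z = TO X P" "\<And>k. k \<in> K \<Longrightarrow> TM X (\<pi> k) \<cdot> z = h k"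
      proof (rule is_limit_obtain[OF LT fg(1), of h])
        fix k k' assume kk: "(k, k') \<in> E"
        note k = is_limit_edge[OF L kk]
        note dt = is_limitD(7-9)[OF L kk]
        have dl: "d k k' \<cdot> phat (D k) = phat (D k') \<cdot> TM X (d k k')" using d[OF kk] by (simp add: linear_map_def)
        have d\<pi>: "d k k' \<cdot> (\<pi> k \<cdot> x) = \<pi> k' \<cdot> x" if "x \<in> Arr X" "Cod X x = P" for x
          using tail[OF is_limitD(6)[OF L kk], of x] \<pi>[OF k(1)] dt that by simp
        show "TM X (d k k') \<cdot> h k = h k'"
        proof (rule product_ext[OF DD(5)[OF k(2)]])
          show "tproj X (carrier (D k')) \<cdot> (TM X (d k k') \<cdot> h k) = tproj X (carrier (D k')) \<cdot> h k'"
            using tail[OF proj_nat[of "d k k'" "carrier (D k')"], of "h k"] dt h[OF k(1)] h[OF k(2)] DM(1)[OF k(1)] DM(1)[OF k(2)] fg d\<pi> by simp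
          show "phat (D k') \<cdot> (TM X (d k k') \<cdot> h k) = phat (D k') \<cdot> h k'"
            using tail[OF dl, of "h k"] dt h[OF k(1)] h[OF k(2)] DD(2-4)[OF k(1)] DD(2-4)[OF k(2)] fg d\<pi> by simp
        qed (use dt h k in simp_all)
      qed (use h in simp_all)
      have zf: "tproj X P \<cdot> z = f"
        by (rule J) (use z fg P h u in \<open>simp_all flip: u\<close>)
      have zg: "p \<cdot> z = g"
        by (rule J) (use z fg b h in \<open>simp_all add: \<pi>p\<close>)
      show "\<exists>!h. h \<in> hom X C (TO X P) \<and> tproj X P \<cdot> h = f \<and> p \<cdot> h = g"
      proof (rule ex1I[of _ z])
        show "z \<in> hom X C (TO X P) \<and> tproj X P \<cdot> z = f \<and> p \<cdot> z = g" using z(1-3) zf zg by simp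
        fix y assume y: "y \<in> hom X C (TO X P) \<and> tproj X P \<cdot> y = f \<and> p \<cdot> y = g"
        show "y = z"
        proof (rule jointly_monicD[OF is_limit_jointly_monic[OF LT]])
          fix k assume k: "k \<in> K"
          show "TM X (\<pi> k) \<cdot> y = TM X (\<pi> k) \<cdot> z"
          proof (rule product_ext[OF DD(5)[OF k]])
            show "tproj X (carrier (D k)) \<cdot> (TM X (\<pi> k) \<cdot> y) = tproj X (carrier (D k)) \<cdot> (TM X (\<pi> k) \<cdot> z)"
              using y z(1-3) k by (simp add: u zf)
            show "phat (D k) \<cdot> (TM X (\<pi> k) \<cdot> y) = phat (D k) \<cdot> (TM X (\<pi> k) \<cdot> z)"
              using y z(1-3) k zg by (simp flip: \<pi>p)
          qed (use y z(1-3) \<pi>[OF k] in simp_all)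
        qed (use y z(1-3) in simp_all)
      qed
    qed (use P b in simp_all)
    show "p \<cdot> TM X \<zeta> = \<zeta> \<cdot> bang X (TO X One)"
    proof (rule J)
      fix k assume k: "k \<in> K"
      have "TM X (\<pi> k) \<cdot> TM X \<zeta> = TM X (zeta (D k))" using arg_cong[OF e(1)[OF k], of "TM X"] \<pi>[OF k] b by simp
      then show "\<pi> k \<cdot> (p \<cdot> TM X \<zeta>) = \<pi> k \<cdot> (\<zeta> \<cdot> bang X (TO X One))"
        using k b DD(6)[OF k] by (simp add: \<pi>p \<pi>\<zeta>)
    qed (use b in simp_all)
    show "p \<cdot> TM X \<sigma> = \<sigma> \<cdot> cpair X P P (p \<cdot> TM X (cfst X P P)) (p \<cdot> TM X (csnd X P P))"
    proof (rule J)
      fix k assume k: "k \<in> K"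
      let ?A = "carrier (D k)"
      have c: "cfst X ?A ?A \<cdot> cmap X (\<pi> k) (\<pi> k) = \<pi> k \<cdot> cfst X P P" "csnd X ?A ?A \<cdot> cmap X (\<pi> k) (\<pi> k) = \<pi> k \<cdot> csnd X P P"
        using \<pi>[OF k] P by (simp_all add: cmap_cpair)
      note cm = cmap_cpair(2-4)[of "\<pi> k" "\<pi> k"]
      have Tc: "TM X (cfst X ?A ?A) \<cdot> TM X (cmap X (\<pi> k) (\<pi> k)) = TM X (\<pi> k) \<cdot> TM X (cfst X P P)"
        "TM X (csnd X ?A ?A) \<cdot> TM X (cmap X (\<pi> k) (\<pi> k)) = TM X (\<pi> k) \<cdot> TM X (csnd X P P)"
        using arg_cong[OF c(1), of "TM X"] arg_cong[OF c(2), of "TM X"] cm \<pi>[OF k] DM(1)[OF k] P by simp_all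
      have "TM X (\<pi> k) \<cdot> TM X \<sigma> = TM X (sigma (D k)) \<cdot> TM X (cmap X (\<pi> k) (\<pi> k))"
        using arg_cong[OF e(2)[OF k], of "TM X"] \<pi>[OF k] b cm DM(1-7)[OF k] by simp
      then have "\<pi> k \<cdot> (p \<cdot> TM X \<sigma>) = phat (D k) \<cdot> (TM X (sigma (D k)) \<cdot> TM X (cmap X (\<pi> k) (\<pi> k)))"
        using k b by (simp add: \<pi>p)
      also have "\<dots> = sigma (D k) \<cdot> cpair X ?A ?A (phat (D k) \<cdot> (TM X (\<pi> k) \<cdot> TM X (cfst X P P))) (phat (D k) \<cdot> (TM X (\<pi> k) \<cdot> TM X (csnd X P P)))"
        using tail[OF DD(7)[OF k], of "TM X (cmap X (\<pi> k) (\<pi> k))"] \<pi>[OF k] cm DM(1-7)[OF k] DD(2-4)[OF k] P by (simp add: Tc)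
      also have "\<dots> = \<pi> k \<cdot> (\<sigma> \<cdot> cpair X P P (p \<cdot> TM X (cfst X P P)) (p \<cdot> TM X (csnd X P P)))"
        using \<pi>[OF k] k b P by (simp add: \<pi>\<sigma> \<pi>p)
      finally show "\<pi> k \<cdot> (p \<cdot> TM X \<sigma>) = \<pi> k \<cdot> (\<sigma> \<cdot> cpair X P P (p \<cdot> TM X (cfst X P P)) (p \<cdot> TM X (csnd X P P)))" .
    qed (use b P in simp_all)
    show "p \<cdot> tzero X P = \<zeta> \<cdot> bang X P"
    proof (rule J)
      fix k assume k: "k \<in> K"
      show "\<pi> k \<cdot> (p \<cdot> tzero X P) = \<pi> k \<cdot> (\<zeta> \<cdot> bang X P)"
        using k b P \<pi>[OF k] zero_nat[of "\<pi> k" "carrier (D k)"] tail[OF DD(8)[OF k], of "\<pi> k"] DD(2-4)[OF k] DM(1-4)[OF k]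
        by (simp add: \<pi>p \<pi>\<zeta>)
    qed (use b P in simp_all)
    show "p \<cdot> tsum X P = \<sigma> \<cdot> cpair X P P (p \<cdot> tpi1 X P) (p \<cdot> tpi2 X P)"
    proof (rule J)
      fix k assume k: "k \<in> K"
      let ?A = "carrier (D k)"
      have "\<pi> k \<cdot> (p \<cdot> tsum X P) = phat (D k) \<cdot> (tsum X ?A \<cdot> T2M X (\<pi> k))"
        using k b P \<pi>[OF k] sum_nat[of "\<pi> k" ?A] by (simp add: \<pi>p)
      also have "\<dots> = sigma (D k) \<cdot> cpair X ?A ?A (phat (D k) \<cdot> (TM X (\<pi> k) \<cdot> tpi1 X P)) (phat (D k) \<cdot> (TM X (\<pi> k) \<cdot> tpi2 X P))"
        using tail[OF DD(9)[OF k], of "T2M X (\<pi> k)"] DD(2-4)[OF k] DM(1-7)[OF k] T2M_simps[of "\<pi> k"] \<pi>[OF k] by simp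
      also have "\<dots> = \<pi> k \<cdot> (\<sigma> \<cdot> cpair X P P (p \<cdot> tpi1 X P) (p \<cdot> tpi2 X P))"
        using \<pi>[OF k] k b P by (simp add: \<pi>\<sigma> \<pi>p)
      finally show "\<pi> k \<cdot> (p \<cdot> tsum X P) = \<pi> k \<cdot> (\<sigma> \<cdot> cpair X P P (p \<cdot> tpi1 X P) (p \<cdot> tpi2 X P))" .
    qed (use b P in simp_all)
    show "p \<cdot> (TM X p \<cdot> tlift X P) = p"
    proof (rule J)
      fix k assume k: "k \<in> K"
      let ?A = "carrier (D k)"
      have "TM X (\<pi> k) \<cdot> TM X p = TM X (phat (D k)) \<cdot> TM X (TM X (\<pi> k))"
        using arg_cong[OF e(3)[OF k], of "TM X"] \<pi>[OF k] b DD(2-4)[OF k] by simp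
      from tail[OF this, of "tlift X P"]
      show "\<pi> k \<cdot> (p \<cdot> (TM X p \<cdot> tlift X P)) = \<pi> k \<cdot> p"
        using k b P \<pi>[OF k] lift_nat[of "\<pi> k" ?A] DD(2-4)[OF k] DM(1)[OF k] tail3[OF DD(10)[OF k], of "TM X (\<pi> k)"] e(3)[OF k]
        by (simp add: \<pi>p)
    qed (use b P in simp_all)
  qed (use b in simp_all)
qed

text \<open>Linear maps preserve zero and sums, so the structure maps of the \<open>D k\<close> form cones.\<close>

lemma limit_differential_structure:
  assumes L: "is_limit X K E d (\<lambda>k. carrier (D k)) P \<pi>"
    and D: "\<And>k. k \<in> K \<Longrightarrow> differential_object X (D k)"
    and d: "\<And>k k'. (k, k') \<in> E \<Longrightarrow> linear_map X (D k) (D k') (d k k')"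
  obtains \<zeta> \<sigma> p where "\<zeta> \<in> hom X One P" "\<sigma> \<in> hom X (cprod X P P) P" "p \<in> hom X (TO X P) P"
    "\<And>k. k \<in> K \<Longrightarrow> \<pi> k \<cdot> \<zeta> = zeta (D k)"
    "\<And>k. k \<in> K \<Longrightarrow> \<pi> k \<cdot> \<sigma> = sigma (D k) \<cdot> cmap X (\<pi> k) (\<pi> k)"
    "\<And>k. k \<in> K \<Longrightarrow> \<pi> k \<cdot> p = phat (D k) \<cdot> TM X (\<pi> k)"
proof -
  have P: "P \<in> Obj X" using is_limitD(1)[OF L] .
  have \<pi>: "\<pi> k \<in> Arr X" "Dom X (\<pi> k) = P" "Cod X (\<pi> k) = carrier (D k)" if "k \<in> K" for k
    using is_limitD(2-4)[OF L] that by simp_all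
  note DD = differential_objectD[OF D] and DM = commutative_monoidD[OF differential_objectD(1)[OF D]]
  have dd: "d k k' \<in> Arr X" "Dom X (d k k') = carrier (D k)" "Cod X (d k k') = carrier (D k')"
    "d k k' \<cdot> phat (D k) = phat (D k') \<cdot> TM X (d k k')" "d k k' \<cdot> \<pi> k = \<pi> k'" "k \<in> K" "k' \<in> K"
    "d k k' \<cdot> zeta (D k) = zeta (D k')" if "(k, k') \<in> E" for k k'
    using d[OF that] is_limitD(6)[OF L that] is_limit_edge[OF L that] linear_map_additive(1)[OF D D d[OF that]]
    by (simp_all add: linear_map_def)
  obtain \<zeta> where \<zeta>: "\<zeta> \<in> Arr X" "Dom X \<zeta> = One" "Cod X \<zeta> = P" "\<And>k. k \<in> K \<Longrightarrow> \<pi> k \<cdot> \<zeta> = zeta (D k)"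
    by (rule is_limit_obtain[OF L, of One "\<lambda>k. zeta (D k)"]) (use DM(2-4) dd(8) in simp_all)
  obtain \<sigma> where \<sigma>: "\<sigma> \<in> Arr X" "Dom X \<sigma> = cprod X P P" "Cod X \<sigma> = P"
    "\<And>k. k \<in> K \<Longrightarrow> \<pi> k \<cdot> \<sigma> = sigma (D k) \<cdot> cmap X (\<pi> k) (\<pi> k)"
  proof (rule is_limit_obtain[OF L, of "cprod X P P" "\<lambda>k. sigma (D k) \<cdot> cmap X (\<pi> k) (\<pi> k)"])
    fix k k' assume kk: "(k, k') \<in> E"
    note d' = dd[OF kk]
    note \<pi>1 = \<pi>[OF d'(6)] and \<pi>2 = \<pi>[OF d'(7)] and M1 = DM(1-7)[OF d'(6)] and M2 = DM(1-7)[OF d'(7)]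
    show "d k k' \<cdot> (sigma (D k) \<cdot> cmap X (\<pi> k) (\<pi> k)) = sigma (D k') \<cdot> cmap X (\<pi> k') (\<pi> k')"
      using linear_map_additive(2)[OF D[OF d'(6)] D[OF d'(7)] d[OF kk], of "\<pi> k \<cdot> cfst X P P" "\<pi> k \<cdot> csnd X P P"]
        tail[OF d'(5), of "cfst X P P"] tail[OF d'(5), of "csnd X P P"] \<pi>1 \<pi>2 M1 M2 d'(1-3) P
      by (simp add: cmap_cpair)
  qed (use P \<pi> DM(5-7) in \<open>simp_all add: cmap_cpair(2-4)\<close>)
  obtain p where p: "p \<in> Arr X" "Dom X p = TO X P" "Cod X p = P" "\<And>k. k \<in> K \<Longrightarrow> \<pi> k \<cdot> p = phat (D k) \<cdot> TM X (\<pi> k)"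
  proof (rule is_limit_obtain[OF L, of "TO X P" "\<lambda>k. phat (D k) \<cdot> TM X (\<pi> k)"])
    fix k k' assume kk: "(k, k') \<in> E"
    note d' = dd[OF kk]
    note \<pi>1 = \<pi>[OF d'(6)] and \<pi>2 = \<pi>[OF d'(7)]
    have "TM X (d k k') \<cdot> TM X (\<pi> k) = TM X (\<pi> k')" using arg_cong[OF d'(5), of "TM X"] d'(1-3) \<pi>1 by simp
    then show "d k k' \<cdot> (phat (D k) \<cdot> TM X (\<pi> k)) = phat (D k') \<cdot> TM X (\<pi> k')"
      using tail[OF d'(4), of "TM X (\<pi> k)"] d'(1-3) \<pi>1 DD(2-4)[OF d'(6)] DD(2-4)[OF d'(7)] by simp
  qed (use P \<pi> DD(2-4) in simp_all)
  show thesis using that[of \<zeta> \<sigma> p] \<zeta> \<sigma> p by simp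
qed

text \<open>The flip is its own inverse, and it makes the tangent bundle functor a tangent morphism.\<close>

lemma product_endomorphism_T: "product_endomorphism X (TO X) (TM X) (tflip X)"
proof
  show "lax_tangent_morphism X X (TO X) (TM X) (tflip X)"
    unfolding lax_tangent_morphism_def
    using tangent_category_axioms T_functor flip_natural flip_proj flip_zero flip_sum lift_flip flip_braid by simp
  show "is_terminal X (TO X One)" by (rule T_terminal)
  fix A B assume "A \<in> Obj X" "B \<in> Obj X"
  then show "is_product X (TO X (cprod X A B)) (TM X (cfst X A B)) (TM X (csnd X A B)) (TO X A) (TO X B)"
    by (rule T_product)
next
  fix A assume "A \<in> Obj X"
  then show "is_iso X (tflip X A)" unfolding is_iso_def using flip_flip[of A] by (auto intro!: bexI[of _ "tflip X A"])
qed

lemma DO_T_eq: "differential_object X D \<Longrightarrow> DO_T X D = product_endomorphism.F_DO X (TO X) (TM X) (tflip X) D"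
  using commutative_monoidD(1)[OF differential_objectD(1), of D]
    inverse_arr_eq[of "tflip X (carrier D)" "tflip X (carrier D)"] flip_flip[of "carrier D"]
  by (simp add: DO_T_def product_endomorphism.F_DO_def[OF product_endomorphism_T])

lemma DO_T_differential_object:
  assumes "differential_object X D" shows "differential_object X (DO_T X D)"
  using product_endomorphism.F_DO_differential_object[OF product_endomorphism_T assms] DO_T_eq[OF assms] by simp

lemma DO_T_linear:
  assumes "differential_object X D" "differential_object X E" "linear_map X D E f"
  shows "linear_map X (DO_T X D) (DO_T X E) (TM X f)"
  using product_endomorphism.F_DO_linear[OF product_endomorphism_T assms] DO_T_eq assms by simp

lemma carrier_Obj [simp]: "differential_object X D \<Longrightarrow> carrier D \<in> Obj X"
  using commutative_monoidD(1)[OF differential_objectD(1)] .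

lemma proj_linear:
  assumes D: "differential_object X D" shows "linear_map X (DO_T X D) D (tproj X (carrier D))"
  using differential_objectD(2-4)[OF D] D tail[OF proj_nat[of "phat D" "carrier D"], of "tflip X (carrier D)"]
  by (simp add: linear_map_def DO_T_def flip_proj)

lemma zero_linear:
  assumes D: "differential_object X D" shows "linear_map X D (DO_T X D) (tzero X (carrier D))"
  using differential_objectD(2-4)[OF D] D zero_nat[of "phat D" "carrier D"]
  by (simp add: linear_map_def DO_T_def flip_zero)

lemma lift_linear:
  assumes D: "differential_object X D" shows "linear_map X (DO_T X D) (DO_T X (DO_T X D)) (tlift X (carrier D))"
  using differential_objectD(2-4)[OF D] D tail[OF lift_nat[of "phat D" "carrier D"], of "tflip X (carrier D)"]
  by (simp add: linear_map_def DO_T_def lift_flip)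

lemma flip_linear:
  assumes D: "differential_object X D" shows "linear_map X (DO_T X (DO_T X D)) (DO_T X (DO_T X D)) (tflip X (carrier D))"
  using differential_objectD(2-4)[OF D] D
    tail[OF flip_nat[of "phat D" "carrier D"], of "TM X (tflip X (carrier D)) \<cdot> tflip X (TO X (carrier D))"]
  by (simp add: linear_map_def DO_T_def flip_braid)

end

context tangent_category
begin

lemma pair2_eqI:
  assumes "A \<in> Obj X" "h \<in> Arr X" "Dom X h = Dom X u" "Cod X h = T2 X A" "tpi1 X A \<cdot> h = u" "tpi2 X A \<cdot> h = v"
  shows "pair2 X A u v = h"
  unfolding pair2_def
  by (rule pair_eqI[where A = undefined and B = undefined, OF disjI2[OF T2_pullback[OF assms(1)]]]) (use assms in simp_all)

end

context cartesian_tangent_category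
begin

lemma cpair_eqI:
  assumes "A \<in> Obj X" "B \<in> Obj X" "h \<in> Arr X" "Dom X h = Dom X u" "Cod X h = cprod X A B" "cfst X A B \<cdot> h = u" "csnd X A B \<cdot> h = v"
  shows "cpair X A B u v = h"
  unfolding cpair_def
  by (rule pair_eqI[where f = undefined and g = undefined, OF disjI1[OF product[OF assms(1,2)]]]) (use assms in simp_all)

lemma DO_simps [simp]:
  "D \<in> Obj (DO X) \<longleftrightarrow> differential_object X D"
  "Dom (DO X) = asrc" "Cod (DO X) = atrg" "idt (DO X) D = Arrow D (idt X (carrier D)) D"
  "g \<cdot>\<^bsub>DO X\<^esub> f = Arrow (asrc f) (amap g \<cdot> amap f) (atrg g)"
  "TO (DO X) = DO_T X" "TM (DO X) f = Arrow (DO_T X (asrc f)) (TM X (amap f)) (DO_T X (atrg f))"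
  "T2 (DO X) = DO_T2 X"
  "tpi1 (DO X) D = Arrow (DO_T2 X D) (tpi1 X (carrier D)) (DO_T X D)"
  "tpi2 (DO X) D = Arrow (DO_T2 X D) (tpi2 X (carrier D)) (DO_T X D)"
  "tproj (DO X) D = Arrow (DO_T X D) (tproj X (carrier D)) D"
  "tzero (DO X) D = Arrow D (tzero X (carrier D)) (DO_T X D)"
  "tsum (DO X) D = Arrow (DO_T2 X D) (tsum X (carrier D)) (DO_T X D)"
  "tlift (DO X) D = Arrow (DO_T X D) (tlift X (carrier D)) (DO_T X (DO_T X D))"
  "tflip (DO X) D = Arrow (DO_T X (DO_T X D)) (tflip X (carrier D)) (DO_T X (DO_T X D))"
  "terminal (DO X) = DO_terminal X" "cprod (DO X) = DO_prod X"
  "cfst (DO X) D E = Arrow (DO_prod X D E) (cfst X (carrier D) (carrier E)) D"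
  "csnd (DO X) D E = Arrow (DO_prod X D E) (csnd X (carrier D) (carrier E)) E"
  by (simp_all add: DO_def)

lemma DO_Arr_iff [simp]: "f \<in> Arr (DO X) \<longleftrightarrow> differential_object X (asrc f) \<and> differential_object X (atrg f) \<and>
    linear_map X (asrc f) (atrg f) (amap f)"
  by (cases f) (auto simp: DO_def)

lemma linear_mapD:
  "linear_map X D E f \<Longrightarrow> f \<in> Arr X" "linear_map X D E f \<Longrightarrow> Dom X f = carrier D" "linear_map X D E f \<Longrightarrow> Cod X f = carrier E"
  "linear_map X D E f \<Longrightarrow> f \<cdot> phat D = phat E \<cdot> TM X f"
  by (auto simp: linear_map_def)

lemma linear_map_comp:
  assumes D: "differential_object X D" "differential_object X E" "differential_object X F"
    and f: "linear_map X D E f" and g: "linear_map X E F g"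
  shows "linear_map X D F (g \<cdot> f)"
  using linear_mapD[OF f] linear_mapD[OF g] differential_objectD(2-4)[OF D(1)] differential_objectD(2-4)[OF D(2)]
    differential_objectD(2-4)[OF D(3)] tail[OF linear_mapD(4)[OF g], of "TM X f"]
  by (simp add: linear_map_def)

lemma linear_map_idt: "differential_object X D \<Longrightarrow> linear_map X D D (idt X (carrier D))"
  using differential_objectD(2-4)[of D] by (simp add: linear_map_def)

lemma category_DO: "category (DO X)"
  by unfold_locales (auto simp: linear_map_comp linear_map_idt linear_mapD arrow.expand)

lemma linear_map_structure:
  assumes D: "differential_object X D" and E: "differential_object X E" and f: "linear_map X D E f"
  shows "f \<cdot> zeta D = zeta E" "f \<cdot> sigma D = sigma E \<cdot> cmap X f f" "f \<cdot> phat D = phat E \<cdot> TM X f"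
proof -
  note M = commutative_monoidD(1-7)[OF differential_objectD(1)[OF D]]
  have "cpair X (carrier D) (carrier D) (cfst X (carrier D) (carrier D)) (csnd X (carrier D) (carrier D)) = idt X (cprod X (carrier D) (carrier D))"
    using M(1) by - (rule cpair_eqI, simp_all)
  then show "f \<cdot> sigma D = sigma E \<cdot> cmap X f f"
    using linear_map_additive(2)[OF D E f, of "cfst X (carrier D) (carrier D)" "csnd X (carrier D) (carrier D)"] M linear_mapD[OF f]
    by (simp add: cmap_cpair)
qed (use linear_map_additive(1)[OF D E f] linear_mapD[OF f] in simp_all)

lemma DO_limit:
  assumes L: "T_limit K E d (\<lambda>k. carrier (D k)) P \<pi>"
    and D: "\<And>k. k \<in> K \<Longrightarrow> differential_object X (D k)"
    and d: "\<And>k k'. (k, k') \<in> E \<Longrightarrow> linear_map X (D k) (D k') (d k k')"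
  obtains Q where "differential_object X Q" "carrier Q = P" "\<forall>k\<in>K. linear_map X Q (D k) (\<pi> k)"
proof -
  note L' = T_limitD(1,2)[OF L]
  obtain \<zeta> \<sigma> p where *: "\<zeta> \<in> hom X One P" "\<sigma> \<in> hom X (cprod X P P) P" "p \<in> hom X (TO X P) P"
    "\<And>k. k \<in> K \<Longrightarrow> \<pi> k \<cdot> \<zeta> = zeta (D k)"
    "\<And>k. k \<in> K \<Longrightarrow> \<pi> k \<cdot> \<sigma> = sigma (D k) \<cdot> cmap X (\<pi> k) (\<pi> k)"
    "\<And>k. k \<in> K \<Longrightarrow> \<pi> k \<cdot> p = phat (D k) \<cdot> TM X (\<pi> k)"
    using limit_differential_structure[OF L'(1) D d] by blast
  show thesis
  proof (rule that)
    show "differential_object X \<lparr>carrier = P, zeta = \<zeta>, sigma = \<sigma>, phat = p\<rparr>"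
      by (rule limit_differential_object[OF L' D d *])
    show "\<forall>k\<in>K. linear_map X \<lparr>carrier = P, zeta = \<zeta>, sigma = \<sigma>, phat = p\<rparr> (D k) (\<pi> k)"
      using is_limitD(2-4)[OF L'(1)] *(6) by (simp add: linear_map_def)
  qed simp
qed

lemma DO_fold:
  assumes D: "differential_object X D"
    and L: "T_limit {..n} ({..<n} \<times> {n}) (\<lambda>_ _. tproj X (carrier D)) ((\<lambda>_. TO X (carrier D))(n := carrier D)) P \<pi>"
  obtains Q where "differential_object X Q" "carrier Q = P" "linear_map X Q D (\<pi> n)"
    "\<forall>j<n. linear_map X Q (DO_T X D) (\<pi> j)"
proof -
  define B where "B k = (if k = n then D else DO_T X D)" for k
  have [simp]: "carrier (DO_T X D) = TO X (carrier D)" by (simp add: DO_T_def)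
  have L': "T_limit {..n} ({..<n} \<times> {n}) (\<lambda>_ _. tproj X (carrier D)) (\<lambda>k. carrier (B k)) P \<pi>"
    by (rule back_subst[of "\<lambda>B. T_limit {..n} ({..<n} \<times> {n}) (\<lambda>_ _. tproj X (carrier D)) B P \<pi>", OF L]) (auto simp: B_def)
  obtain Q where Q: "differential_object X Q" "carrier Q = P" "\<forall>k\<in>{..n}. linear_map X Q (B k) (\<pi> k)"
  proof (rule DO_limit[OF L'])
    show "differential_object X (B k)" for k using D DO_T_differential_object[OF D] by (simp add: B_def)
    show "(k, k') \<in> {..<n} \<times> {n} \<Longrightarrow> linear_map X (B k) (B k') (tproj X (carrier D))" for k k'
      using proj_linear[OF D] by (auto simp: B_def)
  qed
  have "linear_map X Q D (\<pi> n)" using bspec[OF Q(3), of n] by (simp add: B_def)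
  moreover have "\<forall>j<n. linear_map X Q (DO_T X D) (\<pi> j)"
  proof (intro allI impI)
    fix j assume "j < n"
    then show "linear_map X Q (DO_T X D) (\<pi> j)" using bspec[OF Q(3), of j] by (simp add: B_def)
  qed
  ultimately show thesis using that Q by blast
qed

text \<open>There is only one differential structure on \<open>T\<^sub>2 A\<close> for which both projections are linear.\<close>

lemma DO_T2_unique:
  assumes D: "differential_object X D" and Q: "differential_object X Q" "carrier Q = T2 X (carrier D)"
    and l: "linear_map X Q (DO_T X D) (tpi1 X (carrier D))" "linear_map X Q (DO_T X D) (tpi2 X (carrier D))"
  shows "DO_T2 X D = Q"
proof -
  let ?A = "carrier D"
  have A: "?A \<in> Obj X" using D by simp
  note l1 = linear_map_structure[OF Q(1) DO_T_differential_object[OF D] l(1)]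
    and l2 = linear_map_structure[OF Q(1) DO_T_differential_object[OF D] l(2)]
  have c: "carrier (DO_T X D) = TO X ?A" by (simp add: DO_T_def)
  note M = commutative_monoidD(1-7)[OF differential_objectD(1)[OF DO_T_differential_object[OF D]], unfolded c]
    differential_objectD(2-4)[OF DO_T_differential_object[OF D], unfolded c]
    commutative_monoidD(1-7)[OF differential_objectD(1)[OF Q(1)], unfolded Q(2)]
    differential_objectD(2-4)[OF Q(1), unfolded Q(2)]
  have "pair2 X ?A (zeta (DO_T X D)) (zeta (DO_T X D)) = zeta Q"
    by (rule pair2_eqI) (use A l1 l2 M in simp_all)
  moreover have "pair2 X ?A (sigma (DO_T X D) \<cdot> cmap X (tpi1 X ?A) (tpi1 X ?A)) (sigma (DO_T X D) \<cdot> cmap X (tpi2 X ?A) (tpi2 X ?A)) = sigma Q"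
    by (rule pair2_eqI) (use A l1 l2 M in \<open>simp_all add: cmap_cpair(2-4)\<close>)
  moreover have "pair2 X ?A (phat (DO_T X D) \<cdot> TM X (tpi1 X ?A)) (phat (DO_T X D) \<cdot> TM X (tpi2 X ?A)) = phat Q"
    by (rule pair2_eqI) (use A l1 l2 M in simp_all)
  ultimately show ?thesis using Q(2) by (simp add: DO_T2_def Let_def)
qed

text \<open>The limit supplies some differential structure on \<open>T\<^sub>2 A\<close> with linear projections; by uniqueness it is
  the explicit one.\<close>

lemma DO_T2_differential_object:
  assumes D: "differential_object X D"
  shows "differential_object X (DO_T2 X D)" "linear_map X (DO_T2 X D) (DO_T X D) (tpi1 X (carrier D))"
    "linear_map X (DO_T2 X D) (DO_T X D) (tpi2 X (carrier D))"
proof -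
  let ?A = "carrier D"
  have A: "?A \<in> Obj X" using D by simp
  obtain Q where Q: "differential_object X Q" "carrier Q = T2 X ?A" "linear_map X Q D (T2_legs ?A 2)"
    "\<forall>j<2. linear_map X Q (DO_T X D) (T2_legs ?A j)"
    by (rule DO_fold[OF D T2_T_limit[OF A]])
  have l: "linear_map X Q (DO_T X D) (tpi1 X ?A)" "linear_map X Q (DO_T X D) (tpi2 X ?A)"
    using Q(4)[rule_format, of 0] Q(4)[rule_format, of 1] by simp_all
  have "DO_T2 X D = Q" by (rule DO_T2_unique[OF D Q(1,2) l])
  then show "differential_object X (DO_T2 X D)" "linear_map X (DO_T2 X D) (DO_T X D) (tpi1 X (carrier D))"
    "linear_map X (DO_T2 X D) (DO_T X D) (tpi2 X (carrier D))" using Q(1) l by simp_all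
qed

text \<open>As for \<open>T\<^sub>2 A\<close>, the structure that the limit supplies has the explicit components because its projections
  are linear.\<close>

lemma DO_prod_differential_object:
  assumes D: "differential_object X D" and E: "differential_object X E"
  shows "differential_object X (DO_prod X D E)" "linear_map X (DO_prod X D E) D (cfst X (carrier D) (carrier E))"
    "linear_map X (DO_prod X D E) E (csnd X (carrier D) (carrier E))"
proof -
  let ?A = "carrier D" and ?B = "carrier E" and ?D = "case_nat D (\<lambda>_. E)"
  let ?\<pi> = "case_nat (cfst X ?A ?B) (\<lambda>_. csnd X ?A ?B)"
  have A: "?A \<in> Obj X" "?B \<in> Obj X" using D E by simp_all
  have "T_limit {0, 1} {} undefined (case_nat ?A (\<lambda>_. ?B)) (cprod X ?A ?B) ?\<pi>"
    by (rule product_T_limit[OF product[OF A]])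
  moreover have "case_nat ?A (\<lambda>_. ?B) = (\<lambda>k. carrier (?D k))" by (auto split: nat.split)
  ultimately have L: "T_limit {0, 1} {} undefined (\<lambda>k. carrier (?D k)) (cprod X ?A ?B) ?\<pi>" by simp
  obtain Q where Q: "differential_object X Q" "carrier Q = cprod X ?A ?B" "\<forall>k\<in>{0, 1}. linear_map X Q (?D k) (?\<pi> k)"
    by (rule DO_limit[OF L]) (use D E in auto)
  have l: "linear_map X Q D (cfst X ?A ?B)" "linear_map X Q E (csnd X ?A ?B)" using Q(3) by auto
  note l1 = linear_map_structure[OF Q(1) D l(1)] and l2 = linear_map_structure[OF Q(1) E l(2)]
  note M = commutative_monoidD(1-7)[OF differential_objectD(1)[OF D]] differential_objectD(2-4)[OF D]
    commutative_monoidD(1-7)[OF differential_objectD(1)[OF E]] differential_objectD(2-4)[OF E]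
    commutative_monoidD(1-7)[OF differential_objectD(1)[OF Q(1)], unfolded Q(2)]
    differential_objectD(2-4)[OF Q(1), unfolded Q(2)]
  have "cpair X ?A ?B (zeta D) (zeta E) = zeta Q"
    by (rule cpair_eqI) (use A l1 l2 M in simp_all)
  moreover have "cpair X ?A ?B (sigma D \<cdot> cmap X (cfst X ?A ?B) (cfst X ?A ?B)) (sigma E \<cdot> cmap X (csnd X ?A ?B) (csnd X ?A ?B)) = sigma Q"
    by (rule cpair_eqI) (use A l1 l2 M in \<open>simp_all add: cmap_cpair(2-4)\<close>)
  moreover have "cpair X ?A ?B (phat D \<cdot> TM X (cfst X ?A ?B)) (phat E \<cdot> TM X (csnd X ?A ?B)) = phat Q"
    by (rule cpair_eqI) (use A l1 l2 M in simp_all)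
  ultimately have "DO_prod X D E = Q" using Q(2) by (simp add: DO_prod_def Let_def)
  then show "differential_object X (DO_prod X D E)" "linear_map X (DO_prod X D E) D (cfst X (carrier D) (carrier E))"
    "linear_map X (DO_prod X D E) E (csnd X (carrier D) (carrier E))" using Q(1) l by simp_all
qed

lemma DO_terminal_differential_object: "differential_object X (DO_terminal X)"
proof -
  obtain Q where Q: "differential_object X Q" "carrier Q = One"
    by (rule DO_limit[OF terminal_T_limit[OF terminal], of undefined undefined undefined]) auto
  note M = commutative_monoidD(1-7)[OF differential_objectD(1)[OF Q(1)], unfolded Q(2)]
    differential_objectD(2-4)[OF Q(1), unfolded Q(2)]
  have "zeta Q = idt X One" "sigma Q = bang X (cprod X One One)" "phat Q = bang X (TO X One)"
    using bang_unique[of "zeta Q"] bang_unique[of "idt X One"] bang_unique[of "sigma Q"] bang_unique[of "phat Q"] M by simp_all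
  then have "DO_terminal X = Q" using Q(2) by (simp add: DO_terminal_def Let_def)
  then show ?thesis using Q(1) by simp
qed

lemma sum_linear:
  assumes D: "differential_object X D"
  shows "linear_map X (DO_T2 X D) (DO_T X D) (tsum X (carrier D))"
proof -
  let ?A = "carrier D"
  define p where "p = phat D"
  define q where "q = phat (DO_T2 X D)"
  have A: "?A \<in> Obj X" using D by simp
  have c2: "carrier (DO_T2 X D) = T2 X ?A" by (simp add: DO_T2_def Let_def)
  note p = differential_objectD(2-4)[OF D, folded p_def]
  note q = differential_objectD(2-4)[OF DO_T2_differential_object(1)[OF D], folded q_def, unfolded c2]
  have l: "tpi1 X ?A \<cdot> q = TM X p \<cdot> (tflip X ?A \<cdot> TM X (tpi1 X ?A))" "tpi2 X ?A \<cdot> q = TM X p \<cdot> (tflip X ?A \<cdot> TM X (tpi2 X ?A))"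
    using linear_mapD(4)[OF DO_T2_differential_object(2)[OF D]] linear_mapD(4)[OF DO_T2_differential_object(3)[OF D]] p A
    unfolding q_def p_def by (simp_all add: DO_T_def)
  define w where "w = pair2 X (TO X ?A) (tflip X ?A \<cdot> TM X (tpi1 X ?A)) (tflip X ?A \<cdot> TM X (tpi2 X ?A))"
  have w: "w \<in> Arr X" "Dom X w = TO X (T2 X ?A)" "Cod X w = T2 X (TO X ?A)"
    "tpi1 X (TO X ?A) \<cdot> w = tflip X ?A \<cdot> TM X (tpi1 X ?A)" "tpi2 X (TO X ?A) \<cdot> w = tflip X ?A \<cdot> TM X (tpi2 X ?A)"
  proof -
    have "TM X (tproj X ?A) \<cdot> TM X (tpi1 X ?A) = TM X (tproj X ?A) \<cdot> TM X (tpi2 X ?A)"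
      using arg_cong[OF tpi_proj[OF A], of "TM X"] A by simp
    then show "w \<in> Arr X" "Dom X w = TO X (T2 X ?A)" "Cod X w = T2 X (TO X ?A)"
      "tpi1 X (TO X ?A) \<cdot> w = tflip X ?A \<cdot> TM X (tpi1 X ?A)" "tpi2 X (TO X ?A) \<cdot> w = tflip X ?A \<cdot> TM X (tpi2 X ?A)"
      unfolding w_def using A by (simp_all add: flip_tails)
  qed
  note m = T2M_simps[OF p(1), unfolded p(2,3)]
  have "T2M X p \<cdot> w = q"
    by (rule T2_ext[OF A]) (use A p q w m in \<open>simp_all add: l tail[OF m(4)] tail[OF m(5)]\<close>)
  then have "tsum X ?A \<cdot> q = tsum X ?A \<cdot> (T2M X p \<cdot> w)" by simp
  also have "\<dots> = TM X p \<cdot> (tsum X (TO X ?A) \<cdot> w)" using tail[OF sum_nat[OF p(1,3)], of w] p w m A by simp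
  also have "tsum X (TO X ?A) \<cdot> w = tflip X ?A \<cdot> TM X (tsum X ?A)" unfolding w_def using flip_sum[OF A] by simp
  finally show ?thesis
    using A p unfolding linear_map_def q_def[symmetric] by (simp add: DO_T_def c2 p_def)
qed

text \<open>Maps lift along jointly monic legs because both sides of the linearity equation for a map into \<open>P\<close> end
  in \<open>P\<close>, where they can be compared on the legs.\<close>

lemma DO_creation: "cartesian_creation X (DO X) {()} (\<lambda>_. carrier) (\<lambda>_. amap)"
proof -
  interpret DO: category "DO X" by (rule category_DO)
  have c [simp]: "carrier (DO_T X D) = TO X (carrier D)" "carrier (DO_T2 X D) = T2 X (carrier D)" for D
    by (simp_all add: DO_T_def DO_T2_def Let_def)
  have F: "is_functor (DO X) X carrier amap"
    unfolding is_functor_def using DO.category_axioms category_axioms by (auto simp: linear_mapD)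
  show ?thesis
  proof
    show "tangent_typing (DO X)"
      unfolding tangent_typing_def using DO_T_differential_object DO_T2_differential_object proj_linear zero_linear
        lift_linear flip_linear sum_linear DO_T_linear by auto
    show "preserves_tangent_structure (DO X) X carrier amap"
      unfolding preserves_tangent_structure_def using F by auto
    show "f \<in> Arr (DO X) \<Longrightarrow> g \<in> Arr (DO X) \<Longrightarrow> Dom (DO X) f = Dom (DO X) g \<Longrightarrow> Cod (DO X) f = Cod (DO X) g \<Longrightarrow>
      (\<And>i. i \<in> {()} \<Longrightarrow> amap f = amap g) \<Longrightarrow> f = g" for f g
      by (cases f, cases g) auto
    fix C P and K :: "nat set" and \<pi> v and h :: "unit \<Rightarrow> 'a"
    assume CP: "C \<in> Obj (DO X)" "P \<in> Obj (DO X)"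
      and \<pi>: "\<And>k. k \<in> K \<Longrightarrow> \<pi> k \<in> Arr (DO X) \<and> Dom (DO X) (\<pi> k) = P \<and>
        v k \<in> Arr (DO X) \<and> Dom (DO X) (v k) = C \<and> Cod (DO X) (v k) = Cod (DO X) (\<pi> k)"
      and J: "\<And>i. i \<in> {()} \<Longrightarrow> jointly_monic X K (carrier P) (\<lambda>k. amap (\<pi> k)) \<and>
        jointly_monic X K (TO X (carrier P)) (\<lambda>k. TM X (amap (\<pi> k)))"
      and h: "\<And>i. i \<in> {()} \<Longrightarrow> h i \<in> Arr X \<and> Dom X (h i) = carrier C \<and> Cod X (h i) = carrier P"
      and e: "\<And>i k. i \<in> {()} \<Longrightarrow> k \<in> K \<Longrightarrow> amap (\<pi> k) \<cdot> h i = amap (v k)"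
    have CP': "differential_object X C" "differential_object X P" using CP by auto
    note dC = differential_objectD(2-4)[OF CP'(1)] and dP = differential_objectD(2-4)[OF CP'(2)]
    have h': "h () \<in> Arr X" "Dom X (h ()) = carrier C" "Cod X (h ()) = carrier P" using h by auto
    have "h () \<cdot> phat C = phat P \<cdot> TM X (h ())"
    proof (rule jointly_monicD[OF conjunct1[OF J]])
      fix k assume k: "k \<in> K"
      have k': "linear_map X P (atrg (\<pi> k)) (amap (\<pi> k))" "linear_map X C (atrg (\<pi> k)) (amap (v k))"
        "differential_object X (atrg (\<pi> k))" using \<pi>[OF k] by auto
      note lp = linear_mapD[OF k'(1)] and lv = linear_mapD[OF k'(2)] and dk = differential_objectD(2-4)[OF k'(3)]
      have e': "amap (\<pi> k) \<cdot> h () = amap (v k)" using e k by simp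
      have "TM X (amap (\<pi> k)) \<cdot> TM X (h ()) = TM X (amap (v k))"
        using arg_cong[OF e', of "TM X"] lp(1-3) h' by simp
      then show "amap (\<pi> k) \<cdot> (h () \<cdot> phat C) = amap (\<pi> k) \<cdot> (phat P \<cdot> TM X (h ()))"
        using tail[OF e', of "phat C"] tail[OF lp(4), of "TM X (h ())"] lp(1-3) lv dC dP dk h' by simp
    qed (use dC dP h' in simp_all)
    then show "\<exists>h'\<in>hom (DO X) C P. \<forall>i\<in>{()}. amap h' = h i"
      using CP' h' by (intro bexI[of _ "Arrow C (h ()) P"]) (auto simp: linear_map_def)
  next
    fix D n assume "D \<in> Obj (DO X)"
    then have D: "differential_object X D" "carrier D \<in> Obj X" by auto
    obtain P q \<pi> where F: "\<forall>m. is_fold_pullback X n ((TM X ^^ m) (tproj X (carrier D))) ((TO X ^^ m) P) ((TM X ^^ m) q)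
        (\<lambda>i. (TM X ^^ m) (\<pi> i))"
      using fold_pullbacks[OF D(2), of n] by blast
    obtain E where E: "differential_object X E" "carrier E = P" "linear_map X E D ((\<pi>(n := q)) n)"
      "\<forall>j<n. linear_map X E (DO_T X D) ((\<pi>(n := q)) j)"
      by (rule DO_fold[OF D(1) T_limit_fold[OF D(2) F]])
    have q: "linear_map X E D q" using E(3) by simp
    have \<pi>: "linear_map X E (DO_T X D) (\<pi> j)" if "j < n" for j using E(4)[rule_format, OF that] that by simp
    show "\<exists>P q \<pi>. q \<in> hom (DO X) P D \<and> (\<forall>j<n. \<pi> j \<in> hom (DO X) P (TO (DO X) D)) \<and>
      (\<forall>i\<in>{()}. \<forall>m. is_fold_pullback X n ((TM X ^^ m) (tproj X (carrier D))) ((TO X ^^ m) (carrier P))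
        ((TM X ^^ m) (amap q)) (\<lambda>j. (TM X ^^ m) (amap (\<pi> j))))"
      by (rule exI[of _ E], rule exI[of _ "Arrow E q D"], rule exI[of _ "\<lambda>j. Arrow E (\<pi> j) (DO_T X D)"])
        (use E(1,2) q \<pi> D F DO_T_differential_object in simp)
  next
    show "terminal (DO X) \<in> Obj (DO X)" using DO_terminal_differential_object by simp
    show "i \<in> {()} \<Longrightarrow> carrier (terminal (DO X)) = terminal X" for i :: unit by (simp add: DO_terminal_def Let_def)
    fix D E assume "D \<in> Obj (DO X)" "E \<in> Obj (DO X)"
    then show "cprod (DO X) D E \<in> Obj (DO X) \<and> cfst (DO X) D E \<in> hom (DO X) (cprod (DO X) D E) D \<and>
        csnd (DO X) D E \<in> hom (DO X) (cprod (DO X) D E) E"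
      "carrier (cprod (DO X) D E) = cprod X (carrier D) (carrier E) \<and> amap (cfst (DO X) D E) = cfst X (carrier D) (carrier E) \<and>
        amap (csnd (DO X) D E) = csnd X (carrier D) (carrier E)"
      using DO_prod_differential_object[of D E] by (simp_all add: DO_prod_def Let_def)
  qed
qed

end

section \<open>Tangent monads, 1-morphisms and 2-morphisms\<close>

lemma tangent_transformationD:
  assumes "tangent_transformation X' X FO FM \<alpha> HO HM \<beta> \<phi>"
  shows "natural_transformation X' X FO FM HO HM \<phi>"
    "\<And>A. A \<in> Obj X' \<Longrightarrow> TM X (\<phi> A) \<cdot>\<^bsub>X\<^esub> \<alpha> A = \<beta> A \<cdot>\<^bsub>X\<^esub> \<phi> (TO X' A)"
  using assms by (auto simp: tangent_transformation_def)

locale monad_on_tangent_category =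
  fixes S :: "('o, 'a, 'm) tangent_monad"
  assumes tangent_monad: "tangent_monad S"
begin

abbreviation X where "X \<equiv> base S"

lemma tangent_monadD:
  "lax_tangent_morphism X X (SO S) (SM S) (sdist S)"
  "tangent_transformation X X (\<lambda>A. A) (\<lambda>f. f) (\<lambda>A. idt X (TO X A)) (SO S) (SM S) (sdist S) (eta S)"
  "tangent_transformation X X (SO S \<circ> SO S) (SM S \<circ> SM S)
     (\<lambda>A. sdist S (SO S A) \<cdot>\<^bsub>X\<^esub> SM S (sdist S A)) (SO S) (SM S) (sdist S) (mu S)"
  using tangent_monad by (auto simp: tangent_monad_def Let_def)

sublocale X: tangent_category "base S"
  using lax_tangent_morphismD(1)[OF tangent_monadD(1)] .

abbreviation cmp (infixr \<open>\<bullet>\<close> 70) where "g \<bullet> f \<equiv> g \<cdot>\<^bsub>X\<^esub> f"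

lemma S_simps [simp]:
  "A \<in> Obj X \<Longrightarrow> SO S A \<in> Obj X"
  "f \<in> Arr X \<Longrightarrow> SM S f \<in> Arr X"
  "f \<in> Arr X \<Longrightarrow> Dom X (SM S f) = SO S (Dom X f)"
  "f \<in> Arr X \<Longrightarrow> Cod X (SM S f) = SO S (Cod X f)"
  "A \<in> Obj X \<Longrightarrow> SM S (idt X A) = idt X (SO S A)"
  "f \<in> Arr X \<Longrightarrow> g \<in> Arr X \<Longrightarrow> Dom X g = Cod X f \<Longrightarrow> SM S (g \<bullet> f) = SM S g \<bullet> SM S f"
  using is_functorD[OF lax_tangent_morphismD(3)[OF tangent_monadD(1)]] by auto

lemma S_typing [simp]:
  assumes "A \<in> Obj X"
  shows "sdist S A \<in> Arr X" "Dom X (sdist S A) = SO S (TO X A)"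
    "Cod X (sdist S A) = TO X (SO S A)"
    "eta S A \<in> Arr X" "Dom X (eta S A) = A" "Cod X (eta S A) = SO S A"
    "mu S A \<in> Arr X" "Dom X (mu S A) = SO S (SO S A)" "Cod X (mu S A) = SO S A"
  using lax_tangent_morphismD(4-6)[OF tangent_monadD(1)] assms
    natural_transformationD(3-5)[OF tangent_transformationD(1)[OF tangent_monadD(2)]]
    natural_transformationD(3-5)[OF tangent_transformationD(1)[OF tangent_monadD(3)]] by auto

lemmas sdist_nat = lax_tangent_morphismD(7)[OF tangent_monadD(1)]
lemmas sdist_proj = lax_tangent_morphismD(8)[OF tangent_monadD(1)]
lemmas sdist_zero = lax_tangent_morphismD(9)[OF tangent_monadD(1)]
lemmas sdist_sum = lax_tangent_morphismD(10)[OF tangent_monadD(1)]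
lemmas sdist_lift = lax_tangent_morphismD(11)[OF tangent_monadD(1)]
lemmas sdist_flip = lax_tangent_morphismD(12)[OF tangent_monadD(1)]
lemmas eta_nat = natural_transformationD(6)[OF tangent_transformationD(1)[OF tangent_monadD(2)]]

lemma mu_nat: "f \<in> Arr X \<Longrightarrow> Cod X f = B \<Longrightarrow> mu S B \<bullet> SM S (SM S f) = SM S f \<bullet> mu S (Dom X f)"
  using natural_transformationD(6)[OF tangent_transformationD(1)[OF tangent_monadD(3)], of f B] by simp

lemma eta_dist: "A \<in> Obj X \<Longrightarrow> TM X (eta S A) = sdist S A \<bullet> eta S (TO X A)"
  using tangent_transformationD(2)[OF tangent_monadD(2), of A] by simp

lemma mu_dist: "A \<in> Obj X \<Longrightarrow>
    TM X (mu S A) \<bullet> (sdist S (SO S A) \<bullet> SM S (sdist S A)) = sdist S A \<bullet> mu S (TO X A)"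
  using tangent_transformationD(2)[OF tangent_monadD(3), of A] by simp

lemma monad_laws:
  "A \<in> Obj X \<Longrightarrow> mu S A \<bullet> eta S (SO S A) = idt X (SO S A)"
  "A \<in> Obj X \<Longrightarrow> mu S A \<bullet> SM S (eta S A) = idt X (SO S A)"
  "A \<in> Obj X \<Longrightarrow> mu S A \<bullet> SM S (mu S A) = mu S A \<bullet> mu S (SO S A)"
  using tangent_monad by (auto simp: tangent_monad_def Let_def)

end

locale monads = S': monad_on_tangent_category S' + S: monad_on_tangent_category S
  for S' :: "('p, 'b, 'n) tangent_monad" and S :: "('o, 'a, 'm) tangent_monad"
begin

abbreviation X where "X \<equiv> base S"
abbreviation X' where "X' \<equiv> base S'"

notation S.cmp (infixr \<open>\<bullet>\<close> 70)

lemma one_morphism_lax: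
  assumes "one_morphism S' S G"
  shows "lax_tangent_morphism X' X (GO G) (GM G) (gdist G)"
    "tangent_transformation X' X
         (SO S \<circ> GO G) (SM S \<circ> GM G) (\<lambda>A. sdist S (GO G A) \<bullet> SM S (gdist G A))
         (GO G \<circ> SO S') (GM G \<circ> SM S') (\<lambda>A. gdist G (SO S' A) \<bullet> GM G (sdist S' A)) (gtau G)"
    "GO G \<in> extensional (Obj X')" "GM G \<in> extensional (Arr X')"
    "gdist G \<in> extensional (Obj X')" "gtau G \<in> extensional (Obj X')"
  using assms by (auto simp: one_morphism_def Let_def)

lemma G_simps [simp]:
  assumes "one_morphism S' S G"
  shows "A \<in> Obj X' \<Longrightarrow> GO G A \<in> Obj X"
    "f \<in> Arr X' \<Longrightarrow> GM G f \<in> Arr X"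
    "f \<in> Arr X' \<Longrightarrow> Dom X (GM G f) = GO G (Dom X' f)"
    "f \<in> Arr X' \<Longrightarrow> Cod X (GM G f) = GO G (Cod X' f)"
    "A \<in> Obj X' \<Longrightarrow> GM G (idt X' A) = idt X (GO G A)"
    "f \<in> Arr X' \<Longrightarrow> g \<in> Arr X' \<Longrightarrow> Dom X' g = Cod X' f \<Longrightarrow>
      GM G (g \<cdot>\<^bsub>X'\<^esub> f) = GM G g \<bullet> GM G f"
    "A \<in> Obj X' \<Longrightarrow> gdist G A \<in> Arr X"
    "A \<in> Obj X' \<Longrightarrow> Dom X (gdist G A) = GO G (TO X' A)"
    "A \<in> Obj X' \<Longrightarrow> Cod X (gdist G A) = TO X (GO G A)"
    "A \<in> Obj X' \<Longrightarrow> gtau G A \<in> Arr X"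
    "A \<in> Obj X' \<Longrightarrow> Dom X (gtau G A) = SO S (GO G A)"
    "A \<in> Obj X' \<Longrightarrow> Cod X (gtau G A) = GO G (SO S' A)"
  using is_functorD[OF lax_tangent_morphismD(3)[OF one_morphism_lax(1)[OF assms]]]
    lax_tangent_morphismD(4-6)[OF one_morphism_lax(1)[OF assms]]
    natural_transformationD(3-5)[OF tangent_transformationD(1)[OF one_morphism_lax(2)[OF assms]]] by auto

lemmas gdist_nat = lax_tangent_morphismD(7)[OF one_morphism_lax(1)]
lemmas gdist_proj = lax_tangent_morphismD(8)[OF one_morphism_lax(1)]
lemmas gdist_zero = lax_tangent_morphismD(9)[OF one_morphism_lax(1)]
lemmas gdist_sum = lax_tangent_morphismD(10)[OF one_morphism_lax(1)]
lemmas gdist_lift = lax_tangent_morphismD(11)[OF one_morphism_lax(1)]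
lemmas gdist_flip = lax_tangent_morphismD(12)[OF one_morphism_lax(1)]

lemma gtau_nat:
  assumes "one_morphism S' S G" "f \<in> Arr X'" "Cod X' f = B"
  shows "gtau G B \<bullet> SM S (GM G f) = GM G (SM S' f) \<bullet> gtau G (Dom X' f)"
  using natural_transformationD(6)[OF tangent_transformationD(1)[OF one_morphism_lax(2)[OF assms(1)]] assms(2,3)] by simp

lemma gtau_dist:
  assumes "one_morphism S' S G" "A \<in> Obj X'"
  shows "TM X (gtau G A) \<bullet> (sdist S (GO G A) \<bullet> SM S (gdist G A))
    = gdist G (SO S' A) \<bullet> (GM G (sdist S' A) \<bullet> gtau G (TO X' A))"
  using tangent_transformationD(2)[OF one_morphism_lax(2)[OF assms(1)] assms(2)] assms by simp

lemma gtau_monad: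
  assumes "one_morphism S' S G" "A \<in> Obj X'"
  shows "gtau G A \<bullet> eta S (GO G A) = GM G (eta S' A)"
    "gtau G A \<bullet> mu S (GO G A) = GM G (mu S' A) \<bullet> (gtau G (SO S' A) \<bullet> SM S (gtau G A))"
  using assms by (auto simp: one_morphism_def Let_def)

lemma one_morphismI:
  assumes ext: "GO G \<in> extensional (Obj X')" "GM G \<in> extensional (Arr X')"
      "gdist G \<in> extensional (Obj X')" "gtau G \<in> extensional (Obj X')"
    and fn: "\<And>A. A \<in> Obj X' \<Longrightarrow> GO G A \<in> Obj X"
      "\<And>f. f \<in> Arr X' \<Longrightarrow> GM G f \<in> hom X (GO G (Dom X' f)) (GO G (Cod X' f))"
      "\<And>A. A \<in> Obj X' \<Longrightarrow> GM G (idt X' A) = idt X (GO G A)"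
      "\<And>f g. f \<in> Arr X' \<Longrightarrow> g \<in> Arr X' \<Longrightarrow> Dom X' g = Cod X' f \<Longrightarrow>
        GM G (g \<cdot>\<^bsub>X'\<^esub> f) = GM G g \<bullet> GM G f"
    and d: "\<And>A. A \<in> Obj X' \<Longrightarrow> gdist G A \<in> hom X (GO G (TO X' A)) (TO X (GO G A))"
      "\<And>f. f \<in> Arr X' \<Longrightarrow>
        gdist G (Cod X' f) \<bullet> GM G (TM X' f) = TM X (GM G f) \<bullet> gdist G (Dom X' f)"
      "\<And>A. A \<in> Obj X' \<Longrightarrow> tproj X (GO G A) \<bullet> gdist G A = GM G (tproj X' A)"
      "\<And>A. A \<in> Obj X' \<Longrightarrow> gdist G A \<bullet> GM G (tzero X' A) = tzero X (GO G A)"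
      "\<And>A. A \<in> Obj X' \<Longrightarrow> gdist G A \<bullet> GM G (tsum X' A) = tsum X (GO G A) \<bullet>
        pair2 X (GO G A) (gdist G A \<bullet> GM G (tpi1 X' A)) (gdist G A \<bullet> GM G (tpi2 X' A))"
      "\<And>A. A \<in> Obj X' \<Longrightarrow> tlift X (GO G A) \<bullet> gdist G A
        = TM X (gdist G A) \<bullet> (gdist G (TO X' A) \<bullet> GM G (tlift X' A))"
      "\<And>A. A \<in> Obj X' \<Longrightarrow> tflip X (GO G A) \<bullet> (TM X (gdist G A) \<bullet> gdist G (TO X' A))
        = TM X (gdist G A) \<bullet> (gdist G (TO X' A) \<bullet> GM G (tflip X' A))"
    and t: "\<And>A. A \<in> Obj X' \<Longrightarrow> gtau G A \<in> hom X (SO S (GO G A)) (GO G (SO S' A))"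
      "\<And>f. f \<in> Arr X' \<Longrightarrow> gtau G (Cod X' f) \<bullet> SM S (GM G f) = GM G (SM S' f) \<bullet> gtau G (Dom X' f)"
      "\<And>A. A \<in> Obj X' \<Longrightarrow> TM X (gtau G A) \<bullet> (sdist S (GO G A) \<bullet> SM S (gdist G A))
        = gdist G (SO S' A) \<bullet> (GM G (sdist S' A) \<bullet> gtau G (TO X' A))"
      "\<And>A. A \<in> Obj X' \<Longrightarrow> gtau G A \<bullet> eta S (GO G A) = GM G (eta S' A)"
      "\<And>A. A \<in> Obj X' \<Longrightarrow> gtau G A \<bullet> mu S (GO G A) = GM G (mu S' A) \<bullet> (gtau G (SO S' A) \<bullet> SM S (gtau G A))"
  shows "one_morphism S' S G"
proof -
  have F: "is_functor X' X (GO G) (GM G)"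
    unfolding is_functor_def using fn S'.X.category_axioms S.X.category_axioms by auto
  note T' = S'.X.T_functor and T = S.X.T_functor
  have S': "is_functor X' X' (SO S') (SM S')" by (rule lax_tangent_morphismD(3)[OF S'.tangent_monadD(1)])
  have S: "is_functor X X (SO S) (SM S)" by (rule lax_tangent_morphismD(3)[OF S.tangent_monadD(1)])
  have fn': "f \<in> Arr X' \<Longrightarrow> GM G f \<in> Arr X" "f \<in> Arr X' \<Longrightarrow> Dom X (GM G f) = GO G (Dom X' f)"
    "f \<in> Arr X' \<Longrightarrow> Cod X (GM G f) = GO G (Cod X' f)" for f using fn(2)[of f] by auto
  have d': "A \<in> Obj X' \<Longrightarrow> gdist G A \<in> Arr X" "A \<in> Obj X' \<Longrightarrow> Dom X (gdist G A) = GO G (TO X' A)"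
    "A \<in> Obj X' \<Longrightarrow> Cod X (gdist G A) = TO X (GO G A)" for A using d(1)[of A] by auto
  have t': "A \<in> Obj X' \<Longrightarrow> gtau G A \<in> Arr X" "A \<in> Obj X' \<Longrightarrow> Dom X (gtau G A) = SO S (GO G A)"
    "A \<in> Obj X' \<Longrightarrow> Cod X (gtau G A) = GO G (SO S' A)" for A using t(1)[of A] by auto
  have L: "lax_tangent_morphism X' X (GO G) (GM G) (gdist G)"
    unfolding lax_tangent_morphism_def
  proof (intro conjI ballI)
    show "natural_transformation X' X (GO G \<circ> TO X') (GM G \<circ> TM X')
      (TO X \<circ> GO G) (TM X \<circ> GM G) (gdist G)"
      unfolding comp_def
      by (rule natural_transformationI[OF is_functor_comp[OF T' F] is_functor_comp[OF F T]]) (use d' d(2) in auto)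
  qed (use d(3-7) F S'.X.tangent_category_axioms S.X.tangent_category_axioms in auto)
  have TT: "tangent_transformation X' X
         (SO S \<circ> GO G) (SM S \<circ> GM G) (\<lambda>A. sdist S (GO G A) \<bullet> SM S (gdist G A))
         (GO G \<circ> SO S') (GM G \<circ> SM S') (\<lambda>A. gdist G (SO S' A) \<bullet> GM G (sdist S' A)) (gtau G)"
    unfolding tangent_transformation_def comp_def
  proof (intro conjI ballI)
    show "natural_transformation X' X (\<lambda>x. SO S (GO G x)) (\<lambda>x. SM S (GM G x)) (\<lambda>x. GO G (SO S' x)) (\<lambda>x. GM G (SM S' x)) (gtau G)"
      by (rule natural_transformationI[OF is_functor_comp[OF F S] is_functor_comp[OF S' F]]) (use t' t(2) in auto)
    fix A assume "A \<in> Obj X'"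
    then show "TM X (gtau G A) \<bullet> (sdist S (GO G A) \<bullet> SM S (gdist G A)) = (gdist G (SO S' A) \<bullet> GM G (sdist S' A)) \<bullet> gtau G (TO X' A)"
      using t(3)[of A] fn fn' d' t' by simp
  qed
  show ?thesis
    unfolding one_morphism_def Let_def using ext L TT t(4,5) by auto
qed

lemma two_morphism_iff:
  assumes "one_morphism S' S G" "one_morphism S' S H"
  shows "two_morphism S' S G H \<phi> \<longleftrightarrow> \<phi> \<in> extensional (Obj X') \<and>
    (\<forall>A\<in>Obj X'. \<phi> A \<in> Arr X \<and> Dom X (\<phi> A) = GO G A \<and> Cod X (\<phi> A) = GO H A \<and>
       TM X (\<phi> A) \<bullet> gdist G A = gdist H A \<bullet> \<phi> (TO X' A) \<and>
       \<phi> (SO S' A) \<bullet> gtau G A = gtau H A \<bullet> SM S (\<phi> A)) \<and>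
    (\<forall>f\<in>Arr X'. \<phi> (Cod X' f) \<bullet> GM G f = GM H f \<bullet> \<phi> (Dom X' f))"
  using lax_tangent_morphismD(3)[OF one_morphism_lax(1)[OF assms(1)]] lax_tangent_morphismD(3)[OF one_morphism_lax(1)[OF assms(2)]]
  unfolding two_morphism_def Let_def tangent_transformation_def natural_transformation_def by auto

lemma mor1_eqI:
  assumes "one_morphism S' S G" "one_morphism S' S H"
    "\<And>A. A \<in> Obj X' \<Longrightarrow> GO G A = GO H A" "\<And>f. f \<in> Arr X' \<Longrightarrow> GM G f = GM H f"
    "\<And>A. A \<in> Obj X' \<Longrightarrow> gdist G A = gdist H A" "\<And>A. A \<in> Obj X' \<Longrightarrow> gtau G A = gtau H A"
  shows "G = H"
  by (rule mor1.equality)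
    (use one_morphism_lax(3-6)[OF assms(1)] one_morphism_lax(3-6)[OF assms(2)] assms(3-6) in \<open>auto intro!: extensionalityI\<close>)

end

locale three_monads = H: monads S'' S' + G: monads S' S
  for S'' :: "('q, 'c, 'k) tangent_monad" and S' :: "('p, 'b, 'n) tangent_monad" and S :: "('o, 'a, 'm) tangent_monad"
begin

sublocale GH: monads S'' S ..

abbreviation X where "X \<equiv> base S"
abbreviation X' where "X' \<equiv> base S'"
abbreviation X'' where "X'' \<equiv> base S''"

notation G.S.cmp (infixr \<open>\<bullet>\<close> 70)
notation H.S.cmp (infixr \<open>\<bullet>''\<close> 70)

text \<open>The laws are pasted together from those of \<open>G\<close> and \<open>H\<close>. For additivity one also has to move a pairing
  into \<open>T\<^sub>2 (H A)\<close> through \<open>G\<close>, which is possible because its two components determine it.\<close>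

lemma comp1_one_morphism:
  assumes G: "one_morphism S' S G" and H: "one_morphism S'' S' H"
  shows "one_morphism S'' S (comp1 S'' S G H)"
proof (rule GH.one_morphismI)
  let ?K = "comp1 S'' S G H"
  have K: "A \<in> Obj X'' \<Longrightarrow> GO ?K A = GO G (GO H A)" "f \<in> Arr X'' \<Longrightarrow> GM ?K f = GM G (GM H f)"
    "A \<in> Obj X'' \<Longrightarrow> gdist ?K A = gdist G (GO H A) \<bullet> GM G (gdist H A)"
    "A \<in> Obj X'' \<Longrightarrow> gtau ?K A = GM G (gtau H A) \<bullet> gtau G (GO H A)" for A f
    by (simp_all add: comp1_def)
  note [simp] = G H
  show "GO ?K \<in> extensional (Obj X'')" "GM ?K \<in> extensional (Arr X'')" "gdist ?K \<in> extensional (Obj X'')"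
    "gtau ?K \<in> extensional (Obj X'')" by (simp_all add: comp1_def)
  show "GO ?K A \<in> Obj X" "GM ?K (idt X'' A) = idt X (GO ?K A)" if "A \<in> Obj X''" for A using that by (simp_all add: K)
  show "GM ?K f \<in> hom X (GO ?K (Dom X'' f)) (GO ?K (Cod X'' f))" if "f \<in> Arr X''" for f using that by (simp add: K)
  show "GM ?K (g \<cdot>\<^bsub>X''\<^esub> f) = GM ?K g \<bullet> GM ?K f" if "f \<in> Arr X''" "g \<in> Arr X''" "Dom X'' g = Cod X'' f" for f g
    using that by (simp add: K)
  fix A assume A: "A \<in> Obj X''"
  define b t where "b = gdist H A" and "t = gtau H A"
  have b: "b \<in> Arr X'" "Dom X' b = GO H (TO X'' A)" "Cod X' b = TO X' (GO H A)"
    and t: "t \<in> Arr X'" "Dom X' t = SO S' (GO H A)" "Cod X' t = GO H (SO S'' A)"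
    using A by (simp_all add: b_def t_def)
  show "gdist ?K A \<in> hom X (GO ?K (TO X'' A)) (TO X (GO ?K A))" "gtau ?K A \<in> hom X (SO S (GO ?K A)) (GO ?K (SO S'' A))"
    using A by (simp_all add: K)
  have pb: "tproj X' (GO H A) \<bullet>' b = GM H (tproj X'' A)" using H.gdist_proj[OF H A] by (simp add: b_def)
  show "tproj X (GO ?K A) \<bullet> gdist ?K A = GM ?K (tproj X'' A)"
    using A G.S.X.tail[OF G.gdist_proj[OF G, of "GO H A"], of "GM G b"] b arg_cong[OF pb, of "GM G"] by (simp add: K b_def[symmetric])
  show "gdist ?K A \<bullet> GM ?K (tzero X'' A) = tzero X (GO ?K A)"
    using A arg_cong[OF H.gdist_zero[OF H A], of "GM G"] G.gdist_zero[OF G, of "GO H A"] by (simp add: K)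
  show "gdist ?K A \<bullet> GM ?K (tsum X'' A) = tsum X (GO ?K A) \<bullet>
        pair2 X (GO ?K A) (gdist ?K A \<bullet> GM ?K (tpi1 X'' A)) (gdist ?K A \<bullet> GM ?K (tpi2 X'' A))"
  proof -
    define B where "B = GO H A"
    have B: "B \<in> Obj X'" using A by (simp add: B_def)
    define u v where "u = b \<bullet>' GM H (tpi1 X'' A)" and "v = b \<bullet>' GM H (tpi2 X'' A)"
    have "GM H (tproj X'' A) \<bullet>' GM H (tpi1 X'' A) = GM H (tproj X'' A) \<bullet>' GM H (tpi2 X'' A)"
      using arg_cong[OF H.S'.X.tpi_proj[OF A], of "GM H"] A by simp
    then have "tproj X' B \<bullet>' u = tproj X' B \<bullet>' v"
      using A b H.S.X.tail[OF pb, of "GM H (tpi1 X'' A)"] H.S.X.tail[OF pb, of "GM H (tpi2 X'' A)"]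
      unfolding u_def v_def B_def by simp
    moreover have uv: "u \<in> Arr X'" "v \<in> Arr X'" "Dom X' u = Dom X' v" "Cod X' u = TO X' B" "Cod X' v = TO X' B"
      "Dom X' v = GO H (T2 X'' A)"
      using A b unfolding u_def v_def B_def by simp_all
    ultimately have q: "pair2 X' B u v \<in> Arr X'" "Dom X' (pair2 X' B u v) = Dom X' v" "Cod X' (pair2 X' B u v) = T2 X' B"
      "tpi1 X' B \<bullet>' pair2 X' B u v = u" "tpi2 X' B \<bullet>' pair2 X' B u v = v"
      using B by simp_all
    define w where "w = pair2 X (GO G B) (gdist G B \<bullet> GM G (tpi1 X' B)) (gdist G B \<bullet> GM G (tpi2 X' B))"
    have "GM G (tproj X' B) \<bullet> GM G (tpi1 X' B) = GM G (tproj X' B) \<bullet> GM G (tpi2 X' B)"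
      using arg_cong[OF H.S.X.tpi_proj[OF B], of "GM G"] B by simp
    then have "tproj X (GO G B) \<bullet> (gdist G B \<bullet> GM G (tpi1 X' B)) = tproj X (GO G B) \<bullet> (gdist G B \<bullet> GM G (tpi2 X' B))"
      using B G.S.X.tail[OF G.gdist_proj[OF G B], of "GM G (tpi1 X' B)"] G.S.X.tail[OF G.gdist_proj[OF G B], of "GM G (tpi2 X' B)"]
      by simp
    then have w: "w \<in> Arr X" "Dom X w = GO G (T2 X' B)" "Cod X w = T2 X (GO G B)"
      "tpi1 X (GO G B) \<bullet> w = gdist G B \<bullet> GM G (tpi1 X' B)" "tpi2 X (GO G B) \<bullet> w = gdist G B \<bullet> GM G (tpi2 X' B)"
      unfolding w_def using B by simp_all
    have Gq: "GM G (tpi1 X' B) \<bullet> GM G (pair2 X' B u v) = GM G u" "GM G (tpi2 X' B) \<bullet> GM G (pair2 X' B u v) = GM G v"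
      using arg_cong[OF q(4), of "GM G"] arg_cong[OF q(5), of "GM G"] q(1-3) B by simp_all
    have "pair2 X (GO G B) (gdist G B \<bullet> GM G u) (gdist G B \<bullet> GM G v) = w \<bullet> GM G (pair2 X' B u v)"
      by (rule G.S.X.pair2_eqI) (use B w q(1-3) uv Gq in \<open>simp_all add: G.S.X.tail[OF w(4)] G.S.X.tail[OF w(5)]\<close>)
    then have "tsum X (GO G B) \<bullet> pair2 X (GO G B) (gdist G B \<bullet> GM G u) (gdist G B \<bullet> GM G v)
      = (tsum X (GO G B) \<bullet> w) \<bullet> GM G (pair2 X' B u v)" using B w q(1-3) by simp
    also have "\<dots> = gdist G B \<bullet> (GM G (tsum X' B \<bullet>' pair2 X' B u v))"
      unfolding w_def G.gdist_sum[OF G B, symmetric] using B q(1-3) by simp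
    also have "tsum X' B \<bullet>' pair2 X' B u v = b \<bullet>' GM H (tsum X'' A)"
      unfolding u_def v_def B_def b_def using H.gdist_sum[OF H A] by simp
    finally show ?thesis using A b unfolding u_def v_def B_def by (simp add: K b_def[symmetric])
  qed
  have lb: "tlift X' (GO H A) \<bullet>' b = TM X' b \<bullet>' (gdist H (TO X'' A) \<bullet>' GM H (tlift X'' A))"
    using H.gdist_lift[OF H A] by (simp add: b_def)
  have Gb: "gdist G (TO X' (GO H A)) \<bullet> (GM G (TM X' b) \<bullet> x) = TM X (GM G b) \<bullet> (gdist G (GO H (TO X'' A)) \<bullet> x)"
    if "x \<in> Arr X" "Cod X x = GO G (TO X' (GO H (TO X'' A)))" for x
    using G.S.X.tail[OF G.gdist_nat[OF G b(1,3)], of x] that b A by simp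
  show "tlift X (GO ?K A) \<bullet> gdist ?K A = TM X (gdist ?K A) \<bullet> (gdist ?K (TO X'' A) \<bullet> GM ?K (tlift X'' A))"
    using A G.S.X.tail[OF G.gdist_lift[OF G, of "GO H A"], of "GM G b"] b arg_cong[OF lb, of "GM G"] Gb
    by (simp add: K b_def[symmetric])
  have fb: "tflip X' (GO H A) \<bullet>' (TM X' b \<bullet>' gdist H (TO X'' A)) = TM X' b \<bullet>' (gdist H (TO X'' A) \<bullet>' GM H (tflip X'' A))"
    using H.gdist_flip[OF H A] by (simp add: b_def)
  show "tflip X (GO ?K A) \<bullet> (TM X (gdist ?K A) \<bullet> gdist ?K (TO X'' A))
     = TM X (gdist ?K A) \<bullet> (gdist ?K (TO X'' A) \<bullet> GM ?K (tflip X'' A))"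
  proof -
    have "tflip X (GO G (GO H A)) \<bullet> (TM X (gdist G (GO H A)) \<bullet> (TM X (GM G b) \<bullet> (gdist G (GO H (TO X'' A)) \<bullet> GM G (gdist H (TO X'' A)))))
      = TM X (gdist G (GO H A)) \<bullet> (gdist G (TO X' (GO H A)) \<bullet> (GM G (tflip X' (GO H A)) \<bullet> (GM G (TM X' b) \<bullet> GM G (gdist H (TO X'' A)))))"
      using A b Gb[of "GM G (gdist H (TO X'' A))"]
        G.S.X.tail3[OF G.gdist_flip[OF G, of "GO H A"], of "GM G (TM X' b) \<bullet> GM G (gdist H (TO X'' A))"] by simp
    also have "GM G (tflip X' (GO H A)) \<bullet> (GM G (TM X' b) \<bullet> GM G (gdist H (TO X'' A)))
      = GM G (TM X' b) \<bullet> (GM G (gdist H (TO X'' A)) \<bullet> GM G (GM H (tflip X'' A)))"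
      using A b arg_cong[OF fb, of "GM G"] by simp
    finally show ?thesis using A b by (simp add: K b_def[symmetric] Gb)
  qed
  have td: "TM X' t \<bullet>' (sdist S' (GO H A) \<bullet>' SM S' b) = gdist H (SO S'' A) \<bullet>' (GM H (sdist S'' A) \<bullet>' gtau H (TO X'' A))"
    using H.gtau_dist[OF H A] by (simp add: b_def t_def)
  show "TM X (gtau ?K A) \<bullet> (sdist S (GO ?K A) \<bullet> SM S (gdist ?K A))
     = gdist ?K (SO S'' A) \<bullet> (GM ?K (sdist S'' A) \<bullet> gtau ?K (TO X'' A))"
  proof -
    let ?B = "GO H A"
    have B: "?B \<in> Obj X'" using A by simp
    have "TM X (GM G t) \<bullet> (TM X (gtau G ?B) \<bullet> (sdist S (GO G ?B) \<bullet> (SM S (gdist G ?B) \<bullet> SM S (GM G b))))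
      = TM X (GM G t) \<bullet> (gdist G (SO S' ?B) \<bullet> (GM G (sdist S' ?B) \<bullet> (gtau G (TO X' ?B) \<bullet> SM S (GM G b))))"
      using G.S.X.tail3[OF G.gtau_dist[OF G B], of "SM S (GM G b)"] A b by simp
    also have "\<dots> = gdist G (GO H (SO S'' A)) \<bullet> (GM G (TM X' t) \<bullet> (GM G (sdist S' ?B) \<bullet> (GM G (SM S' b) \<bullet> gtau G (GO H (TO X'' A)))))"
      using G.S.X.tail[OF G.gdist_nat[OF G t(1,3)], of "GM G (sdist S' ?B) \<bullet> (GM G (SM S' b) \<bullet> gtau G (GO H (TO X'' A)))"]
        G.gtau_nat[OF G b(1,3)] A b t by simp
    also have "\<dots> = gdist G (GO H (SO S'' A)) \<bullet> (GM G (TM X' t \<bullet>' (sdist S' ?B \<bullet>' SM S' b)) \<bullet> gtau G (GO H (TO X'' A)))"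
      using A b t by simp
    finally show ?thesis unfolding td using A b t by (simp add: K b_def[symmetric] t_def[symmetric])
  qed
  show "gtau ?K A \<bullet> eta S (GO ?K A) = GM ?K (eta S'' A)"
    using A G.gtau_monad(1)[OF G, of "GO H A"] arg_cong[OF H.gtau_monad(1)[OF H A], of "GM G"] by (simp add: K)
  show "gtau ?K A \<bullet> mu S (GO ?K A) = GM ?K (mu S'' A) \<bullet> (gtau ?K (SO S'' A) \<bullet> SM S (gtau ?K A))"
  proof -
    let ?B = "GO H A"
    have B: "?B \<in> Obj X'" using A by simp
    have tm: "t \<bullet>' mu S' ?B = GM H (mu S'' A) \<bullet>' (gtau H (SO S'' A) \<bullet>' SM S' t)"
      using H.gtau_monad(2)[OF H A] by (simp add: t_def)
    have "GM G t \<bullet> (gtau G ?B \<bullet> mu S (GO G ?B)) = GM G (t \<bullet>' mu S' ?B) \<bullet> (gtau G (SO S' ?B) \<bullet> SM S (gtau G ?B))"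
      using G.gtau_monad(2)[OF G B] A t by simp
    also have "\<dots> = GM G (GM H (mu S'' A)) \<bullet> (GM G (gtau H (SO S'' A)) \<bullet> (gtau G (GO H (SO S'' A)) \<bullet> (SM S (GM G t) \<bullet> SM S (gtau G ?B))))"
      unfolding tm using G.S.X.tail[OF G.gtau_nat[OF G t(1,3)], of "SM S (gtau G ?B)"] A t by simp
    finally show ?thesis using A t by (simp add: K t_def[symmetric])
  qed
next
  fix f assume f: "f \<in> Arr X''"
  note [simp] = G H
  let ?K = "comp1 S'' S G H"
  have K: "A \<in> Obj X'' \<Longrightarrow> GO ?K A = GO G (GO H A)" "f \<in> Arr X'' \<Longrightarrow> GM ?K f = GM G (GM H f)"
    "A \<in> Obj X'' \<Longrightarrow> gdist ?K A = gdist G (GO H A) \<bullet> GM G (gdist H A)"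
    "A \<in> Obj X'' \<Longrightarrow> gtau ?K A = GM G (gtau H A) \<bullet> gtau G (GO H A)" for A f
    by (simp_all add: comp1_def)
  show "gdist ?K (Cod X'' f) \<bullet> GM ?K (TM X'' f) = TM X (GM ?K f) \<bullet> gdist ?K (Dom X'' f)"
    using f arg_cong[OF H.gdist_nat[OF H f refl], of "GM G"]
      G.S.X.tail[OF G.gdist_nat[OF G, of "GM H f" "GO H (Cod X'' f)"], of "GM G (gdist H (Dom X'' f))"] by (simp add: K)
  show "gtau ?K (Cod X'' f) \<bullet> SM S (GM ?K f) = GM ?K (SM S'' f) \<bullet> gtau ?K (Dom X'' f)"
  proof -
    have "GM G (gtau H (Cod X'' f)) \<bullet> GM G (SM S' (GM H f)) = GM G (GM H (SM S'' f)) \<bullet> GM G (gtau H (Dom X'' f))"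
      using f arg_cong[OF H.gtau_nat[OF H f refl], of "GM G"] by simp
    from G.S.X.tail[OF this, of "gtau G (GO H (Dom X'' f))"] show ?thesis
      using f G.gtau_nat[OF G, of "GM H f" "GO H (Cod X'' f)"] by (simp add: K)
  qed
qed

end

section \<open>The hom-tangent categories\<close>

context monads
begin

lemma two_morphismD:
  assumes "one_morphism S' S G" "one_morphism S' S H" "two_morphism S' S G H \<phi>"
  shows "A \<in> Obj X' \<Longrightarrow> \<phi> A \<in> Arr X" "A \<in> Obj X' \<Longrightarrow> Dom X (\<phi> A) = GO G A"
    "A \<in> Obj X' \<Longrightarrow> Cod X (\<phi> A) = GO H A"
    "A \<in> Obj X' \<Longrightarrow> TM X (\<phi> A) \<bullet> gdist G A = gdist H A \<bullet> \<phi> (TO X' A)"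
    "A \<in> Obj X' \<Longrightarrow> \<phi> (SO S' A) \<bullet> gtau G A = gtau H A \<bullet> SM S (\<phi> A)"
    "f \<in> Arr X' \<Longrightarrow> Cod X' f = B \<Longrightarrow> \<phi> B \<bullet> GM G f = GM H f \<bullet> \<phi> (Dom X' f)"
    "\<phi> \<in> extensional (Obj X')"
  using assms two_morphism_iff by auto

text \<open>Laws of 1-morphisms are inherited along legs that are jointly monic, also after applying \<open>T\<close> and
  \<open>T\<^sup>2\<close>, the latter because of the two coherence laws for the lift and the flip.\<close>

lemma one_morphism_from_legs:
  assumes B: "\<And>k. k \<in> K \<Longrightarrow> one_morphism S' S (B k)"
    and ext: "GO G \<in> extensional (Obj X')" "GM G \<in> extensional (Arr X')"
      "gdist G \<in> extensional (Obj X')" "gtau G \<in> extensional (Obj X')"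
    and O: "\<And>A. A \<in> Obj X' \<Longrightarrow> GO G A \<in> Obj X"
    and M: "\<And>f. f \<in> Arr X' \<Longrightarrow> GM G f \<in> Arr X \<and> Dom X (GM G f) = GO G (Dom X' f) \<and>
      Cod X (GM G f) = GO G (Cod X' f)"
    and d: "\<And>A. A \<in> Obj X' \<Longrightarrow> gdist G A \<in> Arr X \<and> Dom X (gdist G A) = GO G (TO X' A) \<and>
      Cod X (gdist G A) = TO X (GO G A)"
    and t: "\<And>A. A \<in> Obj X' \<Longrightarrow> gtau G A \<in> Arr X \<and> Dom X (gtau G A) = SO S (GO G A) \<and>
      Cod X (gtau G A) = GO G (SO S' A)"
    and \<pi>: "\<And>k A. k \<in> K \<Longrightarrow> A \<in> Obj X' \<Longrightarrow> \<pi> k A \<in> Arr X \<and> Dom X (\<pi> k A) = GO G A \<and>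
      Cod X (\<pi> k A) = GO (B k) A"
    and J: "\<And>A. A \<in> Obj X' \<Longrightarrow> jointly_monic X K (GO G A) (\<lambda>k. \<pi> k A)"
      "\<And>A. A \<in> Obj X' \<Longrightarrow> jointly_monic X K (TO X (GO G A)) (\<lambda>k. TM X (\<pi> k A))"
      "\<And>A. A \<in> Obj X' \<Longrightarrow> jointly_monic X K (TO X (TO X (GO G A))) (\<lambda>k. TM X (TM X (\<pi> k A)))"
    and eM: "\<And>k f. k \<in> K \<Longrightarrow> f \<in> Arr X' \<Longrightarrow> \<pi> k (Cod X' f) \<bullet> GM G f = GM (B k) f \<bullet> \<pi> k (Dom X' f)"
    and ed: "\<And>k A. k \<in> K \<Longrightarrow> A \<in> Obj X' \<Longrightarrow> TM X (\<pi> k A) \<bullet> gdist G A = gdist (B k) A \<bullet> \<pi> k (TO X' A)"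
    and et: "\<And>k A. k \<in> K \<Longrightarrow> A \<in> Obj X' \<Longrightarrow> \<pi> k (SO S' A) \<bullet> gtau G A = gtau (B k) A \<bullet> SM S (\<pi> k A)"
  shows "one_morphism S' S G"
proof -
  note [simp] = O B
  have M' [simp]: "GM G f \<in> Arr X" "Dom X (GM G f) = GO G (Dom X' f)" "Cod X (GM G f) = GO G (Cod X' f)" if "f \<in> Arr X'" for f
    using M[OF that] by auto
  have d' [simp]: "gdist G A \<in> Arr X" "Dom X (gdist G A) = GO G (TO X' A)" "Cod X (gdist G A) = TO X (GO G A)"
    if "A \<in> Obj X'" for A using d[OF that] by auto
  have t' [simp]: "gtau G A \<in> Arr X" "Dom X (gtau G A) = SO S (GO G A)" "Cod X (gtau G A) = GO G (SO S' A)"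
    if "A \<in> Obj X'" for A using t[OF that] by auto
  have \<pi>' [simp]: "\<pi> k A \<in> Arr X" "Dom X (\<pi> k A) = GO G A" "Cod X (\<pi> k A) = GO (B k) A" if "k \<in> K" "A \<in> Obj X'" for k A
    using \<pi>[OF that] by auto
  have piM: "\<pi> k C \<bullet> (GM G f \<bullet> x) = GM (B k) f \<bullet> (\<pi> k (Dom X' f) \<bullet> x)"
    if "k \<in> K" "f \<in> Arr X'" "Cod X' f = C" "x \<in> Arr X" "Cod X x = GO G (Dom X' f)" for k f C x
    using S.X.tail[OF eM[OF that(1,2)], of x] that by auto
  have pid: "TM X (\<pi> k A) \<bullet> (gdist G A \<bullet> x) = gdist (B k) A \<bullet> (\<pi> k (TO X' A) \<bullet> x)"
    if "k \<in> K" "A \<in> Obj X'" "x \<in> Arr X" "Cod X x = GO G (TO X' A)" for k A x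
    using S.X.tail[OF ed[OF that(1,2)], of x] that by auto
  have pit: "\<pi> k (SO S' A) \<bullet> (gtau G A \<bullet> x) = gtau (B k) A \<bullet> (SM S (\<pi> k A) \<bullet> x)"
    if "k \<in> K" "A \<in> Obj X'" "x \<in> Arr X" "Cod X x = SO S (GO G A)" for k A x
    using S.X.tail[OF et[OF that(1,2)], of x] that by auto
  have eM': "\<pi> k C \<bullet> GM G f = GM (B k) f \<bullet> \<pi> k (Dom X' f)" if "k \<in> K" "f \<in> Arr X'" "Cod X' f = C" for k f C
    using eM that by auto
  have Ted: "TM X (TM X (\<pi> k A)) \<bullet> TM X (gdist G A) = TM X (gdist (B k) A) \<bullet> TM X (\<pi> k (TO X' A))"
    if "k \<in> K" "A \<in> Obj X'" for k A using arg_cong[OF ed[OF that], of "TM X"] that by simp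
  have TeM: "TM X (\<pi> k C) \<bullet> TM X (GM G f) = TM X (GM (B k) f) \<bullet> TM X (\<pi> k (Dom X' f))"
    if "k \<in> K" "f \<in> Arr X'" "Cod X' f = C" for k f C using arg_cong[OF eM'[OF that], of "TM X"] that by auto
  have Tet: "TM X (\<pi> k (SO S' A)) \<bullet> TM X (gtau G A) = TM X (gtau (B k) A) \<bullet> TM X (SM S (\<pi> k A))"
    if "k \<in> K" "A \<in> Obj X'" for k A using arg_cong[OF et[OF that], of "TM X"] that by simp
  have SeM: "SM S (\<pi> k C) \<bullet> SM S (GM G f) = SM S (GM (B k) f) \<bullet> SM S (\<pi> k (Dom X' f))"
    if "k \<in> K" "f \<in> Arr X'" "Cod X' f = C" for k f C using arg_cong[OF eM'[OF that], of "SM S"] that by auto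
  have Sed: "SM S (TM X (\<pi> k A)) \<bullet> SM S (gdist G A) = SM S (gdist (B k) A) \<bullet> SM S (\<pi> k (TO X' A))"
    if "k \<in> K" "A \<in> Obj X'" for k A using arg_cong[OF ed[OF that], of "SM S"] that by simp
  have Set: "SM S (\<pi> k (SO S' A)) \<bullet> SM S (gtau G A) = SM S (gtau (B k) A) \<bullet> SM S (SM S (\<pi> k A))"
    if "k \<in> K" "A \<in> Obj X'" for k A using arg_cong[OF et[OF that], of "SM S"] that by simp
  have idt: "GM G (idt X' A) = idt X (GO G A)" if A: "A \<in> Obj X'" for A
    by (rule jointly_monicD[OF J(1)[OF A]]) (use A in \<open>simp_all add: eM'\<close>)
  have comp: "GM G (g \<cdot>\<^bsub>X'\<^esub> f) = GM G g \<bullet> GM G f" if f: "f \<in> Arr X'" "g \<in> Arr X'" "Dom X' g = Cod X' f" for f g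
    by (rule jointly_monicD[OF J(1)[of "Cod X' g"]]) (use f in \<open>simp_all add: eM' piM\<close>)
  have pd: "tproj X (GO G A) \<bullet> gdist G A = GM G (tproj X' A)" if A: "A \<in> Obj X'" for A
  proof (rule jointly_monicD[OF J(1)[OF A]])
    fix k assume k: "k \<in> K"
    show "\<pi> k A \<bullet> (tproj X (GO G A) \<bullet> gdist G A) = \<pi> k A \<bullet> GM G (tproj X' A)"
      using A k S.X.tail[OF S.X.proj_nat[of "\<pi> k A" "GO (B k) A"], of "gdist G A"] ed[OF k A]
        S.X.tail[OF gdist_proj[OF B[OF k] A], of "\<pi> k (TO X' A)"] by (simp add: eM')
  qed (use A in simp_all)
  show ?thesis
  proof (rule one_morphismI[OF ext O _ idt comp _ _ pd])
    fix f assume f: "f \<in> Arr X'"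
    show "GM G f \<in> hom X (GO G (Dom X' f)) (GO G (Cod X' f))" using f by simp
    show "gdist G (Cod X' f) \<bullet> GM G (TM X' f) = TM X (GM G f) \<bullet> gdist G (Dom X' f)"
    proof (rule jointly_monicD[OF J(2)[of "Cod X' f"]])
      fix k assume k: "k \<in> K"
      show "TM X (\<pi> k (Cod X' f)) \<bullet> (gdist G (Cod X' f) \<bullet> GM G (TM X' f)) = TM X (\<pi> k (Cod X' f)) \<bullet> (TM X (GM G f) \<bullet> gdist G (Dom X' f))"
        using k f S.X.tail[OF TeM[OF k f refl], of "gdist G (Dom X' f)"] S.X.tail[OF gdist_nat[OF B[OF k] f refl], of "\<pi> k (TO X' (Dom X' f))"]
        by (simp add: pid eM' ed)
    qed (use f in simp_all)
    show "gtau G (Cod X' f) \<bullet> SM S (GM G f) = GM G (SM S' f) \<bullet> gtau G (Dom X' f)"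
    proof (rule jointly_monicD[OF J(1)[of "SO S' (Cod X' f)"]])
      fix k assume k: "k \<in> K"
      show "\<pi> k (SO S' (Cod X' f)) \<bullet> (gtau G (Cod X' f) \<bullet> SM S (GM G f)) = \<pi> k (SO S' (Cod X' f)) \<bullet> (GM G (SM S' f) \<bullet> gtau G (Dom X' f))"
        using k f S.X.tail[OF gtau_nat[OF B[OF k] f refl], of "SM S (\<pi> k (Dom X' f))"]
        by (simp add: pit SeM piM et)
    qed (use f in simp_all)
  next
    fix A assume A: "A \<in> Obj X'"
    show "gdist G A \<in> hom X (GO G (TO X' A)) (TO X (GO G A))" "gtau G A \<in> hom X (SO S (GO G A)) (GO G (SO S' A))" using A by simp_all
    show "gdist G A \<bullet> GM G (tzero X' A) = tzero X (GO G A)"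
    proof (rule jointly_monicD[OF J(2)[OF A]])
      fix k assume k: "k \<in> K"
      show "TM X (\<pi> k A) \<bullet> (gdist G A \<bullet> GM G (tzero X' A)) = TM X (\<pi> k A) \<bullet> tzero X (GO G A)"
        using A k S.X.zero_nat[of "\<pi> k A" "GO (B k) A"] S.X.tail[OF gdist_zero[OF B[OF k] A], of "\<pi> k A"] by (simp add: pid eM')
    qed (use A in simp_all)
    have "GM G (tproj X' A) \<bullet> GM G (tpi1 X' A) = GM G (tproj X' A) \<bullet> GM G (tpi2 X' A)"
      using A comp[of "tpi1 X' A" "tproj X' A"] comp[of "tpi2 X' A" "tproj X' A"] S'.X.tpi_proj[OF A] by simp
    then have c: "tproj X (GO G A) \<bullet> (gdist G A \<bullet> GM G (tpi1 X' A)) = tproj X (GO G A) \<bullet> (gdist G A \<bullet> GM G (tpi2 X' A))"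
      using A S.X.tail[OF pd[OF A], of "GM G (tpi1 X' A)"] S.X.tail[OF pd[OF A], of "GM G (tpi2 X' A)"] by simp
    show "gdist G A \<bullet> GM G (tsum X' A) = tsum X (GO G A) \<bullet>
        pair2 X (GO G A) (gdist G A \<bullet> GM G (tpi1 X' A)) (gdist G A \<bullet> GM G (tpi2 X' A))"
    proof (rule jointly_monicD[OF J(2)[OF A]])
      fix k assume k: "k \<in> K"
      define C where "C = GO (B k) A"
      have C: "C \<in> Obj X" using A k by (simp add: C_def)
      define u v where "u = gdist (B k) A \<bullet> GM (B k) (tpi1 X' A)" and "v = gdist (B k) A \<bullet> GM (B k) (tpi2 X' A)"
      have uv: "u \<in> Arr X" "v \<in> Arr X" "Dom X u = Dom X v" "Cod X u = TO X C" "Cod X v = TO X C" "Dom X v = GO (B k) (T2 X' A)"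
        unfolding u_def v_def C_def using A k by simp_all
      have "GM (B k) (tproj X' A) \<bullet> GM (B k) (tpi1 X' A) = GM (B k) (tproj X' A) \<bullet> GM (B k) (tpi2 X' A)"
        using A k arg_cong[OF S'.X.tpi_proj[OF A], of "GM (B k)"] by simp
      then have uvc: "tproj X C \<bullet> u = tproj X C \<bullet> v"
        using A k S.X.tail[OF gdist_proj[OF B[OF k] A], of "GM (B k) (tpi1 X' A)"]
          S.X.tail[OF gdist_proj[OF B[OF k] A], of "GM (B k) (tpi2 X' A)"] unfolding u_def v_def C_def by simp
      note q = S.X.pair2_simps[OF uv(1-5) uvc C]
      have "TM X (\<pi> k A) \<bullet> (gdist G A \<bullet> GM G (tsum X' A)) = (gdist (B k) A \<bullet> GM (B k) (tsum X' A)) \<bullet> \<pi> k (T2 X' A)"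
        using A k by (simp add: pid eM')
      also have "\<dots> = (tsum X C \<bullet> pair2 X C u v) \<bullet> \<pi> k (T2 X' A)"
        unfolding gdist_sum[OF B[OF k] A] u_def v_def C_def ..
      also have "\<dots> = tsum X C \<bullet> pair2 X C (u \<bullet> \<pi> k (T2 X' A)) (v \<bullet> \<pi> k (T2 X' A))"
        using A k q(1-3) uv C S.X.pair2_comp[OF uv(1-5) uvc C, of "\<pi> k (T2 X' A)"] by simp
      also have "u \<bullet> \<pi> k (T2 X' A) = TM X (\<pi> k A) \<bullet> (gdist G A \<bullet> GM G (tpi1 X' A))"
        unfolding u_def using A k by (simp add: pid eM')
      also have "v \<bullet> \<pi> k (T2 X' A) = TM X (\<pi> k A) \<bullet> (gdist G A \<bullet> GM G (tpi2 X' A))"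
        unfolding v_def using A k by (simp add: pid eM')
      also have "tsum X C \<bullet> pair2 X C (TM X (\<pi> k A) \<bullet> (gdist G A \<bullet> GM G (tpi1 X' A))) (TM X (\<pi> k A) \<bullet> (gdist G A \<bullet> GM G (tpi2 X' A)))
        = TM X (\<pi> k A) \<bullet> (tsum X (GO G A) \<bullet> pair2 X (GO G A) (gdist G A \<bullet> GM G (tpi1 X' A)) (gdist G A \<bullet> GM G (tpi2 X' A)))"
        using S.X.sum_pair_nat[of "\<pi> k A" "gdist G A \<bullet> GM G (tpi1 X' A)" "gdist G A \<bullet> GM G (tpi2 X' A)"] A k c by (simp add: C_def)
      finally show "TM X (\<pi> k A) \<bullet> (gdist G A \<bullet> GM G (tsum X' A))
        = TM X (\<pi> k A) \<bullet> (tsum X (GO G A) \<bullet> pair2 X (GO G A) (gdist G A \<bullet> GM G (tpi1 X' A)) (gdist G A \<bullet> GM G (tpi2 X' A)))" .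
    qed (use A c in simp_all)
    show "tlift X (GO G A) \<bullet> gdist G A = TM X (gdist G A) \<bullet> (gdist G (TO X' A) \<bullet> GM G (tlift X' A))"
    proof (rule jointly_monicD[OF J(3)[OF A]])
      fix k assume k: "k \<in> K"
      show "TM X (TM X (\<pi> k A)) \<bullet> (tlift X (GO G A) \<bullet> gdist G A)
        = TM X (TM X (\<pi> k A)) \<bullet> (TM X (gdist G A) \<bullet> (gdist G (TO X' A) \<bullet> GM G (tlift X' A)))"
        using A k S.X.tail[OF S.X.lift_nat[of "\<pi> k A" "GO (B k) A"], of "gdist G A"] ed[OF k A]
          S.X.tail[OF gdist_lift[OF B[OF k] A], of "\<pi> k (TO X' A)"]
          S.X.tail[OF Ted[OF k A], of "gdist G (TO X' A) \<bullet> GM G (tlift X' A)"] by (simp add: pid eM')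
    qed (use A in simp_all)
    show "tflip X (GO G A) \<bullet> (TM X (gdist G A) \<bullet> gdist G (TO X' A)) = TM X (gdist G A) \<bullet> (gdist G (TO X' A) \<bullet> GM G (tflip X' A))"
    proof (rule jointly_monicD[OF J(3)[OF A]])
      fix k assume k: "k \<in> K"
      have "TM X (TM X (\<pi> k A)) \<bullet> (tflip X (GO G A) \<bullet> (TM X (gdist G A) \<bullet> gdist G (TO X' A)))
        = tflip X (GO (B k) A) \<bullet> (TM X (gdist (B k) A) \<bullet> (gdist (B k) (TO X' A) \<bullet> \<pi> k (TO X' (TO X' A))))"
        using A k S.X.tail[OF S.X.flip_nat[of "\<pi> k A" "GO (B k) A"], of "TM X (gdist G A) \<bullet> gdist G (TO X' A)"]
          S.X.tail[OF Ted[OF k A], of "gdist G (TO X' A)"] by (simp add: ed)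
      also have "\<dots> = TM X (gdist (B k) A) \<bullet> (gdist (B k) (TO X' A) \<bullet> (GM (B k) (tflip X' A) \<bullet> \<pi> k (TO X' (TO X' A))))"
        using A k S.X.tail3[OF gdist_flip[OF B[OF k] A], of "\<pi> k (TO X' (TO X' A))"] by simp
      also have "\<dots> = TM X (TM X (\<pi> k A)) \<bullet> (TM X (gdist G A) \<bullet> (gdist G (TO X' A) \<bullet> GM G (tflip X' A)))"
        using A k S.X.tail[OF Ted[OF k A], of "gdist G (TO X' A) \<bullet> GM G (tflip X' A)"] by (simp add: pid eM')
      finally show "TM X (TM X (\<pi> k A)) \<bullet> (tflip X (GO G A) \<bullet> (TM X (gdist G A) \<bullet> gdist G (TO X' A)))
        = TM X (TM X (\<pi> k A)) \<bullet> (TM X (gdist G A) \<bullet> (gdist G (TO X' A) \<bullet> GM G (tflip X' A)))" .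
    qed (use A in simp_all)
    show "TM X (gtau G A) \<bullet> (sdist S (GO G A) \<bullet> SM S (gdist G A)) = gdist G (SO S' A) \<bullet> (GM G (sdist S' A) \<bullet> gtau G (TO X' A))"
    proof (rule jointly_monicD[OF J(2)[of "SO S' A"]])
      fix k assume k: "k \<in> K"
      have "TM X (\<pi> k (SO S' A)) \<bullet> (TM X (gtau G A) \<bullet> (sdist S (GO G A) \<bullet> SM S (gdist G A)))
        = TM X (gtau (B k) A) \<bullet> (sdist S (GO (B k) A) \<bullet> (SM S (gdist (B k) A) \<bullet> SM S (\<pi> k (TO X' A))))"
        using A k S.X.tail[OF Tet[OF k A], of "sdist S (GO G A) \<bullet> SM S (gdist G A)"]
          S.X.tail[OF S.sdist_nat[of "\<pi> k A" "GO (B k) A"], of "SM S (gdist G A)"] Sed[OF k A] by simp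
      also have "\<dots> = gdist (B k) (SO S' A) \<bullet> (GM (B k) (sdist S' A) \<bullet> (gtau (B k) (TO X' A) \<bullet> SM S (\<pi> k (TO X' A))))"
        using A k S.X.tail3[OF gtau_dist[OF B[OF k] A], of "SM S (\<pi> k (TO X' A))"] by simp
      also have "\<dots> = TM X (\<pi> k (SO S' A)) \<bullet> (gdist G (SO S' A) \<bullet> (GM G (sdist S' A) \<bullet> gtau G (TO X' A)))"
        using A k by (simp add: pid piM et)
      finally show "TM X (\<pi> k (SO S' A)) \<bullet> (TM X (gtau G A) \<bullet> (sdist S (GO G A) \<bullet> SM S (gdist G A)))
        = TM X (\<pi> k (SO S' A)) \<bullet> (gdist G (SO S' A) \<bullet> (GM G (sdist S' A) \<bullet> gtau G (TO X' A)))" .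
    qed (use A in simp_all)
    show "gtau G A \<bullet> eta S (GO G A) = GM G (eta S' A)"
    proof (rule jointly_monicD[OF J(1)[of "SO S' A"]])
      fix k assume k: "k \<in> K"
      show "\<pi> k (SO S' A) \<bullet> (gtau G A \<bullet> eta S (GO G A)) = \<pi> k (SO S' A) \<bullet> GM G (eta S' A)"
        using A k S.eta_nat[of "\<pi> k A" "GO (B k) A"] S.X.tail[OF gtau_monad(1)[OF B[OF k] A], of "\<pi> k A"] by (simp add: pit eM')
    qed (use A in simp_all)
    show "gtau G A \<bullet> mu S (GO G A) = GM G (mu S' A) \<bullet> (gtau G (SO S' A) \<bullet> SM S (gtau G A))"
    proof (rule jointly_monicD[OF J(1)[of "SO S' A"]])
      fix k assume k: "k \<in> K"
      show "\<pi> k (SO S' A) \<bullet> (gtau G A \<bullet> mu S (GO G A)) = \<pi> k (SO S' A) \<bullet> (GM G (mu S' A) \<bullet> (gtau G (SO S' A) \<bullet> SM S (gtau G A)))"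
        using A k S.mu_nat[of "\<pi> k A" "GO (B k) A"] S.X.tail[OF gtau_monad(2)[OF B[OF k] A], of "SM S (SM S (\<pi> k A))"] Set[OF k A]
        by (simp add: pit piM)
    qed (use A in simp_all)
  qed
qed

text \<open>Limits of 1-morphisms are computed objectwise. The universal properties at the various objects induce the
  action on maps and the distributive law with the monads; for the one with the tangent bundle functors
  the limit at \<open>A\<close> has to be preserved by \<open>T\<close>.\<close>

lemma limit_one_morphism:
  assumes B: "\<And>k. k \<in> K \<Longrightarrow> one_morphism S' S (B k)"
    and d: "\<And>k k'. (k, k') \<in> E \<Longrightarrow> two_morphism S' S (B k) (B k') (d k k')"
    and L: "\<And>A. A \<in> Obj X' \<Longrightarrow> S.X.T_limit K E (\<lambda>k k'. d k k' A) (\<lambda>k. GO (B k) A) (P A) (\<lambda>k. \<pi> k A)"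
  obtains Q where "one_morphism S' S Q" "\<forall>A\<in>Obj X'. GO Q A = P A"
    "\<forall>k\<in>K. two_morphism S' S Q (B k) (\<lambda>A\<in>Obj X'. \<pi> k A)"
proof -
  note L1 = S.X.T_limitD(1)[OF L] and L2 = S.X.T_limitD(2)[OF L] and L3 = S.X.T_limitD(3)[OF L]
  note [simp] = B
  have P [simp]: "P A \<in> Obj X" if "A \<in> Obj X'" for A using is_limitD(1)[OF L1[OF that]] .
  have \<pi> [simp]: "\<pi> k A \<in> Arr X" "Dom X (\<pi> k A) = P A" "Cod X (\<pi> k A) = GO (B k) A" if "k \<in> K" "A \<in> Obj X'" for k A
    using is_limitD(2-4)[OF L1[OF that(2)] that(1)] by simp_all
  have edge: "k \<in> K" "k' \<in> K" if "(k, k') \<in> E" "A \<in> Obj X'" for k k' A using is_limit_edge[OF L1[OF that(2)] that(1)] .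
  have d\<pi>: "d k k' A \<bullet> \<pi> k A = \<pi> k' A" if "(k, k') \<in> E" "A \<in> Obj X'" for k k' A using is_limitD(6)[OF L1[OF that(2)] that(1)] .
  have "\<forall>f\<in>Arr X'. \<exists>h. h \<in> Arr X \<and> Dom X h = P (Dom X' f) \<and> Cod X h = P (Cod X' f) \<and>
      (\<forall>k\<in>K. \<pi> k (Cod X' f) \<bullet> h = GM (B k) f \<bullet> \<pi> k (Dom X' f))"
  proof
    fix f assume f: "f \<in> Arr X'"
    obtain h where "h \<in> Arr X" "Dom X h = P (Dom X' f)" "Cod X h = P (Cod X' f)"
      "\<And>k. k \<in> K \<Longrightarrow> \<pi> k (Cod X' f) \<bullet> h = GM (B k) f \<bullet> \<pi> k (Dom X' f)"
    proof (rule is_limit_obtain[OF L1[of "Cod X' f"], of "P (Dom X' f)" "\<lambda>k. GM (B k) f \<bullet> \<pi> k (Dom X' f)"])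
      fix k k' assume e: "(k, k') \<in> E"
      have D: "Dom X' f \<in> Obj X'" using f by simp
      note kk = edge[OF e D]
      note dd = two_morphismD[OF B[OF kk(1)] B[OF kk(2)] d[OF e]]
      show "d k k' (Cod X' f) \<bullet> (GM (B k) f \<bullet> \<pi> k (Dom X' f)) = GM (B k') f \<bullet> \<pi> k' (Dom X' f)"
        using S.X.tail[OF dd(6)[OF f refl], of "\<pi> k (Dom X' f)"] f kk dd(1-3) d\<pi>[OF e D] by simp
    qed (use f in simp_all)
    then show "\<exists>h. h \<in> Arr X \<and> Dom X h = P (Dom X' f) \<and> Cod X h = P (Cod X' f) \<and>
      (\<forall>k\<in>K. \<pi> k (Cod X' f) \<bullet> h = GM (B k) f \<bullet> \<pi> k (Dom X' f))" by blast
  qed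
  from bchoice[OF this] obtain m where m: "\<forall>f\<in>Arr X'. m f \<in> Arr X \<and> Dom X (m f) = P (Dom X' f) \<and> Cod X (m f) = P (Cod X' f) \<and>
      (\<forall>k\<in>K. \<pi> k (Cod X' f) \<bullet> m f = GM (B k) f \<bullet> \<pi> k (Dom X' f))" by blast
  have "\<forall>A\<in>Obj X'. \<exists>h. h \<in> Arr X \<and> Dom X h = P (TO X' A) \<and> Cod X h = TO X (P A) \<and>
      (\<forall>k\<in>K. TM X (\<pi> k A) \<bullet> h = gdist (B k) A \<bullet> \<pi> k (TO X' A))"
  proof
    fix A assume A: "A \<in> Obj X'"
    then have TA: "TO X' A \<in> Obj X'" by simp
    obtain h where "h \<in> Arr X" "Dom X h = P (TO X' A)" "Cod X h = TO X (P A)"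
      "\<And>k. k \<in> K \<Longrightarrow> TM X (\<pi> k A) \<bullet> h = gdist (B k) A \<bullet> \<pi> k (TO X' A)"
    proof (rule is_limit_obtain[OF L2[OF A], of "P (TO X' A)" "\<lambda>k. gdist (B k) A \<bullet> \<pi> k (TO X' A)"])
      fix k k' assume e: "(k, k') \<in> E"
      note kk = edge[OF e A]
      note dd = two_morphismD[OF B[OF kk(1)] B[OF kk(2)] d[OF e]]
      show "TM X (d k k' A) \<bullet> (gdist (B k) A \<bullet> \<pi> k (TO X' A)) = gdist (B k') A \<bullet> \<pi> k' (TO X' A)"
        using S.X.tail[OF dd(4)[OF A], of "\<pi> k (TO X' A)"] A TA kk dd(1-3) d\<pi>[OF e TA] by simp
    qed (use A in simp_all)
    then show "\<exists>h. h \<in> Arr X \<and> Dom X h = P (TO X' A) \<and> Cod X h = TO X (P A) \<and>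
      (\<forall>k\<in>K. TM X (\<pi> k A) \<bullet> h = gdist (B k) A \<bullet> \<pi> k (TO X' A))" by blast
  qed
  from bchoice[OF this] obtain b where b: "\<forall>A\<in>Obj X'. b A \<in> Arr X \<and> Dom X (b A) = P (TO X' A) \<and> Cod X (b A) = TO X (P A) \<and>
      (\<forall>k\<in>K. TM X (\<pi> k A) \<bullet> b A = gdist (B k) A \<bullet> \<pi> k (TO X' A))" by blast
  have "\<forall>A\<in>Obj X'. \<exists>h. h \<in> Arr X \<and> Dom X h = SO S (P A) \<and> Cod X h = P (SO S' A) \<and>
      (\<forall>k\<in>K. \<pi> k (SO S' A) \<bullet> h = gtau (B k) A \<bullet> SM S (\<pi> k A))"
  proof
    fix A assume A: "A \<in> Obj X'"
    obtain h where "h \<in> Arr X" "Dom X h = SO S (P A)" "Cod X h = P (SO S' A)"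
      "\<And>k. k \<in> K \<Longrightarrow> \<pi> k (SO S' A) \<bullet> h = gtau (B k) A \<bullet> SM S (\<pi> k A)"
    proof (rule is_limit_obtain[OF L1[of "SO S' A"], of "SO S (P A)" "\<lambda>k. gtau (B k) A \<bullet> SM S (\<pi> k A)"])
      fix k k' assume e: "(k, k') \<in> E"
      note kk = edge[OF e A]
      note dd = two_morphismD[OF B[OF kk(1)] B[OF kk(2)] d[OF e]]
      have "SM S (d k k' A) \<bullet> SM S (\<pi> k A) = SM S (\<pi> k' A)"
        using arg_cong[OF d\<pi>[OF e A], of "SM S"] A kk dd(1-3) by simp
      then show "d k k' (SO S' A) \<bullet> (gtau (B k) A \<bullet> SM S (\<pi> k A)) = gtau (B k') A \<bullet> SM S (\<pi> k' A)"
        using S.X.tail[OF dd(5)[OF A], of "SM S (\<pi> k A)"] A kk dd(1-3) by simp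
    qed (use A in simp_all)
    then show "\<exists>h. h \<in> Arr X \<and> Dom X h = SO S (P A) \<and> Cod X h = P (SO S' A) \<and>
      (\<forall>k\<in>K. \<pi> k (SO S' A) \<bullet> h = gtau (B k) A \<bullet> SM S (\<pi> k A))" by blast
  qed
  from bchoice[OF this] obtain t where t: "\<forall>A\<in>Obj X'. t A \<in> Arr X \<and> Dom X (t A) = SO S (P A) \<and> Cod X (t A) = P (SO S' A) \<and>
      (\<forall>k\<in>K. \<pi> k (SO S' A) \<bullet> t A = gtau (B k) A \<bullet> SM S (\<pi> k A))" by blast
  define Q where "Q = \<lparr>GO = (\<lambda>A\<in>Obj X'. P A), GM = (\<lambda>f\<in>Arr X'. m f), gdist = (\<lambda>A\<in>Obj X'. b A), gtau = (\<lambda>A\<in>Obj X'. t A)\<rparr>"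
  have Q: "A \<in> Obj X' \<Longrightarrow> GO Q A = P A" "f \<in> Arr X' \<Longrightarrow> GM Q f = m f" "A \<in> Obj X' \<Longrightarrow> gdist Q A = b A"
    "A \<in> Obj X' \<Longrightarrow> gtau Q A = t A" for A f by (simp_all add: Q_def)
  have 1: "one_morphism S' S Q"
  proof (rule one_morphism_from_legs[where B = B and K = K and \<pi> = \<pi>, OF B])
    fix A assume A: "A \<in> Obj X'"
    show "jointly_monic X K (GO Q A) (\<lambda>k. \<pi> k A)"
      "jointly_monic X K (TO X (GO Q A)) (\<lambda>k. TM X (\<pi> k A))"
      "jointly_monic X K (TO X (TO X (GO Q A))) (\<lambda>k. TM X (TM X (\<pi> k A)))"
      using S.X.is_limit_jointly_monic[OF L1[OF A]] S.X.is_limit_jointly_monic[OF L2[OF A]] S.X.is_limit_jointly_monic[OF L3[OF A]]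
      by (simp_all add: Q A)
  qed (use m b t in \<open>simp_all add: Q\<close>, simp_all add: Q_def)
  show thesis
  proof (rule that[OF 1])
    show "\<forall>A\<in>Obj X'. GO Q A = P A" by (simp add: Q)
    show "\<forall>k\<in>K. two_morphism S' S Q (B k) (\<lambda>A\<in>Obj X'. \<pi> k A)"
      using m b t by (simp add: two_morphism_iff 1 Q)
  qed
qed

end

context monad_on_tangent_category
begin

text \<open>The tangent bundle functor, with the flip and the distributive law of the monad, is an
  endo-1-morphism; postcomposition with it is the tangent bundle functor of the hom-tangent
  categories.\<close>

definition tangent_bundle :: "('o, 'a, 'o, 'a) mor1" where
  "tangent_bundle = \<lparr>GO = (\<lambda>A\<in>Obj X. TO X A), GM = (\<lambda>f\<in>Arr X. TM X f),
     gdist = (\<lambda>A\<in>Obj X. tflip X A), gtau = (\<lambda>A\<in>Obj X. sdist S A)\<rparr>"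

lemma tangent_bundle_one_morphism: "one_morphism S S tangent_bundle"
proof -
  interpret SS: monads S S ..
  show ?thesis
    by (rule SS.one_morphismI)
      (simp_all add: tangent_bundle_def X.flip_nat X.flip_proj X.flip_zero X.flip_sum X.lift_flip X.flip_braid
        sdist_nat sdist_flip eta_dist mu_dist)
qed

end

context monads
begin

lemma mor1_T_simps [simp]:
  "A \<in> Obj X' \<Longrightarrow> GO (mor1_T S' S G) A = TO X (GO G A)"
  "f \<in> Arr X' \<Longrightarrow> GM (mor1_T S' S G) f = TM X (GM G f)"
  "A \<in> Obj X' \<Longrightarrow> gdist (mor1_T S' S G) A = tflip X (GO G A) \<bullet> TM X (gdist G A)"
  "A \<in> Obj X' \<Longrightarrow> gtau (mor1_T S' S G) A = TM X (gtau G A) \<bullet> sdist S (GO G A)"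
  by (simp_all add: mor1_T_def Let_def)

lemma mor1_T_comp1:
  assumes "one_morphism S' S G"
  shows "mor1_T S' S G = comp1 S' S S.tangent_bundle G"
  using assms by (auto simp: mor1_T_def comp1_def S.tangent_bundle_def Let_def intro!: restrict_ext)

lemma mor1_T_one_morphism [simp]:
  assumes G: "one_morphism S' S G"
  shows "one_morphism S' S (mor1_T S' S G)"
proof -
  interpret T: three_monads S' S S ..
  show ?thesis unfolding mor1_T_comp1[OF G] by (rule T.comp1_one_morphism[OF S.tangent_bundle_one_morphism G])
qed

lemma proj_two_morphism:
  assumes G: "one_morphism S' S G"
  shows "two_morphism S' S (mor1_T S' S G) G (\<lambda>A\<in>Obj X'. tproj X (GO G A))"
proof -
  note [simp] = G
  have "TM X (tproj X (GO G A)) \<bullet> (tflip X (GO G A) \<bullet> TM X (gdist G A))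
      = gdist G A \<bullet> tproj X (GO G (TO X' A))" if "A \<in> Obj X'" for A
    using that S.X.tail[OF S.X.flip_proj_T[of "GO G A"], of "TM X (gdist G A)"] S.X.proj_nat[of "gdist G A" "TO X (GO G A)"] by simp
  moreover have "tproj X (GO G (SO S' A)) \<bullet> (TM X (gtau G A) \<bullet> sdist S (GO G A))
      = gtau G A \<bullet> SM S (tproj X (GO G A))" if "A \<in> Obj X'" for A
    using that S.X.tail[OF S.X.proj_nat[of "gtau G A" "GO G (SO S' A)"], of "sdist S (GO G A)"] S.sdist_proj[of "GO G A"] by simp
  ultimately show ?thesis
    using S.X.proj_nat[of "GM G _"] by (simp add: two_morphism_iff)
qed

lemma zero_two_morphism:
  assumes G: "one_morphism S' S G"
  shows "two_morphism S' S G (mor1_T S' S G) (\<lambda>A\<in>Obj X'. tzero X (GO G A))"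
proof -
  note [simp] = G
  have z: "tflip X B \<bullet> tzero X (TO X B) = TM X (tzero X B)" if "B \<in> Obj X" for B
    using that S.X.flip_tails(4)[of B "TM X (tzero X B)"] S.X.flip_zero[of B] by simp
  have "TM X (tzero X (GO G A)) \<bullet> gdist G A
      = tflip X (GO G A) \<bullet> (TM X (gdist G A) \<bullet> tzero X (GO G (TO X' A)))" if "A \<in> Obj X'" for A
    using that S.X.tail[OF z[of "GO G A"], of "gdist G A"] S.X.zero_nat[of "gdist G A" "TO X (GO G A)"] by simp
  moreover have "tzero X (GO G (SO S' A)) \<bullet> gtau G A
      = TM X (gtau G A) \<bullet> (sdist S (GO G A) \<bullet> SM S (tzero X (GO G A)))" if "A \<in> Obj X'" for A
    using that S.sdist_zero[of "GO G A"] S.X.zero_nat[of "gtau G A" "GO G (SO S' A)"] by simp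
  ultimately show ?thesis
    using S.X.zero_nat[of "GM G _"] by (simp add: two_morphism_iff)
qed

lemma lift_two_morphism:
  assumes G: "one_morphism S' S G"
  shows "two_morphism S' S (mor1_T S' S G) (mor1_T S' S (mor1_T S' S G)) (\<lambda>A\<in>Obj X'. tlift X (GO G A))"
proof -
  note [simp] = G
  have "TM X (tlift X (GO G A)) \<bullet> (tflip X (GO G A) \<bullet> TM X (gdist G A))
      = tflip X (TO X (GO G A)) \<bullet> (TM X (tflip X (GO G A)) \<bullet> (TM X (TM X (gdist G A)) \<bullet> tlift X (GO G (TO X' A))))"
    if "A \<in> Obj X'" for A
    using that S.X.tail3[OF S.X.flip_flip_lift[of "GO G A"], of "TM X (gdist G A)"] S.X.lift_nat[of "gdist G A" "TO X (GO G A)"] by simp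
  moreover have "tlift X (GO G (SO S' A)) \<bullet> (TM X (gtau G A) \<bullet> sdist S (GO G A))
      = TM X (TM X (gtau G A)) \<bullet> (TM X (sdist S (GO G A)) \<bullet> (sdist S (TO X (GO G A)) \<bullet> SM S (tlift X (GO G A))))"
    if "A \<in> Obj X'" for A
    using that S.sdist_lift[of "GO G A"] S.X.tail[OF S.X.lift_nat[of "gtau G A" "GO G (SO S' A)"], of "sdist S (GO G A)"] by simp
  ultimately show ?thesis
    using S.X.lift_nat[of "GM G _"] by (simp add: two_morphism_iff)
qed

lemma flip_two_morphism:
  assumes G: "one_morphism S' S G"
  shows "two_morphism S' S (mor1_T S' S (mor1_T S' S G)) (mor1_T S' S (mor1_T S' S G)) (\<lambda>A\<in>Obj X'. tflip X (GO G A))"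
proof -
  note [simp] = G
  have "TM X (tflip X (GO G A)) \<bullet> (tflip X (TO X (GO G A)) \<bullet> (TM X (tflip X (GO G A)) \<bullet> TM X (TM X (gdist G A))))
      = tflip X (TO X (GO G A)) \<bullet> (TM X (tflip X (GO G A)) \<bullet> (TM X (TM X (gdist G A)) \<bullet> tflip X (GO G (TO X' A))))"
    if "A \<in> Obj X'" for A
    using that S.X.tail3[OF S.X.flip_braid[of "GO G A"], of "TM X (TM X (gdist G A))"]
      S.X.flip_nat[of "gdist G A" "TO X (GO G A)"] by simp
  moreover have "tflip X (GO G (SO S' A)) \<bullet> (TM X (TM X (gtau G A)) \<bullet> (TM X (sdist S (GO G A)) \<bullet> sdist S (TO X (GO G A))))
      = TM X (TM X (gtau G A)) \<bullet> (TM X (sdist S (GO G A)) \<bullet> (sdist S (TO X (GO G A)) \<bullet> SM S (tflip X (GO G A))))"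
    if "A \<in> Obj X'" for A
    using that S.sdist_flip[of "GO G A"]
      S.X.tail[OF S.X.flip_nat[of "gtau G A" "GO G (SO S' A)"], of "TM X (sdist S (GO G A)) \<bullet> sdist S (TO X (GO G A))"] by simp
  ultimately show ?thesis
    using S.X.flip_nat[of "GM G _"] by (simp add: two_morphism_iff)
qed

lemma T_two_morphism:
  assumes G: "one_morphism S' S G" and H: "one_morphism S' S H" and \<phi>: "two_morphism S' S G H \<phi>"
  shows "two_morphism S' S (mor1_T S' S G) (mor1_T S' S H) (\<lambda>A\<in>Obj X'. TM X (\<phi> A))"
proof -
  note [simp] = G H
  note f = two_morphismD[OF G H \<phi>]
  note [simp] = f(1-3)
  have "TM X (TM X (\<phi> A)) \<bullet> (tflip X (GO G A) \<bullet> TM X (gdist G A)) = tflip X (GO H A) \<bullet> (TM X (gdist H A) \<bullet> TM X (\<phi> (TO X' A)))"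
    if "A \<in> Obj X'" for A
    using that arg_cong[OF f(4)[OF that], of "TM X"] S.X.tail[OF S.X.flip_nat[of "\<phi> A" "GO H A"], of "TM X (gdist G A)"] by simp
  moreover have "TM X (\<phi> (SO S' A)) \<bullet> (TM X (gtau G A) \<bullet> sdist S (GO G A)) = TM X (gtau H A) \<bullet> (sdist S (GO H A) \<bullet> SM S (TM X (\<phi> A)))"
    if A: "A \<in> Obj X'" for A
  proof -
    have "TM X (\<phi> (SO S' A)) \<bullet> TM X (gtau G A) = TM X (gtau H A) \<bullet> TM X (SM S (\<phi> A))"
      using A arg_cong[OF f(5)[OF A], of "TM X"] by simp
    from S.X.tail[OF this, of "sdist S (GO G A)"] show ?thesis using A S.sdist_nat[of "\<phi> A" "GO H A"] by simp
  qed
  moreover have "TM X (\<phi> (Cod X' g)) \<bullet> TM X (GM G g) = TM X (GM H g) \<bullet> TM X (\<phi> (Dom X' g))"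
    if "g \<in> Arr X'" for g
    using that arg_cong[OF f(6)[OF that refl], of "TM X"] by simp
  ultimately show ?thesis by (simp add: two_morphism_iff)
qed

lemma fold_one_morphism:
  assumes G: "one_morphism S' S G"
    and L: "\<And>A. A \<in> Obj X' \<Longrightarrow> S.X.T_limit {..n} ({..<n} \<times> {n}) (\<lambda>_ _. tproj X (GO G A))
      ((\<lambda>_. TO X (GO G A))(n := GO G A)) (P A) (\<pi> A)"
  obtains Q where "one_morphism S' S Q" "\<forall>A\<in>Obj X'. GO Q A = P A"
    "two_morphism S' S Q G (\<lambda>A\<in>Obj X'. \<pi> A n)"
    "\<forall>j<n. two_morphism S' S Q (mor1_T S' S G) (\<lambda>A\<in>Obj X'. \<pi> A j)"
proof -
  define B where "B k = (if k = n then G else mor1_T S' S G)" for k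
  obtain Q where Q: "one_morphism S' S Q" "\<forall>A\<in>Obj X'. GO Q A = P A"
    "\<forall>k\<in>{..n}. two_morphism S' S Q (B k) (\<lambda>A\<in>Obj X'. \<pi> A k)"
  proof (rule limit_one_morphism[where B = B and K = "{..n}" and E = "{..<n} \<times> {n}" and P = P and \<pi> = "\<lambda>k A. \<pi> A k"
      and d = "\<lambda>_ _. \<lambda>A\<in>Obj X'. tproj X (GO G A)"])
    show "one_morphism S' S (B k)" for k using G by (simp add: B_def)
    show "(k, k') \<in> {..<n} \<times> {n} \<Longrightarrow> two_morphism S' S (B k) (B k') (\<lambda>A\<in>Obj X'. tproj X (GO G A))" for k k'
      using proj_two_morphism[OF G] by (auto simp: B_def)
    fix A assume A: "A \<in> Obj X'"
    have "(\<lambda>k. GO (B k) A) = (\<lambda>_. TO X (GO G A))(n := GO G A)" using A by (auto simp: B_def)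
    then show "S.X.T_limit {..n} ({..<n} \<times> {n}) (\<lambda>k k'. (\<lambda>A\<in>Obj X'. tproj X (GO G A)) A)
      (\<lambda>k. GO (B k) A) (P A) (\<lambda>k. \<pi> A k)" using L[OF A] A by simp
  qed
  have "two_morphism S' S Q G (\<lambda>A\<in>Obj X'. \<pi> A n)" using bspec[OF Q(3), of n] by (simp add: B_def)
  moreover have "\<forall>j<n. two_morphism S' S Q (mor1_T S' S G) (\<lambda>A\<in>Obj X'. \<pi> A j)"
  proof (intro allI impI)
    fix j assume "j < n"
    then show "two_morphism S' S Q (mor1_T S' S G) (\<lambda>A\<in>Obj X'. \<pi> A j)" using bspec[OF Q(3), of j] by (simp add: B_def)
  qed
  ultimately show thesis using that Q(1,2) by blast
qed

text \<open>There is at most one 1-morphism with underlying objects \<open>T\<^sub>2 G A\<close> for which both projections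
  are 2-morphisms.\<close>

lemma mor1_T2_unique:
  assumes G: "one_morphism S' S G" and Q: "one_morphism S' S Q" "\<forall>A\<in>Obj X'. GO Q A = T2 X (GO G A)"
    and p: "two_morphism S' S Q (mor1_T S' S G) (\<lambda>A\<in>Obj X'. tpi1 X (GO G A))"
    "two_morphism S' S Q (mor1_T S' S G) (\<lambda>A\<in>Obj X'. tpi2 X (GO G A))"
  shows "mor1_T2 S' S G = Q"
proof -
  note [simp] = G
  note p1 = two_morphismD[OF Q(1) mor1_T_one_morphism[OF G] p(1)] and p2 = two_morphismD[OF Q(1) mor1_T_one_morphism[OF G] p(2)]
  have QO: "GO Q A = T2 X (GO G A)" if "A \<in> Obj X'" for A using Q(2) that by simp
  note [simp] = Q(1)
  show ?thesis
  proof (rule mor1.equality)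
    show "GO (mor1_T2 S' S G) = GO Q"
      using one_morphism_lax(3)[OF Q(1)] by (intro extensionalityI[of _ "Obj X'"]) (auto simp: mor1_T2_def Let_def QO)
    show "GM (mor1_T2 S' S G) = GM Q"
    proof (rule extensionalityI[of _ "Arr X'"])
      fix f assume f: "f \<in> Arr X'"
      have "T2M X (GM G f) = GM Q f"
        unfolding T2M_def by (rule S.X.pair2_eqI) (use f p1(6)[OF f refl] p2(6)[OF f refl] in \<open>simp_all add: QO\<close>)
      then show "GM (mor1_T2 S' S G) f = GM Q f" using f by (simp add: mor1_T2_def Let_def)
    qed (use one_morphism_lax(4)[OF Q(1)] in \<open>auto simp: mor1_T2_def Let_def\<close>)
    show "gdist (mor1_T2 S' S G) = gdist Q"
    proof (rule extensionalityI[of _ "Obj X'"])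
      fix A assume A: "A \<in> Obj X'"
      have B: "GO G A \<in> Obj X" using A by simp
      have "pair X (TM X (tpi1 X (GO G A))) (TM X (tpi2 X (GO G A)))
         (gdist (mor1_T S' S G) A \<bullet> tpi1 X (GO G (TO X' A))) (gdist (mor1_T S' S G) A \<bullet> tpi2 X (GO G (TO X' A))) = gdist Q A"
        by (rule S.X.pair_eqI[where A = undefined and B = undefined, OF disjI2[OF S.X.T_T2_pullback[OF B, of 1, simplified]]])
          (use A p1(4)[OF A] p2(4)[OF A] in \<open>simp_all add: QO\<close>)
      then show "gdist (mor1_T2 S' S G) A = gdist Q A" using A by (simp add: mor1_T2_def Let_def)
    qed (use one_morphism_lax(5)[OF Q(1)] in \<open>auto simp: mor1_T2_def Let_def\<close>)
    show "gtau (mor1_T2 S' S G) = gtau Q"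
    proof (rule extensionalityI[of _ "Obj X'"])
      fix A assume A: "A \<in> Obj X'"
      have "pair2 X (GO G (SO S' A)) (gtau (mor1_T S' S G) A \<bullet> SM S (tpi1 X (GO G A))) (gtau (mor1_T S' S G) A \<bullet> SM S (tpi2 X (GO G A))) = gtau Q A"
        by (rule S.X.pair2_eqI) (use A p1(5)[OF A] p2(5)[OF A] in \<open>simp_all add: QO\<close>)
      then show "gtau (mor1_T2 S' S G) A = gtau Q A" using A by (simp add: mor1_T2_def Let_def)
    qed (use one_morphism_lax(6)[OF Q(1)] in \<open>auto simp: mor1_T2_def Let_def\<close>)
  qed simp
qed

text \<open>The explicit formulas for \<open>T\<^sub>2 G\<close> describe the 1-morphism that exists as a limit of \<open>G\<close> and \<open>T G\<close>. The
  same argument yields products and the terminal object below.\<close>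

lemma mor1_T2_one_morphism:
  assumes G: "one_morphism S' S G"
  shows "one_morphism S' S (mor1_T2 S' S G)"
    "two_morphism S' S (mor1_T2 S' S G) (mor1_T S' S G) (\<lambda>A\<in>Obj X'. tpi1 X (GO G A))"
    "two_morphism S' S (mor1_T2 S' S G) (mor1_T S' S G) (\<lambda>A\<in>Obj X'. tpi2 X (GO G A))"
proof -
  note [simp] = G
  obtain Q where Q: "one_morphism S' S Q" "\<forall>A\<in>Obj X'. GO Q A = T2 X (GO G A)"
    "\<forall>j<2. two_morphism S' S Q (mor1_T S' S G) (\<lambda>A\<in>Obj X'. S.X.T2_legs (GO G A) j)"
    by (rule fold_one_morphism[OF G, where n = 2 and P = "\<lambda>A. T2 X (GO G A)" and \<pi> = "\<lambda>A. S.X.T2_legs (GO G A)"])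
      (use S.X.T2_T_limit in auto)
  have p: "two_morphism S' S Q (mor1_T S' S G) (\<lambda>A\<in>Obj X'. tpi1 X (GO G A))"
    "two_morphism S' S Q (mor1_T S' S G) (\<lambda>A\<in>Obj X'. tpi2 X (GO G A))"
    using Q(3)[rule_format, of 0] Q(3)[rule_format, of 1] by simp_all
  have "mor1_T2 S' S G = Q" by (rule mor1_T2_unique[OF G Q(1,2) p])
  then show "one_morphism S' S (mor1_T2 S' S G)"
    "two_morphism S' S (mor1_T2 S' S G) (mor1_T S' S G) (\<lambda>A\<in>Obj X'. tpi1 X (GO G A))"
    "two_morphism S' S (mor1_T2 S' S G) (mor1_T S' S G) (\<lambda>A\<in>Obj X'. tpi2 X (GO G A))" using Q(1) p by simp_all
qed

lemma mor1_T2_simps: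
  "A \<in> Obj X' \<Longrightarrow> GO (mor1_T2 S' S G) A = T2 X (GO G A)"
  "f \<in> Arr X' \<Longrightarrow> GM (mor1_T2 S' S G) f = T2M X (GM G f)"
  "A \<in> Obj X' \<Longrightarrow> gtau (mor1_T2 S' S G) A = pair2 X (GO G (SO S' A))
     (gtau (mor1_T S' S G) A \<bullet> SM S (tpi1 X (GO G A))) (gtau (mor1_T S' S G) A \<bullet> SM S (tpi2 X (GO G A)))"
  by (simp_all add: mor1_T2_def Let_def)

lemma sum_two_morphism:
  assumes G: "one_morphism S' S G"
  shows "two_morphism S' S (mor1_T2 S' S G) (mor1_T S' S G) (\<lambda>A\<in>Obj X'. tsum X (GO G A))"
proof -
  note T2 = mor1_T2_one_morphism[OF G]
  note [simp] = G T2(1)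
  note p1 = two_morphismD(4,5)[OF T2(1) mor1_T_one_morphism[OF G] T2(2)] and p2 = two_morphismD(4,5)[OF T2(1) mor1_T_one_morphism[OF G] T2(3)]
  have d: "TM X (tsum X (GO G A)) \<bullet> gdist (mor1_T2 S' S G) A
      = gdist (mor1_T S' S G) A \<bullet> tsum X (GO G (TO X' A))" if A: "A \<in> Obj X'" for A
  proof -
    define B C b D where "B = GO G A" and "C = GO G (TO X' A)" and "b = gdist G A" and "D = gdist (mor1_T2 S' S G) A"
    have t: "B \<in> Obj X" "C \<in> Obj X" "b \<in> Arr X" "Dom X b = C" "Cod X b = TO X B" "D \<in> Arr X" "Dom X D = T2 X C" "Cod X D = TO X (T2 X B)"
      unfolding B_def C_def b_def D_def using A by (simp_all add: mor1_T2_simps)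
    have e: "TM X (tpi1 X B) \<bullet> D = tflip X B \<bullet> (TM X b \<bullet> tpi1 X C)" "TM X (tpi2 X B) \<bullet> D = tflip X B \<bullet> (TM X b \<bullet> tpi2 X C)"
      unfolding B_def C_def b_def D_def using A p1(1)[OF A] p2(1)[OF A] by simp_all
    define w where "w = pair2 X (TO X B) (tflip X B \<bullet> TM X (tpi1 X B)) (tflip X B \<bullet> TM X (tpi2 X B))"
    have "TM X (tproj X B) \<bullet> TM X (tpi1 X B) = TM X (tproj X B) \<bullet> TM X (tpi2 X B)"
      using arg_cong[OF S.X.tpi_proj[OF t(1)], of "TM X"] t by simp
    then have w: "w \<in> Arr X" "Dom X w = TO X (T2 X B)" "Cod X w = T2 X (TO X B)"
      "tpi1 X (TO X B) \<bullet> w = tflip X B \<bullet> TM X (tpi1 X B)" "tpi2 X (TO X B) \<bullet> w = tflip X B \<bullet> TM X (tpi2 X B)"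
      unfolding w_def using t(1) by (simp_all add: S.X.flip_tails)
    have bt: "T2M X b \<in> Arr X" "Dom X (T2M X b) = T2 X C" "Cod X (T2M X b) = T2 X (TO X B)"
      "tpi1 X (TO X B) \<bullet> T2M X b = TM X b \<bullet> tpi1 X C" "tpi2 X (TO X B) \<bullet> T2M X b = TM X b \<bullet> tpi2 X C"
      using S.X.T2M_simps[of b] t by simp_all
    have wD: "w \<bullet> D = T2M X b"
      by (rule S.X.T2_ext[of "TO X B"])
        (use t w bt in \<open>simp_all add: e S.X.tail[OF w(4)] S.X.tail[OF w(5)] S.X.flip_tails(4)\<close>)
    have "tflip X B \<bullet> (TM X (tsum X B) \<bullet> D) = tsum X (TO X B) \<bullet> (w \<bullet> D)"
      using S.X.tail[OF S.X.flip_sum[OF t(1), folded w_def], of D] t w by simp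
    also have "\<dots> = TM X b \<bullet> tsum X C" unfolding wD using S.X.sum_nat[of b "TO X B"] t by simp
    finally have "tflip X B \<bullet> (tflip X B \<bullet> (TM X (tsum X B) \<bullet> D)) = tflip X B \<bullet> (TM X b \<bullet> tsum X C)" by simp
    then have "TM X (tsum X B) \<bullet> D = tflip X B \<bullet> (TM X b \<bullet> tsum X C)" using t by (simp add: S.X.flip_tails(4))
    then show ?thesis using A by (simp add: B_def C_def b_def D_def)
  qed
  have "tsum X (GO G (SO S' A)) \<bullet> gtau (mor1_T2 S' S G) A = gtau (mor1_T S' S G) A \<bullet> SM S (tsum X (GO G A))"
    if A: "A \<in> Obj X'" for A
  proof -
    define B C t where "B = GO G A" and "C = GO G (SO S' A)" and "t = gtau G A"
    have ty: "B \<in> Obj X" "C \<in> Obj X" "t \<in> Arr X" "Dom X t = SO S B" "Cod X t = C"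
      unfolding B_def C_def t_def using A by simp_all
    have "SM S (tproj X B) \<bullet> SM S (tpi1 X B) = SM S (tproj X B) \<bullet> SM S (tpi2 X B)"
      using arg_cong[OF S.X.tpi_proj[OF ty(1)], of "SM S"] ty by simp
    then have "tproj X (SO S B) \<bullet> (sdist S B \<bullet> SM S (tpi1 X B)) = tproj X (SO S B) \<bullet> (sdist S B \<bullet> SM S (tpi2 X B))"
      using ty S.X.tail[OF S.sdist_proj[OF ty(1)], of "SM S (tpi1 X B)"] S.X.tail[OF S.sdist_proj[OF ty(1)], of "SM S (tpi2 X B)"] by simp
    then have "TM X t \<bullet> (tsum X (SO S B) \<bullet> pair2 X (SO S B) (sdist S B \<bullet> SM S (tpi1 X B)) (sdist S B \<bullet> SM S (tpi2 X B)))
      = tsum X C \<bullet> pair2 X C (TM X t \<bullet> (sdist S B \<bullet> SM S (tpi1 X B))) (TM X t \<bullet> (sdist S B \<bullet> SM S (tpi2 X B)))"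
      using S.X.sum_pair_nat[of t "sdist S B \<bullet> SM S (tpi1 X B)" "sdist S B \<bullet> SM S (tpi2 X B)"] ty by simp
    then have "TM X t \<bullet> (sdist S B \<bullet> SM S (tsum X B)) = tsum X C \<bullet> pair2 X C (TM X t \<bullet> (sdist S B \<bullet> SM S (tpi1 X B))) (TM X t \<bullet> (sdist S B \<bullet> SM S (tpi2 X B)))"
      unfolding S.sdist_sum[OF ty(1)] .
    then show ?thesis using A ty by (simp add: mor1_T2_simps B_def C_def t_def)
  qed
  then show ?thesis
    using d S.X.sum_nat[of "GM G _"] by (simp add: two_morphism_iff mor1_T2_simps)
qed

end

locale cartesian_monads = monads S' S
  for S' :: "('p, 'b, 'n) tangent_monad" and S :: "('o, 'a) cart_tangent_monad" +
  assumes cartesian: "cartesian_tangent_monad S"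
begin

sublocale C: cartesian_tangent_category "base S"
  using cartesian by (simp add: cartesian_tangent_monad_def Let_def)

abbreviation "H \<equiv> hom_tangent S' S"

lemma H_simps [simp]:
  "G \<in> Obj H \<longleftrightarrow> one_morphism S' S G"
  "Dom H = asrc" "Cod H = atrg" "idt H G = Arrow G (\<lambda>A\<in>Obj X'. idt X (GO G A)) G"
  "\<psi> \<cdot>\<^bsub>H\<^esub> \<phi> = Arrow (asrc \<phi>) (\<lambda>A\<in>Obj X'. amap \<psi> A \<bullet> amap \<phi> A) (atrg \<psi>)"
  "TO H = mor1_T S' S" "T2 H = mor1_T2 S' S"
  "TM H \<phi> = Arrow (mor1_T S' S (asrc \<phi>)) (\<lambda>A\<in>Obj X'. TM X (amap \<phi> A)) (mor1_T S' S (atrg \<phi>))"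
  "tpi1 H G = Arrow (mor1_T2 S' S G) (\<lambda>A\<in>Obj X'. tpi1 X (GO G A)) (mor1_T S' S G)"
  "tpi2 H G = Arrow (mor1_T2 S' S G) (\<lambda>A\<in>Obj X'. tpi2 X (GO G A)) (mor1_T S' S G)"
  "tproj H G = Arrow (mor1_T S' S G) (\<lambda>A\<in>Obj X'. tproj X (GO G A)) G"
  "tzero H G = Arrow G (\<lambda>A\<in>Obj X'. tzero X (GO G A)) (mor1_T S' S G)"
  "tsum H G = Arrow (mor1_T2 S' S G) (\<lambda>A\<in>Obj X'. tsum X (GO G A)) (mor1_T S' S G)"
  "tlift H G = Arrow (mor1_T S' S G) (\<lambda>A\<in>Obj X'. tlift X (GO G A)) (mor1_T S' S (mor1_T S' S G))"
  "tflip H G = Arrow (mor1_T S' S (mor1_T S' S G)) (\<lambda>A\<in>Obj X'. tflip X (GO G A)) (mor1_T S' S (mor1_T S' S G))"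
  "terminal H = mor1_terminal S' S" "cprod H = mor1_prod S' S"
  "cfst H G K = Arrow (mor1_prod S' S G K) (\<lambda>A\<in>Obj X'. cfst X (GO G A) (GO K A)) G"
  "csnd H G K = Arrow (mor1_prod S' S G K) (\<lambda>A\<in>Obj X'. csnd X (GO G A) (GO K A)) K"
  by (simp_all add: hom_tangent_def Let_def)

lemma H_Arr_iff [simp]: "\<phi> \<in> Arr H \<longleftrightarrow> one_morphism S' S (asrc \<phi>) \<and> one_morphism S' S (atrg \<phi>) \<and>
    two_morphism S' S (asrc \<phi>) (atrg \<phi>) (amap \<phi>)"
  by (cases \<phi>) (auto simp: hom_tangent_def Let_def)

lemma two_morphism_idt: "one_morphism S' S G \<Longrightarrow> two_morphism S' S G G (\<lambda>A\<in>Obj X'. idt X (GO G A))"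
  by (simp add: two_morphism_iff)

lemma two_morphism_comp:
  assumes G: "one_morphism S' S G" "one_morphism S' S K" "one_morphism S' S L"
    and f: "two_morphism S' S G K \<phi>" and g: "two_morphism S' S K L \<psi>"
  shows "two_morphism S' S G L (\<lambda>A\<in>Obj X'. \<psi> A \<bullet> \<phi> A)"
proof -
  note [simp] = G
  note F = two_morphismD[OF G(1,2) f] and P = two_morphismD[OF G(2,3) g]
  note [simp] = F(1-3) P(1-3)
  have "TM X (\<psi> A) \<bullet> (TM X (\<phi> A) \<bullet> gdist G A) = gdist L A \<bullet> (\<psi> (TO X' A) \<bullet> \<phi> (TO X' A))"
    "\<psi> (SO S' A) \<bullet> (\<phi> (SO S' A) \<bullet> gtau G A) = gtau L A \<bullet> (SM S (\<psi> A) \<bullet> SM S (\<phi> A))" if "A \<in> Obj X'" for A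
    using that F(4,5)[OF that] S.X.tail[OF P(4)[OF that], of "\<phi> (TO X' A)"] S.X.tail[OF P(5)[OF that], of "SM S (\<phi> A)"] by simp_all
  moreover have "\<psi> (Cod X' h) \<bullet> (\<phi> (Cod X' h) \<bullet> GM G h) = GM L h \<bullet> (\<psi> (Dom X' h) \<bullet> \<phi> (Dom X' h))"
    if "h \<in> Arr X'" for h
    using that F(6)[OF that refl] S.X.tail[OF P(6)[OF that refl], of "\<phi> (Dom X' h)"] by simp
  ultimately show ?thesis by (simp add: two_morphism_iff)
qed

lemma category_H: "category H"
proof
  fix \<phi> \<psi> \<chi> G K L M
  have ext: "f = g" if "f \<in> extensional (Obj X')" "g \<in> extensional (Obj X')" "\<And>A. A \<in> Obj X' \<Longrightarrow> f A = g A"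
    for f g :: "'p \<Rightarrow> 'a" using that by (rule extensionalityI)
  show "\<phi> \<in> hom H G K \<Longrightarrow> \<psi> \<in> hom H K L \<Longrightarrow> \<psi> \<cdot>\<^bsub>H\<^esub> \<phi> \<in> hom H G L" using two_morphism_comp by auto
  show "\<phi> \<in> hom H G K \<Longrightarrow> \<phi> \<cdot>\<^bsub>H\<^esub> idt H G = \<phi>"
    by (cases \<phi>) (auto intro!: ext simp: two_morphismD)
  show "\<phi> \<in> hom H G K \<Longrightarrow> idt H K \<cdot>\<^bsub>H\<^esub> \<phi> = \<phi>"
    by (cases \<phi>) (auto intro!: ext simp: two_morphismD)
  show "\<phi> \<in> hom H G K \<Longrightarrow> \<psi> \<in> hom H K L \<Longrightarrow> \<chi> \<in> hom H L M \<Longrightarrow> \<chi> \<cdot>\<^bsub>H\<^esub> (\<psi> \<cdot>\<^bsub>H\<^esub> \<phi>) = (\<chi> \<cdot>\<^bsub>H\<^esub> \<psi>) \<cdot>\<^bsub>H\<^esub> \<phi>"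
    by (auto intro!: ext simp: two_morphismD)
qed (auto simp: two_morphism_idt)

lemma mor1_prod_one_morphism:
  assumes G: "one_morphism S' S G" and K: "one_morphism S' S K"
  shows "one_morphism S' S (mor1_prod S' S G K)"
    "two_morphism S' S (mor1_prod S' S G K) G (\<lambda>A\<in>Obj X'. cfst X (GO G A) (GO K A))"
    "two_morphism S' S (mor1_prod S' S G K) K (\<lambda>A\<in>Obj X'. csnd X (GO G A) (GO K A))"
proof -
  note [simp] = G K
  let ?B = "case_nat G (\<lambda>_. K)"
  let ?\<pi> = "\<lambda>k A. case_nat (cfst X (GO G A) (GO K A)) (\<lambda>_. csnd X (GO G A) (GO K A)) k"
  obtain Q where Q: "one_morphism S' S Q" "\<forall>A\<in>Obj X'. GO Q A = cprod X (GO G A) (GO K A)"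
    "\<forall>k\<in>{0, 1}. two_morphism S' S Q (?B k) (\<lambda>A\<in>Obj X'. ?\<pi> k A)"
  proof (rule limit_one_morphism[where K = "{0, 1}" and E = "{}" and B = ?B and P = "\<lambda>A. cprod X (GO G A) (GO K A)" and \<pi> = ?\<pi> and d = undefined])
    fix A assume A: "A \<in> Obj X'"
    have "S.X.T_limit {0, 1} {} (\<lambda>k k'. undefined k k' A) (case_nat (GO G A) (\<lambda>_. GO K A)) (cprod X (GO G A) (GO K A)) (\<lambda>k. ?\<pi> k A)"
      using C.product_T_limit[OF C.product[of "GO G A" "GO K A"]] A by simp
    moreover have "case_nat (GO G A) (\<lambda>_. GO K A) = (\<lambda>k. GO (?B k) A)" by (auto split: nat.split)
    ultimately show "S.X.T_limit {0, 1} {} (\<lambda>k k'. undefined k k' A) (\<lambda>k. GO (?B k) A) (cprod X (GO G A) (GO K A)) (\<lambda>k. ?\<pi> k A)"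
      by simp
  qed (auto split: nat.split)
  have p: "two_morphism S' S Q G (\<lambda>A\<in>Obj X'. cfst X (GO G A) (GO K A))"
    "two_morphism S' S Q K (\<lambda>A\<in>Obj X'. csnd X (GO G A) (GO K A))" using Q(3) by simp_all
  note p1 = two_morphismD[OF Q(1) G p(1)] and p2 = two_morphismD[OF Q(1) K p(2)]
  have QO: "GO Q A = cprod X (GO G A) (GO K A)" if "A \<in> Obj X'" for A using Q(2) that by simp
  note [simp] = Q(1)
  have "mor1_prod S' S G K = Q"
  proof (rule mor1.equality)
    show "GO (mor1_prod S' S G K) = GO Q"
      using one_morphism_lax(3)[OF Q(1)] by (intro extensionalityI[of _ "Obj X'"]) (auto simp: mor1_prod_def Let_def QO)
    show "GM (mor1_prod S' S G K) = GM Q"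
    proof (rule extensionalityI[of _ "Arr X'"])
      fix f assume f: "f \<in> Arr X'"
      have "cmap X (GM G f) (GM K f) = GM Q f"
        unfolding cmap_def by (rule C.cpair_eqI) (use f p1(6)[OF f refl] p2(6)[OF f refl] in \<open>simp_all add: QO\<close>)
      then show "GM (mor1_prod S' S G K) f = GM Q f" using f by (simp add: mor1_prod_def Let_def)
    qed (use one_morphism_lax(4)[OF Q(1)] in \<open>auto simp: mor1_prod_def Let_def\<close>)
    show "gdist (mor1_prod S' S G K) = gdist Q"
    proof (rule extensionalityI[of _ "Obj X'"])
      fix A assume A: "A \<in> Obj X'"
      have B: "GO G A \<in> Obj X" "GO K A \<in> Obj X" using A by simp_all
      note m = product_endomorphism.cmp_simps[OF C.product_endomorphism_T B]
      have "prod_cmp X (TO X) (TM X) (GO G A) (GO K A) \<bullet> cmap X (gdist G A) (gdist K A) = gdist Q A"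
        by (rule S.X.product_ext[OF C.T_product[OF B]])
          (use A B m p1(4)[OF A] p2(4)[OF A] in \<open>simp_all add: QO C.cmap_cpair S.X.tail[OF m(4)] S.X.tail[OF m(5)]\<close>)
      then show "gdist (mor1_prod S' S G K) A = gdist Q A" using A by (simp add: mor1_prod_def Let_def)
    qed (use one_morphism_lax(5)[OF Q(1)] in \<open>auto simp: mor1_prod_def Let_def\<close>)
    show "gtau (mor1_prod S' S G K) = gtau Q"
    proof (rule extensionalityI[of _ "Obj X'"])
      fix A assume A: "A \<in> Obj X'"
      have "cpair X (GO G (SO S' A)) (GO K (SO S' A)) (gtau G A \<bullet> SM S (cfst X (GO G A) (GO K A))) (gtau K A \<bullet> SM S (csnd X (GO G A) (GO K A))) = gtau Q A"
        by (rule C.cpair_eqI) (use A p1(5)[OF A] p2(5)[OF A] in \<open>simp_all add: QO\<close>)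
      then show "gtau (mor1_prod S' S G K) A = gtau Q A" using A by (simp add: mor1_prod_def Let_def)
    qed (use one_morphism_lax(6)[OF Q(1)] in \<open>auto simp: mor1_prod_def Let_def\<close>)
  qed simp
  then show "one_morphism S' S (mor1_prod S' S G K)"
    "two_morphism S' S (mor1_prod S' S G K) G (\<lambda>A\<in>Obj X'. cfst X (GO G A) (GO K A))"
    "two_morphism S' S (mor1_prod S' S G K) K (\<lambda>A\<in>Obj X'. csnd X (GO G A) (GO K A))" using Q(1) p by simp_all
qed

lemma mor1_terminal_one_morphism: "one_morphism S' S (mor1_terminal S' S)"
proof -
  obtain Q where Q: "one_morphism S' S Q" "\<forall>A\<in>Obj X'. GO Q A = terminal X"
  proof (rule limit_one_morphism[where K = "{}" and E = "{}" and P = "\<lambda>A. terminal X" and B = undefined and d = undefined and \<pi> = undefined])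
    fix A assume A: "A \<in> Obj X'"
    show "S.X.T_limit {} {} (\<lambda>k k'. undefined k k' A) (\<lambda>k. GO (undefined k) A) (terminal X) (\<lambda>k. undefined k A)"
      by (rule C.terminal_T_limit[OF C.terminal])
  qed auto
  have QO: "GO Q A = terminal X" if "A \<in> Obj X'" for A using Q(2) that by simp
  note [simp] = Q(1)
  have "mor1_terminal S' S = Q"
  proof (rule mor1.equality)
    show "GO (mor1_terminal S' S) = GO Q"
      using one_morphism_lax(3)[OF Q(1)] by (intro extensionalityI[of _ "Obj X'"]) (auto simp: mor1_terminal_def Let_def QO)
    show "GM (mor1_terminal S' S) = GM Q"
    proof (rule extensionalityI[of _ "Arr X'"])
      fix f assume f: "f \<in> Arr X'"
      have "GM Q f = idt X (terminal X)"
        by (rule C.terminal_unique) (use f C.terminal in \<open>simp_all add: QO\<close>)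
      then show "GM (mor1_terminal S' S) f = GM Q f" using f by (simp add: mor1_terminal_def Let_def)
    qed (use one_morphism_lax(4)[OF Q(1)] in \<open>auto simp: mor1_terminal_def Let_def\<close>)
    show "gdist (mor1_terminal S' S) = gdist Q"
    proof (rule extensionalityI[of _ "Obj X'"])
      fix A assume A: "A \<in> Obj X'"
      have "unit_cmp X (TO X) = gdist Q A"
        by (rule C.unit_cmp_eq) (use A C.T_terminal in \<open>simp_all add: QO\<close>)
      then show "gdist (mor1_terminal S' S) A = gdist Q A" using A by (simp add: mor1_terminal_def Let_def)
    qed (use one_morphism_lax(5)[OF Q(1)] in \<open>auto simp: mor1_terminal_def Let_def\<close>)
    show "gtau (mor1_terminal S' S) = gtau Q"
    proof (rule extensionalityI[of _ "Obj X'"])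
      fix A assume A: "A \<in> Obj X'"
      then show "gtau (mor1_terminal S' S) A = gtau Q A"
        using C.bang_unique[of "gtau Q A"] by (simp add: mor1_terminal_def Let_def QO)
    qed (use one_morphism_lax(6)[OF Q(1)] in \<open>auto simp: mor1_terminal_def Let_def\<close>)
  qed simp
  then show ?thesis using Q(1) by simp
qed

text \<open>A family of maps is a 2-morphism into \<open>P\<close> if it becomes one after composition with jointly monic legs:
  the equations to be checked end in objects \<open>P A\<close> and \<open>T (P A)\<close>.\<close>

lemma H_creation: "cartesian_creation X H (Obj X') (\<lambda>A G. GO G A) (\<lambda>A \<phi>. amap \<phi> A)"
proof -
  interpret H: category H by (rule category_H)
  note T2 = mor1_T2_one_morphism
  show ?thesis
  proof
    show "tangent_typing H"
      unfolding tangent_typing_def using T2 proj_two_morphism zero_two_morphism sum_two_morphism lift_two_morphism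
        flip_two_morphism T_two_morphism by auto
    fix A assume A: "A \<in> Obj X'"
    have F: "is_functor H X (\<lambda>G. GO G A) (\<lambda>\<phi>. amap \<phi> A)"
      unfolding is_functor_def using A H.category_axioms S.X.category_axioms by (auto simp: two_morphismD)
    then show "preserves_tangent_structure H X (\<lambda>G. GO G A) (\<lambda>\<phi>. amap \<phi> A)"
      unfolding preserves_tangent_structure_def using A by (auto simp: mor1_T2_simps)
  next
    fix f g assume "f \<in> Arr H" "g \<in> Arr H" "Dom H f = Dom H g" "Cod H f = Cod H g" "\<And>i. i \<in> Obj X' \<Longrightarrow> amap f i = amap g i"
    then show "f = g"
      by (cases f, cases g) (auto intro!: extensionalityI[where A = "Obj X'"] dest: two_morphismD(7))
  next
    fix C P and K :: "nat set" and \<pi> v and h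
    assume CP: "C \<in> Obj H" "P \<in> Obj H"
      and \<pi>: "\<And>k. k \<in> K \<Longrightarrow> \<pi> k \<in> Arr H \<and> Dom H (\<pi> k) = P \<and> v k \<in> Arr H \<and> Dom H (v k) = C \<and> Cod H (v k) = Cod H (\<pi> k)"
      and J: "\<And>i. i \<in> Obj X' \<Longrightarrow> jointly_monic X K (GO P i) (\<lambda>k. amap (\<pi> k) i) \<and>
        jointly_monic X K (TO X (GO P i)) (\<lambda>k. TM X (amap (\<pi> k) i))"
      and h: "\<And>i. i \<in> Obj X' \<Longrightarrow> h i \<in> Arr X \<and> Dom X (h i) = GO C i \<and> Cod X (h i) = GO P i"
      and e: "\<And>i k. i \<in> Obj X' \<Longrightarrow> k \<in> K \<Longrightarrow> amap (\<pi> k) i \<bullet> h i = amap (v k) i"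
    have [simp]: "one_morphism S' S C" "one_morphism S' S P" using CP by auto
    have [simp]: "h i \<in> Arr X" "Dom X (h i) = GO C i" "Cod X (h i) = GO P i" if "i \<in> Obj X'" for i using h that by auto
    have k1: "one_morphism S' S (atrg (\<pi> k))" "two_morphism S' S P (atrg (\<pi> k)) (amap (\<pi> k))"
      "two_morphism S' S C (atrg (\<pi> k)) (amap (v k))" if "k \<in> K" for k using \<pi>[OF that] by auto
    have p: "one_morphism S' S P" "one_morphism S' S C" by simp_all
    have "two_morphism S' S C P (\<lambda>A\<in>Obj X'. h A)"
      unfolding two_morphism_iff[OF p(2,1)]
    proof (intro conjI ballI)
      fix A assume A: "A \<in> Obj X'"
      then have A': "TO X' A \<in> Obj X'" "SO S' A \<in> Obj X'" by simp_all
      have "TM X (h A) \<bullet> gdist C A = gdist P A \<bullet> h (TO X' A)"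
      proof (rule jointly_monicD[OF conjunct2[OF J[OF A]]])
        fix k assume k: "k \<in> K"
        note P = two_morphismD[OF p(1) k1(1)[OF k] k1(2)[OF k]] and V = two_morphismD[OF p(2) k1(1)[OF k] k1(3)[OF k]]
        have "TM X (amap (\<pi> k) A) \<bullet> TM X (h A) = TM X (amap (v k) A)"
          using arg_cong[OF e[OF A k], of "TM X"] P(1-3)[OF A] A by simp
        then show "TM X (amap (\<pi> k) A) \<bullet> (TM X (h A) \<bullet> gdist C A) = TM X (amap (\<pi> k) A) \<bullet> (gdist P A \<bullet> h (TO X' A))"
          using S.X.tail[of "TM X (amap (\<pi> k) A)" "TM X (h A)" _ "gdist C A"] S.X.tail[OF P(4)[OF A], of "h (TO X' A)"]
            V(4)[OF A] e[OF A'(1) k] P(1-3) V(1-3) A A' k1(1)[OF k] by simp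
      qed (use A in simp_all)
      moreover have "h (SO S' A) \<bullet> gtau C A = gtau P A \<bullet> SM S (h A)"
      proof (rule jointly_monicD[OF conjunct1[OF J[OF A'(2)]]])
        fix k assume k: "k \<in> K"
        note P = two_morphismD[OF p(1) k1(1)[OF k] k1(2)[OF k]] and V = two_morphismD[OF p(2) k1(1)[OF k] k1(3)[OF k]]
        have "SM S (amap (\<pi> k) A) \<bullet> SM S (h A) = SM S (amap (v k) A)"
          using arg_cong[OF e[OF A k], of "SM S"] P(1-3)[OF A] A by simp
        then show "amap (\<pi> k) (SO S' A) \<bullet> (h (SO S' A) \<bullet> gtau C A) = amap (\<pi> k) (SO S' A) \<bullet> (gtau P A \<bullet> SM S (h A))"
          using S.X.tail[OF e[OF A'(2) k], of "gtau C A"] S.X.tail[OF P(5)[OF A], of "SM S (h A)"]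
            V(5)[OF A] P(1-3) V(1-3) A A' k1(1)[OF k] by simp
      qed (use A A' in simp_all)
      ultimately show "(\<lambda>A\<in>Obj X'. h A) A \<in> Arr X" "Dom X ((\<lambda>A\<in>Obj X'. h A) A) = GO C A" "Cod X ((\<lambda>A\<in>Obj X'. h A) A) = GO P A"
        "TM X ((\<lambda>A\<in>Obj X'. h A) A) \<bullet> gdist C A = gdist P A \<bullet> (\<lambda>A\<in>Obj X'. h A) (TO X' A)"
        "(\<lambda>A\<in>Obj X'. h A) (SO S' A) \<bullet> gtau C A = gtau P A \<bullet> SM S ((\<lambda>A\<in>Obj X'. h A) A)"
        using A by simp_all
    next
      fix f assume f: "f \<in> Arr X'"
      then have O: "Dom X' f \<in> Obj X'" "Cod X' f \<in> Obj X'" by simp_all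
      have "h (Cod X' f) \<bullet> GM C f = GM P f \<bullet> h (Dom X' f)"
      proof (rule jointly_monicD[OF conjunct1[OF J[OF O(2)]]])
        fix k assume k: "k \<in> K"
        note P = two_morphismD[OF p(1) k1(1)[OF k] k1(2)[OF k]] and V = two_morphismD[OF p(2) k1(1)[OF k] k1(3)[OF k]]
        show "amap (\<pi> k) (Cod X' f) \<bullet> (h (Cod X' f) \<bullet> GM C f) = amap (\<pi> k) (Cod X' f) \<bullet> (GM P f \<bullet> h (Dom X' f))"
          using S.X.tail[OF e[OF O(2) k], of "GM C f"] S.X.tail[OF P(6)[OF f refl], of "h (Dom X' f)"]
            V(6)[OF f refl] e[OF O(1) k] P(1-3) V(1-3) f O k1(1)[OF k] by simp
      qed (use f in simp_all)
      then show "(\<lambda>A\<in>Obj X'. h A) (Cod X' f) \<bullet> GM C f = GM P f \<bullet> (\<lambda>A\<in>Obj X'. h A) (Dom X' f)" using f by simp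
    qed simp
    then show "\<exists>h'\<in>hom H C P. \<forall>i\<in>Obj X'. amap h' i = h i"
      by (intro bexI[of _ "Arrow C (\<lambda>A\<in>Obj X'. h A) P"]) simp_all
  next
    fix G n assume "G \<in> Obj H"
    then have G: "one_morphism S' S G" by simp
    have "\<forall>A\<in>Obj X'. \<exists>z. \<forall>m. is_fold_pullback X n ((TM X ^^ m) (tproj X (GO G A))) ((TO X ^^ m) (fst z)) ((TM X ^^ m) (fst (snd z)))
        (\<lambda>i. (TM X ^^ m) (snd (snd z) i))"
      using S.X.fold_pullbacks[of "GO G _" n] G by (metis G_simps(1) fst_conv snd_conv)
    from bchoice[OF this] obtain z where z: "\<forall>A\<in>Obj X'. \<forall>m. is_fold_pullback X n ((TM X ^^ m) (tproj X (GO G A))) ((TO X ^^ m) (fst (z A)))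
        ((TM X ^^ m) (fst (snd (z A)))) (\<lambda>i. (TM X ^^ m) (snd (snd (z A)) i))" by blast
    define P q \<pi> where "P A = fst (z A)" and "q A = fst (snd (z A))" and "\<pi> A = snd (snd (z A))" for A
    note z = z[folded P_def q_def \<pi>_def]
    obtain Q where Q: "one_morphism S' S Q" "\<forall>A\<in>Obj X'. GO Q A = P A"
      "two_morphism S' S Q G (\<lambda>A\<in>Obj X'. ((\<pi> A)(n := q A)) n)"
      "\<forall>j<n. two_morphism S' S Q (mor1_T S' S G) (\<lambda>A\<in>Obj X'. ((\<pi> A)(n := q A)) j)"
    proof (rule fold_one_morphism[OF G])
      fix A assume A: "A \<in> Obj X'"
      show "S.X.T_limit {..n} ({..<n} \<times> {n}) (\<lambda>_ _. tproj X (GO G A)) ((\<lambda>_. TO X (GO G A))(n := GO G A)) (P A) ((\<pi> A)(n := q A))"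
        by (rule S.X.T_limit_fold) (use z A G in simp_all)
    qed
    have 1: "two_morphism S' S Q G (\<lambda>A\<in>Obj X'. q A)" using Q(3) by simp
    have 2: "two_morphism S' S Q (mor1_T S' S G) (\<lambda>A\<in>Obj X'. \<pi> A j)" if "j < n" for j using Q(4)[rule_format, OF that] that by simp
    show "\<exists>P q \<pi>. q \<in> hom H P G \<and> (\<forall>j<n. \<pi> j \<in> hom H P (TO H G)) \<and>
      (\<forall>i\<in>Obj X'. \<forall>m. is_fold_pullback X n ((TM X ^^ m) (tproj X (GO G i))) ((TO X ^^ m) (GO P i))
        ((TM X ^^ m) (amap q i)) (\<lambda>j. (TM X ^^ m) (amap (\<pi> j) i)))"
      by (rule exI[of _ Q], rule exI[of _ "Arrow Q (\<lambda>A\<in>Obj X'. q A) G"],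
          rule exI[of _ "\<lambda>j. Arrow Q (\<lambda>A\<in>Obj X'. \<pi> A j) (mor1_T S' S G)"])
        (use 1 2 Q(1,2) G z in simp)
  next
    show "terminal H \<in> Obj H" using mor1_terminal_one_morphism by simp
    show "A \<in> Obj X' \<Longrightarrow> GO (terminal H) A = terminal X" for A by (simp add: mor1_terminal_def Let_def)
    fix G K assume GK: "G \<in> Obj H" "K \<in> Obj H"
    then show "cprod H G K \<in> Obj H \<and> cfst H G K \<in> hom H (cprod H G K) G \<and> csnd H G K \<in> hom H (cprod H G K) K"
      using mor1_prod_one_morphism[of G K] by simp
    show "GO (cprod H G K) A = cprod X (GO G A) (GO K A) \<and> amap (cfst H G K) A = cfst X (GO G A) (GO K A) \<and>
      amap (csnd H G K) A = csnd X (GO G A) (GO K A)" if "A \<in> Obj X'" for A using that by (simp add: mor1_prod_def Let_def)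
  qed
qed

end

section \<open>The monad on differential objects and the forgetful 1-morphism\<close>

locale strong_cartesian_monad = monad_on_tangent_category S
  for S :: "('o, 'a) cart_tangent_monad" +
  assumes cartesian_monad: "cartesian_tangent_monad S"
    and strong: "strong_tangent_monad S"
begin

sublocale C: cartesian_tangent_category "base S"
  using cartesian_monad by (simp add: cartesian_tangent_monad_def Let_def)

sublocale F: product_endomorphism "base S" "SO S" "SM S" "sdist S"
  using cartesian_monad strong tangent_monadD(1)
  by unfold_locales (simp_all add: cartesian_tangent_monad_def strong_tangent_monad_def Let_def)

sublocale D: cartesian_creation "base S" "DO (base S)" "{()}" "\<lambda>_. carrier" "\<lambda>_. amap"
  by (rule C.DO_creation)

notation D.cmp_Y (infixr \<open>\<odot>\<close> 70)

lemma DO_S_F_DO: "DO_S S = F.F_DO"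
  by (rule ext) (simp add: DO_S_def F.F_DO_def Let_def)

lemma carrier_simps [simp]:
  "carrier (DO_S S D) = SO S (carrier D)" "carrier (DO_T X D) = TO X (carrier D)"
  "carrier (DO_T2 X D) = T2 X (carrier D)"
  by (simp_all add: DO_S_def DO_T_def DO_T2_def Let_def)

lemma DO_S_differential_object [simp]:
  "differential_object X D \<Longrightarrow> differential_object X (DO_S S D)"
  "differential_object X D \<Longrightarrow> differential_object X (DO_T X D)"
  "differential_object X D \<Longrightarrow> differential_object X (DO_T2 X D)"
  using F.F_DO_differential_object C.DO_T_differential_object C.DO_T2_differential_object(1) by (simp_all add: DO_S_F_DO)

text \<open>The distributive law is linear because it is compatible with the flip; unit and multiplication are linear
  because they are tangent transformations.\<close>

lemma sdist_linear:
  assumes D: "differential_object X D"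
  shows "linear_map X (DO_S S (DO_T X D)) (DO_T X (DO_S S D)) (sdist S (carrier D))"
proof -
  define A p where "A = carrier D" and "p = phat D"
  have A: "A \<in> Obj X" using D by (simp add: A_def)
  note p = C.differential_objectD(2-4)[OF D, folded A_def p_def]
  have Ti: "TM X (F.\<alpha>i A) \<bullet> (TM X (sdist S A) \<bullet> z) = z" if "z \<in> Arr X" "Cod X z = TO X (SO S (TO X A))" for z
    using X.tail[OF X.TM_simps(6)[of "sdist S A" "F.\<alpha>i A", symmetric], of z] that A by simp
  have "sdist S A \<bullet> ((SM S (TM X p) \<bullet> SM S (tflip X A)) \<bullet> F.\<alpha>i (TO X A)) = (TM X (SM S p) \<bullet> (TM X (F.\<alpha>i A) \<bullet> tflip X (SO S A))) \<bullet> TM X (sdist S A)"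
  proof (rule F.\<alpha>_cancel[of "TO X A"])
    show "(sdist S A \<bullet> ((SM S (TM X p) \<bullet> SM S (tflip X A)) \<bullet> F.\<alpha>i (TO X A))) \<bullet> sdist S (TO X A)
      = ((TM X (SM S p) \<bullet> (TM X (F.\<alpha>i A) \<bullet> tflip X (SO S A))) \<bullet> TM X (sdist S A)) \<bullet> sdist S (TO X A)"
      using A p X.tail[OF sdist_nat[of p A], of "SM S (tflip X A)"] sdist_flip[OF A] Ti by simp
  qed (use A p in simp_all)
  then show ?thesis using A p by (simp add: linear_map_def DO_T_def DO_S_def Let_def A_def[symmetric] p_def[symmetric])
qed

lemma eta_linear:
  assumes D: "differential_object X D"
  shows "linear_map X D (DO_S S D) (eta S (carrier D))"
proof -
  define A p where "A = carrier D" and "p = phat D"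
  have A: "A \<in> Obj X" using D by (simp add: A_def)
  note p = C.differential_objectD(2-4)[OF D, folded A_def p_def]
  show ?thesis
    using A p eta_nat[of p A] eta_dist[OF A] by (simp add: linear_map_def DO_S_def Let_def A_def[symmetric] p_def[symmetric])
qed

lemma mu_linear:
  assumes D: "differential_object X D"
  shows "linear_map X (DO_S S (DO_S S D)) (DO_S S D) (mu S (carrier D))"
proof -
  define A p where "A = carrier D" and "p = phat D"
  have A: "A \<in> Obj X" using D by (simp add: A_def)
  note p = C.differential_objectD(2-4)[OF D, folded A_def p_def]
  have "sdist S (SO S A) \<bullet> (SM S (sdist S A) \<bullet> (SM S (F.\<alpha>i A) \<bullet> F.\<alpha>i (SO S A))) = idt X (TO X (SO S (SO S A)))"
    using A X.tail[OF S_simps(6)[of "F.\<alpha>i A" "sdist S A", symmetric], of "F.\<alpha>i (SO S A)"] by simp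
  then have "TM X (mu S A) = (TM X (mu S A) \<bullet> (sdist S (SO S A) \<bullet> SM S (sdist S A))) \<bullet> (SM S (F.\<alpha>i A) \<bullet> F.\<alpha>i (SO S A))"
    using A by simp
  also have "\<dots> = sdist S A \<bullet> (mu S (TO X A) \<bullet> (SM S (F.\<alpha>i A) \<bullet> F.\<alpha>i (SO S A)))"
    unfolding mu_dist[OF A] using A by simp
  finally have T: "TM X (mu S A) = sdist S A \<bullet> (mu S (TO X A) \<bullet> (SM S (F.\<alpha>i A) \<bullet> F.\<alpha>i (SO S A)))" .
  show ?thesis
    using A p X.tail[OF mu_nat[of p A], of "SM S (F.\<alpha>i A) \<bullet> F.\<alpha>i (SO S A)"]
    by (simp add: linear_map_def DO_S_def Let_def A_def[symmetric] p_def[symmetric] T)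
qed

lemma S_linear:
  assumes "differential_object X D" "differential_object X E" "linear_map X D E f"
  shows "linear_map X (DO_S S D) (DO_S S E) (SM S f)"
  using F.F_DO_linear[OF assms] by (simp add: DO_S_F_DO)

abbreviation "E \<equiv> DO_monad S"

lemma E_simps [simp]:
  "base E = DO X" "SO E = DO_S S" "SM E f = Arrow (DO_S S (asrc f)) (SM S (amap f)) (DO_S S (atrg f))"
  "sdist E D = Arrow (DO_S S (DO_T X D)) (sdist S (carrier D)) (DO_T X (DO_S S D))"
  "eta E D = Arrow D (eta S (carrier D)) (DO_S S D)"
  "mu E D = Arrow (DO_S S (DO_S S D)) (mu S (carrier D)) (DO_S S D)"
  by (simp_all add: DO_monad_def)

lemma linear_map_typing:
  assumes "linear_map X D F f"
  shows "f \<in> Arr X" "Dom X f = carrier D" "Cod X f = carrier F"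
  using C.linear_mapD[OF assms] by simp_all

text \<open>The axioms are equations between maps of differential objects and hold because they hold for \<open>S\<close>. Only
  additivity mentions a pairing, which the forgetful functor preserves.\<close>

lemma E_tangent_monad: "tangent_monad E"
proof -
  let ?Y = "DO X"
  note [simp] = linear_map_typing
  note Y = D.created_tangent_category
  note T = D.Y.T_functor
  have I: "is_functor ?Y ?Y (\<lambda>A. A) (\<lambda>f. f)" unfolding is_functor_def using D.Y.category_axioms by auto
  have S: "is_functor ?Y ?Y (DO_S S) (SM E)"
    unfolding is_functor_def using D.Y.category_axioms by (auto simp: S_linear)
  have lax: "lax_tangent_morphism ?Y ?Y (DO_S S) (SM E) (sdist E)"
    unfolding lax_tangent_morphism_def
  proof (intro conjI ballI)
    show "natural_transformation ?Y ?Y (DO_S S \<circ> TO ?Y) (SM E \<circ> TM ?Y) (TO ?Y \<circ> DO_S S) (TM ?Y \<circ> SM E) (sdist E)"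
      unfolding comp_def
      by (rule natural_transformationI[OF is_functor_comp[OF T S] is_functor_comp[OF S T]])
        (auto simp: sdist_linear sdist_nat)
    fix D assume "D \<in> Obj ?Y"
    then have D: "differential_object X D" by simp
    then show "tproj ?Y (DO_S S D) \<odot> sdist E D = SM E (tproj ?Y D)"
      "sdist E D \<odot> SM E (tzero ?Y D) = tzero ?Y (DO_S S D)"
      "tlift ?Y (DO_S S D) \<odot> sdist E D = TM ?Y (sdist E D) \<odot> (sdist E (TO ?Y D) \<odot> SM E (tlift ?Y D))"
      "tflip ?Y (DO_S S D) \<odot> (TM ?Y (sdist E D) \<odot> sdist E (TO ?Y D)) = TM ?Y (sdist E D) \<odot> (sdist E (TO ?Y D) \<odot> SM E (tflip ?Y D))"
      by (simp_all add: sdist_proj sdist_zero sdist_lift sdist_flip)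
    define u v where "u = sdist E D \<odot> SM E (tpi1 ?Y D)" and "v = sdist E D \<odot> SM E (tpi2 ?Y D)"
    note T2 = DO_S_differential_object(3)[OF D] and T = DO_S_differential_object(2)[OF D]
    note l1 = C.linear_map_comp[OF DO_S_differential_object(1)[OF T2] DO_S_differential_object(1)[OF T]
      DO_S_differential_object(2)[OF DO_S_differential_object(1)[OF D]] S_linear[OF T2 T C.DO_T2_differential_object(2)[OF D]] sdist_linear[OF D]]
    note l2 = C.linear_map_comp[OF DO_S_differential_object(1)[OF T2] DO_S_differential_object(1)[OF T]
      DO_S_differential_object(2)[OF DO_S_differential_object(1)[OF D]] S_linear[OF T2 T C.DO_T2_differential_object(3)[OF D]] sdist_linear[OF D]]
    have u_eq: "u = Arrow (DO_S S (DO_T2 X D)) (sdist S (carrier D) \<bullet> SM S (tpi1 X (carrier D))) (DO_T X (DO_S S D))"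
      and v_eq: "v = Arrow (DO_S S (DO_T2 X D)) (sdist S (carrier D) \<bullet> SM S (tpi2 X (carrier D))) (DO_T X (DO_S S D))"
      unfolding u_def v_def by (simp_all only: E_simps C.DO_simps arrow.sel)
    note DD = DO_S_differential_object(1)[OF T2] DO_S_differential_object(2)[OF DO_S_differential_object(1)[OF D]]
    have u: "u \<in> Arr ?Y" "asrc u = DO_S S (DO_T2 X D)" "atrg u = DO_T X (DO_S S D)" "amap u = sdist S (carrier D) \<bullet> SM S (tpi1 X (carrier D))"
      and v: "v \<in> Arr ?Y" "asrc v = DO_S S (DO_T2 X D)" "atrg v = DO_T X (DO_S S D)" "amap v = sdist S (carrier D) \<bullet> SM S (tpi2 X (carrier D))"
      unfolding u_eq v_eq C.DO_Arr_iff arrow.sel using l1 l2 DD by blast+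
    have "SM S (tproj X (carrier D)) \<bullet> SM S (tpi1 X (carrier D)) = SM S (tproj X (carrier D)) \<bullet> SM S (tpi2 X (carrier D))"
      using arg_cong[OF X.tpi_proj[of "carrier D"], of "SM S"] D by simp
    then have "tproj ?Y (DO_S S D) \<odot> u = tproj ?Y (DO_S S D) \<odot> v"
      using u v D X.tail[OF sdist_proj[of "carrier D"], of "SM S (tpi1 X (carrier D))"]
        X.tail[OF sdist_proj[of "carrier D"], of "SM S (tpi2 X (carrier D))"] by simp
    note e = this
    have O: "DO_S S D \<in> Obj ?Y" unfolding C.DO_simps by (rule DO_S_differential_object(1)[OF D])
    have d: "Dom ?Y u = Dom ?Y v" "Cod ?Y u = TO ?Y (DO_S S D)" "Cod ?Y v = TO ?Y (DO_S S D)"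
      unfolding C.DO_simps u v by (rule refl)+
    note p = D.U_pair2[OF O u(1) v(1) d e]
    have p': "pair2 ?Y (DO_S S D) u v \<in> Arr ?Y" "asrc (pair2 ?Y (DO_S S D) u v) = DO_S S (DO_T2 X D)"
      "atrg (pair2 ?Y (DO_S S D) u v) = DO_T2 X (DO_S S D)"
      "amap (pair2 ?Y (DO_S S D) u v) = pair2 X (SO S (carrier D)) (amap u) (amap v)"
      using p(1-3) p(6)[of "()"] unfolding C.DO_simps carrier_simps u v by simp_all
    show "sdist E D \<odot> SM E (tsum ?Y D) = tsum ?Y (DO_S S D) \<odot> pair2 ?Y (DO_S S D) (sdist E D \<odot> SM E (tpi1 ?Y D)) (sdist E D \<odot> SM E (tpi2 ?Y D))"
      unfolding u_def[symmetric] v_def[symmetric] using p'(2-4) u v D by (simp add: sdist_sum)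
  qed (use S Y in simp_all)
  have eta: "tangent_transformation ?Y ?Y (\<lambda>A. A) (\<lambda>f. f) (\<lambda>A. idt ?Y (TO ?Y A)) (DO_S S) (SM E) (sdist E) (eta E)"
    unfolding tangent_transformation_def
  proof (intro conjI ballI)
    show "natural_transformation ?Y ?Y (\<lambda>A. A) (\<lambda>f. f) (DO_S S) (SM E) (eta E)"
      by (rule natural_transformationI[OF I S]) (auto simp: eta_linear eta_nat)
  qed (simp add: eta_dist)
  have mu: "tangent_transformation ?Y ?Y (DO_S S \<circ> DO_S S) (SM E \<circ> SM E)
      (\<lambda>D. sdist E (DO_S S D) \<odot> SM E (sdist E D)) (DO_S S) (SM E) (sdist E) (mu E)"
    unfolding tangent_transformation_def comp_def
  proof (intro conjI ballI)
    show "natural_transformation ?Y ?Y (\<lambda>x. DO_S S (DO_S S x)) (\<lambda>x. SM E (SM E x)) (DO_S S) (SM E) (mu E)"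
      by (rule natural_transformationI[OF is_functor_comp[OF S S] S]) (auto simp: mu_linear mu_nat)
  qed (simp add: mu_dist)
  show ?thesis
    unfolding tangent_monad_def Let_def E_simps(1,2) using lax eta mu by (simp add: monad_laws)
qed

lemma E_cartesian: "cartesian_tangent_monad E"
  unfolding cartesian_tangent_monad_def Let_def E_simps(1)
proof (intro conjI ballI)
  show "tangent_monad E" by (rule E_tangent_monad)
  show "cartesian_tangent_category (DO X)" by (rule D.created_cartesian_tangent_category)
  show "is_terminal (DO X) (SO E (terminal (DO X)))"
    by (rule D.created_terminal)
      (use C.DO_terminal_differential_object F.F_terminal C.T_preserves_terminal[OF F.F_terminal] in \<open>simp_all add: DO_terminal_def Let_def\<close>)
  fix A B assume "A \<in> Obj (DO X)" "B \<in> Obj (DO X)"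
  then have AB: "differential_object X A" "differential_object X B" by simp_all
  have c: "carrier (DO_prod X A B) = cprod X (carrier A) (carrier B)" by (simp add: DO_prod_def Let_def)
  have p: "is_product X (SO S (cprod X (carrier A) (carrier B))) (SM S (cfst X (carrier A) (carrier B)))
    (SM S (csnd X (carrier A) (carrier B))) (SO S (carrier A)) (SO S (carrier B))"
    using F.F_product AB by simp
  note Q = C.DO_prod_differential_object[OF AB] and [simp] = linear_map_typing
  show "is_product (DO X) (SO E (cprod (DO X) A B)) (SM E (cfst (DO X) A B)) (SM E (csnd (DO X) A B)) (SO E A) (SO E B)"
    by (rule D.created_product)
      (use AB Q p X.product_jointly_monic[OF C.T_preserves_products[OF p]] S_linear[OF Q(1) _ Q(2)] S_linear[OF Q(1) _ Q(3)]
        in \<open>simp_all add: c\<close>)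
qed

sublocale E: monad_on_tangent_category E
  by unfold_locales (rule E_tangent_monad)

sublocale ES: cartesian_monads E S
  by unfold_locales (rule cartesian_monad)

lemma forgetful_simps [simp]:
  "D \<in> Obj (DO X) \<Longrightarrow> GO (forgetful S) D = carrier D"
  "f \<in> Arr (DO X) \<Longrightarrow> GM (forgetful S) f = amap f"
  "D \<in> Obj (DO X) \<Longrightarrow> gdist (forgetful S) D = idt X (TO X (carrier D))"
  "D \<in> Obj (DO X) \<Longrightarrow> gtau (forgetful S) D = idt X (SO S (carrier D))"
  by (simp_all only: forgetful_def Let_def mor1.simps restrict_apply if_True)

lemma forgetful_one_morphism: "one_morphism E S (forgetful S)"
proof (rule ES.one_morphismI, unfold E_simps(1))
  let ?Y = "DO X"
  show "GO (forgetful S) \<in> extensional (Obj ?Y)" "GM (forgetful S) \<in> extensional (Arr ?Y)"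
    "gdist (forgetful S) \<in> extensional (Obj ?Y)" "gtau (forgetful S) \<in> extensional (Obj ?Y)"
    by (simp_all only: forgetful_def Let_def mor1.simps restrict_extensional)
  fix D assume "D \<in> Obj ?Y"
  then have D: "differential_object X D" by simp
  note [simp] = linear_map_typing
  note l [simp] = C.proj_linear[OF D] C.zero_linear[OF D] C.sum_linear[OF D] C.lift_linear[OF D] C.flip_linear[OF D]
    C.DO_T2_differential_object(2,3)[OF D] sdist_linear[OF D] eta_linear[OF D] mu_linear[OF D] C.linear_map_idt[OF D]
  note [simp] = D
  have "pair2 X (carrier D) (tpi1 X (carrier D)) (tpi2 X (carrier D)) = idt X (T2 X (carrier D))"
    by (rule X.pair2_eqI) simp_all
  then show "gdist (forgetful S) D \<bullet> GM (forgetful S) (tsum ?Y D) = tsum X (GO (forgetful S) D) \<bullet>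
      pair2 X (GO (forgetful S) D) (gdist (forgetful S) D \<bullet> GM (forgetful S) (tpi1 ?Y D)) (gdist (forgetful S) D \<bullet> GM (forgetful S) (tpi2 ?Y D))"
    by simp
  show "GO (forgetful S) D \<in> Obj X" "GM (forgetful S) (idt ?Y D) = idt X (GO (forgetful S) D)"
    "gdist (forgetful S) D \<in> hom X (GO (forgetful S) (TO ?Y D)) (TO X (GO (forgetful S) D))"
    "tproj X (GO (forgetful S) D) \<bullet> gdist (forgetful S) D = GM (forgetful S) (tproj ?Y D)"
    "gdist (forgetful S) D \<bullet> GM (forgetful S) (tzero ?Y D) = tzero X (GO (forgetful S) D)"
    "tlift X (GO (forgetful S) D) \<bullet> gdist (forgetful S) D = TM X (gdist (forgetful S) D) \<bullet> (gdist (forgetful S) (TO ?Y D) \<bullet> GM (forgetful S) (tlift ?Y D))"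
    "tflip X (GO (forgetful S) D) \<bullet> (TM X (gdist (forgetful S) D) \<bullet> gdist (forgetful S) (TO ?Y D))
      = TM X (gdist (forgetful S) D) \<bullet> (gdist (forgetful S) (TO ?Y D) \<bullet> GM (forgetful S) (tflip ?Y D))"
    "gtau (forgetful S) D \<in> hom X (SO S (GO (forgetful S) D)) (GO (forgetful S) (SO E D))"
    "TM X (gtau (forgetful S) D) \<bullet> (sdist S (GO (forgetful S) D) \<bullet> SM S (gdist (forgetful S) D))
      = gdist (forgetful S) (SO E D) \<bullet> (GM (forgetful S) (sdist E D) \<bullet> gtau (forgetful S) (TO ?Y D))"
    "gtau (forgetful S) D \<bullet> eta S (GO (forgetful S) D) = GM (forgetful S) (eta E D)"
    "gtau (forgetful S) D \<bullet> mu S (GO (forgetful S) D) = GM (forgetful S) (mu E D) \<bullet> (gtau (forgetful S) (SO E D) \<bullet> SM S (gtau (forgetful S) D))"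
    by simp_all
next
  let ?Y = "DO X"
  fix f assume f: "f \<in> Arr ?Y"
  then have l: "linear_map X (asrc f) (atrg f) (amap f)" "differential_object X (asrc f)" "differential_object X (atrg f)" by simp_all
  note [simp] = linear_map_typing l C.DO_T_linear[OF l(2,3,1)] S_linear[OF l(2,3,1)]
  show "GM (forgetful S) f \<in> hom X (GO (forgetful S) (Dom ?Y f)) (GO (forgetful S) (Cod ?Y f))"
    "gdist (forgetful S) (Cod ?Y f) \<bullet> GM (forgetful S) (TM ?Y f) = TM X (GM (forgetful S) f) \<bullet> gdist (forgetful S) (Dom ?Y f)"
    "gtau (forgetful S) (Cod ?Y f) \<bullet> SM S (GM (forgetful S) f) = GM (forgetful S) (SM E f) \<bullet> gtau (forgetful S) (Dom ?Y f)"
    by simp_all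
  fix g assume g: "g \<in> Arr ?Y" "Dom ?Y g = Cod ?Y f"
  then have "g \<odot> f \<in> Arr ?Y" using f by (intro D.Y.comp_typing(1))
  then show "GM (forgetful S) (g \<odot> f) = GM (forgetful S) g \<bullet> GM (forgetful S) f"
    using f g by (simp only: forgetful_simps) simp
qed

lemma forgetful_strict: "strict_one_morphism E S (forgetful S)"
  unfolding strict_one_morphism_def using forgetful_one_morphism by simp

end

section \<open>Transport of tangent structure along an isomorphism\<close>

lemma is_fold_pullback_cong:
  "(\<And>i. i < n \<Longrightarrow> \<pi> i = \<pi>' i) \<Longrightarrow> is_fold_pullback X n f P q \<pi> \<longleftrightarrow> is_fold_pullback X n f P q \<pi>'"
  by (simp add: is_fold_pullback_def)

text \<open>The inverse of the isomorphism is faithful, preserves the structure maps and lifts all maps, so it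
  creates the tangent structure of \<open>Y\<close>. For pointwise differential objects this includes that being
  pointwise is stable under \<open>T\<close>.\<close>

lemma tangent_category_transport:
  assumes X: "tangent_category X" and Y: "category Y" and F: "preserves_tangent_structure X Y FO FM"
    and bO: "bij_betw FO (Obj X) (Obj Y)" and bM: "bij_betw FM (Arr X) (Arr Y)"
  shows "tangent_category Y"
proof -
  interpret X: tangent_category X by fact
  interpret Y: category Y by fact
  define HO HM where "HO = inv_into (Obj X) FO" and "HM = inv_into (Arr X) FM"
  have HO: "HO A \<in> Obj X" "FO (HO A) = A" if "A \<in> Obj Y" for A
    using bO that unfolding HO_def bij_betw_def by (auto simp: inv_into_into f_inv_into_f)
  have HM: "HM f \<in> Arr X" "FM (HM f) = f" if "f \<in> Arr Y" for f
    using bM that unfolding HM_def bij_betw_def by (auto simp: inv_into_into f_inv_into_f)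
  have FO: "FO A \<in> Obj Y" "HO (FO A) = A" if "A \<in> Obj X" for A
    using bO that unfolding HO_def bij_betw_def by auto
  have FM: "FM f \<in> Arr Y" "HM (FM f) = f" if "f \<in> Arr X" for f
    using bM that unfolding HM_def bij_betw_def by auto
  have fctr: "is_functor X Y FO FM" using F by (simp add: preserves_tangent_structure_def)
  note f = is_functorD[OF fctr]
  have p: "FO (TO X A) = TO Y (FO A)" "FO (T2 X A) = T2 Y (FO A)" "FM (tpi1 X A) = tpi1 Y (FO A)" "FM (tpi2 X A) = tpi2 Y (FO A)"
    "FM (tproj X A) = tproj Y (FO A)" "FM (tzero X A) = tzero Y (FO A)" "FM (tsum X A) = tsum Y (FO A)"
    "FM (tlift X A) = tlift Y (FO A)" "FM (tflip X A) = tflip Y (FO A)" if "A \<in> Obj X" for A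
    using F that by (auto simp: preserves_tangent_structure_def)
  have pM: "FM (TM X f) = TM Y (FM f)" if "f \<in> Arr X" for f using F that by (auto simp: preserves_tangent_structure_def)
  have D: "Dom X (HM f) = HO (Dom Y f)" "Cod X (HM f) = HO (Cod Y f)" if "f \<in> Arr Y" for f
    using f(5,6)[OF HM(1)[OF that]] HM[OF that] FO(2) by (metis X.Obj_ends(1), metis X.Obj_ends(2))
  interpret tangent_creation X Y "{()}" "\<lambda>_. HO" "\<lambda>_. HM"
  proof
    show "tangent_typing Y"
      unfolding tangent_typing_def
    proof (intro conjI ballI)
      fix A assume A: "A \<in> Obj Y"
      note B = HO[OF A]
      note q = p[OF B(1), unfolded B(2)]
      show "TO Y A \<in> Obj Y" "T2 Y A \<in> Obj Y" using q(1,2) FO(1) B(1) by (metis X.TM_simps(1), metis X.T2_Obj)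
      show "tpi1 Y A \<in> hom Y (T2 Y A) (TO Y A)" "tpi2 Y A \<in> hom Y (T2 Y A) (TO Y A)" "tproj Y A \<in> hom Y (TO Y A) A"
        "tzero Y A \<in> hom Y A (TO Y A)" "tsum Y A \<in> hom Y (T2 Y A) (TO Y A)" "tlift Y A \<in> hom Y (TO Y A) (TO Y (TO Y A))"
        "tflip Y A \<in> hom Y (TO Y (TO Y A)) (TO Y (TO Y A))"
        using B f(4-6) p(1)[of "TO X (HO A)"] by (simp_all flip: q)
    next
      fix g assume g: "g \<in> Arr Y"
      note h = HM[OF g]
      have "FM (TM X (HM g)) \<in> hom Y (FO (TO X (HO (Dom Y g)))) (FO (TO X (HO (Cod Y g))))"
        using f(4-6) h(1) D[OF g] by simp
      then show "TM Y g \<in> hom Y (TO Y (Dom Y g)) (TO Y (Cod Y g))"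
        using p(1)[of "HO (Dom Y g)"] p(1)[of "HO (Cod Y g)"] HO g pM[OF h(1)] h(2) by simp
    qed
    have F': "is_functor Y X HO HM"
      unfolding is_functor_def
    proof (intro conjI ballI impI)
      fix A assume A: "A \<in> Obj Y"
      show "HM (idt Y A) = idt X (HO A)" using f(7)[OF HO(1)[OF A]] HO[OF A] FM(2)[of "idt X (HO A)"] by simp
    next
      fix g h assume g: "g \<in> Arr Y" "h \<in> Arr Y" "Dom Y h = Cod Y g"
      then have "FM (HM h \<cdot>\<^bsub>X\<^esub> HM g) = h \<cdot>\<^bsub>Y\<^esub> g" using f(8)[of "HM g" "HM h"] HM D by simp
      then show "HM (h \<cdot>\<^bsub>Y\<^esub> g) = HM h \<cdot>\<^bsub>X\<^esub> HM g" using FM(2)[of "HM h \<cdot>\<^bsub>X\<^esub> HM g"] g HM D by simp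
    qed (use HO HM D X.category_axioms Y.category_axioms in auto)
    show "preserves_tangent_structure Y X HO HM"
      unfolding preserves_tangent_structure_def
    proof (intro conjI ballI F')
      fix A assume A: "A \<in> Obj Y"
      note B = HO[OF A]
      note q = p[OF B(1), unfolded B(2)]
      show "HO (TO Y A) = TO X (HO A)" "HO (T2 Y A) = T2 X (HO A)" "HM (tpi1 Y A) = tpi1 X (HO A)" "HM (tpi2 Y A) = tpi2 X (HO A)"
        "HM (tproj Y A) = tproj X (HO A)" "HM (tzero Y A) = tzero X (HO A)" "HM (tsum Y A) = tsum X (HO A)"
        "HM (tlift Y A) = tlift X (HO A)" "HM (tflip Y A) = tflip X (HO A)"
        using B(1) FO(2) FM(2) by (simp_all flip: q)
    next
      fix g assume g: "g \<in> Arr Y"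
      show "HM (TM Y g) = TM X (HM g)" using pM[OF HM(1)[OF g]] HM[OF g] FM(2)[of "TM X (HM g)"] by simp
    qed
  next
    fix g h assume "g \<in> Arr Y" "h \<in> Arr Y" "\<And>i. i \<in> {()} \<Longrightarrow> HM g = HM h"
    then show "g = h" using HM(2) by (metis insertI1)
  next
    fix C P and K :: "nat set" and \<pi> v and h :: "unit \<Rightarrow> _"
    assume CP: "C \<in> Obj Y" "P \<in> Obj Y" and h: "\<And>i. i \<in> {()} \<Longrightarrow> h i \<in> Arr X \<and> Dom X (h i) = HO C \<and> Cod X (h i) = HO P"
    show "\<exists>h'\<in>hom Y C P. \<forall>i\<in>{()}. HM h' = h i"
      using h[of "()"] CP f(4-6) HO FM(2) by (intro bexI[of _ "FM (h ())"]) auto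
  next
    fix A n assume A: "A \<in> Obj Y"
    note B = HO[OF A]
    obtain P q \<pi> where L: "\<forall>m. is_fold_pullback X n ((TM X ^^ m) (tproj X (HO A))) ((TO X ^^ m) P) ((TM X ^^ m) q) (\<lambda>j. (TM X ^^ m) (\<pi> j))"
      using X.fold_pullbacks[OF B(1), of n] by blast
    have t: "q \<in> Arr X" "Dom X q = P" "Cod X q = HO A" "\<And>j. j < n \<Longrightarrow> \<pi> j \<in> Arr X \<and> Dom X (\<pi> j) = P \<and> Cod X (\<pi> j) = TO X (HO A)"
      using L[rule_format, of 0] B(1) by (auto simp: is_fold_pullback_def)
    have P: "P \<in> Obj X" using t(1,2) X.Obj_ends(1) by metis
    have "is_fold_pullback X n ((TM X ^^ m) (tproj X (HO A))) ((TO X ^^ m) (HO (FO P))) ((TM X ^^ m) (HM (FM q)))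
        (\<lambda>j. (TM X ^^ m) (HM (FM (\<pi> j))))" for m
      by (rule iffD1[OF is_fold_pullback_cong, rotated]) (use L t P FO(2) FM(2) in auto)
    moreover have "FM q \<in> hom Y (FO P) A" "\<forall>j<n. FM (\<pi> j) \<in> hom Y (FO P) (TO Y A)"
      using t f(4-6) B p(1)[OF B(1)] by auto
    ultimately show "\<exists>P q \<pi>. q \<in> hom Y P A \<and> (\<forall>j<n. \<pi> j \<in> hom Y P (TO Y A)) \<and>
      (\<forall>i\<in>{()}. \<forall>m. is_fold_pullback X n ((TM X ^^ m) (tproj X (HO A))) ((TO X ^^ m) (HO P))
        ((TM X ^^ m) (HM q)) (\<lambda>j. (TM X ^^ m) (HM (\<pi> j))))"
      by (intro exI[of _ "FO P"] exI[of _ "FM q"] exI[of _ "\<lambda>j. FM (\<pi> j)"]) simp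
  qed
  show ?thesis by (rule created_tangent_category)
qed

text \<open>A functor that preserves the tangent structure on the nose is a tangent morphism whose
  distributive law is the identity.\<close>

lemma preserves_tangent_structure_lax:
  assumes X: "tangent_category X" and Y: "tangent_category Y" and F: "preserves_tangent_structure X Y FO FM"
  shows "lax_tangent_morphism X Y FO FM (\<lambda>A. idt Y (TO Y (FO A)))"
proof -
  interpret X: tangent_category X by fact
  interpret Y: tangent_category Y by fact
  have fctr: "is_functor X Y FO FM" using F by (simp add: preserves_tangent_structure_def)
  note f [simp] = is_functorD(3-8)[OF fctr]
  have p [simp]: "FO (TO X A) = TO Y (FO A)" "FO (T2 X A) = T2 Y (FO A)" "FM (tpi1 X A) = tpi1 Y (FO A)" "FM (tpi2 X A) = tpi2 Y (FO A)"
    "FM (tproj X A) = tproj Y (FO A)" "FM (tzero X A) = tzero Y (FO A)" "FM (tsum X A) = tsum Y (FO A)"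
    "FM (tlift X A) = tlift Y (FO A)" "FM (tflip X A) = tflip Y (FO A)" if "A \<in> Obj X" for A
    using F that by (auto simp: preserves_tangent_structure_def)
  have pM [simp]: "FM (TM X f) = TM Y (FM f)" if "f \<in> Arr X" for f using F that by (auto simp: preserves_tangent_structure_def)
  show ?thesis
    unfolding lax_tangent_morphism_def
  proof (intro conjI ballI X Y fctr)
    show "natural_transformation X Y (FO \<circ> TO X) (FM \<circ> TM X) (TO Y \<circ> FO) (TM Y \<circ> FM) (\<lambda>A. idt Y (TO Y (FO A)))"
      unfolding comp_def
      by (rule natural_transformationI[OF is_functor_comp[OF X.T_functor fctr] is_functor_comp[OF fctr Y.T_functor]]) auto
    fix A assume A: "A \<in> Obj X"
    have "pair2 Y (FO A) (tpi1 Y (FO A)) (tpi2 Y (FO A)) = idt Y (T2 Y (FO A))"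
      by (rule Y.pair2_eqI) (use A in simp_all)
    then show "idt Y (TO Y (FO A)) \<cdot>\<^bsub>Y\<^esub> FM (tsum X A) = tsum Y (FO A) \<cdot>\<^bsub>Y\<^esub>
        pair2 Y (FO A) (idt Y (TO Y (FO A)) \<cdot>\<^bsub>Y\<^esub> FM (tpi1 X A)) (idt Y (TO Y (FO A)) \<cdot>\<^bsub>Y\<^esub> FM (tpi2 X A))"
      using A by simp
  qed simp_all
qed

lemma category_full_subcategory: "category X \<Longrightarrow> category (full_subcategory X Q)"
proof -
  assume "category X"
  then interpret category X .
  show ?thesis by unfold_locales (auto simp: full_subcategory_def)
qed

section \<open>Differential objects in hom-categories are families of differential objects\<close>

context cartesian_creation
begin

lemma U_diff_DO_T:
  assumes "i \<in> I" and D: "differential_object Y D"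
  shows "U_diff i (DO_T Y D) = DO_T X (U_diff i D)"
proof -
  note M = Y.commutative_monoidD(1-7)[OF Y.differential_objectD(1)[OF D]] Y.differential_objectD(2-4)[OF D]
  note u = Y.unit_cmp_typing[where HO = "TO Y", OF Y.T_terminal] and m = T_cmp_typing[OF M(1) M(1)]
  show ?thesis using assms(1) M u m by (simp add: U_diff_def DO_T_def)
qed

lemma differential_object_eqI:
  assumes D: "differential_object Y D" and E: "differential_object Y E" and c: "carrier D = carrier E"
    and U: "\<And>i. i \<in> I \<Longrightarrow> U_diff i D = U_diff i E"
  shows "D = E"
proof -
  note M = Y.commutative_monoidD(1-7)[OF Y.differential_objectD(1)[OF D]] Y.differential_objectD(2-4)[OF D]
  note M' = Y.commutative_monoidD(1-7)[OF Y.differential_objectD(1)[OF E]] Y.differential_objectD(2-4)[OF E]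
  have *: "UM i (zeta D) = UM i (zeta E)" "UM i (sigma D) = UM i (sigma E)" "UM i (phat D) = UM i (phat E)" if "i \<in> I" for i
    using U[OF that] by (simp_all add: U_diff_def)
  have "zeta D = zeta E" by (subst eq_iff_underlying) (use M M' c * in simp_all)
  moreover have "sigma D = sigma E" by (subst eq_iff_underlying) (use M M' c * in simp_all)
  moreover have "phat D = phat E" by (subst eq_iff_underlying) (use M M' c * in simp_all)
  ultimately show ?thesis using c by simp
qed

lemma linear_map_underlying:
  assumes D: "differential_object Y D" and E: "differential_object Y E"
    and f: "f \<in> Arr Y" "Dom Y f = carrier D" "Cod Y f = carrier E"
  shows "linear_map Y D E f \<longleftrightarrow> (\<forall>i\<in>I. linear_map X (U_diff i D) (U_diff i E) (UM i f))"
proof -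
  note M = Y.commutative_monoidD(1)[OF Y.differential_objectD(1)[OF D]] Y.differential_objectD(2-4)[OF D]
  note M' = Y.commutative_monoidD(1)[OF Y.differential_objectD(1)[OF E]] Y.differential_objectD(2-4)[OF E]
  have "f \<odot> phat D = phat E \<odot> TM Y f \<longleftrightarrow> (\<forall>i\<in>I. UM i f \<cdot> UM i (phat D) = UM i (phat E) \<cdot> TM X (UM i f))"
    by (subst eq_iff_underlying) (use M M' f in simp_all)
  then show ?thesis using f M(1) M'(1) by (simp add: linear_map_def U_diff_def)
qed

end

locale test_monad = strong_cartesian_monad S + T: monad_on_tangent_category S'
  for S :: "('o, 'a) cart_tangent_monad" and S' :: "('q, 'c, 'k) tangent_monad"
begin

sublocale HS: cartesian_monads S' S
  by unfold_locales (rule cartesian_monad)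

sublocale HE: cartesian_monads S' E
  by unfold_locales (rule E_cartesian)

sublocale U3: three_monads S' E S ..

abbreviation X' where "X' \<equiv> base S'"

abbreviation "P \<equiv> pointwise_DO S' S"

definition fibre :: "'q \<Rightarrow> (('q, 'c, 'o, 'a) mor1, (('q, 'c, 'o, 'a) mor1, 'q \<Rightarrow> 'a) arrow) diff_object \<Rightarrow> ('o, 'a) diff_object" where
  "fibre A D = \<lparr>carrier = GO (carrier D) A, zeta = amap (zeta D) A, sigma = amap (sigma D) A, phat = amap (phat D) A\<rparr>"

lemma U_diff_fibre: "cartesian_creation.U_diff (\<lambda>A G. GO G A) (\<lambda>A \<phi>. amap \<phi> A) = fibre"
  by (intro ext) (simp add: cartesian_creation.U_diff_def[OF HS.H_creation] fibre_def)

lemmas H_cartesian = cartesian_creation.created_cartesian_tangent_category[OF HS.H_creation]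
lemmas H_DO_simps = cartesian_tangent_category.DO_simps[OF H_cartesian]
lemmas fibre_DO_T = cartesian_creation.U_diff_DO_T[OF HS.H_creation, unfolded U_diff_fibre]
lemmas H_eqI = cartesian_creation.differential_object_eqI[OF HS.H_creation, unfolded U_diff_fibre]
lemmas H_linear_map_iff = cartesian_creation.linear_map_underlying[OF HS.H_creation, unfolded U_diff_fibre]

lemma P_simps:
  "D \<in> Obj P \<longleftrightarrow> differential_object HS.H D \<and> pointwise S' S D"
  "f \<in> Arr P \<longleftrightarrow> differential_object HS.H (asrc f) \<and> differential_object HS.H (atrg f) \<and>
    linear_map HS.H (asrc f) (atrg f) (amap f) \<and> pointwise S' S (asrc f) \<and> pointwise S' S (atrg f)"
  "Dom P = asrc" "Cod P = atrg" "idt P D = Arrow D (idt HS.H (carrier D)) D"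
  "g \<cdot>\<^bsub>P\<^esub> f = Arrow (asrc f) (amap g \<cdot>\<^bsub>HS.H\<^esub> amap f) (atrg g)"
  "TO P = DO_T HS.H" "TM P f = Arrow (DO_T HS.H (asrc f)) (TM HS.H (amap f)) (DO_T HS.H (atrg f))"
  "T2 P = DO_T2 HS.H"
  "tpi1 P D = Arrow (DO_T2 HS.H D) (tpi1 HS.H (carrier D)) (DO_T HS.H D)"
  "tpi2 P D = Arrow (DO_T2 HS.H D) (tpi2 HS.H (carrier D)) (DO_T HS.H D)"
  "tproj P D = Arrow (DO_T HS.H D) (tproj HS.H (carrier D)) D"
  "tzero P D = Arrow D (tzero HS.H (carrier D)) (DO_T HS.H D)"
  "tsum P D = Arrow (DO_T2 HS.H D) (tsum HS.H (carrier D)) (DO_T HS.H D)"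
  "tlift P D = Arrow (DO_T HS.H D) (tlift HS.H (carrier D)) (DO_T HS.H (DO_T HS.H D))"
  "tflip P D = Arrow (DO_T HS.H (DO_T HS.H D)) (tflip HS.H (carrier D)) (DO_T HS.H (DO_T HS.H D))"
  by (auto simp del: HS.H_simps HS.H_Arr_iff simp: pointwise_DO_def full_subcategory_def H_DO_simps
      cartesian_tangent_category.DO_Arr_iff[OF H_cartesian])

lemma category_P: "category P"
  unfolding pointwise_DO_def
  by (rule category_full_subcategory[OF cartesian_tangent_category.category_DO[OF H_cartesian]])

text \<open>The axioms other than the product diagram can be tested at each \<open>A\<close>, and being pointwise takes care of the
  product diagram.\<close>

lemma P_Obj_iff:
  "D \<in> Obj P \<longleftrightarrow> one_morphism S' S (carrier D) \<and> zeta D \<in> hom HS.H (mor1_terminal S' S) (carrier D) \<and>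
    sigma D \<in> hom HS.H (mor1_prod S' S (carrier D) (carrier D)) (carrier D) \<and>
    phat D \<in> hom HS.H (mor1_T S' S (carrier D)) (carrier D) \<and>
    (\<forall>A\<in>Obj X'. differential_object X (fibre A D))"
proof -
  note U = cartesian_creation.differential_object_underlying[OF HS.H_creation, of D, unfolded U_diff_fibre HS.H_simps]
  note M = cartesian_tangent_category.commutative_monoidD(1-7)[OF H_cartesian cartesian_tangent_category.differential_objectD(1)[OF H_cartesian, of D]]
    cartesian_tangent_category.differential_objectD(2-4)[OF H_cartesian, of D]
  have "one_morphism S' S (carrier D)" "zeta D \<in> hom HS.H (mor1_terminal S' S) (carrier D)"
    "sigma D \<in> hom HS.H (mor1_prod S' S (carrier D) (carrier D)) (carrier D)"
    "phat D \<in> hom HS.H (mor1_T S' S (carrier D)) (carrier D)" if "differential_object HS.H D"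
    using M[OF that] unfolding in_hom_iff HS.H_simps by blast+
  then show ?thesis using U unfolding P_simps(1) pointwise_def Let_def by blast
qed

text \<open>A family of differential objects \<open>D A\<close> on the values of \<open>G\<close>, with all structure maps of \<open>G\<close>
  linear. This is the common unfolding of 1-morphisms into differential objects and of pointwise
  differential objects in the hom-category.\<close>

definition linear_family :: "('q, 'c, 'o, 'a) mor1 \<Rightarrow> ('q \<Rightarrow> ('o, 'a) diff_object) \<Rightarrow> bool" where
  "linear_family G D \<longleftrightarrow> one_morphism S' S G \<and>
     (\<forall>A\<in>Obj X'. differential_object X (D A) \<and> carrier (D A) = GO G A \<and>
       linear_map X (D (TO X' A)) (DO_T X (D A)) (gdist G A) \<and>
       linear_map X (DO_S S (D A)) (D (SO S' A)) (gtau G A)) \<and>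
     (\<forall>f\<in>Arr X'. linear_map X (D (Dom X' f)) (D (Cod X' f)) (GM G f))"

text \<open>Inverse to taking fibres, for the linear families defined above.\<close>

definition diff_of :: "('q, 'c, 'o, 'a) mor1 \<Rightarrow> ('q \<Rightarrow> ('o, 'a) diff_object) \<Rightarrow> _" where
  "diff_of G D = \<lparr>carrier = G,
     zeta = Arrow (mor1_terminal S' S) (\<lambda>A\<in>Obj X'. zeta (D A)) G,
     sigma = Arrow (mor1_prod S' S G G) (\<lambda>A\<in>Obj X'. sigma (D A)) G,
     phat = Arrow (mor1_T S' S G) (\<lambda>A\<in>Obj X'. phat (D A)) G\<rparr>"

lemma mor1_terminal_simps:
  "A \<in> Obj X' \<Longrightarrow> GO (mor1_terminal S' S) A = terminal X"
  "f \<in> Arr X' \<Longrightarrow> GM (mor1_terminal S' S) f = idt X (terminal X)"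
  "A \<in> Obj X' \<Longrightarrow> gdist (mor1_terminal S' S) A = unit_cmp X (TO X)"
  "A \<in> Obj X' \<Longrightarrow> gtau (mor1_terminal S' S) A = bang X (SO S (terminal X))"
  by (simp_all add: mor1_terminal_def Let_def)

lemma mor1_prod_simps:
  "A \<in> Obj X' \<Longrightarrow> GO (mor1_prod S' S G K) A = cprod X (GO G A) (GO K A)"
  "f \<in> Arr X' \<Longrightarrow> GM (mor1_prod S' S G K) f = cmap X (GM G f) (GM K f)"
  "A \<in> Obj X' \<Longrightarrow> gdist (mor1_prod S' S G K) A =
    prod_cmp X (TO X) (TM X) (GO G A) (GO K A) \<bullet> cmap X (gdist G A) (gdist K A)"
  "A \<in> Obj X' \<Longrightarrow> gtau (mor1_prod S' S G K) A = cpair X (GO G (SO S' A)) (GO K (SO S' A))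
    (gtau G A \<bullet> SM S (cfst X (GO G A) (GO K A))) (gtau K A \<bullet> SM S (csnd X (GO G A) (GO K A)))"
  by (simp_all add: mor1_prod_def Let_def)

text \<open>Each linearity condition on a structure map of \<open>G\<close> is the condition for the maps \<open>p\<close> to be compatible with
  it. For \<open>\<tau>\<close> the two differ by a composition with \<open>\<alpha>\<close>, which is invertible.\<close>

lemma family_phat:
  assumes G: "one_morphism S' S G" and D: "\<And>A. A \<in> Obj X' \<Longrightarrow> differential_object X (D A)"
    and c: "\<And>A. A \<in> Obj X' \<Longrightarrow> carrier (D A) = GO G A"
  shows "linear_family G D \<longleftrightarrow> two_morphism S' S (mor1_T S' S G) G (\<lambda>A\<in>Obj X'. phat (D A))"
proof -
  note [simp] = G
  have p [simp]: "phat (D A) \<in> Arr X" "Dom X (phat (D A)) = TO X (GO G A)" "Cod X (phat (D A)) = GO G A" if "A \<in> Obj X'" for A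
    using C.differential_objectD(2-4)[OF D[OF that]] c[OF that] by simp_all
  have d: "linear_map X (D (TO X' A)) (DO_T X (D A)) (gdist G A) \<longleftrightarrow>
      TM X (phat (D A)) \<bullet> gdist (mor1_T S' S G) A = gdist G A \<bullet> phat (D (TO X' A))" if A: "A \<in> Obj X'" for A
    using A c by (auto simp: linear_map_def DO_T_def)
  have t: "linear_map X (DO_S S (D A)) (D (SO S' A)) (gtau G A) \<longleftrightarrow>
      phat (D (SO S' A)) \<bullet> gtau (mor1_T S' S G) A = gtau G A \<bullet> SM S (phat (D A))" if A: "A \<in> Obj X'" for A
  proof -
    have "phat (D (SO S' A)) \<bullet> (TM X (gtau G A) \<bullet> sdist S (GO G A)) = gtau G A \<bullet> SM S (phat (D A))"
      if e: "gtau G A \<bullet> (SM S (phat (D A)) \<bullet> F.\<alpha>i (GO G A)) = phat (D (SO S' A)) \<bullet> TM X (gtau G A)"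
      using A X.tail3[OF e, of "sdist S (GO G A)"] by simp
    moreover have "gtau G A \<bullet> (SM S (phat (D A)) \<bullet> F.\<alpha>i (GO G A)) = phat (D (SO S' A)) \<bullet> TM X (gtau G A)"
      if e: "phat (D (SO S' A)) \<bullet> (TM X (gtau G A) \<bullet> sdist S (GO G A)) = gtau G A \<bullet> SM S (phat (D A))"
      using A X.tail3[OF e, of "F.\<alpha>i (GO G A)"] by simp
    ultimately show ?thesis using A c by (auto simp: linear_map_def DO_S_def Let_def)
  qed
  have n: "linear_map X (D (Dom X' f)) (D (Cod X' f)) (GM G f) \<longleftrightarrow>
      phat (D (Cod X' f)) \<bullet> GM (mor1_T S' S G) f = GM G f \<bullet> phat (D (Dom X' f))" if "f \<in> Arr X'" for f
    using that c by (auto simp: linear_map_def)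
  show ?thesis
    unfolding HS.two_morphism_iff[OF HS.mor1_T_one_morphism[OF G] G] linear_family_def using d t n D c by auto
qed

end

context test_monad
begin

text \<open>Compatibility with \<open>\<zeta>\<close> and \<open>\<sigma>\<close> is no further condition, since linear maps preserve zero and sums.\<close>

lemma family_zeta:
  assumes D: "linear_family G D"
  shows "two_morphism S' S (mor1_terminal S' S) G (\<lambda>A\<in>Obj X'. zeta (D A))"
proof -
  have G [simp]: "one_morphism S' S G" using D by (simp add: linear_family_def)
  have DA: "differential_object X (D A)" "carrier (D A) = GO G A"
    and l: "linear_map X (D (TO X' A)) (DO_T X (D A)) (gdist G A)" "linear_map X (DO_S S (D A)) (D (SO S' A)) (gtau G A)"
    if "A \<in> Obj X'" for A using D that by (auto simp: linear_family_def)
  have lf: "linear_map X (D (Dom X' f)) (D (Cod X' f)) (GM G f)" if "f \<in> Arr X'" for f using D that by (auto simp: linear_family_def)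
  have M [simp]: "zeta (D A) \<in> Arr X" "Dom X (zeta (D A)) = terminal X" "Cod X (zeta (D A)) = GO G A" if "A \<in> Obj X'" for A
    using C.commutative_monoidD(1-4)[OF C.differential_objectD(1)[OF DA(1)[OF that]]] DA(2)[OF that] by simp_all
  note u = C.unit_cmp_typing[where HO = "SO S", OF F.F_terminal]
  have ub: "unit_cmp X (SO S) \<bullet> bang X (SO S (terminal X)) = idt X (SO S (terminal X))"
    by (rule C.terminal_unique) (use u F.F_terminal in simp_all)
  have d: "TM X (zeta (D A)) \<bullet> unit_cmp X (TO X) = gdist G A \<bullet> zeta (D (TO X' A))" if A: "A \<in> Obj X'" for A
    using C.linear_map_structure(1)[OF DA(1) DO_S_differential_object(2)[OF DA(1)[OF A]] l(1)[OF A]] DA A by (simp add: DO_T_def)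
  have t: "zeta (D (SO S' A)) \<bullet> bang X (SO S (terminal X)) = gtau G A \<bullet> SM S (zeta (D A))" if A: "A \<in> Obj X'" for A
  proof -
    have e: "gtau G A \<bullet> (SM S (zeta (D A)) \<bullet> unit_cmp X (SO S)) = zeta (D (SO S' A))"
      using C.linear_map_structure(1)[OF DO_S_differential_object(1)[OF DA(1)[OF A]] DA(1) l(2)[OF A]] DA A by (simp add: DO_S_def Let_def)
    show ?thesis using X.tail3[OF e, of "bang X (SO S (terminal X))"] u A by (simp add: ub)
  qed
  have n: "zeta (D (Cod X' f)) = GM G f \<bullet> zeta (D (Dom X' f))" if "f \<in> Arr X'" for f
    using C.linear_map_structure(1)[OF _ _ lf[OF that]] DA that by simp
  show ?thesis
    unfolding HS.two_morphism_iff[OF HS.mor1_terminal_one_morphism G]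
  proof (intro conjI ballI)
    fix f assume "f \<in> Arr X'"
    then show "(\<lambda>A\<in>Obj X'. zeta (D A)) (Cod X' f) \<bullet> GM (mor1_terminal S' S) f = GM G f \<bullet> (\<lambda>A\<in>Obj X'. zeta (D A)) (Dom X' f)"
      using n by (simp add: mor1_terminal_simps)
  qed (use d t in \<open>simp_all add: mor1_terminal_simps\<close>)
qed

lemma family_sigma:
  assumes D: "linear_family G D"
  shows "two_morphism S' S (mor1_prod S' S G G) G (\<lambda>A\<in>Obj X'. sigma (D A))"
proof -
  have G [simp]: "one_morphism S' S G" using D by (simp add: linear_family_def)
  have DA: "differential_object X (D A)" "carrier (D A) = GO G A"
    and l: "linear_map X (D (TO X' A)) (DO_T X (D A)) (gdist G A)" "linear_map X (DO_S S (D A)) (D (SO S' A)) (gtau G A)"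
    if "A \<in> Obj X'" for A using D that by (auto simp: linear_family_def)
  have lf: "linear_map X (D (Dom X' f)) (D (Cod X' f)) (GM G f)" if "f \<in> Arr X'" for f using D that by (auto simp: linear_family_def)
  have M [simp]: "sigma (D A) \<in> Arr X" "Dom X (sigma (D A)) = cprod X (GO G A) (GO G A)" "Cod X (sigma (D A)) = GO G A" if "A \<in> Obj X'" for A
    using C.commutative_monoidD(5-7)[OF C.differential_objectD(1)[OF DA(1)[OF that]]] DA(2)[OF that] by simp_all
  note mT = product_endomorphism.cmp_simps[OF C.product_endomorphism_T]
  note mS = F.cmp_simps
  have d: "TM X (sigma (D A)) \<bullet> (prod_cmp X (TO X) (TM X) (GO G A) (GO G A) \<bullet> cmap X (gdist G A) (gdist G A))
      = gdist G A \<bullet> sigma (D (TO X' A))" if A: "A \<in> Obj X'" for A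
  proof -
    have "gdist G A \<bullet> sigma (D (TO X' A)) = (TM X (sigma (D A)) \<bullet> prod_cmp X (TO X) (TM X) (GO G A) (GO G A)) \<bullet> cmap X (gdist G A) (gdist G A)"
      using C.linear_map_structure(2)[OF DA(1) DO_S_differential_object(2)[OF DA(1)[OF A]] l(1)[OF A]] DA A by (simp add: DO_T_def)
    then show ?thesis using A mT[of "GO G A" "GO G A"] C.cmap_cpair(2-4)[of "gdist G A" "gdist G A"] by simp
  qed
  have t: "sigma (D (SO S' A)) \<bullet> cpair X (GO G (SO S' A)) (GO G (SO S' A)) (gtau G A \<bullet> SM S (cfst X (GO G A) (GO G A))) (gtau G A \<bullet> SM S (csnd X (GO G A) (GO G A)))
      = gtau G A \<bullet> SM S (sigma (D A))" if A: "A \<in> Obj X'" for A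
  proof -
    define B t where "B = GO G A" and "t = gtau G A"
    have B: "B \<in> Obj X" "t \<in> Arr X" "Dom X t = SO S B" "Cod X t = GO G (SO S' A)" using A by (simp_all add: B_def t_def)
    define c where "c = cpair X (SO S B) (SO S B) (SM S (cfst X B B)) (SM S (csnd X B B))"
    have c: "c \<in> Arr X" "Dom X c = SO S (cprod X B B)" "Cod X c = cprod X (SO S B) (SO S B)" unfolding c_def using B by simp_all
    have "cpair X B B (cfst X B B) (csnd X B B) = idt X (cprod X B B)" by (rule C.cpair_eqI) (use B in simp_all)
    then have i: "prod_cmp X (SO S) (SM S) B B \<bullet> c = idt X (SO S (cprod X B B))"
      using F.cmp_cpair[of "cfst X B B" "csnd X B B" B B "idt X (SO S (cprod X B B))"] B unfolding c_def by simp
    have "t \<bullet> (SM S (sigma (D A)) \<bullet> prod_cmp X (SO S) (SM S) B B) = sigma (D (SO S' A)) \<bullet> cmap X t t"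
      using C.linear_map_structure(2)[OF DO_S_differential_object(1)[OF DA(1)[OF A]] DA(1) l(2)[OF A]] DA A unfolding B_def t_def by (simp add: DO_S_def Let_def)
    from arg_cong[OF this, of "\<lambda>k. k \<bullet> c"] have "t \<bullet> SM S (sigma (D A)) = sigma (D (SO S' A)) \<bullet> (cmap X t t \<bullet> c)"
      using A B c i mS[of B B] C.cmap_cpair(2-4)[of t t] by (simp add: B_def[symmetric])
    also have "cmap X t t \<bullet> c = cpair X (GO G (SO S' A)) (GO G (SO S' A)) (t \<bullet> SM S (cfst X B B)) (t \<bullet> SM S (csnd X B B))"
      unfolding c_def using B by (simp add: C.cmap_cpair(1))
    finally show ?thesis by (simp add: B_def t_def)
  qed
  have n: "sigma (D (Cod X' f)) \<bullet> cmap X (GM G f) (GM G f) = GM G f \<bullet> sigma (D (Dom X' f))" if "f \<in> Arr X'" for f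
    using C.linear_map_structure(2)[OF _ _ lf[OF that]] DA that by simp
  show ?thesis
    unfolding HS.two_morphism_iff[OF HS.mor1_prod_one_morphism(1)[OF G G] G]
  proof (intro conjI ballI)
    fix f assume "f \<in> Arr X'"
    then show "(\<lambda>A\<in>Obj X'. sigma (D A)) (Cod X' f) \<bullet> GM (mor1_prod S' S G G) f = GM G f \<bullet> (\<lambda>A\<in>Obj X'. sigma (D A)) (Dom X' f)"
      using n by (simp add: mor1_prod_simps)
  qed (use d t in \<open>simp_all add: mor1_prod_simps\<close>)
qed

lemma family_Obj:
  assumes D: "linear_family G D"
  shows "diff_of G D \<in> Obj P"
proof -
  have G: "one_morphism S' S G" and DA: "\<And>A. A \<in> Obj X' \<Longrightarrow> differential_object X (D A)"
    "\<And>A. A \<in> Obj X' \<Longrightarrow> carrier (D A) = GO G A"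
    using D by (auto simp: linear_family_def)
  have "two_morphism S' S (mor1_T S' S G) G (\<lambda>A\<in>Obj X'. phat (D A))"
    using family_phat[of G D, OF G DA] D by simp
  moreover have "fibre A (diff_of G D) = D A" if "A \<in> Obj X'" for A using that DA(2) by (simp add: fibre_def diff_of_def)
  ultimately show ?thesis
    using G DA(1) family_zeta[OF D] family_sigma[OF D] HS.mor1_T_one_morphism[OF G] HS.mor1_prod_one_morphism(1)[OF G G]
      HS.mor1_terminal_one_morphism
    by (simp add: P_Obj_iff) (simp add: diff_of_def)
qed

lemma Obj_family:
  assumes D: "D \<in> Obj P"
  shows "linear_family (carrier D) (\<lambda>A. fibre A D)" "diff_of (carrier D) (\<lambda>A. fibre A D) = D"
proof -
  define G where "G = carrier D"
  note D = D[unfolded P_Obj_iff in_hom_iff HS.H_Arr_iff HS.H_simps(2,3), folded G_def]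
  have G: "one_morphism S' S G" using D by blast
  have e: "amap (zeta D) \<in> extensional (Obj X')" "amap (sigma D) \<in> extensional (Obj X')" "amap (phat D) \<in> extensional (Obj X')"
    using D unfolding two_morphism_def Let_def by metis+
  have r: "(\<lambda>A\<in>Obj X'. zeta (fibre A D)) = amap (zeta D)" "(\<lambda>A\<in>Obj X'. sigma (fibre A D)) = amap (sigma D)"
    "(\<lambda>A\<in>Obj X'. phat (fibre A D)) = amap (phat D)"
    using e by (auto simp: fibre_def extensional_restrict)
  show "diff_of (carrier D) (\<lambda>A. fibre A D) = D"
    unfolding diff_of_def r G_def[symmetric] using D by (intro diff_object.equality) (auto simp: G_def intro!: arrow.expand)
  have "linear_family G (\<lambda>A. fibre A D) \<longleftrightarrow> two_morphism S' S (mor1_T S' S G) G (\<lambda>A\<in>Obj X'. phat (fibre A D))"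
    by (rule family_phat[OF G]) (use D in \<open>auto simp: fibre_def G_def\<close>)
  then show "linear_family (carrier D) (\<lambda>A. fibre A D)" unfolding r G_def[symmetric] using D by auto
qed

end

section \<open>The universal property\<close>

context test_monad
begin

abbreviation "U \<equiv> forgetful S"

text \<open>A 1-morphism into the monad on differential objects, spelled out in terms of underlying maps.\<close>

lemma over_simps:
  assumes K: "one_morphism S' E K"
  shows "A \<in> Obj X' \<Longrightarrow> differential_object X (GO K A)"
    "f \<in> Arr X' \<Longrightarrow> linear_map X (GO K (Dom X' f)) (GO K (Cod X' f)) (amap (GM K f))"
    "f \<in> Arr X' \<Longrightarrow> asrc (GM K f) = GO K (Dom X' f)" "f \<in> Arr X' \<Longrightarrow> atrg (GM K f) = GO K (Cod X' f)"
    "A \<in> Obj X' \<Longrightarrow> linear_map X (GO K (TO X' A)) (DO_T X (GO K A)) (amap (gdist K A))"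
    "A \<in> Obj X' \<Longrightarrow> asrc (gdist K A) = GO K (TO X' A)" "A \<in> Obj X' \<Longrightarrow> atrg (gdist K A) = DO_T X (GO K A)"
    "A \<in> Obj X' \<Longrightarrow> linear_map X (DO_S S (GO K A)) (GO K (SO S' A)) (amap (gtau K A))"
    "A \<in> Obj X' \<Longrightarrow> asrc (gtau K A) = DO_S S (GO K A)" "A \<in> Obj X' \<Longrightarrow> atrg (gtau K A) = GO K (SO S' A)"
proof -
  note g = HE.G_simps[OF K, unfolded E_simps(1,2) C.DO_simps]
  show "A \<in> Obj X' \<Longrightarrow> differential_object X (GO K A)"
    "f \<in> Arr X' \<Longrightarrow> asrc (GM K f) = GO K (Dom X' f)" "f \<in> Arr X' \<Longrightarrow> atrg (GM K f) = GO K (Cod X' f)"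
    "A \<in> Obj X' \<Longrightarrow> asrc (gdist K A) = GO K (TO X' A)" "A \<in> Obj X' \<Longrightarrow> atrg (gdist K A) = DO_T X (GO K A)"
    "A \<in> Obj X' \<Longrightarrow> asrc (gtau K A) = DO_S S (GO K A)" "A \<in> Obj X' \<Longrightarrow> atrg (gtau K A) = GO K (SO S' A)"
    using g(1,3,4,8,9,11,12) by blast+
  show "f \<in> Arr X' \<Longrightarrow> linear_map X (GO K (Dom X' f)) (GO K (Cod X' f)) (amap (GM K f))"
    using g(2)[of f] g(3,4)[of f] unfolding C.DO_Arr_iff by simp
  show "A \<in> Obj X' \<Longrightarrow> linear_map X (GO K (TO X' A)) (DO_T X (GO K A)) (amap (gdist K A))"
    using g(7)[of A] g(8,9)[of A] unfolding C.DO_Arr_iff by simp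
  show "A \<in> Obj X' \<Longrightarrow> linear_map X (DO_S S (GO K A)) (GO K (SO S' A)) (amap (gtau K A))"
    using g(10)[of A] g(11,12)[of A] unfolding C.DO_Arr_iff by simp
qed

lemma U_comp1_simps:
  assumes K: "one_morphism S' E K"
  shows "A \<in> Obj X' \<Longrightarrow> GO (comp1 S' S U K) A = carrier (GO K A)"
    "f \<in> Arr X' \<Longrightarrow> GM (comp1 S' S U K) f = amap (GM K f)"
    "A \<in> Obj X' \<Longrightarrow> gdist (comp1 S' S U K) A = amap (gdist K A)"
    "A \<in> Obj X' \<Longrightarrow> gtau (comp1 S' S U K) A = amap (gtau K A)"
proof -
  note g = HE.G_simps(1,2,7-9,10-12)[OF K, unfolded E_simps(1,2)]
  show "A \<in> Obj X' \<Longrightarrow> GO (comp1 S' S U K) A = carrier (GO K A)"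
    "f \<in> Arr X' \<Longrightarrow> GM (comp1 S' S U K) f = amap (GM K f)"
    using g(1,2) by (simp_all only: comp1_def mor1.simps restrict_apply if_True forgetful_simps)
  show "gdist (comp1 S' S U K) A = amap (gdist K A)" if A: "A \<in> Obj X'"
  proof -
    have "gdist (comp1 S' S U K) A = idt X (TO X (carrier (GO K A))) \<bullet> amap (gdist K A)"
      using A g(1,3) by (simp only: comp1_def mor1.simps restrict_apply if_True forgetful_simps)
    then show ?thesis using linear_map_typing[OF over_simps(5)[OF K A]] over_simps(1)[OF K A] by simp
  qed
  show "gtau (comp1 S' S U K) A = amap (gtau K A)" if A: "A \<in> Obj X'"
  proof -
    have "gtau (comp1 S' S U K) A = amap (gtau K A) \<bullet> idt X (SO S (carrier (GO K A)))"
      using A g(1,6) by (simp only: comp1_def mor1.simps restrict_apply if_True forgetful_simps)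
    then show ?thesis using linear_map_typing[OF over_simps(8)[OF K A]] over_simps(1)[OF K A] by simp
  qed
qed

lemma over_family:
  assumes K: "one_morphism S' E K"
  shows "linear_family (comp1 S' S U K) (GO K)"
  unfolding linear_family_def
  using U3.comp1_one_morphism[OF forgetful_one_morphism K] over_simps(1,2,5,8)[OF K]
  by (simp add: U_comp1_simps[OF K])

text \<open>Together with \<open>over_family\<close>, this identifies 1-morphisms into the monad on differential objects with
  linear families.\<close>

definition lift :: "('q, 'c, 'o, 'a) mor1 \<Rightarrow> ('q \<Rightarrow> ('o, 'a) diff_object) \<Rightarrow> ('q, 'c, ('o, 'a) diff_object, (('o, 'a) diff_object, 'a) arrow) mor1" where
  "lift G D = \<lparr>GO = (\<lambda>A\<in>Obj X'. D A),
     GM = (\<lambda>f\<in>Arr X'. Arrow (D (Dom X' f)) (GM G f) (D (Cod X' f))),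
     gdist = (\<lambda>A\<in>Obj X'. Arrow (D (TO X' A)) (gdist G A) (DO_T X (D A))),
     gtau = (\<lambda>A\<in>Obj X'. Arrow (DO_S S (D A)) (gtau G A) (D (SO S' A)))\<rparr>"

lemma lift_simps:
  "A \<in> Obj X' \<Longrightarrow> GO (lift G D) A = D A"
  "f \<in> Arr X' \<Longrightarrow> GM (lift G D) f = Arrow (D (Dom X' f)) (GM G f) (D (Cod X' f))"
  "A \<in> Obj X' \<Longrightarrow> gdist (lift G D) A = Arrow (D (TO X' A)) (gdist G A) (DO_T X (D A))"
  "A \<in> Obj X' \<Longrightarrow> gtau (lift G D) A = Arrow (DO_S S (D A)) (gtau G A) (D (SO S' A))"
  by (simp_all add: lift_def)

lemma lift_one_morphism:
  assumes D: "linear_family G D"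
  shows "one_morphism S' E (lift G D)"
proof -
  let ?Y = "DO X" and ?K = "lift G D"
  have G: "one_morphism S' S G" using D by (simp add: linear_family_def)
  have DA: "differential_object X (D A)" "carrier (D A) = GO G A"
    and l: "linear_map X (D (TO X' A)) (DO_T X (D A)) (gdist G A)" "linear_map X (DO_S S (D A)) (D (SO S' A)) (gtau G A)"
    if "A \<in> Obj X'" for A using D that by (auto simp: linear_family_def)
  have lf: "linear_map X (D (Dom X' f)) (D (Cod X' f)) (GM G f)" if "f \<in> Arr X'" for f using D that by (auto simp: linear_family_def)
  note [simp] = lift_simps
  show ?thesis
  proof (rule HE.one_morphismI, unfold E_simps(1,2))
    show "GO ?K \<in> extensional (Obj X')" "GM ?K \<in> extensional (Arr X')" "gdist ?K \<in> extensional (Obj X')" "gtau ?K \<in> extensional (Obj X')"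
      by (simp_all add: lift_def)
  next
    fix A assume A: "A \<in> Obj X'"
    note dA = DA(1)[OF A]
    show "GO ?K A \<in> Obj ?Y" "GM ?K (idt X' A) = idt ?Y (GO ?K A)" using A DA G by simp_all
    show "gdist ?K A \<in> hom ?Y (GO ?K (TO X' A)) (TO ?Y (GO ?K A))" "gtau ?K A \<in> hom ?Y (DO_S S (GO ?K A)) (GO ?K (SO S' A))"
      using A DA l by simp_all
    show "tproj ?Y (GO ?K A) \<odot> gdist ?K A = GM ?K (tproj X' A)"
      "gdist ?K A \<odot> GM ?K (tzero X' A) = tzero ?Y (GO ?K A)"
      "tlift ?Y (GO ?K A) \<odot> gdist ?K A = TM ?Y (gdist ?K A) \<odot> (gdist ?K (TO X' A) \<odot> GM ?K (tlift X' A))"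
      "tflip ?Y (GO ?K A) \<odot> (TM ?Y (gdist ?K A) \<odot> gdist ?K (TO X' A)) = TM ?Y (gdist ?K A) \<odot> (gdist ?K (TO X' A) \<odot> GM ?K (tflip X' A))"
      using A DA(2) HS.gdist_proj[OF G A] HS.gdist_zero[OF G A] HS.gdist_lift[OF G A] HS.gdist_flip[OF G A] by simp_all
    show "TM ?Y (gtau ?K A) \<odot> (sdist E (GO ?K A) \<odot> SM E (gdist ?K A)) = gdist ?K (SO S' A) \<odot> (GM ?K (sdist S' A) \<odot> gtau ?K (TO X' A))"
      "gtau ?K A \<odot> eta E (GO ?K A) = GM ?K (eta S' A)"
      "gtau ?K A \<odot> mu E (GO ?K A) = GM ?K (mu S' A) \<odot> (gtau ?K (SO S' A) \<odot> SM E (gtau ?K A))"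
      using A DA(2) HS.gtau_dist[OF G A] HS.gtau_monad[OF G A] by simp_all
    define u v where "u = gdist ?K A \<odot> GM ?K (tpi1 X' A)" and "v = gdist ?K A \<odot> GM ?K (tpi2 X' A)"
    have u_eq: "u = Arrow (D (T2 X' A)) (gdist G A \<bullet> GM G (tpi1 X' A)) (DO_T X (D A))"
      and v_eq: "v = Arrow (D (T2 X' A)) (gdist G A \<bullet> GM G (tpi2 X' A)) (DO_T X (D A))"
      unfolding u_def v_def using A by simp_all
    have T2: "differential_object X (D (T2 X' A))" "differential_object X (D (TO X' A))" "differential_object X (DO_T X (D A))"
      using DA(1) A by simp_all
    have lu: "linear_map X (D (T2 X' A)) (D (TO X' A)) (GM G (tpi1 X' A))" "linear_map X (D (T2 X' A)) (D (TO X' A)) (GM G (tpi2 X' A))"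
      using lf[of "tpi1 X' A"] lf[of "tpi2 X' A"] A by simp_all
    have u: "u \<in> Arr ?Y" "v \<in> Arr ?Y" unfolding u_eq v_eq C.DO_Arr_iff arrow.sel
      using T2 C.linear_map_comp[OF T2 lu(1) l(1)[OF A]] C.linear_map_comp[OF T2 lu(2) l(1)[OF A]] by blast+
    have O: "D A \<in> Obj ?Y" unfolding C.DO_simps by (rule dA)
    have d: "Dom ?Y u = Dom ?Y v" "Cod ?Y u = TO ?Y (D A)" "Cod ?Y v = TO ?Y (D A)"
      unfolding C.DO_simps u_eq v_eq arrow.sel by (rule refl)+
    have "GM G (tproj X' A) \<bullet> GM G (tpi1 X' A) = GM G (tproj X' A) \<bullet> GM G (tpi2 X' A)"
      using arg_cong[OF T.X.tpi_proj[OF A], of "GM G"] A G by simp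
    then have e: "tproj ?Y (D A) \<odot> u = tproj ?Y (D A) \<odot> v"
      using A G DA(2) X.tail[OF HS.gdist_proj[OF G A], of "GM G (tpi1 X' A)"] X.tail[OF HS.gdist_proj[OF G A], of "GM G (tpi2 X' A)"]
      unfolding u_eq v_eq by simp
    note p = D.U_pair2[OF O u d e]
    have "amap (pair2 ?Y (D A) u v) = pair2 X (GO G A) (gdist G A \<bullet> GM G (tpi1 X' A)) (gdist G A \<bullet> GM G (tpi2 X' A))"
      "asrc (pair2 ?Y (D A) u v) = D (T2 X' A)"
      using p(2) p(6)[of "()"] DA(2)[OF A] unfolding C.DO_simps u_eq v_eq by simp_all
    then have "gdist ?K A \<odot> GM ?K (tsum X' A) = tsum ?Y (D A) \<odot> pair2 ?Y (D A) u v"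
      using A DA(2) HS.gdist_sum[OF G A] by simp
    then show "gdist ?K A \<odot> GM ?K (tsum X' A) = tsum ?Y (GO ?K A) \<odot>
        pair2 ?Y (GO ?K A) (gdist ?K A \<odot> GM ?K (tpi1 X' A)) (gdist ?K A \<odot> GM ?K (tpi2 X' A))"
      unfolding u_def v_def using A by simp
  next
    fix f assume f: "f \<in> Arr X'"
    show "GM ?K f \<in> hom ?Y (GO ?K (Dom X' f)) (GO ?K (Cod X' f))" using f DA lf by simp
    show "gdist ?K (Cod X' f) \<odot> GM ?K (TM X' f) = TM ?Y (GM ?K f) \<odot> gdist ?K (Dom X' f)"
      "gtau ?K (Cod X' f) \<odot> SM E (GM ?K f) = GM ?K (SM S' f) \<odot> gtau ?K (Dom X' f)"
      using f HS.gdist_nat[OF G f refl] HS.gtau_nat[OF G f refl] by simp_all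
    fix g assume "g \<in> Arr X'" "Dom X' g = Cod X' f"
    then show "GM ?K (g \<cdot>\<^bsub>X'\<^esub> f) = GM ?K g \<odot> GM ?K f" using f G by simp
  qed
qed

lemma comp1_lift:
  assumes D: "linear_family G D"
  shows "comp1 S' S U (lift G D) = G"
proof (rule HS.mor1_eqI)
  note K = lift_one_morphism[OF D]
  show "one_morphism S' S (comp1 S' S U (lift G D))" by (rule U3.comp1_one_morphism[OF forgetful_one_morphism K])
  show "one_morphism S' S G" using D by (simp add: linear_family_def)
  show "A \<in> Obj X' \<Longrightarrow> GO (comp1 S' S U (lift G D)) A = GO G A" "f \<in> Arr X' \<Longrightarrow> GM (comp1 S' S U (lift G D)) f = GM G f"
    "A \<in> Obj X' \<Longrightarrow> gdist (comp1 S' S U (lift G D)) A = gdist G A" "A \<in> Obj X' \<Longrightarrow> gtau (comp1 S' S U (lift G D)) A = gtau G A" for A f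
    using D by (simp_all add: U_comp1_simps[OF K] lift_simps linear_family_def)
qed

lemma lift_comp1:
  assumes K: "one_morphism S' E K"
  shows "lift (comp1 S' S U K) (GO K) = K"
proof (rule HE.mor1_eqI)
  show "one_morphism S' E (lift (comp1 S' S U K) (GO K))" by (rule lift_one_morphism[OF over_family[OF K]])
qed (simp_all add: K lift_simps U_comp1_simps[OF K] over_simps[OF K] arrow.expand)

end

context test_monad
begin

text \<open>The objectwise terminal object, products and tangent bundles of 1-morphisms are stable under
  precomposition, so that restricting the tautological differential object along \<open>K\<close> yields a differential
  object in the hom-category.\<close>

lemma comp1_terminal:
  assumes K: "one_morphism S' E K"
  shows "comp1 S' S (mor1_terminal E S) K = mor1_terminal S' S"
proof -
  note g = HE.G_simps[OF K, unfolded E_simps(1,2)]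
  note u = C.unit_cmp_typing[where HO = "TO X", OF C.T_terminal]
  show ?thesis
    unfolding comp1_def mor1_terminal_def Let_def E_simps(1,2) mor1.simps
    using g(1,2,7,10) u by (auto intro!: restrict_ext simp del: C.DO_simps C.DO_Arr_iff)
qed

lemma comp1_prod:
  assumes K: "one_morphism S' E K"
  shows "comp1 S' S (mor1_prod E S U U) K = mor1_prod S' S (comp1 S' S U K) (comp1 S' S U K)"
proof -
  let ?V = "comp1 S' S U K"
  note g = HE.G_simps[OF K, unfolded E_simps(1,2)]
  note V = U_comp1_simps[OF K]
  note o = over_simps[OF K]
  note mT = product_endomorphism.cmp_simps[OF C.product_endomorphism_T]
  note simps = mor1_prod_simps V
  have d: "gdist (mor1_prod E S U U) (GO K A) \<bullet> GM (mor1_prod E S U U) (gdist K A) = gdist (mor1_prod S' S ?V ?V) A" if A: "A \<in> Obj X'" for A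
  proof -
    define B b where "B = carrier (GO K A)" and "b = amap (gdist K A)"
    have t: "B \<in> Obj X" "b \<in> Arr X" "Cod X b = TO X B"
      using linear_map_typing[OF o(5)[OF A]] C.carrier_Obj[OF o(1)[OF A]] by (simp_all add: B_def b_def)
    have "gdist (mor1_prod E S U U) (GO K A) = prod_cmp X (TO X) (TM X) B B \<bullet> cmap X (idt X (TO X B)) (idt X (TO X B))"
      "GM (mor1_prod E S U U) (gdist K A) = cmap X b b"
      unfolding B_def b_def using g(1,7)[OF A] by (simp_all only: mor1_prod_def Let_def mor1.simps restrict_apply if_True forgetful_simps E_simps(1))
    then show ?thesis using A t mT[of B B] by (simp add: simps B_def[symmetric] b_def[symmetric] C.cmap_cpair)
  qed
  have t: "GM (mor1_prod E S U U) (gtau K A) \<bullet> gtau (mor1_prod E S U U) (GO K A) = gtau (mor1_prod S' S ?V ?V) A" if A: "A \<in> Obj X'" for A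
  proof -
    define B t where "B = carrier (GO K A)" and "t = amap (gtau K A)"
    have t: "B \<in> Obj X" "t \<in> Arr X" "Dom X t = SO S B" "Cod X t = carrier (GO K (SO S' A))"
      using linear_map_typing[OF o(8)[OF A]] C.carrier_Obj[OF o(1)[OF A]] by (simp_all add: B_def t_def)
    have SA: "DO_S S (GO K A) \<in> Obj (DO X)" using o(1)[OF A] by simp
    have "gtau (mor1_prod E S U U) (GO K A) = cpair X (SO S B) (SO S B) (idt X (SO S B) \<bullet> SM S (cfst X B B)) (idt X (SO S B) \<bullet> SM S (csnd X B B))"
      "GM (mor1_prod E S U U) (gtau K A) = cmap X t t"
      unfolding B_def t_def using g(1,10)[OF A] SA by (simp_all only: mor1_prod_def Let_def mor1.simps restrict_apply if_True forgetful_simps E_simps(1,2) carrier_simps)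
    then show ?thesis using A t by (simp add: simps B_def[symmetric] t_def[symmetric] C.cmap_cpair)
  qed
  have o: "GO (mor1_prod E S U U) (GO K A) = GO (mor1_prod S' S ?V ?V) A" if A: "A \<in> Obj X'" for A
    unfolding mor1_prod_simps(1)[OF A] V(1)[OF A] using g(1)[OF A] by (simp only: mor1_prod_def Let_def mor1.simps restrict_apply if_True forgetful_simps E_simps(1))
  have m: "GM (mor1_prod E S U U) (GM K f) = GM (mor1_prod S' S ?V ?V) f" if f: "f \<in> Arr X'" for f
    unfolding mor1_prod_simps(2)[OF f] V(2)[OF f] using g(2)[OF f] by (simp only: mor1_prod_def Let_def mor1.simps restrict_apply if_True forgetful_simps E_simps(1))
  show ?thesis
  proof (rule HS.mor1_eqI)
    note W = U3.comp1_one_morphism[OF forgetful_one_morphism K]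
    show "one_morphism S' S (comp1 S' S (mor1_prod E S U U) K)"
      by (rule U3.comp1_one_morphism[OF ES.mor1_prod_one_morphism(1)[OF forgetful_one_morphism forgetful_one_morphism] K])
    show "one_morphism S' S (mor1_prod S' S ?V ?V)" by (rule HS.mor1_prod_one_morphism(1)[OF W W])
  qed (simp_all only: comp1_def[of S' S "mor1_prod E S U U"] mor1.simps restrict_apply if_True d t o m)
qed

lemma comp1_T:
  assumes K: "one_morphism S' E K"
  shows "comp1 S' S (mor1_T E S U) K = mor1_T S' S (comp1 S' S U K)"
    "comp1 S' S U (mor1_T S' E K) = mor1_T S' S (comp1 S' S U K)"
proof -
  note U = forgetful_one_morphism
  note V = U3.comp1_one_morphism[OF U K]
  note g = HE.G_simps[OF K, unfolded E_simps(1,2)]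
  note TK = HE.mor1_T_one_morphism[OF K]
  note o = over_simps[OF K]
  show "comp1 S' S U (mor1_T S' E K) = mor1_T S' S (comp1 S' S U K)"
  proof (rule HS.mor1_eqI)
    show "one_morphism S' S (comp1 S' S U (mor1_T S' E K))" by (rule U3.comp1_one_morphism[OF U TK])
    show "one_morphism S' S (mor1_T S' S (comp1 S' S U K))" by (rule HS.mor1_T_one_morphism[OF V])
  qed (simp_all add: U_comp1_simps[OF K] U_comp1_simps[OF TK])
  show "comp1 S' S (mor1_T E S U) K = mor1_T S' S (comp1 S' S U K)"
  proof (rule HS.mor1_eqI)
    note TU = ES.mor1_T_one_morphism[OF U]
    note T = ES.mor1_T_simps[unfolded E_simps(1), of _ U]
    show "one_morphism S' S (comp1 S' S (mor1_T E S U) K)" by (rule U3.comp1_one_morphism[OF TU K])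
    show "one_morphism S' S (mor1_T S' S (comp1 S' S U K))" by (rule HS.mor1_T_one_morphism[OF V])
    fix A assume A: "A \<in> Obj X'"
    have O: "carrier (GO K A) \<in> Obj X" using C.carrier_Obj[OF o(1)[OF A]] .
    note t = linear_map_typing[OF o(5)[OF A]] linear_map_typing[OF o(8)[OF A]]
    show "GO (comp1 S' S (mor1_T E S U) K) A = GO (mor1_T S' S (comp1 S' S U K)) A"
      using A by (simp add: comp1_def T(1)[OF g(1)[OF A]] forgetful_simps(1)[OF g(1)[OF A]] del: C.DO_simps)
    show "gdist (comp1 S' S (mor1_T E S U) K) A = gdist (mor1_T S' S (comp1 S' S U K)) A"
      using A O t by (simp add: U_comp1_simps[OF K]) (simp add: comp1_def T(3)[OF g(1)[OF A]] T(2)[OF g(7)[OF A]] forgetful_simps(1,3)[OF g(1)[OF A]] forgetful_simps(2)[OF g(7)[OF A]] del: C.DO_simps)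
    show "gtau (comp1 S' S (mor1_T E S U) K) A = gtau (mor1_T S' S (comp1 S' S U K)) A"
      using A O t by (simp add: U_comp1_simps[OF K]) (simp add: comp1_def T(4)[OF g(1)[OF A]] T(2)[OF g(10)[OF A]] forgetful_simps(1,4)[OF g(1)[OF A]] forgetful_simps(2)[OF g(10)[OF A]] del: C.DO_simps)
  next
    fix f assume f: "f \<in> Arr X'"
    show "GM (comp1 S' S (mor1_T E S U) K) f = GM (mor1_T S' S (comp1 S' S U K)) f"
      using f by (simp add: U_comp1_simps[OF K]) (simp add: comp1_def ES.mor1_T_simps(2)[unfolded E_simps(1), OF g(2)[OF f]] forgetful_simps(2)[OF g(2)[OF f]] del: C.DO_simps)
  qed
qed

abbreviation "R \<equiv> restrict_along S' S (tautological S)"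
abbreviation "RM \<equiv> restrict_along_map S' S (tautological S)"

lemma restrict_along_diff_of:
  assumes K: "one_morphism S' E K"
  shows "R K = diff_of (comp1 S' S U K) (GO K)"
proof -
  have "(\<lambda>A\<in>Obj X'. (\<lambda>D\<in>Obj (DO X). h D) (GO K A)) = (\<lambda>A\<in>Obj X'. h (GO K A))" for h :: "('o, 'a) diff_object \<Rightarrow> 'a"
    using over_simps(1)[OF K] by (auto intro!: restrict_ext)
  then show ?thesis
    unfolding restrict_along_def tautological_def Let_def whisker_right_def diff_of_def diff_object.simps arrow.sel ES.H_simps
      comp1_terminal[OF K] comp1_prod[OF K] comp1_T(1)[OF K] by simp
qed

lemma R_simps:
  assumes K: "one_morphism S' E K"
  shows "R K \<in> Obj P" "carrier (R K) = comp1 S' S U K" "A \<in> Obj X' \<Longrightarrow> fibre A (R K) = GO K A"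
  unfolding restrict_along_diff_of[OF K]
  using family_Obj[OF over_family[OF K]] by (simp_all add: diff_of_def fibre_def U_comp1_simps[OF K])

lemma R_bij: "bij_betw R (Obj HE.H) (Obj P)"
proof (rule bij_betwI')
  fix K L assume "K \<in> Obj HE.H" "L \<in> Obj HE.H"
  then have K: "one_morphism S' E K" and L: "one_morphism S' E L" by simp_all
  have lift_cong: "lift G D = lift G D'" if "\<forall>A\<in>Obj X'. D A = D' A" for G D D'
    unfolding lift_def using that by (auto intro!: restrict_ext)
  show "R K = R L \<longleftrightarrow> K = L"
  proof
    assume e: "R K = R L"
    then have "comp1 S' S U K = comp1 S' S U L" "\<forall>A\<in>Obj X'. GO K A = GO L A"
      using R_simps(2,3)[OF K] R_simps(2,3)[OF L] by (metis, metis)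
    then show "K = L" using lift_comp1[OF K] lift_comp1[OF L] lift_cong by metis
  qed simp
next
  fix K assume "K \<in> Obj HE.H"
  then show "R K \<in> Obj P" by (simp add: R_simps(1))
next
  fix D assume D: "D \<in> Obj P"
  note f = Obj_family[OF D]
  let ?K = "lift (carrier D) (\<lambda>A. fibre A D)"
  have K: "one_morphism S' E ?K" by (rule lift_one_morphism[OF f(1)])
  have "R ?K = diff_of (carrier D) (\<lambda>A. fibre A D)"
    unfolding restrict_along_diff_of[OF K] comp1_lift[OF f(1)] by (auto simp: diff_of_def lift_simps intro!: restrict_ext)
  then show "\<exists>K\<in>Obj HE.H. D = R K" using K f(2) by (intro bexI[of _ ?K]) simp_all
qed

end

context test_monad
begin

text \<open>The compatibility conditions of a 2-morphism are equations between linear maps, hence between underlying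
  maps.\<close>

lemma over_two_morphism_iff:
  assumes K: "one_morphism S' E K" and L: "one_morphism S' E L"
  shows "two_morphism S' E K L \<phi> \<longleftrightarrow> \<phi> \<in> extensional (Obj X') \<and>
    (\<forall>A\<in>Obj X'. asrc (\<phi> A) = GO K A \<and> atrg (\<phi> A) = GO L A \<and> linear_map X (GO K A) (GO L A) (amap (\<phi> A))) \<and>
    two_morphism S' S (comp1 S' S U K) (comp1 S' S U L) (\<lambda>A\<in>Obj X'. amap (\<phi> A))"
proof -
  note V = U3.comp1_one_morphism[OF forgetful_one_morphism K] U3.comp1_one_morphism[OF forgetful_one_morphism L]
  note o = over_simps[OF K] over_simps[OF L]
  have ty: "\<phi> A \<in> Arr (DO X) \<and> Dom (DO X) (\<phi> A) = GO K A \<and> Cod (DO X) (\<phi> A) = GO L A \<longleftrightarrow>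
      asrc (\<phi> A) = GO K A \<and> atrg (\<phi> A) = GO L A \<and> linear_map X (GO K A) (GO L A) (amap (\<phi> A))" if "A \<in> Obj X'" for A
    using o(1,11)[OF that] by auto
  have d: "TM (DO X) (\<phi> A) \<odot> gdist K A = gdist L A \<odot> \<phi> (TO X' A) \<longleftrightarrow>
      TM X (amap (\<phi> A)) \<bullet> amap (gdist K A) = amap (gdist L A) \<bullet> amap (\<phi> (TO X' A))"
    "\<phi> (SO S' A) \<odot> gtau K A = gtau L A \<odot> SM E (\<phi> A) \<longleftrightarrow>
      amap (\<phi> (SO S' A)) \<bullet> amap (gtau K A) = amap (gtau L A) \<bullet> SM S (amap (\<phi> A))"
    if A: "A \<in> Obj X'" and t: "\<And>B. B \<in> Obj X' \<Longrightarrow> asrc (\<phi> B) = GO K B \<and> atrg (\<phi> B) = GO L B" for A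
    using A o(6,7,9,10,16,17,19,20)[OF A] t[OF A] t[of "TO X' A"] t[of "SO S' A"] by simp_all
  have n: "\<phi> (Cod X' f) \<odot> GM K f = GM L f \<odot> \<phi> (Dom X' f) \<longleftrightarrow>
      amap (\<phi> (Cod X' f)) \<bullet> amap (GM K f) = amap (GM L f) \<bullet> amap (\<phi> (Dom X' f))"
    if f: "f \<in> Arr X'" and t: "\<And>B. B \<in> Obj X' \<Longrightarrow> asrc (\<phi> B) = GO K B \<and> atrg (\<phi> B) = GO L B" for f
    using f o(3,4,13,14)[OF f] t[of "Dom X' f"] t[of "Cod X' f"] by simp
  show ?thesis
    unfolding HE.two_morphism_iff[OF K L] HS.two_morphism_iff[OF V] E_simps(1)
    using ty d n linear_map_typing by (simp add: U_comp1_simps[OF K] U_comp1_simps[OF L] del: C.DO_simps C.DO_Arr_iff E_simps) (smt (verit) T.X.Obj_ends T.S_simps(1) T.X.TM_simps(1))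
qed

end

context test_monad
begin

lemma RM_eq:
  assumes \<phi>: "\<phi> \<in> Arr HE.H"
  shows "RM \<phi> = Arrow (R (asrc \<phi>)) (Arrow (comp1 S' S U (asrc \<phi>)) (\<lambda>A\<in>Obj X'. amap (amap \<phi> A)) (comp1 S' S U (atrg \<phi>))) (R (atrg \<phi>))"
proof -
  have K: "one_morphism S' E (asrc \<phi>)" "one_morphism S' E (atrg \<phi>)" and t: "two_morphism S' E (asrc \<phi>) (atrg \<phi>) (amap \<phi>)"
    using \<phi> by simp_all
  have "amap \<phi> A \<in> Arr (DO X)" if "A \<in> Obj X'" for A
    using t that unfolding HE.two_morphism_iff[OF K] E_simps(1) by blast
  then have "(\<lambda>A\<in>Obj X'. GM U (amap \<phi> A)) = (\<lambda>A\<in>Obj X'. amap (amap \<phi> A))"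
    by (intro restrict_ext forgetful_simps(2))
  then show ?thesis unfolding restrict_along_map_def whisker_left_def tautological_def Let_def diff_object.simps by simp
qed

lemma RM_Arr:
  assumes \<phi>: "\<phi> \<in> Arr HE.H"
  shows "RM \<phi> \<in> Arr P"
proof -
  have K: "one_morphism S' E (asrc \<phi>)" "one_morphism S' E (atrg \<phi>)" and t: "two_morphism S' E (asrc \<phi>) (atrg \<phi>) (amap \<phi>)"
    using \<phi> by simp_all
  note t = t[unfolded over_two_morphism_iff[OF K]]
  note R = R_simps(1)[OF K(1), unfolded P_simps] R_simps(1)[OF K(2), unfolded P_simps]
  let ?f = "Arrow (comp1 S' S U (asrc \<phi>)) (\<lambda>A\<in>Obj X'. amap (amap \<phi> A)) (comp1 S' S U (atrg \<phi>))"
  have f: "?f \<in> Arr HS.H" "Dom HS.H ?f = carrier (R (asrc \<phi>))" "Cod HS.H ?f = carrier (R (atrg \<phi>))"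
    using t U3.comp1_one_morphism[OF forgetful_one_morphism K(1)] U3.comp1_one_morphism[OF forgetful_one_morphism K(2)]
    by (simp_all add: R_simps(2) K)
  have "linear_map HS.H (R (asrc \<phi>)) (R (atrg \<phi>)) ?f"
    unfolding H_linear_map_iff[OF conjunct1[OF R(1)] conjunct1[OF R(2)] f] using t by (simp add: R_simps(3) K)
  then show ?thesis unfolding RM_eq[OF \<phi>] P_simps(2) using R by simp
qed

lemma R_T:
  assumes K: "one_morphism S' E K"
  shows "R (mor1_T S' E K) = DO_T HS.H (R K)"
proof (rule H_eqI)
  note TK = HE.mor1_T_one_morphism[OF K]
  note R = R_simps(1)[OF K, unfolded P_simps, THEN conjunct1]
  show "differential_object HS.H (R (mor1_T S' E K))" using R_simps(1)[OF TK, unfolded P_simps] by blast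
  show "differential_object HS.H (DO_T HS.H (R K))" by (rule cartesian_tangent_category.DO_T_differential_object[OF H_cartesian R])
  show "carrier (R (mor1_T S' E K)) = carrier (DO_T HS.H (R K))"
    by (simp add: DO_T_def R_simps(2) TK K comp1_T(2))
  show "A \<in> Obj X' \<Longrightarrow> fibre A (R (mor1_T S' E K)) = fibre A (DO_T HS.H (R K))" for A
    by (simp add: R_simps(3) TK K fibre_DO_T R)
qed

text \<open>The differential structures on \<open>T\<^sub>2\<close> agree because both have linear projections, the underlying
  1-morphisms because both have projections that are 2-morphisms.\<close>

lemma R_T2:
  assumes K: "one_morphism S' E K"
  shows "R (mor1_T2 S' E K) = DO_T2 HS.H (R K)"
proof -
  let ?V = "comp1 S' S U K" and ?W = "comp1 S' S U (mor1_T2 S' E K)"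
  note TK = HE.mor1_T_one_morphism[OF K] and T2 = HE.mor1_T2_one_morphism[OF K]
  note V = U3.comp1_one_morphism[OF forgetful_one_morphism K] and W = U3.comp1_one_morphism[OF forgetful_one_morphism T2(1)]
  note R = R_simps(1)[OF K, unfolded P_simps, THEN conjunct1] and R2 = R_simps(1)[OF T2(1), unfolded P_simps, THEN conjunct1]
  have p: "two_morphism S' S ?W (mor1_T S' S ?V) (\<lambda>A\<in>Obj X'. tpi1 X (GO ?V A))"
    "two_morphism S' S ?W (mor1_T S' S ?V) (\<lambda>A\<in>Obj X'. tpi2 X (GO ?V A))"
    using T2(2,3)[unfolded over_two_morphism_iff[OF T2(1) TK]] by (simp_all add: comp1_T(2)[OF K] U_comp1_simps(1)[OF K] cong: restrict_cong)
  have c: "mor1_T2 S' S ?V = ?W"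
    by (rule HS.mor1_T2_unique[OF V W _ p]) (simp add: U_comp1_simps[OF K] U_comp1_simps[OF T2(1)] HE.mor1_T2_simps)
  have "tpi1 HE.H K \<in> Arr HE.H" "tpi2 HE.H K \<in> Arr HE.H" using TK T2 by simp_all
  note a = RM_Arr[OF this(1), unfolded RM_eq[OF this(1)] P_simps] RM_Arr[OF this(2), unfolded RM_eq[OF this(2)] P_simps]
  have "DO_T2 HS.H (R K) = R (mor1_T2 S' E K)"
  proof (rule cartesian_tangent_category.DO_T2_unique[OF H_cartesian R R2])
    show "carrier (R (mor1_T2 S' E K)) = T2 HS.H (carrier (R K))" by (simp add: R_simps(2) K T2(1) c)
    show "linear_map HS.H (R (mor1_T2 S' E K)) (DO_T HS.H (R K)) (tpi1 HS.H (carrier (R K)))"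
      "linear_map HS.H (R (mor1_T2 S' E K)) (DO_T HS.H (R K)) (tpi2 HS.H (carrier (R K)))"
      using a by (simp_all add: R_simps(2) K c R_T comp1_T(2) U_comp1_simps(1) cong: restrict_cong)
  qed
  then show ?thesis by simp
qed

lemma R_functor: "is_functor HE.H P R RM"
  unfolding is_functor_def
proof (intro conjI ballI impI)
  show "category HE.H" by (rule HE.category_H)
  show "category P" by (rule category_P)
  show "K \<in> Obj HE.H \<Longrightarrow> R K \<in> Obj P" for K using R_simps(1) by simp
  fix \<phi> assume \<phi>: "\<phi> \<in> Arr HE.H"
  show "RM \<phi> \<in> hom P (R (Dom HE.H \<phi>)) (R (Cod HE.H \<phi>))"
    using RM_Arr[OF \<phi>] by (simp add: P_simps(3,4)) (simp add: RM_eq[OF \<phi>])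
  fix \<psi> assume \<psi>: "\<psi> \<in> Arr HE.H" "Dom HE.H \<psi> = Cod HE.H \<phi>"
  have "\<psi> \<cdot>\<^bsub>HE.H\<^esub> \<phi> \<in> Arr HE.H" by (rule category.comp_typing(1)[OF HE.category_H]) (use \<phi> \<psi> in blast)+
  from RM_eq[OF this] show "RM (\<psi> \<cdot>\<^bsub>HE.H\<^esub> \<phi>) = RM \<psi> \<cdot>\<^bsub>P\<^esub> RM \<phi>"
    unfolding RM_eq[OF \<phi>] RM_eq[OF \<psi>(1)] P_simps by (simp cong: restrict_cong)
next
  fix K assume "K \<in> Obj HE.H"
  then have K: "one_morphism S' E K" by simp
  have "idt HE.H K \<in> Arr HE.H" using category.idt_typing(1)[OF HE.category_H, of K] K by simp
  from RM_eq[OF this] show "RM (idt HE.H K) = idt P (R K)"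
    unfolding P_simps by (simp add: R_simps(2) K U_comp1_simps(1) cong: restrict_cong)
qed

lemma R_preserves_tangent_structure: "preserves_tangent_structure HE.H P R RM"
  unfolding preserves_tangent_structure_def
proof (intro conjI ballI)
  show "is_functor HE.H P R RM" by (rule R_functor)
  have ty: "tangent_typing HE.H"
    using cartesian_creation.axioms(1)[OF HE.H_creation] by (simp add: tangent_creation_def tangent_creation_axioms_def)
  fix K assume "K \<in> Obj HE.H"
  then have K: "one_morphism S' E K" and TK: "one_morphism S' E (mor1_T S' E K)" by simp_all
  have ar: "tpi1 HE.H K \<in> Arr HE.H" "tpi2 HE.H K \<in> Arr HE.H" "tproj HE.H K \<in> Arr HE.H" "tzero HE.H K \<in> Arr HE.H"
    "tsum HE.H K \<in> Arr HE.H" "tlift HE.H K \<in> Arr HE.H" "tflip HE.H K \<in> Arr HE.H"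
    using ty K unfolding tangent_typing_def in_hom_iff by (simp_all del: HE.H_Arr_iff)
  note s = R_simps(2)[OF K] comp1_T(2)[OF K] comp1_T(2)[OF TK] R_T[OF K] R_T[OF TK] R_T2[OF K] U_comp1_simps(1)[OF K]
  have c2: "comp1 S' S U (mor1_T2 S' E K) = mor1_T2 S' S (comp1 S' S U K)"
    using arg_cong[OF R_T2[OF K], of carrier] by (simp add: DO_T2_def Let_def R_simps(2) K HE.mor1_T2_one_morphism(1))
  show "R (TO HE.H K) = TO P (R K)" "R (T2 HE.H K) = T2 P (R K)" by (simp_all add: P_simps(7,9) s)
  show "RM (tpi1 HE.H K) = tpi1 P (R K)" "RM (tpi2 HE.H K) = tpi2 P (R K)" "RM (tproj HE.H K) = tproj P (R K)"
    "RM (tzero HE.H K) = tzero P (R K)" "RM (tsum HE.H K) = tsum P (R K)" "RM (tlift HE.H K) = tlift P (R K)" "RM (tflip HE.H K) = tflip P (R K)"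
    unfolding ar[THEN RM_eq] P_simps by (simp_all add: s c2 cong: restrict_cong)
next
  fix \<phi> assume \<phi>: "\<phi> \<in> Arr HE.H"
  then have K: "one_morphism S' E (asrc \<phi>)" "one_morphism S' E (atrg \<phi>)" by simp_all
  have "TM HE.H \<phi> \<in> Arr HE.H" using HE.T_two_morphism[OF K] \<phi> by simp
  from RM_eq[OF this] show "RM (TM HE.H \<phi>) = TM P (RM \<phi>)"
    unfolding RM_eq[OF \<phi>] P_simps by (simp add: R_T K comp1_T(2) cong: restrict_cong)
qed

text \<open>Linearity in the hom-category is tested at each \<open>A\<close>, so a linear 2-morphism is a family of linear maps.\<close>

lemma RM_bij: "bij_betw RM (Arr HE.H) (Arr P)"
proof (rule bij_betwI')
  fix \<phi> \<psi> assume \<phi>: "\<phi> \<in> Arr HE.H" and \<psi>: "\<psi> \<in> Arr HE.H"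
  have K: "one_morphism S' E (asrc \<phi>)" "one_morphism S' E (atrg \<phi>)" "one_morphism S' E (asrc \<psi>)" "one_morphism S' E (atrg \<psi>)"
    and t: "two_morphism S' E (asrc \<phi>) (atrg \<phi>) (amap \<phi>)" "two_morphism S' E (asrc \<psi>) (atrg \<psi>) (amap \<psi>)"
    using \<phi> \<psi> by simp_all
  note t = t(1)[unfolded over_two_morphism_iff[OF K(1,2)]] t(2)[unfolded over_two_morphism_iff[OF K(3,4)]]
  have inj: "inj_on R (Obj HE.H)" using R_bij by (simp add: bij_betw_def)
  show "RM \<phi> = RM \<psi> \<longleftrightarrow> \<phi> = \<psi>"
  proof
    assume "RM \<phi> = RM \<psi>"
    then have e: "R (asrc \<phi>) = R (asrc \<psi>)" "R (atrg \<phi>) = R (atrg \<psi>)"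
      "(\<lambda>A\<in>Obj X'. amap (amap \<phi> A)) = (\<lambda>A\<in>Obj X'. amap (amap \<psi> A))"
      unfolding RM_eq[OF \<phi>] RM_eq[OF \<psi>] by simp_all
    have a: "asrc \<phi> = asrc \<psi>" "atrg \<phi> = atrg \<psi>" using inj_onD[OF inj e(1)] inj_onD[OF inj e(2)] K by simp_all
    have "amap \<phi> = amap \<psi>"
    proof (rule extensionalityI)
      show "amap \<phi> \<in> extensional (Obj X')" "amap \<psi> \<in> extensional (Obj X')" using t by simp_all
      fix A assume A: "A \<in> Obj X'"
      then have "amap (amap \<phi> A) = amap (amap \<psi> A)" using fun_cong[OF e(3), of A] by simp
      then show "amap \<phi> A = amap \<psi> A" using A t a by - (rule arrow.expand, simp)
    qed
    then show "\<phi> = \<psi>" using a by - (rule arrow.expand, simp)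
  qed simp
next
  fix \<phi> assume "\<phi> \<in> Arr HE.H"
  then show "RM \<phi> \<in> Arr P" by (rule RM_Arr)
next
  fix f assume "f \<in> Arr P"
  then have f: "asrc f \<in> Obj P" "atrg f \<in> Obj P" "linear_map HS.H (asrc f) (atrg f) (amap f)" unfolding P_simps by blast+
  have surj: "\<exists>K. one_morphism S' E K \<and> R K = D" if "D \<in> Obj P" for D
  proof -
    have "D \<in> R ` Obj HE.H" using that by (simp only: bij_betw_imp_surj_on[OF R_bij])
    then obtain K where "D = R K" "K \<in> Obj HE.H" by (rule imageE)
    then show ?thesis using HE.H_simps(1)[of K] by (intro exI[of _ K] conjI) (simp_all only:)
  qed
  obtain K L where K: "one_morphism S' E K" "R K = asrc f" and L: "one_morphism S' E L" "R L = atrg f"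
    using surj[OF f(1)] surj[OF f(2)] by blast
  define \<psi> where "\<psi> = amap f"
  note R = R_simps(1)[OF K(1), unfolded P_simps, THEN conjunct1] R_simps(1)[OF L(1), unfolded P_simps, THEN conjunct1]
  have l: "linear_map HS.H (R K) (R L) \<psi>" using f(3) K L by (simp add: \<psi>_def)
  then have p: "\<psi> \<in> Arr HS.H" "Dom HS.H \<psi> = carrier (R K)" "Cod HS.H \<psi> = carrier (R L)" unfolding linear_map_def in_hom_iff by blast+
  have pt: "two_morphism S' S (comp1 S' S U K) (comp1 S' S U L) (amap \<psi>)" and ps: "asrc \<psi> = comp1 S' S U K" "atrg \<psi> = comp1 S' S U L"
    using p by (simp_all add: R_simps(2) K(1) L(1))
  have pe: "(\<lambda>A\<in>Obj X'. amap \<psi> A) = amap \<psi>" using pt by (simp add: two_morphism_def Let_def extensional_restrict)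
  have pl: "linear_map X (GO K A) (GO L A) (amap \<psi> A)" if "A \<in> Obj X'" for A
    using l[unfolded H_linear_map_iff[OF R p]] that by (simp add: R_simps(3) K(1) L(1))
  define \<phi> where "\<phi> = Arrow K (\<lambda>A\<in>Obj X'. Arrow (GO K A) (amap \<psi> A) (GO L A)) L"
  have \<phi>: "\<phi> \<in> Arr HE.H"
    using K(1) L(1) pt pl by (simp add: \<phi>_def over_two_morphism_iff pe cong: restrict_cong)
  have "RM \<phi> = f"
    unfolding RM_eq[OF \<phi>] using K L ps pe by - (rule arrow.expand, simp add: \<phi>_def \<psi>_def[symmetric] arrow.expand cong: restrict_cong)
  then show "\<exists>\<phi>\<in>Arr HE.H. f = RM \<phi>" using \<phi> by blast
qed

theorem restrict_along_isomorphism: "tangent_isomorphism HE.H P R RM"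
proof -
  have H: "tangent_category HE.H"
    using cartesian_creation.created_cartesian_tangent_category[OF HE.H_creation] by (rule cartesian_tangent_category.axioms(1))
  have P: "tangent_category P"
    by (rule tangent_category_transport[OF H category_P R_preserves_tangent_structure R_bij RM_bij])
  show ?thesis
    unfolding tangent_isomorphism_def using preserves_tangent_structure_lax[OF H P R_preserves_tangent_structure] R_bij RM_bij by blast
qed

end

context strong_cartesian_monad
begin

lemma tautological_pointwise: "tautological S \<in> Obj (pointwise_DO E S)"
proof -
  interpret E: test_monad S E ..
  have "E.linear_family (forgetful S) (\<lambda>D. D)"
    unfolding E.linear_family_def
  proof (intro conjI ballI)
    show "one_morphism E S (forgetful S)" by (rule forgetful_one_morphism)
    fix D assume D: "D \<in> Obj (base E)"
    then have D': "D \<in> Obj (DO X)" and dD: "differential_object X D" by simp_all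
    show "differential_object X D" by (rule dD)
    show "carrier D = GO (forgetful S) D" using forgetful_simps(1)[OF D'] by simp
    show "linear_map X (TO (base E) D) (DO_T X D) (gdist (forgetful S) D)"
      unfolding forgetful_simps(3)[OF D'] E_simps(1) C.DO_simps using C.linear_map_idt[OF DO_S_differential_object(2)[OF dD]] by simp
    show "linear_map X (DO_S S D) (SO E D) (gtau (forgetful S) D)"
      unfolding forgetful_simps(4)[OF D'] E_simps(2) using C.linear_map_idt[OF DO_S_differential_object(1)[OF dD]] by simp
  next
    fix f assume "f \<in> Arr (base E)"
    then have f: "f \<in> Arr (DO X)" by simp
    show "linear_map X (Dom (base E) f) (Cod (base E) f) (GM (forgetful S) f)"
      unfolding forgetful_simps(2)[OF f] using f by simp
  qed
  from E.family_Obj[OF this] have "E.diff_of (forgetful S) (\<lambda>D. D) \<in> Obj (pointwise_DO E S)" .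
  also have "E.diff_of (forgetful S) (\<lambda>D. D) = tautological S"
    unfolding E.diff_of_def tautological_def Let_def ES.H_simps E_simps(1) ..
  finally show ?thesis .
qed

end

theorem theorem3p15:
  fixes S :: "('o, 'a) cart_tangent_monad"
  assumes "cartesian_tangent_monad S"
    and "strong_tangent_monad S"
  shows "admits_differential_objects TYPE('q) TYPE('c)
           TYPE(('o, 'a) diff_object) TYPE((('o, 'a) diff_object, 'a) arrow) S \<and>
         tangentad_of_differential_objects TYPE('q) TYPE('c) S (DO_monad S) (tautological S)"
proof -
  interpret strong_cartesian_monad S
    using assms by unfold_locales (simp_all add: strong_tangent_monad_def)
  have "tangentad_of_differential_objects TYPE('q) TYPE('c) S (DO_monad S) (tautological S)"
    unfolding tangentad_of_differential_objects_def
  proof (intro conjI allI impI)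
    show "cartesian_tangent_monad E" by (rule E_cartesian)
    show "strict_one_morphism E S (carrier (tautological S))"
      using forgetful_strict by (simp add: tautological_def Let_def)
    show "tautological S \<in> Obj (pointwise_DO E S)" by (rule tautological_pointwise)
    fix S' :: "('q, 'c, unit) tangent_monad"
    assume "tangent_monad S'"
    then interpret test_monad S S' by unfold_locales
    show "tangent_isomorphism (hom_tangent S' E) (pointwise_DO S' S) (restrict_along S' S (tautological S)) (restrict_along_map S' S (tautological S))"
      by (rule restrict_along_isomorphism)
  qed
  then show ?thesis unfolding admits_differential_objects_def using assms(1) by blast
qed

end
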